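(* Assume $A=0$ and fix $n\ge1$. For $\epsilon>0$, let $Y_1=Y_1(\epsilon)$ be the unique positive definite solution of $$-Y\,C'V^{-1}C\,Y+(W+\epsilon Z)=0,$$ let $Y_n=Y_n(\epsilon)$ be the unique positive definite solution of $$-Y\,C_n'V_n^{-1}C_n\,Y+(W_n+\epsilon Z_n)=0,$$ let $X_1$ be the unique positive definite solution of $-XBR^{-1}B'X+Q=0$, and let $X_n$ be the unique positive definite solution of $-X\,nB_nR_n^{-1}B_n'\,X+\frac1nQ_n=0$. Then, as $\epsilon\to0^+$, $$Y_n(\epsilon)-\frac{1}{\sqrt n}E_n\otimes Y_1(\epsilon)\longrightarrow 0,$$ and the optimal LQG cost per agent with imperfect measurements, $$J_I^*(0,n)=\mathrm{Tr}\left(Y_n\frac{Q_n}{n}+(W_n+\epsilon Z_n)X_n\right),$$ satisfies $$J_I^*(0,n)-\left[\frac1{\sqrt n}\mathrm{Tr}\left(Y_1(\epsilon)Q\right)+\mathrm{Tr}(WX_1)\right]\longrightarrow 0 .$$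
   Context: Primes denote transposes and $\otimes$ is the Kronecker product; positive definite matrices are symmetric. $A\in\mathbb{R}^{d\times d}$ (here $A=0$), $B\in\mathbb{R}^{d\times m}$, $C,F,G,H\in\mathbb{R}^{d\times d}$, $W=GG'$, $Z=FF'$, $V=HH'$ with $V$ positive definite; $Q\in\mathbb{R}^{d\times d}$ is symmetric positive semidefinite, $R\in\mathbb{R}^{m\times m}$ is symmetric positive definite. Standing assumptions: $(A,B)$ and $(A,F)$ are controllable, $(A,C)$ and $(A,Q)$ are observable. (For $A=0$ this means $B$ and $F$ have full row rank and $C$, $Q$ are injective.) $I_n$ is the $n\times n$ identity, $E_n$ the $n\times n$ matrix of ones; $B_n=I_n\otimes B$, $C_n=I_n\otimes C$, $V_n=I_n\otimes V$, $Z_n=I_n\otimes Z$, $Q_n=I_n\otimes Q$, $R_n=I_n\otimes R$, $W_n=E_n\otimes W$. $J_I^*(0,n)$ is the optimal cost per agent in the LQG problem of minimizing $\lim_{T\to\infty}\frac1T\mathbb{E}\int_0^T\frac1n(x'Q_nx+u'R_nu)\,dt$ for $n$ agents tracking a common target, with relative dynamics $\dot x=A_nx+B_nu+\sqrt\epsilon\,(I_n\otimes F)w_p-(\mathbf 1_n\otimes G)w_e$, where $A_n=I_n\otimes A$ and $\mathbf 1_n$ is the vector of $n$ ones, and noisy measurements $y=C_nx+(I_n\otimes H)v$, where $w_p,w_e,v$ are independent standard white Gaussian noises. *)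

theory Defs
  imports "HOL-Probability.Probability"
begin

section \<open>Matrices\<close>

definition pos_def :: "real^'k^'k \<Rightarrow> bool" where
  "pos_def A \<longleftrightarrow> transpose A = A \<and> (\<forall>x. x \<noteq> 0 \<longrightarrow> 0 < x \<bullet> (A *v x))"

definition pos_semidef :: "real^'k^'k \<Rightarrow> bool" where
  "pos_semidef A \<longleftrightarrow> transpose A = A \<and> (\<forall>x. 0 \<le> x \<bullet> (A *v x))"

definition kron :: "real^'b^'a \<Rightarrow> real^'d^'c \<Rightarrow> real^('b \<times> 'd)^('a \<times> 'c)"  (infixl \<open>\<otimes>\<^sub>K\<close> 75) where
  "A \<otimes>\<^sub>K B = (\<chi> p q. A $ fst p $ fst q * B $ snd p $ snd q)"

definition ones_mat :: "real^'n^'n" where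
  "ones_mat = (\<chi> i j. 1)"

text \<open>The product of the all-ones column vector with \<open>G\<close>; the column index \<open>1 \<times> 'b\<close> is identified with \<open>'b\<close>.\<close>

definition ones_kron :: "real^'b^'a \<Rightarrow> real^'b^('n::finite \<times> 'a)" where
  "ones_kron G = (\<chi> p q. G $ snd p $ q)"

text \<open>Kalman's rank conditions: the columns of \<open>B, AB, \<dots>, A^(d-1) B\<close> span the state space;
  the kernels of \<open>C, CA, \<dots>, C A^(d-1)\<close> intersect trivially.\<close>

definition controllable :: "real^'d^'d \<Rightarrow> real^'m^'d \<Rightarrow> bool" where
  "controllable A B \<longleftrightarrow> span (\<Union>k<CARD('d). columns (((\<lambda>P. A ** P) ^^ k) B)) = UNIV"

definition observable :: "real^'d^'d \<Rightarrow> real^'d^'p \<Rightarrow> bool" where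
  "observable A C \<longleftrightarrow> (\<forall>x. (\<forall>k<CARD('d). C *v (((*v) A ^^ k) x) = 0) \<longrightarrow> x = 0)"

definition pd_riccati_solution :: "real^'k^'k \<Rightarrow> real^'k^'k \<Rightarrow> real^'k^'k \<Rightarrow> bool" where
  "pd_riccati_solution K S X \<longleftrightarrow> pos_def X \<and> - (X ** K ** X) + S = 0"

definition riccati :: "real^'k^'k \<Rightarrow> real^'k^'k \<Rightarrow> real^'k^'k" where
  "riccati K S = (THE X. pd_riccati_solution K S X)"

section \<open>White noise\<close>

text \<open>White noise is rendered by its integral, a standard Wiener process: the increments of all
  components over consecutive time intervals are jointly independent centred Gaussians.\<close>

definition standard_wiener :: "'a measure \<Rightarrow> (real \<Rightarrow> 'a \<Rightarrow> real^'k) \<Rightarrow> bool" where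
  "standard_wiener M w \<longleftrightarrow>
     prob_space M \<and>
     (\<forall>t\<ge>0. w t \<in> borel_measurable M) \<and>
     (\<forall>\<omega>\<in>space M. w 0 \<omega> = 0 \<and> continuous_on {0..} (\<lambda>t. w t \<omega>)) \<and>
     (\<forall>s t i. 0 \<le> s \<and> s < t \<longrightarrow>
        distributed M lborel (\<lambda>\<omega>. (w t \<omega> - w s \<omega>) $ i) (normal_density 0 (sqrt (t - s)))) \<and>
     (\<forall>\<tau>::nat \<Rightarrow> real. 0 \<le> \<tau> 0 \<and> mono \<tau> \<longrightarrow>
        prob_space.indep_vars M (\<lambda>_. borel)
          (\<lambda>(j, i) \<omega>. (w (\<tau> (Suc j)) \<omega> - w (\<tau> j) \<omega>) $ i) UNIV)"

text \<open>Three standard Wiener processes are independent iff the process obtained by stacking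
  them is again a standard Wiener process.\<close>

definition stack3 :: "real^'i \<Rightarrow> real^'j \<Rightarrow> real^'k \<Rightarrow> real^('i + 'j + 'k)" where
  "stack3 a b c = (\<chi> l. case l of Inl i \<Rightarrow> a $ i | Inr (Inl j) \<Rightarrow> b $ j | Inr (Inr k) \<Rightarrow> c $ k)"

definition independent_wiener ::
  "'a measure \<Rightarrow> (real \<Rightarrow> 'a \<Rightarrow> real^'i) \<Rightarrow> (real \<Rightarrow> 'a \<Rightarrow> real^'j) \<Rightarrow> (real \<Rightarrow> 'a \<Rightarrow> real^'k) \<Rightarrow> bool" where
  "independent_wiener M w1 w2 w3 \<longleftrightarrow>
     standard_wiener M (\<lambda>t \<omega>. stack3 (w1 t \<omega>) (w2 t \<omega>) (w3 t \<omega>))"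

section \<open>The LQG problem\<close>

text \<open>Since the noise is additive, the controlled equation \<open>dx = (Ax + Bu) dt + dN\<close> is understood
  pathwise in integrated form, and so is the observation \<open>dz = Cx dt + dN'\<close> (i.e. \<open>z\<close> is the
  integral of the measurement \<open>y\<close>).\<close>

definition lqg_trajectory ::
  "'a measure \<Rightarrow> real^'s^'s \<Rightarrow> real^'u^'s \<Rightarrow> real^'s \<Rightarrow> (real \<Rightarrow> 'a \<Rightarrow> real^'s) \<Rightarrow>
   (real \<Rightarrow> 'a \<Rightarrow> real^'u) \<Rightarrow> (real \<Rightarrow> 'a \<Rightarrow> real^'s) \<Rightarrow> bool" where
  "lqg_trajectory M A B x0 N u x \<longleftrightarrow>
     (\<forall>\<omega>\<in>space M. \<forall>t\<ge>0.
        set_integrable lborel {0..t} (\<lambda>s. u s \<omega>) \<and>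
        set_integrable lborel {0..t} (\<lambda>s. x s \<omega>) \<and>
        x t \<omega> = x0 + (LINT s:{0..t}|lborel. A *v x s \<omega> + B *v u s \<omega>) + N t \<omega>)"

definition lqg_observation ::
  "real^'s^'y \<Rightarrow> (real \<Rightarrow> 'a \<Rightarrow> real^'y) \<Rightarrow> (real \<Rightarrow> 'a \<Rightarrow> real^'s) \<Rightarrow> real \<Rightarrow> 'a \<Rightarrow> real^'y" where
  "lqg_observation C N' x t \<omega> = (LINT s:{0..t}|lborel. C *v x s \<omega>) + N' t \<omega>"

definition history :: "'a measure \<Rightarrow> (real \<Rightarrow> 'a \<Rightarrow> real^'y) \<Rightarrow> real \<Rightarrow> 'a measure" where
  "history M z t =
     sigma (space M) (\<Union>s\<in>{0..t}. {z s -` S \<inter> space M | S. S \<in> sets borel})"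

definition adapted_to_history ::
  "'a measure \<Rightarrow> (real \<Rightarrow> 'a \<Rightarrow> real^'y) \<Rightarrow> (real \<Rightarrow> 'a \<Rightarrow> real^'u) \<Rightarrow> bool" where
  "adapted_to_history M z u \<longleftrightarrow> (\<forall>t\<ge>0. u t \<in> borel_measurable (history M z t))"

text \<open>Admissible controls are the (possibly nonlinear) output feedbacks: \<open>u t\<close> is a function of the
  observations made up to time \<open>t\<close>.  As usual for partially observed problems, \<open>u\<close> is also
  required to be adapted to the observations \<open>C x'\<close> of the uncontrolled trajectory \<open>x'\<close>, which the
  controller can reconstruct by subtracting the effect of its own past inputs; this excludes
  non-unique closed loops through which \<open>u\<close> could anticipate the noise.\<close>

definition lqg_admissible ::
  "'a measure \<Rightarrow> real^'s^'s \<Rightarrow> real^'u^'s \<Rightarrow> real^'s^'y \<Rightarrow> real^'s \<Rightarrow>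
   (real \<Rightarrow> 'a \<Rightarrow> real^'s) \<Rightarrow> (real \<Rightarrow> 'a \<Rightarrow> real^'y) \<Rightarrow>
   (real \<Rightarrow> 'a \<Rightarrow> real^'u) \<Rightarrow> (real \<Rightarrow> 'a \<Rightarrow> real^'s) \<Rightarrow> bool" where
  "lqg_admissible M A B C x0 N N' u x \<longleftrightarrow>
     (\<lambda>(t, \<omega>). u t \<omega>) \<in> borel_measurable (borel \<Otimes>\<^sub>M M) \<and>
     lqg_trajectory M A B x0 N u x \<and>
     adapted_to_history M (lqg_observation C N' x) u \<and>
     (\<exists>x'. lqg_trajectory M A B x0 N (\<lambda>_ _. 0) x' \<and>
           adapted_to_history M (lqg_observation C N' x') u)"

definition lqg_average_cost ::
  "'a measure \<Rightarrow> real^'s^'s \<Rightarrow> real^'u^'u \<Rightarrow>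
   (real \<Rightarrow> 'a \<Rightarrow> real^'u) \<Rightarrow> (real \<Rightarrow> 'a \<Rightarrow> real^'s) \<Rightarrow> real \<Rightarrow> ennreal" where
  "lqg_average_cost M Q R u x T =
     (\<integral>\<^sup>+\<omega>. (\<integral>\<^sup>+t\<in>{0..T}. ennreal (x t \<omega> \<bullet> (Q *v x t \<omega>) + u t \<omega> \<bullet> (R *v u t \<omega>)) \<partial>lborel) \<partial>M)
       / ennreal T"

definition lqg_optimal_cost ::
  "'a measure \<Rightarrow> real^'s^'s \<Rightarrow> real^'u^'s \<Rightarrow> real^'s^'y \<Rightarrow> real^'s \<Rightarrow>
   (real \<Rightarrow> 'a \<Rightarrow> real^'s) \<Rightarrow> (real \<Rightarrow> 'a \<Rightarrow> real^'y) \<Rightarrow> real^'s^'s \<Rightarrow> real^'u^'u \<Rightarrow> ennreal" where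
  "lqg_optimal_cost M A B C x0 N N' Q R =
     Inf {c. \<exists>u x. lqg_admissible M A B C x0 N N' u x \<and>
                   (lqg_average_cost M Q R u x \<longlongrightarrow> c) at_top}"

text \<open>Optimal cost per agent of \<open>CARD('n)\<close> agents tracking a common target, as a function of
  \<open>\<epsilon>\<close>; \<open>wp\<close>, \<open>we\<close>, \<open>v\<close> are the integrated white noises and \<open>x0\<close> is the initial relative position.\<close>

definition tracking_cost_per_agent ::
  "'a measure \<Rightarrow> (real \<Rightarrow> 'a \<Rightarrow> real^('n::finite \<times> 'd::finite)) \<Rightarrow> (real \<Rightarrow> 'a \<Rightarrow> real^'d) \<Rightarrow>
   (real \<Rightarrow> 'a \<Rightarrow> real^('n \<times> 'd)) \<Rightarrow> real^('n \<times> 'd) \<Rightarrow>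
   real^'d^'d \<Rightarrow> real^'m^'d \<Rightarrow> real^'d^'d \<Rightarrow> real^'d^'d \<Rightarrow> real^'d^'d \<Rightarrow> real^'d^'d \<Rightarrow>
   real^'d^'d \<Rightarrow> real^'m^'m \<Rightarrow> real \<Rightarrow> ennreal" where
  "tracking_cost_per_agent M wp we v x0 A B C F G H Q R \<epsilon> =
     (let I = (mat 1 :: real^'n^'n); n = real CARD('n) in
      lqg_optimal_cost M (I \<otimes>\<^sub>K A) (I \<otimes>\<^sub>K B) (I \<otimes>\<^sub>K C) x0
        (\<lambda>t \<omega>. sqrt \<epsilon> *\<^sub>R ((I \<otimes>\<^sub>K F) *v wp t \<omega>) - ones_kron G *v we t \<omega>)
        (\<lambda>t \<omega>. (I \<otimes>\<^sub>K H) *v v t \<omega>)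
        ((1 / n) *\<^sub>R (I \<otimes>\<^sub>K Q)) ((1 / n) *\<^sub>R (I \<otimes>\<^sub>K R)))"

end

theory Submission
  imports Defs "HOL-Real_Asymp.Real_Asymp"
begin

text \<open>Write \<open>K = C' V\<^sup>-\<^sup>1 C\<close>. Since \<open>A = 0\<close>, a congruence takes the noise covariance \<open>S\<close> to \<open>1\<close> and \<open>K\<close> to \<open>diag (l\<^sup>2)\<close>,
  and the Kalman filter splits into scalar filters whose error variances \<open>tanh (l t) / l\<close> are explicit.
  Completing the square with \<open>X\<close> turns the cost up to time \<open>T\<close> into \<open>T tr (S X)\<close> plus the integral of
  \<open>E |u + R\<^sup>-\<^sup>1 B' X x|\<^sup>2\<close> in the \<open>R\<close>-norm, up to the initial and terminal terms. That integral is at least its value for the filter error in place of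
  \<open>u + R\<^sup>-\<^sup>1 B' X x\<close>, because the filter error is orthogonal to every functional of the past observations; Gaussian integration
  by parts gives this orthogonality without conditional expectations. Equality holds for the certainty-equivalent control,
  which is adapted because the filter estimate solves a linear Volterra equation driven by the observations.

  For the limit, \<open>E\<^sub>n \<otimes> Y\<^sub>1 / sqrt n\<close> solves the \<open>n\<close>-agent Riccati equation with \<open>Z\<^sub>n\<close> replaced by \<open>E\<^sub>n \<otimes> Z\<close>,
  solutions are 1/2-Hoelder continuous in the right-hand side, and \<open>X\<^sub>n = I \<otimes> X\<^sub>1 / n\<close>.\<close>

section \<open>Riccati equations\<close>

text \<open>Two obstacles shape the argument. \<open>W\<close> may be singular, so the Riccati
  solutions may degenerate as \<epsilon> tends to 0; the continuity estimate therefore has a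
  constant that depends on \<open>K\<close> alone. And an admissible control comes with no moment
  bound: only the convergence of its average cost is known, so the terminal term
  \<open>E (x \<bullet> X x)\<close> cannot simply be discarded. If the average cost had a limit
  below the claimed value, the terminal term would grow at least linearly at all late times, hence
  its time integral quadratically; but that integral is at most a constant times the running cost,
  which grows linearly. Orthogonality is stated relative to the observations of the uncontrolled
  trajectory. They are Gaussian and the same for every control, whereas the closed-loop observations
  of a nonlinear control need not be Gaussian. Recovering the estimate from closed-loop observations
  is required for one explicit control only, and there the loop is linear.\<close>

lemma inner_matrix_transpose: "x \<bullet> ((A::real^'n^'m) *v y) = (transpose A *v x) \<bullet> y"
  by (metis dot_lmul_matrix transpose_matrix_vector)

lemma pos_def_inner_sym: "transpose A = A \<Longrightarrow> x \<bullet> (A *v y) = y \<bullet> ((A::real^'n^'n) *v x)"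
  by (metis inner_commute inner_matrix_transpose)

lemma pos_def_imp_pos_semidef: "pos_def A \<Longrightarrow> pos_semidef A"
  unfolding pos_def_def pos_semidef_def by (metis inner_zero_left order.order_iff_strict)

lemma pos_def_coercive:
  assumes "pos_def (A :: real^'n^'n)"
  obtains c where "c > 0" "\<And>x. c * (x \<bullet> x) \<le> x \<bullet> (A *v x)"
proof -
  let ?S = "sphere 0 1 :: (real^'n) set"
  have "continuous_on ?S (\<lambda>x. x \<bullet> (A *v x))" by (intro continuous_intros matrix_vector_mult_linear_continuous_on)
  moreover have "axis undefined 1 \<in> ?S" by (simp add: norm_axis_1)
  then have "?S \<noteq> {}" by blast
  ultimately obtain z where z: "z \<in> ?S" "\<And>x. x \<in> ?S \<Longrightarrow> z \<bullet> (A *v z) \<le> x \<bullet> (A *v x)"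
    using continuous_attains_inf[OF compact_sphere] by blast
  have "z \<noteq> 0" using z(1) by auto
  then have pos: "0 < z \<bullet> (A *v z)" using assms unfolding pos_def_def by auto
  have "z \<bullet> (A *v z) * (x \<bullet> x) \<le> x \<bullet> (A *v x)" for x
  proof (cases "x = 0")
    case False
    have "z \<bullet> (A *v z) \<le> (x /\<^sub>R norm x) \<bullet> (A *v (x /\<^sub>R norm x))"
      by (rule z(2)) (use False in auto)
    also have "\<dots> = (x \<bullet> (A *v x)) / (norm x)\<^sup>2"
      by (simp add: matrix_vector_mult_scaleR power2_eq_square divide_inverse ac_simps)
    finally show ?thesis using False by (simp add: field_simps power2_norm_eq_inner[symmetric])
  qed simp
  then show ?thesis using pos that by blast
qed

text \<open>The first-order condition: a quadratic that is minimal at 0 has no linear term. It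
  yields the eigenvector equation for Rayleigh quotients, the degenerate case of Cauchy--Schwarz and
  the kernel of a semidefinite form.\<close>

lemma quadratic_nonneg_imp_zero:
  assumes "\<And>t::real. 0 \<le> 2 * t * b + t\<^sup>2 * c"
  shows "b = 0"
proof (rule ccontr)
  assume "b \<noteq> 0"
  have c: "0 \<le> c" using assms[of 1] assms[of "-1"] by simp
  \<comment> \<open>The \<open>+ 1\<close> keeps the denominator nonzero when \<open>c = 0\<close>;
    the quadratic is still negative at this point.\<close>
  define t where "t = - b / (c + 1)"
  have t: "t * (c + 1) = - b" using c unfolding t_def by simp
  have "(c + 1)\<^sup>2 * (2 * t * b + t\<^sup>2 * c) = 2 * b * (t * (c + 1)) * (c + 1) + (t * (c + 1))\<^sup>2 * c"
    by (simp add: algebra_simps power2_eq_square)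
  also have "\<dots> = - (b\<^sup>2 * (c + 2))" unfolding t by (simp add: algebra_simps power2_eq_square)
  also have "\<dots> < 0" using c \<open>b \<noteq> 0\<close> by simp
  finally show False using assms[of t] by (simp add: mult_less_0_iff not_less)
qed

text \<open>Generalised Rayleigh quotients: each further eigenvector maximises \<open>x \<bullet> A x\<close> on the
  \<open>N\<close>-orthogonal complement of the previous ones.\<close>

lemma symmetric_pos_def_eigenbasis:
  fixes A N :: "real^'n^'n"
  assumes A: "transpose A = A" and N: "pos_def N"
  shows "\<exists>(p :: 'n \<Rightarrow> real^'n) \<kappa>. (\<forall>i j. p i \<bullet> (N *v p j) = (if i = j then 1 else 0)) \<and> (\<forall>i. A *v p i = \<kappa> i *\<^sub>R (N *v p i))"
proof -
  have Nt: "transpose N = N" and Np: "\<And>x. x \<noteq> 0 \<Longrightarrow> 0 < x \<bullet> (N *v x)"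
    using N unfolding pos_def_def by auto
  note symA = pos_def_inner_sym[OF A] and symN = pos_def_inner_sym[OF Nt]
  obtain c where c: "c > 0" "\<And>x. c * (x \<bullet> x) \<le> x \<bullet> (N *v x)" using pos_def_coercive[OF N] by metis
  have "\<exists>p \<kappa>. (\<forall>i\<in>I. \<forall>j\<in>I. p i \<bullet> (N *v p j) = (if i = j then 1 else 0)) \<and> (\<forall>i\<in>I. A *v p i = \<kappa> i *\<^sub>R (N *v p i))"
    if "finite I" for I :: "'n set"
    using that
  proof (induction I)
    case (insert k I)
    then obtain p :: "'n \<Rightarrow> real^'n" and \<kappa> where on: "\<And>i j. i \<in> I \<Longrightarrow> j \<in> I \<Longrightarrow> p i \<bullet> (N *v p j) = (if i = j then 1 else 0)"
      and ev: "\<And>i. i \<in> I \<Longrightarrow> A *v p i = \<kappa> i *\<^sub>R (N *v p i)" by blast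
    define U where "U = {x. \<forall>i\<in>I. p i \<bullet> (N *v x) = 0}"
    \<comment> \<open>Fewer constraints than dimensions, so the space \<open>U\<close> on which the
      quotient is maximised contains a nonzero vector.\<close>
    have "dim ((\<lambda>i. N *v p i) ` I) < DIM(real^'n)"
    proof -
      have "dim ((\<lambda>i. N *v p i) ` I) \<le> card I"
        using dim_le_card'[of "(\<lambda>i. N *v p i) ` I"] card_image_le[OF insert.hyps(1), of "\<lambda>i. N *v p i"] insert.hyps(1) by auto
      also have "card I < CARD('n)" using insert.hyps by (intro psubset_card_mono) auto
      finally show ?thesis by simp
    qed
    then obtain z where z: "z \<noteq> 0" "\<And>y. y \<in> span ((\<lambda>i. N *v p i) ` I) \<Longrightarrow> orthogonal z y"
      using orthogonal_to_subspace_exists by blast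
    have zU: "z \<in> U" unfolding U_def
    proof (safe)
      fix i assume "i \<in> I"
      then have "z \<bullet> (N *v p i) = 0" using z(2) by (auto simp: orthogonal_def span_base)
      then show "p i \<bullet> (N *v z) = 0" using symN[of "p i" z] by simp
    qed
    have sub: "subspace U" unfolding U_def
      by (auto simp: subspace_def matrix_vector_right_distrib matrix_vector_mult_scaleR inner_add_right)
    let ?K = "U \<inter> {x. x \<bullet> (N *v x) = 1}"
    have Kc: "compact ?K"
    proof (rule compact_Int_closed[OF _ closed_subspace[OF sub], unfolded Int_commute[of _ U]])
      have cl: "closed {x. x \<bullet> (N *v x) = 1}"
        by (rule closed_Collect_eq) (intro continuous_intros matrix_vector_mult_linear_continuous_on)+
      have "bounded {x. x \<bullet> (N *v x) = 1}"
      proof (rule boundedI)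
        fix x assume "x \<in> {x. x \<bullet> (N *v x) = 1}"
        then have "(norm x)\<^sup>2 \<le> 1 / c" using c(2)[of x] c(1) by (simp add: power2_norm_eq_inner field_simps)
        then show "norm x \<le> sqrt (1 / c)" by (rule real_le_rsqrt)
      qed
      with cl show "compact {x. x \<bullet> (N *v x) = 1}" by (simp add: compact_eq_bounded_closed)
    qed
    have nz: "\<exists>s. s * s * (x \<bullet> (N *v x)) = 1 \<and> s *\<^sub>R x \<in> ?K" if "x \<in> U" "x \<noteq> 0" for x
    proof -
      define s where "s = 1 / sqrt (x \<bullet> (N *v x))"
      have "s\<^sup>2 * (x \<bullet> (N *v x)) = 1" using Np[OF that(2)] unfolding s_def by (simp add: power_divide)
      then have s: "s * s * (x \<bullet> (N *v x)) = 1" by (simp only: power2_eq_square)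
      have "(s *\<^sub>R x) \<bullet> (N *v (s *\<^sub>R x)) = s * s * (x \<bullet> (N *v x))" by (simp only: matrix_vector_mult_scaleR inner_scaleR_left inner_scaleR_right mult.assoc)
      then have "s *\<^sub>R x \<in> ?K" using subspace_scale[OF sub that(1)] s by auto
      with s show ?thesis by blast
    qed
    from nz[OF zU z(1)] have Kn: "?K \<noteq> {}" by blast
    have Kf: "continuous_on ?K (\<lambda>x. x \<bullet> (A *v x))"
      by (intro continuous_intros matrix_vector_mult_linear_continuous_on)
    obtain q where q: "q \<in> ?K" "\<And>x. x \<in> ?K \<Longrightarrow> x \<bullet> (A *v x) \<le> q \<bullet> (A *v q)"
      using continuous_attains_sup[OF Kc Kn Kf] by blast
    define \<mu> where "\<mu> = q \<bullet> (A *v q)"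
    have qU: "q \<in> U" and q1: "q \<bullet> (N *v q) = 1" using q(1) by auto
    have le: "x \<bullet> (A *v x) \<le> \<mu> * (x \<bullet> (N *v x))" if x: "x \<in> U" for x
    proof (cases "x = 0")
      case False
      obtain s where s: "s * s * (x \<bullet> (N *v x)) = 1" "s *\<^sub>R x \<in> ?K" using nz[OF x False] by blast
      from q(2)[OF s(2)] have "s * s * (x \<bullet> (A *v x)) \<le> \<mu>"
        unfolding \<mu>_def by (simp add: matrix_vector_mult_scaleR mult.assoc)
      then have "s * s * (x \<bullet> (A *v x)) * (x \<bullet> (N *v x)) \<le> \<mu> * (x \<bullet> (N *v x))"
        using Np[OF False] by (intro mult_right_mono) auto
      moreover have "s * s * (x \<bullet> (A *v x)) * (x \<bullet> (N *v x)) = (s * s * (x \<bullet> (N *v x))) * (x \<bullet> (A *v x))"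
        by (simp only: ac_simps)
      ultimately show ?thesis using s(1) by simp
    qed simp
    \<comment> \<open>Perturbing the maximiser \<open>q\<close> inside \<open>U\<close> gives a
      nonnegative quadratic in \<open>t\<close> that vanishes at \<open>t = 0\<close>.\<close>
    have eqU: "x \<bullet> (A *v q) = \<mu> * (x \<bullet> (N *v q))" if x: "x \<in> U" for x
    proof -
      have "0 \<le> 2 * t * (\<mu> * (x \<bullet> (N *v q)) - x \<bullet> (A *v q)) + t\<^sup>2 * (\<mu> * (x \<bullet> (N *v x)) - x \<bullet> (A *v x))" for t
      proof -
        have "q + t *\<^sub>R x \<in> U" using subspace_add[OF sub qU subspace_scale[OF sub x]] .
        from le[OF this] show ?thesis
          using q1 symN[of q x] symA[of q x]
          by (simp add: matrix_vector_mult_scaleR matrix_vector_right_distrib inner_add_left inner_add_right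
              \<mu>_def[symmetric] algebra_simps power2_eq_square)
      qed
      from quadratic_nonneg_imp_zero[OF this] show ?thesis by simp
    qed
    have eqI: "p i \<bullet> (A *v q) = 0" "p i \<bullet> (N *v q) = 0" if "i \<in> I" for i
    proof -
      show *: "p i \<bullet> (N *v q) = 0" using qU that unfolding U_def by auto
      show "p i \<bullet> (A *v q) = 0" using ev[OF that] * symA[of "p i" q] symN[of "p i" q] by simp
    qed
    \<comment> \<open>The equation known on \<open>U\<close> extends to all \<open>x\<close>:
      subtracting the \<open>N\<close>-projection onto the earlier eigenvectors lands in
      \<open>U\<close>, and on these eigenvectors both sides vanish by \<open>eqI\<close>.\<close>
    have "x \<bullet> (A *v q) = \<mu> * (x \<bullet> (N *v q))" for x
    proof -
      define y where "y = x - (\<Sum>i\<in>I. (p i \<bullet> (N *v x)) *\<^sub>R p i)"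
      have "p i \<bullet> (N *v y) = 0" if "i \<in> I" for i
      proof -
        have "p i \<bullet> (N *v y) = p i \<bullet> (N *v x) - (\<Sum>j\<in>I. (p j \<bullet> (N *v x)) * (p i \<bullet> (N *v p j)))"
          unfolding y_def
          by (simp add: matrix_vector_mult_diff_distrib linear_sum[OF matrix_vector_mul_linear] inner_diff_right
              inner_sum_right matrix_vector_mult_scaleR)
        also have "(\<Sum>j\<in>I. (p j \<bullet> (N *v x)) * (p i \<bullet> (N *v p j))) = (\<Sum>j\<in>I. if i = j then p j \<bullet> (N *v x) else 0)"
          using on[OF that] by (intro sum.cong) auto
        finally show ?thesis using insert.hyps(1) that by simp
      qed
      then have "y \<in> U" unfolding U_def by blast
      have x: "x = y + (\<Sum>i\<in>I. (p i \<bullet> (N *v x)) *\<^sub>R p i)" unfolding y_def by simp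
      show ?thesis
      proof -
        have "v \<bullet> u = y \<bullet> u + (\<Sum>i\<in>I. (p i \<bullet> (N *v x)) * (p i \<bullet> u))" if "v = x" for u v
          unfolding that by (subst x) (simp add: inner_add_left inner_sum_left)
        from this[OF refl] show ?thesis using eqU[OF \<open>y \<in> U\<close>] eqI by simp
      qed
    qed
    then have "A *v q = \<mu> *\<^sub>R (N *v q)" by (intro vector_eq_rdot[THEN iffD1]) (simp add: inner_commute)
    moreover have "\<forall>i\<in>insert k I. \<forall>j\<in>insert k I. (p(k := q)) i \<bullet> (N *v (p(k := q)) j) = (if i = j then 1 else 0)"
    proof -
      have "q \<bullet> (N *v p j) = 0" if "j \<in> I" for j using eqI(2)[OF that] symN[of q "p j"] by simp
      then show ?thesis using on eqI(2) q1 insert.hyps(2) by auto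
    qed
    ultimately have "(\<forall>i\<in>insert k I. \<forall>j\<in>insert k I. (p(k := q)) i \<bullet> (N *v (p(k := q)) j) = (if i = j then 1 else 0))
      \<and> (\<forall>i\<in>insert k I. A *v (p(k := q)) i = (\<kappa>(k := \<mu>)) i *\<^sub>R (N *v (p(k := q)) i))"
      using ev insert.hyps(2) by (intro conjI) auto
    then show ?case by (intro exI)
  qed auto
  from this[OF finite, of UNIV] show ?thesis unfolding ball_UNIV .
qed

lemma mult_if_0:
  fixes a b :: "'a::mult_zero"
  shows "(if P then a else 0) * b = (if P then a * b else 0)" "b * (if P then a else 0) = (if P then b * a else 0)"
  by auto

definition diag_mat :: "('n \<Rightarrow> real) \<Rightarrow> real^'n^'n" where
  "diag_mat d = (\<chi> i j. if i = j then d i else 0)"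

lemma diag_mat_mult: "diag_mat d ** diag_mat e = diag_mat (\<lambda>i. d i * e i)"
  by (simp add: diag_mat_def matrix_matrix_mult_def vec_eq_iff mult_if_0)

lemma diag_mat_1: "diag_mat (\<lambda>i. 1) = mat 1"
  by (simp add: diag_mat_def mat_def)

lemma diag_mat_vec: "(diag_mat d *v x) $ i = d i * x $ i"
  by (simp add: diag_mat_def matrix_vector_mult_def mult_if_0)

lemma transpose_diag_mat [simp]: "transpose (diag_mat d) = diag_mat d"
  by (auto simp: diag_mat_def transpose_def vec_eq_iff)

lemma congruence_nth: "(P ** S ** transpose P) $ i $ j = P $ i \<bullet> (S *v (P $ j))" for P :: "real^'n^'m"
proof -
  have "(P ** S ** transpose P) $ i $ j = (\<Sum>k\<in>UNIV. \<Sum>l\<in>UNIV. P$i$l * S$l$k * P$j$k)"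
    by (simp add: matrix_matrix_mult_def transpose_def sum_distrib_right)
  also have "\<dots> = P $ i \<bullet> (S *v (P $ j))"
    by (subst sum.swap) (simp add: inner_vec_def matrix_vector_mult_def sum_distrib_left mult.assoc)
  finally show ?thesis .
qed

lemma transpose_minus: "transpose (A - B) = transpose A - transpose (B :: real^'n^'m)"
  by (simp add: transpose_def vec_eq_iff)

lemma matrix_diff_distribs:
  fixes A B :: "real^'n^'m"
  shows "(A - B) ** C = A ** C - B ** C" "D ** (A - B) = D ** A - D ** B"
  by (simp_all add: matrix_matrix_mult_def vec_eq_iff left_diff_distrib right_diff_distrib sum_subtractf)

lemma pos_def_congruence:
  assumes "pos_def S" and inj: "\<And>x. A *v x = 0 \<Longrightarrow> x = (0::real^'n)"
  shows "pos_def (transpose A ** S ** A)"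
proof -
  have "x \<bullet> (transpose A ** S ** A *v x) = (A *v x) \<bullet> (S *v (A *v x))" for x
    by (simp add: matrix_vector_mul_assoc[symmetric] inner_matrix_transpose[of x "transpose A"] del: transpose_matrix_vector)
  then show ?thesis
    using assms unfolding pos_def_def
    by (auto simp: matrix_transpose_mul matrix_mul_assoc)
qed

lemma pos_def_diag_mat: "(\<And>i. 0 < d i) \<Longrightarrow> pos_def (diag_mat d)"
proof -
  assume d: "\<And>i. 0 < d i"
  have "0 < x \<bullet> (diag_mat d *v x)" if "x \<noteq> 0" for x
  proof -
    have "\<exists>i. x $ i \<noteq> 0" using \<open>x \<noteq> 0\<close> by (simp add: vec_eq_iff)
    then obtain i where "x $ i \<noteq> 0" ..
    then have "0 < d i * (x $ i)\<^sup>2" using d[of i] by simp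
    then have "0 < x $ i * (d i * x $ i)" by (simp add: power2_eq_square ac_simps)
    have nn: "0 \<le> x $ j * (d j * x $ j)" for j
      using mult_nonneg_nonneg[OF less_imp_le[OF d[of j]] zero_le_square[of "x $ j"]] by (simp only: ac_simps)
    note \<open>0 < x $ i * (d i * x $ i)\<close>
    also have "x $ i * (d i * x $ i) \<le> x \<bullet> (diag_mat d *v x)"
      unfolding inner_vec_def diag_mat_vec inner_real_def
      by (rule member_le_sum) (use nn in auto)
    finally show ?thesis .
  qed
  then show ?thesis by (simp add: pos_def_def)
qed

text \<open>The eigenproblem is posed for \<open>S ** K ** S\<close> against \<open>S\<close>, not
  for \<open>K\<close> against the inverse of \<open>S\<close>: the eigenvectors are then the rows
  of \<open>P\<close> and the inverse of \<open>S\<close> never appears. The eigenvalues are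
  returned as squares because their roots are the rates of the scalar filters.\<close>

lemma simultaneous_diagonalization:
  fixes K S :: "real^'n^'n"
  assumes K: "pos_def K" and S: "pos_def S"
  obtains P :: "real^'n^'n" and l :: "'n \<Rightarrow> real" where "\<And>i. 0 < l i" "P ** S ** transpose P = mat 1"
    "transpose P ** P ** S = mat 1" "S ** transpose P ** P = mat 1" "K = transpose P ** diag_mat (\<lambda>i. (l i)\<^sup>2) ** P"
proof -
  have St: "transpose S = S" and Kt: "transpose K = K" using S K unfolding pos_def_def by auto
  have "transpose (S ** K ** S) = S ** K ** S"
    by (simp add: matrix_transpose_mul St Kt matrix_mul_assoc)
  from symmetric_pos_def_eigenbasis[OF this S] obtain p :: "'n \<Rightarrow> real^'n" and \<kappa> where
      "(\<forall>i j. p i \<bullet> (S *v p j) = (if i = j then 1 else 0)) \<and> (\<forall>i. (S ** K ** S) *v p i = \<kappa> i *\<^sub>R (S *v p i))"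
    by blast
  then have p: "\<And>i j. p i \<bullet> (S *v p j) = (if i = j then 1 else 0)" and \<kappa>: "\<And>i. (S ** K ** S) *v p i = \<kappa> i *\<^sub>R (S *v p i)"
    by (simp_all only: simp_thms)
  define P where "P = (\<chi> i. p i)"
  have PSP: "P ** S ** transpose P = mat 1"
    by (subst vec_eq_iff, subst vec_eq_iff) (simp add: congruence_nth P_def p mat_def)
  then have *: "transpose P ** (P ** S) = mat 1"
    using matrix_left_right_inverse by blast
  then have **: "S ** transpose P ** P = mat 1"
    proof -
    have "S ** transpose P ** P = transpose (transpose P ** (P ** S))"
      by (simp only: matrix_transpose_mul St matrix_mul_assoc transpose_transpose)
    then show ?thesis unfolding * by simp
  qed
  have D: "P ** (S ** K ** S) ** transpose P = diag_mat \<kappa>"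
    by (subst vec_eq_iff, subst vec_eq_iff) (simp add: congruence_nth P_def p \<kappa> diag_mat_def)
  have "K = (transpose P ** (P ** S)) ** K ** (S ** transpose P ** P)"
    unfolding * ** by simp
  also have "\<dots> = transpose P ** (P ** (S ** K ** S) ** transpose P) ** P"
    by (simp add: matrix_mul_assoc)
  finally have KP: "K = transpose P ** diag_mat \<kappa> ** P" unfolding D .
  have \<kappa>pos: "0 < \<kappa> i" for i
  proof -
    have "S *v p i \<noteq> 0" using p[of i i] by auto
    then have "0 < (S *v p i) \<bullet> (K *v (S *v p i))" using K unfolding pos_def_def by auto
    also have "\<dots> = p i \<bullet> ((S ** K ** S) *v p i)"
      by (simp add: matrix_vector_mul_assoc[symmetric] inner_matrix_transpose[of "p i" S] St)
    also have "\<dots> = \<kappa> i" by (simp add: \<kappa> p)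
    finally show ?thesis .
  qed
  show ?thesis
  proof (rule that[of "\<lambda>i. sqrt (\<kappa> i)" P])
    show "K = transpose P ** diag_mat (\<lambda>i. (sqrt (\<kappa> i))\<^sup>2) ** P"
      using KP \<kappa>pos by (simp add: less_imp_le)
    show "transpose P ** P ** S = mat 1" using * by (simp add: matrix_mul_assoc)
  qed (use \<kappa>pos PSP ** in auto)
qed

text \<open>In coordinates where \<open>S\<close> is the identity and \<open>K\<close> is
  \<open>diag_mat\<close> of the \<open>l\<^sup>2\<close>, the equation is
  \<open>l\<^sup>2 * y\<^sup>2 = 1\<close>. The formula transports \<open>y = 1 / l\<close> back,
  \<open>S ** transpose P\<close> being the inverse of \<open>P\<close>.\<close>

lemma riccati_solution_diagonal:
  fixes K S :: "real^'n^'n"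
  assumes l: "\<And>i. 0 < l i" and P: "P ** S ** transpose P = mat 1" "transpose P ** P ** S = mat 1"
    and K: "K = transpose P ** diag_mat (\<lambda>i. (l i)\<^sup>2) ** P" and S: "pos_def S"
  shows "pd_riccati_solution K S (S ** transpose P ** diag_mat (\<lambda>i. 1 / l i) ** P ** S)"
proof -
  have St: "transpose S = S" using S unfolding pos_def_def by auto
  let ?D = "diag_mat (\<lambda>i. 1 / l i)" and ?L = "diag_mat (\<lambda>i. (l i)\<^sup>2)"
  let ?X = "S ** transpose P ** ?D ** P ** S"
  have inj: "x = 0" if "P ** S *v x = 0" for x
  proof -
    have "x = transpose P *v (P ** S *v x)" using P(2) by (simp add: matrix_vector_mul_assoc matrix_mul_assoc del: transpose_matrix_vector)
    then show ?thesis unfolding that by simp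
  qed
  have "pos_def (transpose (P ** S) ** ?D ** (P ** S))"
    by (rule pos_def_congruence[OF pos_def_diag_mat inj]) (use l in auto)
  then have pd: "pos_def ?X" by (simp add: matrix_transpose_mul St matrix_mul_assoc)
  have "?X ** K ** ?X = S ** transpose P ** (?D ** (P ** S ** transpose P) ** ?L ** (P ** S ** transpose P) ** ?D) ** P ** S"
    unfolding K by (simp add: matrix_mul_assoc)
  also have "?D ** (P ** S ** transpose P) ** ?L ** (P ** S ** transpose P) ** ?D = mat 1"
  proof -
    have "l i \<noteq> 0" for i using l[of i] by simp
    then have "(\<lambda>i. 1 / l i * (l i)\<^sup>2 * (1 / l i)) = (\<lambda>i. 1)" by (simp add: power2_eq_square)
    then show ?thesis unfolding P by (simp add: diag_mat_mult diag_mat_1)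
  qed
  also have "S ** transpose P ** mat 1 ** P ** S = S ** (transpose P ** P ** S)"
    by (simp add: matrix_mul_assoc)
  finally have "?X ** K ** ?X = S" unfolding P by simp
  then show ?thesis using pd by (simp add: pd_riccati_solution_def)
qed

text \<open>The matrix version of \<open>\<bar>sqrt s - sqrt t\<bar>\<^sup>2 \<le> \<bar>s - t\<bar>\<close>: on an eigenvector \<open>r\<close> of \<open>K D\<close>, where \<open>D = Y - Z\<close>,
  the form of \<open>Y K Y - Z K Z = Y K D + D K Z\<close> is the eigenvalue times that of \<open>Y + Z\<close>.\<close>

lemma riccati_holder:
  fixes K :: "real^'n^'n"
  assumes K: "pos_def K"
  obtains c where "\<And>Y Z \<delta> i j. pos_semidef Y \<Longrightarrow> pos_semidef Z \<Longrightarrow>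
    (\<And>x. \<bar>x \<bullet> ((Y ** K ** Y - Z ** K ** Z) *v x)\<bar> \<le> \<delta> * (x \<bullet> x)) \<Longrightarrow> \<bar>(Y - Z) $ i $ j\<bar> \<le> c * sqrt \<delta>"
proof -
  have Kt: "transpose K = K" using K unfolding pos_def_def by auto
  obtain a where a: "a > 0" "\<And>x. a * (x \<bullet> x) \<le> x \<bullet> (K *v x)" using pos_def_coercive[OF K] by metis
  obtain b where b: "b > 0" "\<And>x. norm (K *v x) \<le> b * norm x"
    using linear_bounded_pos[OF matrix_vector_mul_linear[of K]] by (metis mult.commute)
  \<comment> \<open>Each entry of \<open>D\<close> is a sum of \<open>CARD('n)\<close> terms, one
    per eigenvector: the eigenvalue contributes \<open>sqrt (b\<^sup>2 / a) * sqrt \<delta>\<close>,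
    the product of two components of the eigenvector at most \<open>1 / a\<close>. Neither
    \<open>Y\<close> nor \<open>Z\<close> enters.\<close>
  define c where "c = real CARD('n) * (sqrt (b\<^sup>2 / a) / a)"
  have main: "\<bar>(Y - Z) $ i $ j\<bar> \<le> c * sqrt \<delta>" if Y: "pos_semidef Y" and Z: "pos_semidef Z"
    and \<delta>: "\<And>x. \<bar>x \<bullet> ((Y ** K ** Y - Z ** K ** Z) *v x)\<bar> \<le> \<delta> * (x \<bullet> x)" for Y Z \<delta> i j
  proof -
    define D where "D = Y - Z"
    have Yt: "transpose Y = Y" and Zt: "transpose Z = Z" using Y Z unfolding pos_semidef_def by auto
    have Dt: "transpose D = D" unfolding D_def by (simp add: transpose_minus Yt Zt)
    have "transpose (K ** D ** K) = K ** D ** K" by (simp add: matrix_transpose_mul Kt Dt matrix_mul_assoc)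
    from symmetric_pos_def_eigenbasis[OF this K] obtain p :: "'n \<Rightarrow> real^'n" and \<kappa> where
      "(\<forall>i j. p i \<bullet> (K *v p j) = (if i = j then 1 else 0)) \<and> (\<forall>i. (K ** D ** K) *v p i = \<kappa> i *\<^sub>R (K *v p i))"
    by blast
  then have p: "\<And>i j. p i \<bullet> (K *v p j) = (if i = j then 1 else 0)" and \<kappa>: "\<And>i. (K ** D ** K) *v p i = \<kappa> i *\<^sub>R (K *v p i)"
    by (simp_all only: simp_thms)
    define P where "P = (\<chi> i. p i)"
    have "P ** K ** transpose P = mat 1"
      by (subst vec_eq_iff, subst vec_eq_iff) (simp add: congruence_nth P_def p mat_def)
    then have *: "transpose P ** (P ** K) = mat 1"
      using matrix_left_right_inverse by blast
    then have **: "K ** transpose P ** P = mat 1"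
      proof -
    have "K ** transpose P ** P = transpose (transpose P ** (P ** K))"
      by (simp only: matrix_transpose_mul Kt matrix_mul_assoc transpose_transpose)
    then show ?thesis unfolding * by simp
  qed
    have Dg: "P ** (K ** D ** K) ** transpose P = diag_mat \<kappa>"
      by (subst vec_eq_iff, subst vec_eq_iff) (simp add: congruence_nth P_def p \<kappa> diag_mat_def)
    have "D = (transpose P ** (P ** K)) ** D ** (K ** transpose P ** P)"
      unfolding * ** by simp
    also have "\<dots> = transpose P ** (P ** (K ** D ** K) ** transpose P) ** P"
      by (simp add: matrix_mul_assoc)
    finally have DP: "D = transpose P ** diag_mat \<kappa> ** P" unfolding Dg .
    have pp: "p l \<bullet> p l \<le> 1 / a" for l
      using a(2)[of "p l"] a(1) p[of l l] by (simp add: field_simps)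
    have \<kappa>le: "\<bar>\<kappa> l\<bar> \<le> sqrt (b\<^sup>2 / a) * sqrt \<delta>" for l
    proof -
      define r where "r = K *v p l"
      \<comment> \<open>The relation \<open>K ** D ** K *v p = \<kappa> *\<^sub>R (K *v p)\<close>
        says that \<open>r = K *v p\<close> is an eigenvector of \<open>K ** D\<close>.\<close>
      have KDr: "K *v (D *v r) = \<kappa> l *\<^sub>R r"
        using \<kappa>[of l] unfolding r_def by (simp add: matrix_vector_mul_assoc matrix_mul_assoc)
      have yz: "0 \<le> r \<bullet> (Y *v r)" "0 \<le> r \<bullet> (Z *v r)" using Y Z unfolding pos_semidef_def by auto
      have "r \<bullet> (D *v r) = p l \<bullet> (K *v (D *v r))"
        unfolding r_def by (simp add: inner_matrix_transpose[of "p l" K] Kt)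
      also have "\<dots> = \<kappa> l" unfolding KDr using p[of l l] by (simp add: r_def)
      finally have "\<kappa> l = r \<bullet> (Y *v r) - r \<bullet> (Z *v r)"
        by (simp add: D_def matrix_vector_mult_diff_rdistrib inner_diff_right)
      \<comment> \<open>A difference of nonnegative numbers is at most their sum in modulus. This
        sum is the factor that accompanies the eigenvalue in the form of
        \<open>Y ** K ** Y - Z ** K ** Z\<close>, so the bound below becomes quadratic in the
        eigenvalue.\<close>
      then have ab: "\<bar>\<kappa> l\<bar> \<le> r \<bullet> (Y *v r) + r \<bullet> (Z *v r)" using yz by auto
      have "Y ** K ** Y - Z ** K ** Z = Y ** K ** D + D ** K ** Z"
        unfolding D_def by (simp add: matrix_diff_distribs matrix_mul_assoc)
      then have "r \<bullet> ((Y ** K ** Y - Z ** K ** Z) *v r) = r \<bullet> (Y *v (K *v (D *v r))) + r \<bullet> (D *v (K *v (Z *v r)))"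
        by (simp add: matrix_vector_mult_add_rdistrib inner_add_right matrix_vector_mul_assoc[symmetric])
      also have "r \<bullet> (D *v (K *v (Z *v r))) = (K *v (D *v r)) \<bullet> (Z *v r)"
        by (simp add: inner_matrix_transpose Dt Kt)
      finally have "r \<bullet> ((Y ** K ** Y - Z ** K ** Z) *v r) = \<kappa> l * (r \<bullet> (Y *v r) + r \<bullet> (Z *v r))"
        unfolding KDr by (simp add: matrix_vector_mult_scaleR algebra_simps)
      with \<delta>[of r] have "\<bar>\<kappa> l\<bar> * (r \<bullet> (Y *v r) + r \<bullet> (Z *v r)) \<le> \<delta> * (r \<bullet> r)"
        using yz by (simp add: abs_mult)
      then have 1: "(\<kappa> l)\<^sup>2 \<le> \<delta> * (r \<bullet> r)"
        using mult_left_mono[OF ab, of "\<bar>\<kappa> l\<bar>"] by (simp add: power2_eq_square)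
      have \<delta>0: "0 \<le> \<delta>"
        using \<delta>[of "axis undefined 1"] by (simp add: inner_axis_axis)
      have "r \<bullet> r \<le> b\<^sup>2 * (p l \<bullet> p l)"
        using power_mono[OF b(2)[of "p l"], of 2] by (simp add: r_def power_mult_distrib power2_norm_eq_inner)
      also have "\<dots> \<le> b\<^sup>2 * (1 / a)" using pp by (intro mult_left_mono) auto
      finally have "\<delta> * (r \<bullet> r) \<le> \<delta> * (b\<^sup>2 / a)" using \<delta>0 by (intro mult_left_mono) auto
      then have "sqrt ((\<kappa> l)\<^sup>2) \<le> sqrt (\<delta> * (b\<^sup>2 / a))" using 1 by (intro real_sqrt_le_mono) linarith
      then show ?thesis unfolding real_sqrt_mult[symmetric] by (simp add: mult.commute)
    qed
    have "D $ i $ j = (\<Sum>l\<in>UNIV. \<kappa> l * (p l $ i * p l $ j))"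
      unfolding DP by (simp add: P_def matrix_matrix_mult_def transpose_def diag_mat_def mult_if_0 ac_simps)
    also have "\<bar>\<dots>\<bar> \<le> (\<Sum>l\<in>(UNIV::'n set). (sqrt (b\<^sup>2 / a) * sqrt \<delta>) * (1 / a))"
    proof (rule order_trans[OF sum_abs], rule sum_mono)
      fix l
      have "\<bar>p l $ i * p l $ j\<bar> \<le> norm (p l) * norm (p l)"
        unfolding abs_mult by (rule mult_mono) (auto simp: component_le_norm_cart)
      also have "\<dots> \<le> 1 / a" using pp[of l] by (simp add: power2_norm_eq_inner[symmetric] power2_eq_square)
      finally show "\<bar>\<kappa> l * (p l $ i * p l $ j)\<bar> \<le> (sqrt (b\<^sup>2 / a) * sqrt \<delta>) * (1 / a)"
        unfolding abs_mult[of "\<kappa> l"] using \<kappa>le[of l] by (intro mult_mono) auto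
    qed
    finally show ?thesis unfolding c_def D_def by (simp add: ac_simps)
  qed
  then show ?thesis using that by blast
qed

text \<open>Uniqueness is the Hoelder estimate with right-hand sides at distance zero.\<close>

lemma pd_riccati_solution_unique:
  fixes K S :: "real^'n^'n"
  assumes K: "pos_def K" and XY: "pd_riccati_solution K S X" "pd_riccati_solution K S Y"
  shows "X = Y"
proof -
  obtain c where c: "\<And>Y Z \<delta> i j. pos_semidef Y \<Longrightarrow> pos_semidef Z \<Longrightarrow>
    (\<And>x. \<bar>x \<bullet> ((Y ** K ** Y - Z ** K ** Z) *v x)\<bar> \<le> \<delta> * (x \<bullet> x)) \<Longrightarrow> \<bar>(Y - Z) $ i $ j\<bar> \<le> c * sqrt \<delta>"
    by (rule riccati_holder[OF K]) blast
  have "X ** K ** X = Y ** K ** Y" using XY unfolding pd_riccati_solution_def by (simp add: algebra_simps)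
  then have "\<bar>(X - Y) $ i $ j\<bar> \<le> c * sqrt 0" for i j
    by (intro c) (use XY in \<open>auto simp: pd_riccati_solution_def pos_def_imp_pos_semidef\<close>)
  then have "(X - Y) $ i $ j = 0" for i j by (simp only: real_sqrt_zero mult_zero_right abs_le_zero_iff)
  then have "X - Y = 0" by (subst vec_eq_iff, subst vec_eq_iff) simp
  then show ?thesis by simp
qed

lemma pd_riccati_solution_ex1:
  fixes K S :: "real^'n^'n"
  assumes K: "pos_def K" and S: "pos_def S"
  shows "\<exists>!X. pd_riccati_solution K S X"
proof -
  obtain P :: "real^'n^'n" and l :: "'n \<Rightarrow> real" where P: "\<And>i. 0 < l i" "P ** S ** transpose P = mat 1"
    "transpose P ** P ** S = mat 1" "S ** transpose P ** P = mat 1" "K = transpose P ** diag_mat (\<lambda>i. (l i)\<^sup>2) ** P"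
    by (rule simultaneous_diagonalization[OF K S]) (rule that)
  note * = riccati_solution_diagonal[OF P(1,2,3,5) S]
  show ?thesis
  proof (rule ex1I)
    fix X assume "pd_riccati_solution K S X"
    then show "X = S ** transpose P ** diag_mat (\<lambda>i. 1 / l i) ** P ** S"
      using * by (rule pd_riccati_solution_unique[OF K])
  qed (rule *)
qed

section \<open>Gaussian integration by parts\<close>

lemma normal_density_0_deriv:
  assumes "\<sigma> > 0"
  shows "(normal_density 0 \<sigma> has_real_derivative - x / \<sigma>\<^sup>2 * normal_density 0 \<sigma> x) (at x)"
  unfolding normal_density_def using assms
  by (auto intro!: derivative_eq_intros simp: field_simps power2_eq_square)

lemma normal_density_0_at_top:
  assumes "\<sigma> > 0"
  shows "(normal_density 0 \<sigma> \<longlongrightarrow> 0) at_top" "(normal_density 0 \<sigma> \<longlongrightarrow> 0) at_bot"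
  unfolding normal_density_def using assms by real_asymp+

lemma integrable_normal_mult_bounded:
  fixes g :: "real \<Rightarrow> real"
  assumes "\<sigma> > 0" "g \<in> borel_measurable borel" "\<And>x. \<bar>g x\<bar> \<le> c"
  shows "integrable lborel (\<lambda>x. normal_density 0 \<sigma> x * g x)"
    "integrable lborel (\<lambda>x. normal_density 0 \<sigma> x * (x * g x))"
proof -
  have c: "0 \<le> c" using assms(3)[of 0] by linarith
  show "integrable lborel (\<lambda>x. normal_density 0 \<sigma> x * g x)"
    by (rule Bochner_Integration.integrable_bound[where f="\<lambda>x. c * normal_density 0 \<sigma> x"])
       (use assms c in \<open>auto simp: abs_mult mult.commute intro!: mult_right_mono\<close>)
  show "integrable lborel (\<lambda>x. normal_density 0 \<sigma> x * (x * g x))"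
  proof (rule Bochner_Integration.integrable_bound[where f="\<lambda>x. c * (normal_density 0 \<sigma> x * \<bar>x - 0\<bar>^1)"])
    show "integrable lborel (\<lambda>x. c * (normal_density 0 \<sigma> x * \<bar>x - 0\<bar>^1))"
      using integrable_normal_moment_abs[OF assms(1)] by (rule integrable_mult_right)
    have "\<bar>x\<bar> * \<bar>g x\<bar> \<le> c * \<bar>x\<bar>" for x
      using mult_right_mono[OF assms(3)[of x], of "\<bar>x\<bar>"] by (simp add: mult.commute)
    then have "normal_density 0 \<sigma> x * (\<bar>x\<bar> * \<bar>g x\<bar>) \<le> normal_density 0 \<sigma> x * (c * \<bar>x\<bar>)" for x
      by (rule mult_left_mono) simp
    then show "AE x in lborel. norm (normal_density 0 \<sigma> x * (x * g x)) \<le> norm (c * (normal_density 0 \<sigma> x * \<bar>x - 0\<bar> ^ 1))"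
      using c by (auto simp: abs_mult ac_simps)
  qed (use assms in measurable)
qed

text \<open>Integration by parts over the line: the density has logarithmic derivative
  \<open>- x / \<sigma>\<^sup>2\<close>, so the integrand of the difference is the derivative of
  \<open>?F\<close>, and the boundary terms vanish because \<open>g\<close> is bounded and the
  density decays.\<close>

lemma normal_stein:
  fixes g g' :: "real \<Rightarrow> real"
  assumes s: "\<sigma> > 0" and g: "\<And>x. (g has_real_derivative g' x) (at x)"
    and g': "continuous_on UNIV g'" and c: "\<And>x. \<bar>g x\<bar> \<le> c" "\<And>x. \<bar>g' x\<bar> \<le> c'"
  shows "(\<integral>x. normal_density 0 \<sigma> x * (x * g x) \<partial>lborel) = \<sigma>\<^sup>2 * (\<integral>x. normal_density 0 \<sigma> x * g' x \<partial>lborel)"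
proof -
  let ?n = "normal_density 0 \<sigma>"
  let ?F = "\<lambda>x. - \<sigma>\<^sup>2 * (g x * ?n x)"
  let ?f = "\<lambda>x. ?n x * (x * g x) - \<sigma>\<^sup>2 * (?n x * g' x)"
  have gc: "continuous_on UNIV g"
    using g by (meson DERIV_isCont continuous_at_imp_continuous_on)
  have [measurable]: "g \<in> borel_measurable borel" "g' \<in> borel_measurable borel"
    using gc g' by (auto intro: borel_measurable_continuous_onI)
  have i1: "integrable lborel (\<lambda>x. ?n x * (x * g x))" "integrable lborel (\<lambda>x. \<sigma>\<^sup>2 * (?n x * g' x))"
    using integrable_normal_mult_bounded[OF s _ c(1)] integrable_normal_mult_bounded[OF s _ c(2)] by auto
  have F: "(?F has_vector_derivative ?f x) (at x)" for x
    unfolding has_real_derivative_iff_has_vector_derivative[symmetric]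
    using s by (auto intro!: derivative_eq_intros g normal_density_0_deriv simp: field_simps power2_eq_square)
  have nc: "continuous_on UNIV ?n"
    using normal_density_0_deriv[OF s] by (meson DERIV_isCont continuous_at_imp_continuous_on)
  have fc: "continuous_on UNIV ?f"
    by (intro continuous_intros nc gc g')
  have lim0: "((\<lambda>x. g x * ?n x) \<longlongrightarrow> 0) F'" if "(?n \<longlongrightarrow> 0) F'" for F'
  proof (rule Lim_null_comparison[where g="\<lambda>x. c * ?n x"])
    show "\<forall>\<^sub>F x in F'. norm (g x * ?n x) \<le> c * ?n x"
      by (rule always_eventually) (auto simp: abs_mult intro!: mult_right_mono c)
    show "((\<lambda>x. c * ?n x) \<longlongrightarrow> 0) F'" using tendsto_mult[OF tendsto_const that, of c] by simp
  qed
  have lims: "(?F \<longlongrightarrow> 0) at_top" "(?F \<longlongrightarrow> 0) at_bot"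
    using tendsto_mult[OF tendsto_const lim0[OF normal_density_0_at_top(1)[OF s]], of "-\<sigma>\<^sup>2"]
      tendsto_mult[OF tendsto_const lim0[OF normal_density_0_at_top(2)[OF s]], of "-\<sigma>\<^sup>2"] by simp_all
  have "(LBINT x=-\<infinity>..\<infinity>. ?f x) = 0 - 0"
  proof (rule interval_integral_FTC_integrable[where F="?F"])
    show "isCont ?f x" for x using fc by (simp add: continuous_on_eq_continuous_at)
    show "set_integrable lborel (einterval (-\<infinity>) \<infinity>) ?f"
      unfolding set_integrable_def using i1 by simp
    show "((?F \<circ> real_of_ereal) \<longlongrightarrow> 0) (at_right (-\<infinity>))"
      using lims by (simp add: at_right_MInf tendsto_compose_filtermap filtermap_filtermap)
    show "((?F \<circ> real_of_ereal) \<longlongrightarrow> 0) (at_left \<infinity>)"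
      using lims by (simp add: at_left_PInf tendsto_compose_filtermap filtermap_filtermap)
  qed (use F in auto)
  then have "(\<integral>x. ?f x \<partial>lborel) = 0"
    by (simp add: interval_lebesgue_integral_def set_lebesgue_integral_def)
  then show ?thesis using i1 by simp
qed

text \<open>Integrating out \<open>X\<close> first, with \<open>R\<close> frozen, reduces to one
  variable. \<open>X\<close> is presented as \<open>\<pi> (X\<^sub>0 \<omega>)\<close> because
  splitting an independent family by \<open>indep_var_restrict\<close> yields the one-element family
  rather than its member.\<close>

lemma (in prob_space) indep_stein:
  fixes \<psi> \<psi>' :: "'j \<Rightarrow> real \<Rightarrow> real" and N :: "'c measure"
  assumes ind: "indep_var N\<^sub>0 X\<^sub>0 N R" and \<pi>[measurable]: "\<pi> \<in> borel_measurable N\<^sub>0" and X\<^sub>0: "X = (\<lambda>\<omega>. \<pi> (X\<^sub>0 \<omega>))"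
    and X: "distributed M lborel X (normal_density 0 \<sigma>)" and s: "\<sigma> > 0"
    and J: "finite J"
    and \<psi>: "\<And>j x. j \<in> J \<Longrightarrow> (\<psi> j has_real_derivative \<psi>' j x) (at x)" "\<And>j. j \<in> J \<Longrightarrow> continuous_on UNIV (\<psi>' j)"
      "\<And>j x. j \<in> J \<Longrightarrow> \<bar>\<psi> j x\<bar> \<le> 1" "\<And>j x. j \<in> J \<Longrightarrow> \<bar>\<psi>' j x\<bar> \<le> C"
    and \<rho>[measurable]: "\<And>j. j \<in> J \<Longrightarrow> \<rho> j \<in> borel_measurable N"
  shows "expectation (\<lambda>\<omega>. X \<omega> * (\<Prod>j\<in>J. \<psi> j (b j * X \<omega> + \<rho> j (R \<omega>))))
    = \<sigma>\<^sup>2 * expectation (\<lambda>\<omega>. \<Sum>j\<in>J. b j * (\<psi>' j (b j * X \<omega> + \<rho> j (R \<omega>)) * (\<Prod>i\<in>J-{j}. \<psi> i (b i * X \<omega> + \<rho> i (R \<omega>)))))"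
proof -
  let ?n = "normal_density 0 \<sigma>"
  define G where "G = (\<lambda>x r. \<Prod>j\<in>J. \<psi> j (b j * x + \<rho> j r))"
  define D where "D = (\<lambda>x r. \<Sum>j\<in>J. b j * (\<psi>' j (b j * x + \<rho> j r) * (\<Prod>i\<in>J-{j}. \<psi> i (b i * x + \<rho> i r))))"
  have \<psi>c: "continuous_on UNIV (\<psi> j)" if "j \<in> J" for j
    using \<psi>(1)[OF that] by (meson DERIV_isCont continuous_at_imp_continuous_on)
  have [measurable]: "\<psi> j \<in> borel_measurable borel" "\<psi>' j \<in> borel_measurable borel" if "j \<in> J" for j
    using \<psi>c[OF that] \<psi>(2)[OF that] by (auto intro: borel_measurable_continuous_onI)
  have Gm[measurable]: "(\<lambda>(x, r). G x r) \<in> borel_measurable (borel \<Otimes>\<^sub>M N)"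
    unfolding G_def by measurable
  have Dm[measurable]: "(\<lambda>(x, r). D x r) \<in> borel_measurable (borel \<Otimes>\<^sub>M N)"
    unfolding D_def by measurable
  have Gb: "\<bar>G x r\<bar> \<le> 1" for x r
    unfolding G_def abs_prod by (rule prod_le_1) (use \<psi>(3) in auto)
  define c' where "c' = (\<Sum>j\<in>J. \<bar>b j\<bar> * C)"
  have Db: "\<bar>D x r\<bar> \<le> c'" for x r
    unfolding D_def c'_def
  proof (rule order_trans[OF sum_abs], rule sum_mono)
    fix j assume j: "j \<in> J"
    have C: "0 \<le> C" using \<psi>(4)[OF j, of 0] by linarith
    have "\<bar>\<psi>' j (b j * x + \<rho> j r)\<bar> * \<bar>\<Prod>i\<in>J-{j}. \<psi> i (b i * x + \<rho> i r)\<bar> \<le> C * 1"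
      by (rule mult_mono) (use \<psi>(3,4) j C in \<open>auto simp: abs_prod intro!: prod_le_1 prod_nonneg\<close>)
    then show "\<bar>b j * (\<psi>' j (b j * x + \<rho> j r) * (\<Prod>i\<in>J-{j}. \<psi> i (b i * x + \<rho> i r)))\<bar> \<le> \<bar>b j\<bar> * C"
      by (auto simp: abs_mult intro!: mult_left_mono)
  qed
  have Gd: "((\<lambda>x. G x r) has_real_derivative D x r) (at x)" for x r
    unfolding G_def D_def
    by (rule DERIV_cong, rule has_field_derivative_prod, rule DERIV_chain2[OF \<psi>(1)])
      (auto intro!: derivative_eq_intros sum.cong)
  have Dc: "continuous_on UNIV (\<lambda>x. D x r)" for r
    unfolding D_def
    by (intro continuous_intros continuous_on_compose2[OF \<psi>c] continuous_on_compose2[OF \<psi>(2)]) auto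
  have rv[measurable]: "X\<^sub>0 \<in> measurable M N\<^sub>0" "R \<in> measurable M N"
    using indep_var_rv1[OF ind] indep_var_rv2[OF ind] by auto
  have [measurable]: "X \<in> borel_measurable M" unfolding X\<^sub>0 by simp
  have jd: "distr M (N\<^sub>0 \<Otimes>\<^sub>M N) (\<lambda>\<omega>. (X\<^sub>0 \<omega>, R \<omega>)) = distr M N\<^sub>0 X\<^sub>0 \<Otimes>\<^sub>M distr M N R"
    using ind unfolding indep_var_distribution_eq by simp
  have dX: "distr M borel X = density lborel ?n"
    using distributed_distr_eq_density[OF X] by (metis distr_cong sets_lborel)
  interpret A: prob_space "distr M N\<^sub>0 X\<^sub>0" by (rule prob_space_distr) simp
  interpret B: prob_space "distr M N R" by (rule prob_space_distr) simp
  interpret AB: pair_prob_space "distr M N\<^sub>0 X\<^sub>0" "distr M N R" ..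
  have E: "expectation (\<lambda>\<omega>. h (X \<omega>) (R \<omega>)) = (\<integral>r. (\<integral>x. ?n x * h x r \<partial>lborel) \<partial>distr M N R)"
    if [measurable]: "(\<lambda>(x, r). h x r) \<in> borel_measurable (borel \<Otimes>\<^sub>M N)"
      and i: "integrable M (\<lambda>\<omega>. h (X \<omega>) (R \<omega>))" for h :: "real \<Rightarrow> 'c \<Rightarrow> real"
  proof -
    have i': "integrable (distr M N\<^sub>0 X\<^sub>0 \<Otimes>\<^sub>M distr M N R) (\<lambda>(x, r). h (\<pi> x) r)"
      unfolding jd[symmetric] by (subst integrable_distr_eq) (use i in \<open>auto simp: X\<^sub>0\<close>)
    have "expectation (\<lambda>\<omega>. h (X \<omega>) (R \<omega>)) = (\<integral>p. (\<lambda>(x, r). h (\<pi> x) r) p \<partial>distr M (N\<^sub>0 \<Otimes>\<^sub>M N) (\<lambda>\<omega>. (X\<^sub>0 \<omega>, R \<omega>)))"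
      by (subst integral_distr) (auto simp: X\<^sub>0)
    also have "\<dots> = (\<integral>r. (\<integral>x. h (\<pi> x) r \<partial>distr M N\<^sub>0 X\<^sub>0) \<partial>distr M N R)"
      unfolding jd by (rule AB.integral_snd[symmetric, OF i'])
    also have "\<dots> = (\<integral>r. (\<integral>x. ?n x * h x r \<partial>lborel) \<partial>distr M N R)"
    proof (rule Bochner_Integration.integral_cong[OF refl])
      fix r assume "r \<in> space (distr M N R)"
      then have [measurable]: "(\<lambda>x. h x r) \<in> borel_measurable borel" by simp
      have "(\<integral>x. h (\<pi> x) r \<partial>distr M N\<^sub>0 X\<^sub>0) = (\<integral>x. h x r \<partial>distr M borel X)"
        by (simp add: integral_distr X\<^sub>0)
      also have "\<dots> = (\<integral>x. ?n x * h x r \<partial>lborel)"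
        unfolding dX by (subst integral_density) auto
      finally show "(\<integral>x. h (\<pi> x) r \<partial>distr M N\<^sub>0 X\<^sub>0) = (\<integral>x. ?n x * h x r \<partial>lborel)" .
    qed
    finally show ?thesis .
  qed
  have iX: "integrable M X"
  proof -
    have "integrable lborel (\<lambda>x. ?n x * x)" using integrable_normal_mult_bounded(2)[OF s, of "\<lambda>_. 1" 1] by simp
    then have "integrable (density lborel ?n) (\<lambda>x. x)" by (subst integrable_density) auto
    then show ?thesis unfolding dX[symmetric] by (subst (asm) integrable_distr_eq) auto
  qed
  have iG: "integrable M (\<lambda>\<omega>. X \<omega> * G (X \<omega>) (R \<omega>))"
  proof (rule Bochner_Integration.integrable_bound[OF iX])
    show "AE \<omega> in M. norm (X \<omega> * G (X \<omega>) (R \<omega>)) \<le> norm (X \<omega>)"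
      using mult_left_mono[OF Gb, of "\<bar>X _\<bar>"] by (auto simp: abs_mult)
  qed measurable
  have iD: "integrable M (\<lambda>\<omega>. D (X \<omega>) (R \<omega>))"
    by (rule integrable_const_bound[where B=c']) (use Db in auto)
  have "expectation (\<lambda>\<omega>. X \<omega> * G (X \<omega>) (R \<omega>)) = (\<integral>r. (\<integral>x. ?n x * (x * G x r) \<partial>lborel) \<partial>distr M N R)"
    by (rule E[of "\<lambda>x r. x * G x r"]) (use iG in measurable)
  also have "\<dots> = (\<integral>r. \<sigma>\<^sup>2 * (\<integral>x. ?n x * D x r \<partial>lborel) \<partial>distr M N R)"
    by (subst normal_stein[OF s Gd Dc Gb Db]) simp
  also have "\<dots> = \<sigma>\<^sup>2 * expectation (\<lambda>\<omega>. D (X \<omega>) (R \<omega>))"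
    by (subst E[OF Dm iD]) simp
  finally show ?thesis unfolding G_def D_def .
qed

lemma (in prob_space) normal_moments:
  assumes X: "distributed M lborel X (normal_density 0 \<sigma>)" and s: "\<sigma> > 0"
  shows "integrable M X" "integrable M (\<lambda>\<omega>. (X \<omega>)\<^sup>2)" "expectation X = 0" "expectation (\<lambda>\<omega>. (X \<omega>)\<^sup>2) = \<sigma>\<^sup>2"
proof -
  show "integrable M X"
    using distributed_integrable_var[OF X _ integrable_normal_moment_nz_1[OF s]] by simp
  show "integrable M (\<lambda>\<omega>. (X \<omega>)\<^sup>2)"
    using distributed_integrable[OF X, of "\<lambda>x. x\<^sup>2"] integrable_normal_moment[OF s, where \<mu>=0 and k=2] by simp
  show e: "expectation X = 0" by (rule normal_distributed_expectation[OF s X])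
  show "expectation (\<lambda>\<omega>. (X \<omega>)\<^sup>2) = \<sigma>\<^sup>2"
    using normal_distributed_variance[OF s X] e by simp
qed

lemma (in prob_space) indep_vars_imp_indep_var:
  assumes ind: "indep_vars M' X I" and "i \<in> I" "j \<in> I" "i \<noteq> j"
  shows "indep_var (M' i) (X i) (M' j) (X j)"
proof -
  have "indep_var (PiM {i} M') (\<lambda>\<omega>. restrict (\<lambda>i. X i \<omega>) {i}) (PiM {j} M') (\<lambda>\<omega>. restrict (\<lambda>i. X i \<omega>) {j})"
    by (rule indep_var_restrict[OF ind]) (use assms in auto)
  from indep_var_compose[OF this, of "\<lambda>f. f i" "M' i" "\<lambda>f. f j" "M' j"]
  show ?thesis by (simp add: comp_def)
qed

lemma (in prob_space) indep_normal_covariance: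
  assumes L: "finite L" and ind: "indep_vars (\<lambda>_. borel) \<xi> L"
    and \<xi>: "\<And>l. l \<in> L \<Longrightarrow> distributed M lborel (\<xi> l) (normal_density 0 (\<sigma> l))" "\<And>l. l \<in> L \<Longrightarrow> \<sigma> l > 0"
  shows "expectation (\<lambda>\<omega>. (\<Sum>l\<in>L. a l * \<xi> l \<omega>) * (\<Sum>l\<in>L. b l * \<xi> l \<omega>)) = (\<Sum>l\<in>L. a l * b l * (\<sigma> l)\<^sup>2)"
proof -
  note m = normal_moments[OF \<xi>]
  have prod: "integrable M (\<lambda>\<omega>. \<xi> l \<omega> * \<xi> k \<omega>) \<and> expectation (\<lambda>\<omega>. \<xi> l \<omega> * \<xi> k \<omega>) = (if k = l then (\<sigma> l)\<^sup>2 else 0)"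
    if "l \<in> L" "k \<in> L" for l k
  proof (cases "k = l")
    case True then show ?thesis using m[OF that(1) that(1)] by (simp add: power2_eq_square)
  next
    case False
    have "indep_var borel (\<xi> l) borel (\<xi> k)"
      using False that by (intro indep_vars_imp_indep_var[OF ind]) auto
    then show ?thesis
      using False m(1,3)[OF that(1) that(1)] m(1,3)[OF that(2) that(2)]
      by (auto intro: indep_var_integrable simp: indep_var_lebesgue_integral)
  qed
  have "expectation (\<lambda>\<omega>. (\<Sum>l\<in>L. a l * \<xi> l \<omega>) * (\<Sum>l\<in>L. b l * \<xi> l \<omega>))
     = expectation (\<lambda>\<omega>. \<Sum>l\<in>L. \<Sum>k\<in>L. a l * b k * (\<xi> l \<omega> * \<xi> k \<omega>))"
    by (simp add: sum_product ac_simps)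
  also have "\<dots> = (\<Sum>l\<in>L. \<Sum>k\<in>L. a l * b k * (if k = l then (\<sigma> l)\<^sup>2 else 0))"
    using prod by (simp add: Bochner_Integration.integral_sum)
  also have "\<dots> = (\<Sum>l\<in>L. a l * b l * (\<sigma> l)\<^sup>2)"
    using L by (intro sum.cong) (auto simp: if_distrib sum.delta' cong: if_cong)
  finally show ?thesis .
qed

text \<open>Summing the one-variable formula over \<open>l\<close> recombines the coefficients into
  the covariances of the two linear forms, each multiplied by the expectation of a factor bounded by
  \<open>C\<close>. The right-hand side no longer shows the representation by \<open>\<xi>\<close>,
  which is what allows the passage to L2 limits.\<close>

lemma (in prob_space) indep_normal_stein_bound:
  fixes \<psi> \<psi>' :: "'j \<Rightarrow> real \<Rightarrow> real" and \<xi> :: "'l \<Rightarrow> 'a \<Rightarrow> real"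
  assumes L: "finite L" and ind: "indep_vars (\<lambda>_. borel) \<xi> L"
    and \<xi>: "\<And>l. l \<in> L \<Longrightarrow> distributed M lborel (\<xi> l) (normal_density 0 (\<sigma> l))" "\<And>l. l \<in> L \<Longrightarrow> \<sigma> l > 0"
    and J: "finite J"
    and \<psi>: "\<And>j x. j \<in> J \<Longrightarrow> (\<psi> j has_real_derivative \<psi>' j x) (at x)" "\<And>j. j \<in> J \<Longrightarrow> continuous_on UNIV (\<psi>' j)"
      "\<And>j x. j \<in> J \<Longrightarrow> \<bar>\<psi> j x\<bar> \<le> 1" "\<And>j x. j \<in> J \<Longrightarrow> \<bar>\<psi>' j x\<bar> \<le> C"
  shows "\<bar>expectation (\<lambda>\<omega>. (\<Sum>l\<in>L. a l * \<xi> l \<omega>) * (\<Prod>j\<in>J. \<psi> j (\<Sum>l\<in>L. b j l * \<xi> l \<omega>)))\<bar>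
    \<le> C * (\<Sum>j\<in>J. \<bar>expectation (\<lambda>\<omega>. (\<Sum>l\<in>L. a l * \<xi> l \<omega>) * (\<Sum>l\<in>L. b j l * \<xi> l \<omega>))\<bar>)"
proof -
  define Y where "Y j \<omega> = (\<Sum>l\<in>L. b j l * \<xi> l \<omega>)" for j \<omega>
  define P where "P j \<omega> = \<psi>' j (Y j \<omega>) * (\<Prod>i\<in>J-{j}. \<psi> i (Y i \<omega>))" for j \<omega>
  have m: "integrable M (\<xi> l)" "integrable M (\<lambda>\<omega>. (\<xi> l \<omega>)\<^sup>2)" "expectation (\<xi> l) = 0" if "l \<in> L" for l
    using normal_moments[OF \<xi>] that by auto
  have \<psi>c: "continuous_on UNIV (\<psi> j)" if "j \<in> J" for j
    using \<psi>(1)[OF that] by (meson DERIV_isCont continuous_at_imp_continuous_on)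
  have [measurable]: "\<psi> j \<in> borel_measurable borel" "\<psi>' j \<in> borel_measurable borel" if "j \<in> J" for j
    using \<psi>c[OF that] \<psi>(2)[OF that] by (auto intro: borel_measurable_continuous_onI)
  have [measurable]: "\<xi> l \<in> borel_measurable M" if "l \<in> L" for l using m(1)[OF that] by auto
  have [measurable]: "Y j \<in> borel_measurable M" for j unfolding Y_def by measurable
  have Pm[measurable]: "P j \<in> borel_measurable M" if "j \<in> J" for j unfolding P_def using that by measurable
  have Pb: "\<bar>P j \<omega>\<bar> \<le> C" if "j \<in> J" for j \<omega>
  proof -
    have C: "0 \<le> C" using \<psi>(4)[OF that, of 0] by linarith
    have "\<bar>\<psi>' j (Y j \<omega>)\<bar> * \<bar>\<Prod>i\<in>J-{j}. \<psi> i (Y i \<omega>)\<bar> \<le> C * 1"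
      by (rule mult_mono) (use \<psi>(3,4) that C in \<open>auto simp: abs_prod intro!: prod_le_1 prod_nonneg\<close>)
    then show ?thesis unfolding P_def by (simp add: abs_mult)
  qed
  have Pi: "integrable M (P j)" if "j \<in> J" for j
    by (rule integrable_const_bound[where B=C]) (use Pb Pm that in auto)
  have one: "expectation (\<lambda>\<omega>. \<xi> l \<omega> * (\<Prod>j\<in>J. \<psi> j (Y j \<omega>))) = (\<Sum>j\<in>J. b j l * (\<sigma> l)\<^sup>2 * expectation (P j))"
    if l: "l \<in> L" for l
  proof -
    let ?N = "PiM (L - {l}) (\<lambda>_. borel :: real measure)" and ?R = "\<lambda>\<omega>. restrict (\<lambda>i. \<xi> i \<omega>) (L - {l})"
    define \<rho> where "\<rho> j r = (\<Sum>i\<in>L-{l}. b j i * r i)" for j and r :: "'l \<Rightarrow> real"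
    have [measurable]: "\<rho> j \<in> borel_measurable ?N" for j
      unfolding \<rho>_def by measurable
    have "indep_var (PiM {l} (\<lambda>_. borel)) (\<lambda>\<omega>. restrict (\<lambda>i. \<xi> i \<omega>) {l}) ?N ?R"
      by (rule indep_var_restrict[OF ind]) (use l in auto)
    note iv = this
    \<comment> \<open>Every linear form is affine in the variable \<open>\<xi> l\<close>, with an
      offset that depends on the other variables only.\<close>
    have Yeq: "Y j \<omega> = b j l * \<xi> l \<omega> + \<rho> j (?R \<omega>)" for j \<omega>
      unfolding Y_def \<rho>_def using L l by (subst sum.remove[OF L l]) auto
    have "expectation (\<lambda>\<omega>. \<xi> l \<omega> * (\<Prod>j\<in>J. \<psi> j (Y j \<omega>))) = (\<sigma> l)\<^sup>2 * expectation (\<lambda>\<omega>. \<Sum>j\<in>J. b j l * P j \<omega>)"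
      unfolding P_def Yeq
      by (rule indep_stein[OF iv, where \<pi>="\<lambda>f. f l", OF _ _ \<xi>(1)[OF l] \<xi>(2)[OF l] J]) (use \<psi> in auto)
    also have "\<dots> = (\<sigma> l)\<^sup>2 * (\<Sum>j\<in>J. b j l * expectation (P j))"
      using Pi by (simp add: Bochner_Integration.integral_sum)
    finally show ?thesis by (simp add: sum_distrib_left ac_simps)
  qed
  have Gb: "\<bar>\<Prod>j\<in>J. \<psi> j (Y j \<omega>)\<bar> \<le> 1" for \<omega>
    unfolding abs_prod by (rule prod_le_1) (use \<psi>(3) in auto)
  have iG: "integrable M (\<lambda>\<omega>. \<xi> l \<omega> * (\<Prod>j\<in>J. \<psi> j (Y j \<omega>)))" if "l \<in> L" for l
    by (rule Bochner_Integration.integrable_bound[OF m(1)[OF that]])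
       (use that mult_left_mono[OF Gb, of "\<bar>\<xi> l _\<bar>"] in \<open>auto simp: abs_mult\<close>)
  have "expectation (\<lambda>\<omega>. (\<Sum>l\<in>L. a l * \<xi> l \<omega>) * (\<Prod>j\<in>J. \<psi> j (Y j \<omega>)))
      = (\<Sum>l\<in>L. a l * expectation (\<lambda>\<omega>. \<xi> l \<omega> * (\<Prod>j\<in>J. \<psi> j (Y j \<omega>))))"
    using iG by (simp add: sum_distrib_right mult.assoc Bochner_Integration.integral_sum)
  also have "\<dots> = (\<Sum>l\<in>L. \<Sum>j\<in>J. a l * b j l * (\<sigma> l)\<^sup>2 * expectation (P j))"
    by (rule sum.cong) (simp_all add: one sum_distrib_left ac_simps)
  also have "\<dots> = (\<Sum>j\<in>J. (\<Sum>l\<in>L. a l * b j l * (\<sigma> l)\<^sup>2) * expectation (P j))"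
    by (subst sum.swap) (simp add: sum_distrib_right)
  finally have eq: "expectation (\<lambda>\<omega>. (\<Sum>l\<in>L. a l * \<xi> l \<omega>) * (\<Prod>j\<in>J. \<psi> j (Y j \<omega>)))
     = (\<Sum>j\<in>J. expectation (\<lambda>\<omega>. (\<Sum>l\<in>L. a l * \<xi> l \<omega>) * Y j \<omega>) * expectation (P j))"
    unfolding Y_def by (simp add: indep_normal_covariance[OF L ind \<xi>])
  have "\<bar>expectation (P j)\<bar> \<le> C" if "j \<in> J" for j
  proof -
    have "\<bar>expectation (P j)\<bar> \<le> expectation (\<lambda>\<omega>. \<bar>P j \<omega>\<bar>)" by (rule integral_abs_bound)
    also have "\<dots> \<le> C" using Pi[OF that] Pb[OF that] by (intro integral_le_const) auto
    finally show ?thesis .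
  qed
  then have "\<bar>\<Sum>j\<in>J. expectation (\<lambda>\<omega>. (\<Sum>l\<in>L. a l * \<xi> l \<omega>) * Y j \<omega>) * expectation (P j)\<bar>
    \<le> (\<Sum>j\<in>J. \<bar>expectation (\<lambda>\<omega>. (\<Sum>l\<in>L. a l * \<xi> l \<omega>) * Y j \<omega>)\<bar> * C)"
    by (intro order_trans[OF sum_abs] sum_mono) (auto simp: abs_mult intro!: mult_left_mono)
  then show ?thesis
    using eq unfolding Y_def by (simp add: sum_distrib_left mult.commute)
qed

section \<open>Square-integrable random variables and processes\<close>

definition itv :: "real \<Rightarrow> real \<Rightarrow> real measure" where
  "itv a b = density lborel (indicator {a..b})"

text \<open>The interval measure is a density on the whole line, so its sigma-algebra is that of
  \<open>borel\<close> for every interval: measurability of a process never depends on the horizon,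
  and Fubini applies with a finite measure in time.\<close>

lemma sets_itv [measurable_cong, simp]: "sets (itv a b) = sets borel"
  by (simp add: itv_def)

lemma space_itv [simp]: "space (itv a b) = UNIV"
  by (simp add: itv_def)

lemma emeasure_itv: "a \<le> b \<Longrightarrow> emeasure (itv a b) UNIV = ennreal (b - a)"
  by (simp add: itv_def emeasure_density)

lemma finite_measure_itv: "finite_measure (itv a b)"
  by (rule finite_measureI) (simp add: itv_def emeasure_density emeasure_lborel_Icc_eq)

lemma sigma_finite_itv [simp]: "sigma_finite_measure (itv a b)"
  using finite_measure_itv by (rule finite_measure.axioms)

lemma measure_itv: "a \<le> b \<Longrightarrow> measure (itv a b) UNIV = b - a"
  by (simp add: measure_def emeasure_itv)

lemma nn_integral_itv:
  "f \<in> borel_measurable borel \<Longrightarrow> (\<integral>\<^sup>+s. f s \<partial>itv a b) = (\<integral>\<^sup>+s\<in>{a..b}. f s \<partial>lborel)"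
  unfolding itv_def by (subst nn_integral_density) (auto intro!: nn_integral_cong simp: mult.commute)

lemma density_indicator_real: "itv a b = density lborel (\<lambda>s. ennreal (indicator {a..b} s))"
  unfolding itv_def by (simp add: ennreal_indicator)

lemma integrable_itv:
  fixes f :: "real \<Rightarrow> 'c::{banach, second_countable_topology}"
  assumes "f \<in> borel_measurable borel"
  shows "integrable (itv a b) f \<longleftrightarrow> set_integrable lborel {a..b} f"
  unfolding density_indicator_real set_integrable_def using assms
  by (subst integrable_density) auto

lemma integral_itv:
  fixes f :: "real \<Rightarrow> 'c::{banach, second_countable_topology}"
  assumes "f \<in> borel_measurable borel"
  shows "(\<integral>s. f s \<partial>itv a b) = (LINT s:{a..b}|lborel. f s)"
  unfolding density_indicator_real set_lebesgue_integral_def using assms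
  by (subst integral_density) auto

lemma AE_itv: "(AE s in itv a b. s \<in> {a..b})"
  unfolding itv_def by (subst AE_density) (auto simp: indicator_def)

lemma AE_itvI: "(\<And>s. s \<in> {a..b} \<Longrightarrow> P s) \<Longrightarrow> AE s in itv a b. P s"
  using AE_itv by eventually_elim auto

lemma integral_itv_continuous:
  fixes f :: "real \<Rightarrow> real"
  assumes f: "continuous_on {a..b} f" and m: "f \<in> borel_measurable borel"
  shows "(\<integral>s. f s \<partial>itv a b) = integral {a..b} f" "integrable (itv a b) f"
proof -
  have i: "set_integrable lborel {a..b} f"
    using borel_integrable_atLeastAtMost'[OF f] .
  then show "(\<integral>s. f s \<partial>itv a b) = integral {a..b} f"
    by (simp add: integral_itv[OF m] set_borel_integral_eq_integral)
  show "integrable (itv a b) f" using i by (simp add: integrable_itv[OF m])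
qed

lemma abs_mult_le_sum_squares: "\<bar>x * y\<bar> \<le> x\<^sup>2 + y\<^sup>2" for x y :: real
proof -
  have "2 * (\<bar>x\<bar> * \<bar>y\<bar>) \<le> x\<^sup>2 + y\<^sup>2" using sum_squares_bound[of "\<bar>x\<bar>" "\<bar>y\<bar>"] by (simp add: mult.assoc)
  moreover have "0 \<le> \<bar>x\<bar> * \<bar>y\<bar>" by simp
  ultimately show ?thesis unfolding abs_mult by linarith
qed

context prob_space
begin

definition sq_int :: "('a \<Rightarrow> real) \<Rightarrow> bool" where
  "sq_int X \<longleftrightarrow> X \<in> borel_measurable M \<and> integrable M (\<lambda>\<omega>. (X \<omega>)\<^sup>2)"

definition n2 :: "('a \<Rightarrow> real) \<Rightarrow> real" where
  "n2 X = sqrt (expectation (\<lambda>\<omega>. (X \<omega>)\<^sup>2))"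

lemma sq_int_measurable [measurable_dest]: "sq_int X \<Longrightarrow> X \<in> borel_measurable M"
  by (simp add: sq_int_def)

lemma n2_nonneg [simp]: "0 \<le> n2 X"
  by (simp add: n2_def)

lemma n2_square: "(n2 X)\<^sup>2 = expectation (\<lambda>\<omega>. (X \<omega>)\<^sup>2)"
  by (simp add: n2_def)

lemma sq_int_const [simp]: "sq_int (\<lambda>\<omega>. c)"
  by (simp add: sq_int_def)

lemma integrable_mult_sq_int:
  assumes "sq_int X" "sq_int Y"
  shows "integrable M (\<lambda>\<omega>. X \<omega> * Y \<omega>)"
proof (rule Bochner_Integration.integrable_bound[where f="\<lambda>\<omega>. (X \<omega>)\<^sup>2 + (Y \<omega>)\<^sup>2"])
  show "integrable M (\<lambda>\<omega>. (X \<omega>)\<^sup>2 + (Y \<omega>)\<^sup>2)" using assms by (auto simp: sq_int_def)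
  show "(\<lambda>\<omega>. X \<omega> * Y \<omega>) \<in> borel_measurable M" using assms by (auto simp: sq_int_def)
  show "AE \<omega> in M. norm (X \<omega> * Y \<omega>) \<le> norm ((X \<omega>)\<^sup>2 + (Y \<omega>)\<^sup>2)"
    using abs_mult_le_sum_squares by (intro AE_I2) simp
qed

lemma sq_int_integrable: "sq_int X \<Longrightarrow> integrable M X"
  using integrable_mult_sq_int[of X "\<lambda>_. 1"] by simp

lemma sq_int_cmult: "sq_int X \<Longrightarrow> sq_int (\<lambda>\<omega>. c * X \<omega>)"
  by (auto simp: sq_int_def power_mult_distrib)

lemma sq_int_add: "sq_int X \<Longrightarrow> sq_int Y \<Longrightarrow> sq_int (\<lambda>\<omega>. X \<omega> + Y \<omega>)"
  using integrable_mult_sq_int[of X Y] by (auto simp: sq_int_def power2_sum mult.assoc)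

lemma sq_int_diff: "sq_int X \<Longrightarrow> sq_int Y \<Longrightarrow> sq_int (\<lambda>\<omega>. X \<omega> - Y \<omega>)"
  using sq_int_add[of X "\<lambda>\<omega>. -1 * Y \<omega>"] sq_int_cmult[of Y "-1"] by simp

lemma sq_int_sum: "(\<And>i. i \<in> I \<Longrightarrow> sq_int (X i)) \<Longrightarrow> sq_int (\<lambda>\<omega>. \<Sum>i\<in>I. X i \<omega>)"
  by (induction I rule: infinite_finite_induct) (auto intro: sq_int_add)

lemma sq_int_cong:
  assumes "sq_int X" "\<And>\<omega>. \<omega> \<in> space M \<Longrightarrow> X \<omega> = Y \<omega>"
  shows "sq_int Y"
proof -
  have "X \<in> borel_measurable M \<longleftrightarrow> Y \<in> borel_measurable M" by (rule measurable_cong) (use assms in auto)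
  moreover have "integrable M (\<lambda>\<omega>. (X \<omega>)\<^sup>2) \<longleftrightarrow> integrable M (\<lambda>\<omega>. (Y \<omega>)\<^sup>2)"
    by (rule Bochner_Integration.integrable_cong) (use assms in auto)
  ultimately show ?thesis using assms by (simp add: sq_int_def)
qed

lemma n2_cong: "(\<And>\<omega>. \<omega> \<in> space M \<Longrightarrow> X \<omega> = Y \<omega>) \<Longrightarrow> n2 X = n2 Y"
  unfolding n2_def by (intro arg_cong[where f=sqrt] Bochner_Integration.integral_cong) auto

lemma n2_cauchy_schwarz:
  assumes X: "sq_int X" and Y: "sq_int Y"
  shows "\<bar>expectation (\<lambda>\<omega>. X \<omega> * Y \<omega>)\<bar> \<le> n2 X * n2 Y"
proof -
  have XX: "integrable M (\<lambda>\<omega>. (X \<omega>)\<^sup>2)" and YY: "integrable M (\<lambda>\<omega>. (Y \<omega>)\<^sup>2)"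
    using X Y by (auto simp: sq_int_def)
  let ?b = "expectation (\<lambda>\<omega>. X \<omega> * Y \<omega>)"
  \<comment> \<open>The form is kept homogeneous in two parameters so that it serves both the case
    \<open>n2 Y = 0\<close> and the general one.\<close>
  have q: "0 \<le> s\<^sup>2 * (n2 X)\<^sup>2 + 2 * s * t * ?b + t\<^sup>2 * (n2 Y)\<^sup>2" for s t
  proof -
    have "0 \<le> expectation (\<lambda>\<omega>. (s * X \<omega> + t * Y \<omega>)\<^sup>2)" by simp
    also have "(\<lambda>\<omega>. (s * X \<omega> + t * Y \<omega>)\<^sup>2) = (\<lambda>\<omega>. s\<^sup>2 * (X \<omega>)\<^sup>2 + (2 * s * t) * (X \<omega> * Y \<omega>) + t\<^sup>2 * (Y \<omega>)\<^sup>2)"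
      by (auto simp: power2_eq_square algebra_simps)
    finally show ?thesis using XX YY integrable_mult_sq_int[OF X Y] by (simp add: n2_square)
  qed
  have "?b\<^sup>2 \<le> (n2 X)\<^sup>2 * (n2 Y)\<^sup>2"
  proof (cases "n2 Y = 0")
    case True
    then have "0 \<le> 2 * t * ?b + t\<^sup>2 * (n2 X)\<^sup>2" for t using q[of t 1] by (simp add: algebra_simps)
    from quadratic_nonneg_imp_zero[OF this] show ?thesis by simp
  next
    case False
    then have Y0: "0 < (n2 Y)\<^sup>2" by simp
    \<comment> \<open>The parameters are the minimiser of the quadratic, cleared of
      denominators.\<close>
    have "0 \<le> (n2 Y)\<^sup>2 * ((n2 X)\<^sup>2 * (n2 Y)\<^sup>2 - ?b\<^sup>2)"
      using q[of "(n2 Y)\<^sup>2" "- ?b"] by (simp add: power2_eq_square algebra_simps)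
    then show ?thesis using Y0 by (simp add: zero_le_mult_iff)
  qed
  then have "\<bar>?b\<bar> \<le> \<bar>n2 X * n2 Y\<bar>" unfolding abs_le_square_iff by (simp add: power_mult_distrib)
  then show ?thesis by (simp add: abs_mult)
qed

lemma n2_triangle:
  assumes X: "sq_int X" and Y: "sq_int Y"
  shows "n2 (\<lambda>\<omega>. X \<omega> + Y \<omega>) \<le> n2 X + n2 Y"
proof (rule power2_le_imp_le)
  have "(n2 (\<lambda>\<omega>. X \<omega> + Y \<omega>))\<^sup>2 = expectation (\<lambda>\<omega>. (X \<omega>)\<^sup>2 + 2 * (X \<omega> * Y \<omega>) + (Y \<omega>)\<^sup>2)"
    unfolding n2_square by (simp add: power2_sum algebra_simps)
  also have "\<dots> = (n2 X)\<^sup>2 + 2 * expectation (\<lambda>\<omega>. X \<omega> * Y \<omega>) + (n2 Y)\<^sup>2"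
    using X Y integrable_mult_sq_int[OF X Y] by (simp add: n2_square sq_int_def)
  also have "\<dots> \<le> (n2 X + n2 Y)\<^sup>2"
    using n2_cauchy_schwarz[OF X Y] by (simp add: power2_sum)
  finally show "(n2 (\<lambda>\<omega>. X \<omega> + Y \<omega>))\<^sup>2 \<le> (n2 X + n2 Y)\<^sup>2" .
qed simp

lemma n2_cmult: "n2 (\<lambda>\<omega>. c * X \<omega>) = \<bar>c\<bar> * n2 X"
  by (simp add: n2_def power_mult_distrib real_sqrt_mult)

lemma n2_minus: "n2 (\<lambda>\<omega>. X \<omega> - Y \<omega>) = n2 (\<lambda>\<omega>. Y \<omega> - X \<omega>)"
  by (simp add: n2_def power2_commute)

lemma n2_sum:
  "finite I \<Longrightarrow> (\<And>i. i \<in> I \<Longrightarrow> sq_int (X i)) \<Longrightarrow> n2 (\<lambda>\<omega>. \<Sum>i\<in>I. X i \<omega>) \<le> (\<Sum>i\<in>I. n2 (X i))"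
proof (induction I rule: finite_induct)
  case empty then show ?case by (simp add: n2_def)
next
  case (insert i I)
  then show ?case using n2_triangle[of "X i" "\<lambda>\<omega>. \<Sum>i\<in>I. X i \<omega>"] sq_int_sum[of I X] by force
qed

lemma n2_le_sqrt: "expectation (\<lambda>\<omega>. (X \<omega>)\<^sup>2) \<le> c \<Longrightarrow> n2 X \<le> sqrt c"
  by (simp add: n2_def)

text \<open>Measurability is required for all times and only the integrability is tied to the
  interval, so that the interval can be shrunk freely.\<close>

definition l2_joint :: "real \<Rightarrow> real \<Rightarrow> (real \<Rightarrow> 'a \<Rightarrow> real) \<Rightarrow> bool" where
  "l2_joint a b X \<longleftrightarrow> (\<lambda>(t, \<omega>). X t \<omega>) \<in> borel_measurable (borel \<Otimes>\<^sub>M M) \<and>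
    integrable (itv a b \<Otimes>\<^sub>M M) (\<lambda>(t, \<omega>). (X t \<omega>)\<^sup>2)"

lemma pair_sigma_finite_itv: "pair_sigma_finite (itv a b) M"
  by (rule pair_sigma_finite.intro) (simp_all add: sigma_finite_measure_axioms)

lemma l2_joint_mult:
  assumes "l2_joint a b X" "l2_joint a b Y"
  shows "integrable (itv a b \<Otimes>\<^sub>M M) (\<lambda>(t, \<omega>). X t \<omega> * Y t \<omega>)"
proof (rule Bochner_Integration.integrable_bound[where f="\<lambda>p. (\<lambda>(t, \<omega>). (X t \<omega>)\<^sup>2) p + (\<lambda>(t, \<omega>). (Y t \<omega>)\<^sup>2) p"])
  have [measurable]: "(\<lambda>(t, \<omega>). X t \<omega>) \<in> borel_measurable (borel \<Otimes>\<^sub>M M)" "(\<lambda>(t, \<omega>). Y t \<omega>) \<in> borel_measurable (borel \<Otimes>\<^sub>M M)"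
    using assms by (auto simp: l2_joint_def)
  show "(\<lambda>(t, \<omega>). X t \<omega> * Y t \<omega>) \<in> borel_measurable (itv a b \<Otimes>\<^sub>M M)" by measurable
  show "integrable (itv a b \<Otimes>\<^sub>M M) (\<lambda>p. (\<lambda>(t, \<omega>). (X t \<omega>)\<^sup>2) p + (\<lambda>(t, \<omega>). (Y t \<omega>)\<^sup>2) p)"
    using assms by (intro Bochner_Integration.integrable_add) (auto simp: l2_joint_def)
  show "AE p in itv a b \<Otimes>\<^sub>M M. norm ((\<lambda>(t, \<omega>). X t \<omega> * Y t \<omega>) p) \<le> norm ((\<lambda>(t, \<omega>). (X t \<omega>)\<^sup>2) p + (\<lambda>(t, \<omega>). (Y t \<omega>)\<^sup>2) p)"
    using abs_mult_le_sum_squares by (intro AE_I2) (simp add: split_beta)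
qed

lemma l2_joint_cmult: "l2_joint a b X \<Longrightarrow> l2_joint a b (\<lambda>t \<omega>. c * X t \<omega>)"
  by (auto simp: l2_joint_def power_mult_distrib case_prod_unfold)

lemma l2_joint_add:
  assumes "l2_joint a b X" "l2_joint a b Y"
  shows "l2_joint a b (\<lambda>t \<omega>. X t \<omega> + Y t \<omega>)"
proof -
  have [measurable]: "(\<lambda>(t, \<omega>). X t \<omega>) \<in> borel_measurable (borel \<Otimes>\<^sub>M M)" "(\<lambda>(t, \<omega>). Y t \<omega>) \<in> borel_measurable (borel \<Otimes>\<^sub>M M)"
    using assms by (auto simp: l2_joint_def)
  have "integrable (itv a b \<Otimes>\<^sub>M M) (\<lambda>p. (\<lambda>(t, \<omega>). (X t \<omega>)\<^sup>2) p + 2 * (\<lambda>(t, \<omega>). X t \<omega> * Y t \<omega>) p + (\<lambda>(t, \<omega>). (Y t \<omega>)\<^sup>2) p)"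
    using assms l2_joint_mult[OF assms]
    by (intro Bochner_Integration.integrable_add integrable_mult_right) (auto simp: l2_joint_def)
  then show ?thesis unfolding l2_joint_def
    by (auto simp: case_prod_unfold power2_sum algebra_simps)
qed

lemma l2_joint_sum:
  "finite I \<Longrightarrow> (\<And>i. i \<in> I \<Longrightarrow> l2_joint a b (X i)) \<Longrightarrow> l2_joint a b (\<lambda>t \<omega>. \<Sum>i\<in>I. X i t \<omega>)"
proof (induction I rule: finite_induct)
  case (insert i I)
  then have "l2_joint a b (X i)" "l2_joint a b (\<lambda>t \<omega>. \<Sum>i\<in>I. X i t \<omega>)" by auto
  from l2_joint_add[OF this] show ?case using insert.hyps by simp
qed (simp add: l2_joint_def case_prod_unfold)

lemma l2_joint_const_time:
  assumes "sq_int Y" "a \<le> b"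
  shows "l2_joint a b (\<lambda>_. Y)"
proof -
  interpret P: pair_sigma_finite "itv a b" M by (rule pair_sigma_finite_itv)
  interpret I: finite_measure "itv a b" by (rule finite_measure_itv)
  have [measurable]: "Y \<in> borel_measurable M" using assms by simp
  have "integrable (itv a b \<Otimes>\<^sub>M M) (\<lambda>(t, \<omega>). (Y \<omega>)\<^sup>2)"
  proof (rule P.Fubini_integrable)
    show "AE x in itv a b. integrable M (\<lambda>y. case (x, y) of (t, \<omega>) \<Rightarrow> (Y \<omega>)\<^sup>2)"
      using assms by (simp add: sq_int_def)
  qed simp_all
  then show ?thesis by (simp add: l2_joint_def)
qed

text \<open>Nonnegativity of the variance of \<open>f\<close> under the uniform distribution,
  multiplied by the length of the interval to avoid division.\<close>

lemma integral_square_le_itv: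
  assumes ab: "a \<le> b" and f: "integrable (itv a b) f" "integrable (itv a b) (\<lambda>s. (f s)\<^sup>2)"
  shows "(\<integral>s. f s \<partial>itv a b)\<^sup>2 \<le> (b - a) * (\<integral>s. (f s)\<^sup>2 \<partial>itv a b)"
proof -
  interpret I: finite_measure "itv a b" by (rule finite_measure_itv)
  let ?m = "\<integral>s. f s \<partial>itv a b"
  have "0 \<le> (\<integral>s. ((b - a) * f s - ?m)\<^sup>2 \<partial>itv a b)" by simp
  also have "(\<lambda>s. ((b - a) * f s - ?m)\<^sup>2) = (\<lambda>s. (b - a)\<^sup>2 * (f s)\<^sup>2 + (- 2 * (b - a) * ?m) * f s + ?m\<^sup>2)"
    by (simp add: power2_eq_square algebra_simps)
  also have "(\<integral>s. \<dots> s \<partial>itv a b) = (b - a)\<^sup>2 * (\<integral>s. (f s)\<^sup>2 \<partial>itv a b) + (- 2 * (b - a) * ?m) * ?m + ?m\<^sup>2 * (b - a)"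
    using f by (simp add: measure_itv[OF ab] mult.commute)
  finally have "0 \<le> (b - a) * ((b - a) * (\<integral>s. (f s)\<^sup>2 \<partial>itv a b) - ?m\<^sup>2)"
    by (simp add: power2_eq_square algebra_simps)
  \<comment> \<open>The inequality just obtained carries a factor \<open>b - a\<close> that has to
    be cancelled; when it is zero, the measure is null and the integral vanishes.\<close>
  moreover have "?m = 0" if "b = a"
  proof -
    have "emeasure (itv a b) (space (itv a b)) = 0" using that emeasure_itv[of a b] by simp
    then have "AE s in itv a b. f s = 0"
      by (intro AE_I'[of UNIV]) (auto simp: null_sets_def)
    then show ?thesis by (rule integral_eq_zero_AE)
  qed
  ultimately show ?thesis using ab by (cases "b = a") (auto simp: zero_le_mult_iff)
qed

text \<open>The exchanges of expectation and time integral used throughout. Square integrability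
  holds at almost every time only, since joint integrability says nothing about a single time. The
  last bound is Cauchy--Schwarz in time, integrated over the probability space.\<close>

lemma l2_joint_integral:
  assumes X: "l2_joint a b X" and ab: "a \<le> b"
  shows "AE s in itv a b. sq_int (X s)"
    and "integrable (itv a b) (\<lambda>s. expectation (\<lambda>\<omega>. (X s \<omega>)\<^sup>2))"
    and "\<And>Y. sq_int Y \<Longrightarrow> integrable (itv a b) (\<lambda>s. expectation (\<lambda>\<omega>. Y \<omega> * X s \<omega>))"
    and "\<And>Y. sq_int Y \<Longrightarrow> expectation (\<lambda>\<omega>. Y \<omega> * (\<integral>s. X s \<omega> \<partial>itv a b)) = (\<integral>s. expectation (\<lambda>\<omega>. Y \<omega> * X s \<omega>) \<partial>itv a b)"
    and "sq_int (\<lambda>\<omega>. \<integral>s. X s \<omega> \<partial>itv a b)"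
    and "expectation (\<lambda>\<omega>. (\<integral>s. X s \<omega> \<partial>itv a b)\<^sup>2) \<le> (b - a) * (\<integral>s. expectation (\<lambda>\<omega>. (X s \<omega>)\<^sup>2) \<partial>itv a b)"
proof -
  interpret P: pair_sigma_finite "itv a b" M by (rule pair_sigma_finite_itv)
  interpret I: finite_measure "itv a b" by (rule finite_measure_itv)
  have Xm[measurable]: "(\<lambda>(t, \<omega>). X t \<omega>) \<in> borel_measurable (borel \<Otimes>\<^sub>M M)"
    and X2: "integrable (itv a b \<Otimes>\<^sub>M M) (\<lambda>(t, \<omega>). (X t \<omega>)\<^sup>2)" using X by (auto simp: l2_joint_def)
  have Xs[measurable]: "X s \<in> borel_measurable M" for s by measurable
  show "AE s in itv a b. sq_int (X s)"
    using P.AE_integrable_fst[OF X2] by eventually_elim (simp add: sq_int_def)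
  show "integrable (itv a b) (\<lambda>s. expectation (\<lambda>\<omega>. (X s \<omega>)\<^sup>2))"
    using P.integrable_fst[OF X2] .
  have YX: "integrable (itv a b \<Otimes>\<^sub>M M) (\<lambda>(t, \<omega>). Y \<omega> * X t \<omega>)" if "sq_int Y" for Y
    using l2_joint_mult[OF l2_joint_const_time[OF that ab] X] .
  show "integrable (itv a b) (\<lambda>s. expectation (\<lambda>\<omega>. Y \<omega> * X s \<omega>))" if "sq_int Y" for Y
    using P.integrable_fst[OF YX[OF that]] .
  show "expectation (\<lambda>\<omega>. Y \<omega> * (\<integral>s. X s \<omega> \<partial>itv a b)) = (\<integral>s. expectation (\<lambda>\<omega>. Y \<omega> * X s \<omega>) \<partial>itv a b)" if "sq_int Y" for Y
    using P.Fubini_integral[OF YX[OF that]] by simp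
  have Jm[measurable]: "(\<lambda>\<omega>. \<integral>s. X s \<omega> \<partial>itv a b) \<in> borel_measurable M"
    by (rule P.M1.borel_measurable_lebesgue_integral) measurable
  have iX: "integrable (itv a b \<Otimes>\<^sub>M M) (\<lambda>(t, \<omega>). X t \<omega>)" using YX[of "\<lambda>_. 1"] by simp
  have le: "AE \<omega> in M. (\<integral>s. X s \<omega> \<partial>itv a b)\<^sup>2 \<le> (b - a) * (\<integral>s. (X s \<omega>)\<^sup>2 \<partial>itv a b)"
    using P.AE_integrable_snd[OF X2] P.AE_integrable_snd[OF iX]
    by eventually_elim (rule integral_square_le_itv[OF ab])
  have iJ: "integrable M (\<lambda>\<omega>. (b - a) * (\<integral>s. (X s \<omega>)\<^sup>2 \<partial>itv a b))"
    using P.integrable_snd[OF X2] by simp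
  have J2: "integrable M (\<lambda>\<omega>. (\<integral>s. X s \<omega> \<partial>itv a b)\<^sup>2)"
    by (rule Bochner_Integration.integrable_bound[OF iJ]) (use le ab in \<open>auto elim!: eventually_mono\<close>)
  then show "sq_int (\<lambda>\<omega>. \<integral>s. X s \<omega> \<partial>itv a b)" by (simp add: sq_int_def)
  have "expectation (\<lambda>\<omega>. (\<integral>s. X s \<omega> \<partial>itv a b)\<^sup>2) \<le> expectation (\<lambda>\<omega>. (b - a) * (\<integral>s. (X s \<omega>)\<^sup>2 \<partial>itv a b))"
    by (rule integral_mono_AE[OF J2 iJ le])
  also have "\<dots> = (b - a) * (\<integral>s. expectation (\<lambda>\<omega>. (X s \<omega>)\<^sup>2) \<partial>itv a b)"
    using P.Fubini_integral[OF X2] by simp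
  finally show "expectation (\<lambda>\<omega>. (\<integral>s. X s \<omega> \<partial>itv a b)\<^sup>2) \<le> (b - a) * (\<integral>s. expectation (\<lambda>\<omega>. (X s \<omega>)\<^sup>2) \<partial>itv a b)" .
qed

lemma l2_jointI_bounded:
  assumes m: "(\<lambda>(t, \<omega>). X t \<omega>) \<in> borel_measurable (borel \<Otimes>\<^sub>M M)"
    and s: "\<And>t. t \<in> {a..b} \<Longrightarrow> sq_int (X t)" and B: "\<And>t. t \<in> {a..b} \<Longrightarrow> expectation (\<lambda>\<omega>. (X t \<omega>)\<^sup>2) \<le> B"
  shows "l2_joint a b X"
proof -
  interpret P: pair_sigma_finite "itv a b" M by (rule pair_sigma_finite_itv)
  interpret I: finite_measure "itv a b" by (rule finite_measure_itv)
  note [measurable] = m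
  have "integrable (itv a b \<Otimes>\<^sub>M M) (\<lambda>(t, \<omega>). (X t \<omega>)\<^sup>2)"
  proof (rule P.Fubini_integrable)
    show "AE t in itv a b. integrable M (\<lambda>\<omega>. case (t, \<omega>) of (t, \<omega>) \<Rightarrow> (X t \<omega>)\<^sup>2)"
      using s by (intro AE_itvI) (simp add: sq_int_def)
    show "integrable (itv a b) (\<lambda>x. \<integral>y. norm (case (x, y) of (t, \<omega>) \<Rightarrow> (X t \<omega>)\<^sup>2) \<partial>M)"
      by (rule I.integrable_const_bound[where B=B]) (use B in \<open>auto intro!: AE_itvI\<close>)
  qed measurable
  then show ?thesis using m by (simp add: l2_joint_def)
qed

end

section \<open>Continuous processes and the covariances of a Wiener process\<close>

lemma measurable_continuous_process:
  fixes X :: "real \<Rightarrow> 'a \<Rightarrow> 'b::metric_space"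
  assumes X[measurable]: "\<And>s. X s \<in> borel_measurable N" and c: "\<And>\<omega>. \<omega> \<in> space N \<Longrightarrow> continuous_on UNIV (\<lambda>s. X s \<omega>)"
  shows "(\<lambda>(s, \<omega>). X s \<omega>) \<in> borel_measurable (borel \<Otimes>\<^sub>M N)"
proof (rule borel_measurable_LIMSEQ_metric)
  \<comment> \<open>Time is rounded down to a grid of mesh \<open>1 / Suc k\<close>. Each
    approximation uses countably many times, hence is jointly measurable, and continuity of the
    paths gives convergence.\<close>
  let ?r = "\<lambda>k s. real_of_int \<lfloor>real (Suc k) * s\<rfloor> / real (Suc k)"
  show "(\<lambda>p. X (?r k (fst p)) (snd p)) \<in> borel_measurable (borel \<Otimes>\<^sub>M N)" for k
  proof -
    have "(\<lambda>p. (\<lambda>i p. X (real_of_int i / real (Suc k)) (snd p)) \<lfloor>real (Suc k) * fst p\<rfloor> p) \<in> borel_measurable (borel \<Otimes>\<^sub>M N)"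
      by (rule measurable_compose_countable) measurable
    then show ?thesis .
  qed
  fix p :: "real \<times> 'a" assume p: "p \<in> space (borel \<Otimes>\<^sub>M N)"
  obtain s \<omega> where [simp]: "p = (s, \<omega>)" by force
  have "(\<lambda>k. ?r k s) \<longlonglongrightarrow> s"
  proof (rule LIMSEQ_I)
    fix e :: real assume "0 < e"
    then obtain n0 where n0: "1 / real (Suc n0) < e" using nat_approx_posE by metis
    have "norm (?r k s - s) < e" if "k \<ge> n0" for k
    proof -
      have "\<bar>real_of_int \<lfloor>real (Suc k) * s\<rfloor> - real (Suc k) * s\<bar> \<le> 1" by linarith
      moreover have "?r k s - s = (real_of_int \<lfloor>real (Suc k) * s\<rfloor> - real (Suc k) * s) / real (Suc k)" by (simp add: field_simps)
      ultimately have "norm (?r k s - s) \<le> 1 / real (Suc k)" by (simp add: divide_right_mono)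
      also have "\<dots> \<le> 1 / real (Suc n0)" using that by (simp add: frac_le)
      finally show ?thesis using n0 by simp
    qed
    then show "\<exists>no. \<forall>k\<ge>no. norm (?r k s - s) < e" by blast
  qed
  moreover have "isCont (\<lambda>s. X s \<omega>) s" using c[of \<omega>] p by (simp add: space_pair_measure continuous_on_eq_continuous_at)
  ultimately show "(\<lambda>k. X (?r k (fst p)) (snd p)) \<longlonglongrightarrow> (case p of (s, \<omega>) \<Rightarrow> X s \<omega>)"
    using isCont_tendsto_compose by force
qed

locale wiener_space = prob_space M for M :: "'a measure" +
  fixes w :: "real \<Rightarrow> 'a \<Rightarrow> real^'q::finite"
  assumes wiener: "standard_wiener M w"
begin

lemma w_0: "\<omega> \<in> space M \<Longrightarrow> w 0 \<omega> = 0"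
  and w_continuous: "\<omega> \<in> space M \<Longrightarrow> continuous_on {0..} (\<lambda>t. w t \<omega>)"
  using wiener by (simp_all add: standard_wiener_def)

lemma w_increment_normal:
  "0 \<le> s \<Longrightarrow> s < t \<Longrightarrow> distributed M lborel (\<lambda>\<omega>. (w t \<omega> - w s \<omega>) $ i) (normal_density 0 (sqrt (t - s)))"
  using wiener by (simp add: standard_wiener_def)

lemma w_increments_indep:
  "0 \<le> \<tau> 0 \<Longrightarrow> mono \<tau> \<Longrightarrow> indep_vars (\<lambda>_. borel) (\<lambda>(j, i) \<omega>. (w (\<tau> (Suc j)) \<omega> - w (\<tau> j) \<omega>) $ i) UNIV"
  using wiener by (simp add: standard_wiener_def)

lemma w_increment_moments:
  assumes "0 \<le> s" "s \<le> t"
  shows "sq_int (\<lambda>\<omega>. (w t \<omega> - w s \<omega>) $ i)" "expectation (\<lambda>\<omega>. (w t \<omega> - w s \<omega>) $ i) = 0"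
    "expectation (\<lambda>\<omega>. ((w t \<omega> - w s \<omega>) $ i)\<^sup>2) = t - s"
proof -
  have "sq_int (\<lambda>\<omega>. (w t \<omega> - w s \<omega>) $ i) \<and> expectation (\<lambda>\<omega>. (w t \<omega> - w s \<omega>) $ i) = 0 \<and>
    expectation (\<lambda>\<omega>. ((w t \<omega> - w s \<omega>) $ i)\<^sup>2) = t - s"
  proof (cases "s = t")
    case False
    then have st: "s < t" using assms by simp
    have "0 < sqrt (t - s)" using st by simp
    from normal_moments[OF w_increment_normal[OF assms(1) st, of i] this] show ?thesis
      using st by (simp add: sq_int_def borel_measurable_integrable)
  qed simp
  then show "sq_int (\<lambda>\<omega>. (w t \<omega> - w s \<omega>) $ i)" "expectation (\<lambda>\<omega>. (w t \<omega> - w s \<omega>) $ i) = 0"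
    "expectation (\<lambda>\<omega>. ((w t \<omega> - w s \<omega>) $ i)\<^sup>2) = t - s" by auto
qed

lemma w_moments:
  assumes "0 \<le> t"
  shows "sq_int (\<lambda>\<omega>. w t \<omega> $ i)" "expectation (\<lambda>\<omega>. w t \<omega> $ i) = 0" "expectation (\<lambda>\<omega>. (w t \<omega> $ i)\<^sup>2) = t"
proof -
  note m = w_increment_moments[OF order_refl assms, of i]
  show "sq_int (\<lambda>\<omega>. w t \<omega> $ i)" by (rule sq_int_cong[OF m(1)]) (simp add: w_0)
  show "expectation (\<lambda>\<omega>. w t \<omega> $ i) = 0" 
    using m(2) by (subst Bochner_Integration.integral_cong[OF refl, of _ _ "\<lambda>\<omega>. (w t \<omega> - w 0 \<omega>) $ i"]) (simp_all add: w_0)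
  show "expectation (\<lambda>\<omega>. (w t \<omega> $ i)\<^sup>2) = t"
    using m(3) by (subst Bochner_Integration.integral_cong[OF refl, of _ _ "\<lambda>\<omega>. ((w t \<omega> - w 0 \<omega>) $ i)\<^sup>2"]) (simp_all add: w_0)
qed

lemma w_cov:
  assumes s: "0 \<le> s" and t: "0 \<le> t"
  shows "expectation (\<lambda>\<omega>. w s \<omega> $ i * w t \<omega> $ j) = (if i = j then min s t else 0)"
proof -
  have *: "expectation (\<lambda>\<omega>. w s \<omega> $ i * w t \<omega> $ j) = (if i = j then s else 0)"
    if s: "0 \<le> s" and st: "s \<le> t" for s t i j
  proof -
    \<comment> \<open>Independence is available for increments along a monotone sequence of times.
      The sequence 0, \<open>s\<close>, \<open>t\<close>, constant afterwards, makes index 0 the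
      increment up to \<open>s\<close> and index 1 the increment from \<open>s\<close> to
      \<open>t\<close>.\<close>
    define \<tau> where "\<tau> k = (if k = 0 then 0 else if k = 1 then s else t)" for k :: nat
    have "mono \<tau>" using s st by (auto simp: \<tau>_def mono_def)
    then have ind: "indep_vars (\<lambda>_. borel) (\<lambda>(j, i) \<omega>. (w (\<tau> (Suc j)) \<omega> - w (\<tau> j) \<omega>) $ i) UNIV"
      by (intro w_increments_indep) (simp add: \<tau>_def)
    have zero: "expectation (\<lambda>\<omega>. X \<omega> * Y \<omega>) = 0"
      if "indep_var borel X borel Y" "sq_int X" "sq_int Y" "expectation X = 0" for X Y
      using indep_var_lebesgue_integral[OF that(1) sq_int_integrable[OF that(2)] sq_int_integrable[OF that(3)]] that(4) by simp
    have sp: "(w s \<omega> - w 0 \<omega>) $ i = w s \<omega> $ i" if "\<omega> \<in> space M" for \<omega> i using w_0[OF that] by simp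
    have 1: "expectation (\<lambda>\<omega>. w s \<omega> $ i * (w t \<omega> - w s \<omega>) $ j) = 0"
    proof -
      have "indep_var borel (\<lambda>\<omega>. (w s \<omega> - w 0 \<omega>) $ i) borel (\<lambda>\<omega>. (w t \<omega> - w s \<omega>) $ j)"
        using indep_vars_imp_indep_var[OF ind, of "(0, i)" "(1, j)"] by (simp add: \<tau>_def)
      from zero[OF this] have "expectation (\<lambda>\<omega>. (w s \<omega> - w 0 \<omega>) $ i * (w t \<omega> - w s \<omega>) $ j) = 0"
        using w_increment_moments[OF order_refl s] w_increment_moments[OF s st] by blast
      moreover have "expectation (\<lambda>\<omega>. (w s \<omega> - w 0 \<omega>) $ i * (w t \<omega> - w s \<omega>) $ j) = expectation (\<lambda>\<omega>. w s \<omega> $ i * (w t \<omega> - w s \<omega>) $ j)"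
        by (rule Bochner_Integration.integral_cong) (simp_all only: sp)
      ultimately show ?thesis by simp
    qed
    have 2: "expectation (\<lambda>\<omega>. w s \<omega> $ i * w s \<omega> $ j) = (if i = j then s else 0)"
    proof (cases "i = j")
      case True
      then show ?thesis using w_moments(3)[OF s, of i] by (simp add: power2_eq_square)
    next
      case False
      have "indep_var borel (\<lambda>\<omega>. (w s \<omega> - w 0 \<omega>) $ i) borel (\<lambda>\<omega>. (w s \<omega> - w 0 \<omega>) $ j)"
        using False indep_vars_imp_indep_var[OF ind, of "(0, i)" "(0, j)"] by (simp add: \<tau>_def)
      from zero[OF this] have "expectation (\<lambda>\<omega>. (w s \<omega> - w 0 \<omega>) $ i * (w s \<omega> - w 0 \<omega>) $ j) = 0"
        using w_increment_moments[OF order_refl s] by blast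
      moreover have "expectation (\<lambda>\<omega>. (w s \<omega> - w 0 \<omega>) $ i * (w s \<omega> - w 0 \<omega>) $ j) = expectation (\<lambda>\<omega>. w s \<omega> $ i * w s \<omega> $ j)"
        by (rule Bochner_Integration.integral_cong) (simp_all only: sp)
      ultimately show ?thesis using False by simp
    qed
    have "expectation (\<lambda>\<omega>. w s \<omega> $ i * w t \<omega> $ j) = expectation (\<lambda>\<omega>. w s \<omega> $ i * w s \<omega> $ j + w s \<omega> $ i * (w t \<omega> - w s \<omega>) $ j)"
      by (rule Bochner_Integration.integral_cong) (simp_all add: algebra_simps)
    also have "\<dots> = (if i = j then s else 0)"
      using 1 2 integrable_mult_sq_int[OF w_moments(1)[OF s] w_moments(1)[OF s]]
        integrable_mult_sq_int[OF w_moments(1)[OF s] w_increment_moments(1)[OF s st]]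
      by (subst Bochner_Integration.integral_add) auto
    finally show ?thesis .
  qed
  show ?thesis
  proof (cases "s \<le> t")
    case True then show ?thesis using *[OF s True, of i j] by simp
  next
    case False then show ?thesis using *[OF t, of s j i] by (auto simp: mult.commute)
  qed
qed

lemma sq_int_inner_w: "0 \<le> t \<Longrightarrow> sq_int (\<lambda>\<omega>. v \<bullet> w t \<omega>)"
  unfolding inner_vec_def inner_real_def by (intro sq_int_sum sq_int_cmult w_moments)

lemma inner_w_cov:
  assumes s: "0 \<le> s" and t: "0 \<le> t"
  shows "expectation (\<lambda>\<omega>. (u \<bullet> w s \<omega>) * (v \<bullet> w t \<omega>)) = (u \<bullet> v) * min s t"
proof -
  have "expectation (\<lambda>\<omega>. (u \<bullet> w s \<omega>) * (v \<bullet> w t \<omega>)) = expectation (\<lambda>\<omega>. \<Sum>i\<in>UNIV. \<Sum>j\<in>UNIV. u $ i * v $ j * (w s \<omega> $ i * w t \<omega> $ j))"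
    by (simp add: inner_vec_def sum_product ac_simps)
  also have "\<dots> = (\<Sum>i\<in>UNIV. \<Sum>j\<in>UNIV. u $ i * v $ j * (if i = j then min s t else 0))"
    using integrable_mult_sq_int[OF w_moments(1)[OF s] w_moments(1)[OF t]]
    by (simp add: Bochner_Integration.integral_sum w_cov[OF s t])
  also have "\<dots> = (u \<bullet> v) * min s t"
    by (simp add: mult_if_0 inner_vec_def sum_distrib_right)
  finally show ?thesis .
qed

text \<open>The set of times is explicit so that finitely many members can be brought to one common
  set of times, padding with zero coefficients.\<close>

definition lin_w :: "('a \<Rightarrow> real) set" where
  "lin_w = {X. \<exists>F a. finite F \<and> F \<subseteq> {0..} \<and> X = (\<lambda>\<omega>. \<Sum>s\<in>F. a s \<bullet> w s \<omega>)}"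

lemma lin_wI: "finite F \<Longrightarrow> F \<subseteq> {0..} \<Longrightarrow> (\<lambda>\<omega>. \<Sum>s\<in>F. a s \<bullet> w s \<omega>) \<in> lin_w"
  unfolding lin_w_def by (intro CollectI exI conjI) auto

lemma lin_w_extend:
  assumes "finite F'" "F \<subseteq> F'"
  shows "\<exists>b. (\<lambda>\<omega>. \<Sum>s\<in>F. a s \<bullet> w s \<omega>) = (\<lambda>\<omega>. \<Sum>s\<in>F'. b s \<bullet> w s \<omega>)"
proof
  show "(\<lambda>\<omega>. \<Sum>s\<in>F. a s \<bullet> w s \<omega>) = (\<lambda>\<omega>. \<Sum>s\<in>F'. (if s \<in> F then a s else 0) \<bullet> w s \<omega>)"
    using assms by (intro ext sum.mono_neutral_cong_left) auto
qed

lemma lin_w_common: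
  assumes "finite J" "\<And>j. j \<in> J \<Longrightarrow> Y j \<in> lin_w"
  shows "\<exists>F. finite F \<and> F \<subseteq> {0..} \<and> (\<forall>j\<in>J. \<exists>a. Y j = (\<lambda>\<omega>. \<Sum>s\<in>F. a s \<bullet> w s \<omega>))"
  using assms
proof (induction J)
  case empty
  show ?case by (rule exI[of _ "{}"]) simp
next
  case (insert j J)
  obtain F where F: "finite F" "F \<subseteq> {0..}" "\<forall>j\<in>J. \<exists>a. Y j = (\<lambda>\<omega>. \<Sum>s\<in>F. a s \<bullet> w s \<omega>)" using insert by blast
  obtain F' a' where F': "finite F'" "F' \<subseteq> {0..}" "Y j = (\<lambda>\<omega>. \<Sum>s\<in>F'. a' s \<bullet> w s \<omega>)"
    using insert.prems[of j] by (auto simp: lin_w_def)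
  have "\<exists>a. Y k = (\<lambda>\<omega>. \<Sum>s\<in>F \<union> F'. a s \<bullet> w s \<omega>)" if k: "k \<in> insert j J" for k
  proof (cases "k = j")
    case True
    then show ?thesis using lin_w_extend[of "F \<union> F'" F' a'] F F' by simp
  next
    case False
    then obtain a where "Y k = (\<lambda>\<omega>. \<Sum>s\<in>F. a s \<bullet> w s \<omega>)" using k F(3) by blast
    then show ?thesis using lin_w_extend[of "F \<union> F'" F a] F F' by simp
  qed
  then show ?case using F F' by (intro exI[of _ "F \<union> F'"]) auto
qed

lemma lin_w_add: "X \<in> lin_w \<Longrightarrow> Y \<in> lin_w \<Longrightarrow> (\<lambda>\<omega>. X \<omega> + Y \<omega>) \<in> lin_w"
proof -
  assume XY: "X \<in> lin_w" "Y \<in> lin_w"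
  have "(if j then X else Y) \<in> lin_w" for j using XY by simp
  from lin_w_common[of UNIV "\<lambda>j::bool. if j then X else Y", OF finite this]
  obtain F where F: "finite F" "F \<subseteq> {0..}" "\<forall>j\<in>UNIV. \<exists>a. (if j then X else Y) = (\<lambda>\<omega>. \<Sum>s\<in>F. a s \<bullet> w s \<omega>)"
    by blast
  have "\<exists>a. X = (\<lambda>\<omega>. \<Sum>s\<in>F. a s \<bullet> w s \<omega>)" using bspec[OF F(3), of True] by simp
  then obtain a where a: "X = (\<lambda>\<omega>. \<Sum>s\<in>F. a s \<bullet> w s \<omega>)" ..
  have "\<exists>a. Y = (\<lambda>\<omega>. \<Sum>s\<in>F. a s \<bullet> w s \<omega>)" using bspec[OF F(3), of False] by simp
  then obtain b where b: "Y = (\<lambda>\<omega>. \<Sum>s\<in>F. b s \<bullet> w s \<omega>)" ..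
  have "(\<lambda>\<omega>. X \<omega> + Y \<omega>) = (\<lambda>\<omega>. \<Sum>s\<in>F. (a s + b s) \<bullet> w s \<omega>)" by (simp add: a b inner_add_left sum.distrib)
  then show ?thesis by (simp only: lin_wI[OF F(1,2)])
qed

lemma lin_w_cmult: "X \<in> lin_w \<Longrightarrow> (\<lambda>\<omega>. c * X \<omega>) \<in> lin_w"
proof -
  assume "X \<in> lin_w"
  then obtain F a where F: "finite F" "F \<subseteq> {0..}" "X = (\<lambda>\<omega>. \<Sum>s\<in>F. a s \<bullet> w s \<omega>)" by (auto simp: lin_w_def)
  then have "(\<lambda>\<omega>. c * X \<omega>) = (\<lambda>\<omega>. \<Sum>s\<in>F. (c *\<^sub>R a s) \<bullet> w s \<omega>)" by (simp add: sum_distrib_left)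
  then show ?thesis by (simp only: lin_wI[OF F(1,2)])
qed

lemma lin_w_0: "(\<lambda>_. 0) \<in> lin_w"
  using lin_wI[of "{}"] by simp

lemma lin_w_inner: "0 \<le> s \<Longrightarrow> (\<lambda>\<omega>. v \<bullet> w s \<omega>) \<in> lin_w"
  using lin_wI[of "{s}" "\<lambda>_. v"] by simp

lemma lin_w_sum: "(\<And>i. i \<in> I \<Longrightarrow> X i \<in> lin_w) \<Longrightarrow> (\<lambda>\<omega>. \<Sum>i\<in>I. X i \<omega>) \<in> lin_w"
  by (induction I rule: infinite_finite_induct) (auto intro: lin_w_add lin_w_0)

lemma lin_w_sq_int: "X \<in> lin_w \<Longrightarrow> sq_int X"
  by (auto simp: lin_w_def intro!: sq_int_sum sq_int_inner_w)

text \<open>Values of \<open>w\<close> at several times are correlated; over the sorted times they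
  become linear forms in the increments, which are independent. Distinct times make all variances
  positive, as the Stein formula requires.\<close>

lemma lin_w_increments:
  assumes F: "finite F" "F \<subseteq> {0..}"
  shows "\<exists>(L :: (nat \<times> 'q) set) \<xi> \<sigma>. finite L \<and> indep_vars (\<lambda>_. borel) \<xi> L \<and>
    (\<forall>l\<in>L. distributed M lborel (\<xi> l) (normal_density 0 (\<sigma> l)) \<and> \<sigma> l > 0) \<and>
    (\<forall>a. \<exists>c. \<forall>\<omega>\<in>space M. (\<Sum>s\<in>F. a s \<bullet> w s \<omega>) = (\<Sum>l\<in>L. c l * \<xi> l \<omega>))"
proof -
  \<comment> \<open>Time 0 is included so that the first increment starts from
    \<open>w 0 = 0\<close> and the telescoping sum is the value itself.\<close>
  define ts where "ts = sorted_list_of_set (insert 0 F)"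
  define n where "n = length ts - 1"
  \<comment> \<open>Beyond the last time the sequence stays constant, hence is monotone on all
    naturals; the null increments produced there lie outside \<open>L\<close>.\<close>
  define \<tau> where "\<tau> j = ts ! min j n" for j
  have set_ts: "set ts = insert 0 F" unfolding ts_def by (rule set_sorted_list_of_set) (use F in simp)
  then have len: "length ts = Suc n" unfolding n_def by (cases ts) auto
  have sorted: "sorted_wrt (<) ts" unfolding ts_def by (rule strict_sorted_list_of_set)
  have \<tau>_strict: "\<tau> j < \<tau> k" if "j < k" "k \<le> n" for j k
    using sorted_wrt_nth_less[OF sorted, of j k] that len by (simp add: \<tau>_def)
  have "mono \<tau>"
  proof (rule monoI)
    fix j k :: nat assume "j \<le> k"
    then have "min j n = min k n \<or> min j n < min k n" by linarith
    then show "\<tau> j \<le> \<tau> k"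
    proof
      assume "min j n < min k n"
      then have "ts ! min j n < ts ! min k n" by (rule sorted_wrt_nth_less[OF sorted]) (simp add: len)
      then show ?thesis unfolding \<tau>_def by (rule less_imp_le)
    qed (simp add: \<tau>_def)
  qed
  have \<tau>_ge: "0 \<le> \<tau> j" for j
  proof -
    have "\<tau> j \<in> set ts" unfolding \<tau>_def using len by (intro nth_mem) linarith
    then show ?thesis using set_ts F by auto
  qed
  have ex: "\<exists>k\<le>n. s = \<tau> k" if "s \<in> insert 0 F" for s
  proof -
    have "s \<in> set ts" using that set_ts by simp
    then obtain k where "k < length ts" "s = ts ! k" by (auto simp: in_set_conv_nth)
    then show ?thesis using len by (intro exI[of _ k]) (simp add: \<tau>_def)
  qed
  obtain k0 where "k0 \<le> n" "0 = \<tau> k0" using ex[of 0] by auto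
  then have \<tau>0: "\<tau> 0 = 0" using \<tau>_strict[of 0 k0] \<tau>_ge[of 0] by (cases "k0 = 0") auto
  define \<xi> where "\<xi> = (\<lambda>(j, i) \<omega>. (w (\<tau> (Suc j)) \<omega> - w (\<tau> j) \<omega>) $ i)"
  define \<sigma> where "\<sigma> = (\<lambda>(j, i::'q). sqrt (\<tau> (Suc j) - \<tau> j))"
  define L where "L = {..<n} \<times> (UNIV :: 'q set)"
  have "indep_vars (\<lambda>_. borel) \<xi> UNIV" unfolding \<xi>_def by (rule w_increments_indep) (simp_all add: \<tau>_ge \<open>mono \<tau>\<close>)
  then have ind: "indep_vars (\<lambda>_. borel) \<xi> L" by (rule indep_vars_subset) simp
  have dist: "distributed M lborel (\<xi> l) (normal_density 0 (\<sigma> l)) \<and> \<sigma> l > 0" if "l \<in> L" for l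
    using that \<tau>_strict w_increment_normal[OF \<tau>_ge] by (auto simp: L_def \<xi>_def \<sigma>_def Suc_le_eq)
  \<comment> \<open>Telescoping, with the upper limit hidden in the coefficient: a coefficient that
    depends on \<open>s\<close> lets all values be expanded over the same increments.\<close>
  have w_eq: "w s \<omega> $ i = (\<Sum>j<n. (if \<tau> (Suc j) \<le> s then 1 else 0) * \<xi> (j, i) \<omega>)"
    if s: "s \<in> F" and \<omega>: "\<omega> \<in> space M" for s \<omega> i
  proof -
    obtain k where k: "k \<le> n" "s = \<tau> k" using ex s by auto
    have "\<tau> (Suc j) \<le> s \<longleftrightarrow> j < k" if "j < n" for j
    proof (cases "j < k")
      case True
      then show ?thesis using k monoD[OF \<open>mono \<tau>\<close>, of "Suc j" k] by auto
    next
      case False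
      then show ?thesis using \<tau>_strict[of k "Suc j"] that k by auto
    qed
    then have "(\<Sum>j<n. (if \<tau> (Suc j) \<le> s then 1 else 0) * \<xi> (j, i) \<omega>) = (\<Sum>j<n. if j < k then \<xi> (j, i) \<omega> else 0)"
      by (intro sum.cong) auto
    also have "\<dots> = (\<Sum>j<k. \<xi> (j, i) \<omega>)"
      using k by (intro sum.mono_neutral_cong_right) auto
    also have "\<dots> = (\<Sum>j<k. w (\<tau> (Suc j)) \<omega> $ i - w (\<tau> j) \<omega> $ i)"
      by (simp add: \<xi>_def)
    also have "\<dots> = w s \<omega> $ i"
      using k \<tau>0 w_0[OF \<omega>] by (subst sum_lessThan_telescope) simp
    finally show ?thesis by simp
  qed
  have "\<exists>c. \<forall>\<omega>\<in>space M. (\<Sum>s\<in>F. a s \<bullet> w s \<omega>) = (\<Sum>l\<in>L. c l * \<xi> l \<omega>)" for a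
  proof (intro exI ballI)
    let ?c = "\<lambda>(j, i). \<Sum>s\<in>F. a s $ i * (if \<tau> (Suc j) \<le> s then 1 else 0)"
    fix \<omega> assume \<omega>: "\<omega> \<in> space M"
    have "(\<Sum>s\<in>F. a s \<bullet> w s \<omega>) = (\<Sum>s\<in>F. \<Sum>i\<in>UNIV. a s $ i * (\<Sum>j<n. (if \<tau> (Suc j) \<le> s then 1 else 0) * \<xi> (j, i) \<omega>))"
      unfolding inner_vec_def inner_real_def by (intro sum.cong refl arg_cong2[where f="(*)"] w_eq \<omega>)
    also have "\<dots> = (\<Sum>s\<in>F. \<Sum>i\<in>UNIV. \<Sum>j<n. a s $ i * (if \<tau> (Suc j) \<le> s then 1 else 0) * \<xi> (j, i) \<omega>)"
      by (simp only: sum_distrib_left mult.assoc)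
    also have "\<dots> = (\<Sum>s\<in>F. \<Sum>j<n. \<Sum>i\<in>UNIV. a s $ i * (if \<tau> (Suc j) \<le> s then 1 else 0) * \<xi> (j, i) \<omega>)"
      by (intro sum.cong refl sum.swap)
    also have "\<dots> = (\<Sum>j<n. \<Sum>s\<in>F. \<Sum>i\<in>UNIV. a s $ i * (if \<tau> (Suc j) \<le> s then 1 else 0) * \<xi> (j, i) \<omega>)"
      by (rule sum.swap)
    also have "\<dots> = (\<Sum>j<n. \<Sum>i\<in>UNIV. ?c (j, i) * \<xi> (j, i) \<omega>)"
      by (intro sum.cong refl) (subst sum.swap, simp only: sum_distrib_right prod.case)
    also have "\<dots> = (\<Sum>l\<in>L. ?c l * \<xi> l \<omega>)"
      unfolding L_def by (simp only: sum.cartesian_product case_prod_unfold prod.collapse)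
    finally show "(\<Sum>s\<in>F. a s \<bullet> w s \<omega>) = (\<Sum>l\<in>L. ?c l * \<xi> l \<omega>)" .
  qed
  moreover have "finite L" by (simp add: L_def)
  ultimately show ?thesis using ind dist by (intro exI[of _ L] exI[of _ \<xi>] exI[of _ \<sigma>] conjI) auto
qed

text \<open>The independent increments have disappeared from the statement; only covariances remain,
  and these are continuous in L2.\<close>

lemma lin_w_stein:
  fixes \<psi> \<psi>' :: "'j \<Rightarrow> real \<Rightarrow> real"
  assumes X: "X \<in> lin_w" and J: "finite J" and Y: "\<And>j. j \<in> J \<Longrightarrow> Y j \<in> lin_w"
    and \<psi>: "\<And>j x. j \<in> J \<Longrightarrow> (\<psi> j has_real_derivative \<psi>' j x) (at x)" "\<And>j. j \<in> J \<Longrightarrow> continuous_on UNIV (\<psi>' j)"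
      "\<And>j x. j \<in> J \<Longrightarrow> \<bar>\<psi> j x\<bar> \<le> 1" "\<And>j x. j \<in> J \<Longrightarrow> \<bar>\<psi>' j x\<bar> \<le> C"
  shows "\<bar>expectation (\<lambda>\<omega>. X \<omega> * (\<Prod>j\<in>J. \<psi> j (Y j \<omega>)))\<bar> \<le> C * (\<Sum>j\<in>J. \<bar>expectation (\<lambda>\<omega>. X \<omega> * Y j \<omega>)\<bar>)"
proof -
  have "\<exists>F. finite F \<and> F \<subseteq> {0..} \<and> (\<forall>j\<in>J. \<exists>a. Y j = (\<lambda>\<omega>. \<Sum>s\<in>F. a s \<bullet> w s \<omega>))"
    by (rule lin_w_common[OF J]) (rule Y)
  then obtain F0 where
    "finite F0 \<and> F0 \<subseteq> {0..} \<and> (\<forall>j\<in>J. \<exists>a. Y j = (\<lambda>\<omega>. \<Sum>s\<in>F0. a s \<bullet> w s \<omega>))"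
    by (elim exE)
  then have F0: "finite F0" "F0 \<subseteq> {0..}" "\<And>j. j \<in> J \<Longrightarrow> \<exists>a. Y j = (\<lambda>\<omega>. \<Sum>s\<in>F0. a s \<bullet> w s \<omega>)"
    by simp_all
  obtain F1 a1 where F1: "finite F1" "F1 \<subseteq> {0..}" "X = (\<lambda>\<omega>. \<Sum>s\<in>F1. a1 s \<bullet> w s \<omega>)"
    using X by (auto simp: lin_w_def)
  let ?F = "F0 \<union> F1"
  have F: "finite ?F" "?F \<subseteq> {0..}" using F0 F1 by auto
  from lin_w_increments[OF F] obtain L :: "(nat \<times> 'q) set" and \<xi> \<sigma> where LL: "finite L \<and> indep_vars (\<lambda>_. borel) \<xi> L \<and>
    (\<forall>l\<in>L. distributed M lborel (\<xi> l) (normal_density 0 (\<sigma> l)) \<and> \<sigma> l > 0) \<and>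
    (\<forall>a. \<exists>c. \<forall>\<omega>\<in>space M. (\<Sum>s\<in>?F. a s \<bullet> w s \<omega>) = (\<Sum>l\<in>L. c l * \<xi> l \<omega>))"
    by (elim exE)
  then have L: "finite L" "indep_vars (\<lambda>_. borel) \<xi> L"
    "\<And>l. l \<in> L \<Longrightarrow> distributed M lborel (\<xi> l) (normal_density 0 (\<sigma> l))" "\<And>l. l \<in> L \<Longrightarrow> \<sigma> l > 0"
    by simp_all
  have rep: "\<exists>c. \<forall>\<omega>\<in>space M. (\<Sum>s\<in>?F. a s \<bullet> w s \<omega>) = (\<Sum>l\<in>L. c l * \<xi> l \<omega>)" for a
    using LL by (elim conjE allE)
  have "\<exists>a0. X = (\<lambda>\<omega>. \<Sum>s\<in>?F. a0 s \<bullet> w s \<omega>)" using lin_w_extend[OF F(1), of F1 a1] F1(3) by simp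
  then obtain a0 where a0: "X = (\<lambda>\<omega>. \<Sum>s\<in>?F. a0 s \<bullet> w s \<omega>)" ..
  obtain a where "\<forall>\<omega>\<in>space M. (\<Sum>s\<in>?F. a0 s \<bullet> w s \<omega>) = (\<Sum>l\<in>L. a l * \<xi> l \<omega>)" using rep[of a0] ..
  then have a: "X \<omega> = (\<Sum>l\<in>L. a l * \<xi> l \<omega>)" if "\<omega> \<in> space M" for \<omega> using a0 that by simp
  have "\<exists>b. \<forall>\<omega>\<in>space M. Y j \<omega> = (\<Sum>l\<in>L. b l * \<xi> l \<omega>)" if j: "j \<in> J" for j
  proof -
    obtain b0 where b0: "Y j = (\<lambda>\<omega>. \<Sum>s\<in>F0. b0 s \<bullet> w s \<omega>)" using F0(3)[OF j] ..
    have "\<exists>b1. (\<lambda>\<omega>. \<Sum>s\<in>F0. b0 s \<bullet> w s \<omega>) = (\<lambda>\<omega>. \<Sum>s\<in>?F. b1 s \<bullet> w s \<omega>)"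
      by (rule lin_w_extend[OF F(1)]) simp
    then obtain b1 where "(\<lambda>\<omega>. \<Sum>s\<in>F0. b0 s \<bullet> w s \<omega>) = (\<lambda>\<omega>. \<Sum>s\<in>?F. b1 s \<bullet> w s \<omega>)" ..
    then show ?thesis using rep[of b1] b0 by simp
  qed
  then have "\<forall>j\<in>J. \<exists>b. \<forall>\<omega>\<in>space M. Y j \<omega> = (\<Sum>l\<in>L. b l * \<xi> l \<omega>)" ..
  from bchoice[OF this] obtain b where b: "\<And>j \<omega>. j \<in> J \<Longrightarrow> \<omega> \<in> space M \<Longrightarrow> Y j \<omega> = (\<Sum>l\<in>L. b j l * \<xi> l \<omega>)" by auto
  have 1: "expectation (\<lambda>\<omega>. X \<omega> * (\<Prod>j\<in>J. \<psi> j (Y j \<omega>)))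
    = expectation (\<lambda>\<omega>. (\<Sum>l\<in>L. a l * \<xi> l \<omega>) * (\<Prod>j\<in>J. \<psi> j (\<Sum>l\<in>L. b j l * \<xi> l \<omega>)))"
    by (rule Bochner_Integration.integral_cong) (simp_all add: a b cong: prod.cong)
  have 2: "expectation (\<lambda>\<omega>. X \<omega> * Y j \<omega>) = expectation (\<lambda>\<omega>. (\<Sum>l\<in>L. a l * \<xi> l \<omega>) * (\<Sum>l\<in>L. b j l * \<xi> l \<omega>))" if "j \<in> J" for j
    by (rule Bochner_Integration.integral_cong) (simp_all add: a b that)
  have "(\<Sum>j\<in>J. \<bar>expectation (\<lambda>\<omega>. X \<omega> * Y j \<omega>)\<bar>) = (\<Sum>j\<in>J. \<bar>expectation (\<lambda>\<omega>. (\<Sum>l\<in>L. a l * \<xi> l \<omega>) * (\<Sum>l\<in>L. b j l * \<xi> l \<omega>))\<bar>)"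
    using 2 by simp
  then show ?thesis
    unfolding 1 using indep_normal_stein_bound[where a=a and b=b, OF L J \<psi>] by simp
qed

end

section \<open>Orthogonality in the Gaussian Hilbert space\<close>

lemma nonpos_if_le_small_mult:
  assumes "\<And>r::real. 0 < r \<Longrightarrow> r \<le> 1 \<Longrightarrow> x \<le> A * r"
  shows "x \<le> 0"
proof (rule ccontr)
  assume "\<not> x \<le> 0"
  then have x: "0 < x" by simp
  \<comment> \<open>The second entry makes \<open>(\<bar>A\<bar> + 1) * r\<close> at most
    \<open>x / 2\<close>; the \<open>+ 1\<close> avoids a zero denominator.\<close>
  define r where "r = min 1 (x / (2 * (\<bar>A\<bar> + 1)))"
  have r: "0 < r" "r \<le> 1" "r \<le> x / (2 * (\<bar>A\<bar> + 1))" using x by (auto simp: r_def)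
  have "x \<le> A * r" by (rule assms) (use r in auto)
  also have "\<dots> \<le> (\<bar>A\<bar> + 1) * r" using r by (intro mult_right_mono) auto
  also have "\<dots> \<le> (\<bar>A\<bar> + 1) * (x / (2 * (\<bar>A\<bar> + 1)))" using r by (intro mult_left_mono) auto
  also have "\<dots> = x / 2"
  proof -
    have "\<bar>A\<bar> + 1 \<noteq> 0" by linarith
    then show ?thesis by (simp add: field_simps)
  qed
  finally show False using x by simp
qed

lemma DERIV_bounded_lipschitz:
  fixes f :: "real \<Rightarrow> real"
  assumes "\<And>x. (f has_real_derivative f' x) (at x)" "\<And>x. \<bar>f' x\<bar> \<le> C"
  shows "\<bar>f x - f y\<bar> \<le> C * \<bar>x - y\<bar>"
proof -
  have "norm (f x - f y) \<le> C * norm (x - y)"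
    by (rule field_differentiable_bound[of UNIV f f']) (use assms in auto)
  then show ?thesis by simp
qed

context prob_space
begin

lemma n2_mono:
  assumes "sq_int X" "sq_int Y" "\<And>\<omega>. \<omega> \<in> space M \<Longrightarrow> \<bar>X \<omega>\<bar> \<le> \<bar>Y \<omega>\<bar>"
  shows "n2 X \<le> n2 Y"
  unfolding n2_def using assms
  by (intro real_sqrt_le_mono integral_mono) (auto simp: sq_int_def abs_le_square_iff)

lemma sq_int_bounded:
  assumes "X \<in> borel_measurable M" "\<And>\<omega>. \<omega> \<in> space M \<Longrightarrow> \<bar>X \<omega>\<bar> \<le> B"
  shows "sq_int X"
proof -
  have "(X \<omega>)\<^sup>2 \<le> B\<^sup>2" if "\<omega> \<in> space M" for \<omega>
    using power_mono[OF assms(2)[OF that], of 2] by simp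
  then show ?thesis unfolding sq_int_def using assms(1)
    by (auto intro!: integrable_const_bound[where B="B\<^sup>2"])
qed

lemma n2_bounded:
  assumes "X \<in> borel_measurable M" "\<And>\<omega>. \<omega> \<in> space M \<Longrightarrow> \<bar>X \<omega>\<bar> \<le> B"
  shows "n2 X \<le> B"
proof -
  have "0 \<le> B" using assms(2) not_empty by (metis abs_ge_zero ex_in_conv order_trans)
  then have "n2 X \<le> n2 (\<lambda>_. B)" using assms by (intro n2_mono sq_int_bounded[OF assms]) auto
  also have "n2 (\<lambda>_. B) = B" using \<open>0 \<le> B\<close> by (simp add: n2_def prob_space)
  finally show ?thesis .
qed

lemma sq_int_abs: "sq_int X \<Longrightarrow> sq_int (\<lambda>\<omega>. \<bar>X \<omega>\<bar>)"
  by (auto simp: sq_int_def)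

lemma n2_abs: "n2 (\<lambda>\<omega>. \<bar>X \<omega>\<bar>) = n2 X"
  by (simp add: n2_def)

end

context wiener_space
begin

text \<open>The Gaussian Hilbert space of \<open>w\<close>.\<close>

definition gauss :: "('a \<Rightarrow> real) \<Rightarrow> bool" where
  "gauss X \<longleftrightarrow> sq_int X \<and> (\<forall>r>0. \<exists>X'\<in>lin_w. n2 (\<lambda>\<omega>. X \<omega> - X' \<omega>) \<le> r)"

lemma gauss_sq_int: "gauss X \<Longrightarrow> sq_int X"
  by (simp add: gauss_def)

lemma gaussE:
  assumes "gauss X" "0 < r"
  obtains X' where "X' \<in> lin_w" "n2 (\<lambda>\<omega>. X \<omega> - X' \<omega>) \<le> r"
  using assms by (auto simp: gauss_def)

lemma sq_int_gauss_diff: "gauss X \<Longrightarrow> X' \<in> lin_w \<Longrightarrow> sq_int (\<lambda>\<omega>. X \<omega> - X' \<omega>)"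
  by (rule sq_int_diff[OF gauss_sq_int lin_w_sq_int])

lemma gauss_lin_w: "X \<in> lin_w \<Longrightarrow> gauss X"
  by (auto simp: gauss_def lin_w_sq_int n2_def intro!: bexI[of _ X])

lemma gauss_cong:
  assumes X: "gauss X" and eq: "\<And>\<omega>. \<omega> \<in> space M \<Longrightarrow> X \<omega> = Y \<omega>"
  shows "gauss Y"
  unfolding gauss_def
proof (intro conjI allI impI)
  show "sq_int Y" by (rule sq_int_cong[OF gauss_sq_int[OF X] eq])
  fix r :: real assume "0 < r"
  then obtain X' where X': "X' \<in> lin_w" "n2 (\<lambda>\<omega>. X \<omega> - X' \<omega>) \<le> r" using gaussE[OF X] by blast
  then have "n2 (\<lambda>\<omega>. Y \<omega> - X' \<omega>) \<le> r" using n2_cong[of "\<lambda>\<omega>. X \<omega> - X' \<omega>" "\<lambda>\<omega>. Y \<omega> - X' \<omega>"] eq by simp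
  then show "\<exists>X'\<in>lin_w. n2 (\<lambda>\<omega>. Y \<omega> - X' \<omega>) \<le> r" using X'(1) by blast
qed

lemma gauss_add:
  assumes "gauss X" "gauss Y"
  shows "gauss (\<lambda>\<omega>. X \<omega> + Y \<omega>)"
  unfolding gauss_def
proof (intro conjI allI impI)
  show "sq_int (\<lambda>\<omega>. X \<omega> + Y \<omega>)" using assms by (simp add: sq_int_add gauss_sq_int)
  fix r :: real assume "0 < r"
  then have "0 < r / 2" by simp
  obtain X' where X': "X' \<in> lin_w" "n2 (\<lambda>\<omega>. X \<omega> - X' \<omega>) \<le> r / 2" using gaussE[OF assms(1) \<open>0 < r / 2\<close>] by blast
  obtain Y' where Y': "Y' \<in> lin_w" "n2 (\<lambda>\<omega>. Y \<omega> - Y' \<omega>) \<le> r / 2" using gaussE[OF assms(2) \<open>0 < r / 2\<close>] by blast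
  have "n2 (\<lambda>\<omega>. (X \<omega> - X' \<omega>) + (Y \<omega> - Y' \<omega>)) \<le> n2 (\<lambda>\<omega>. X \<omega> - X' \<omega>) + n2 (\<lambda>\<omega>. Y \<omega> - Y' \<omega>)"
    by (rule n2_triangle) (use sq_int_gauss_diff assms X'(1) Y'(1) in blast)+
  then have "n2 (\<lambda>\<omega>. (X \<omega> + Y \<omega>) - (X' \<omega> + Y' \<omega>)) \<le> r" using X' Y' by (simp add: algebra_simps)
  then show "\<exists>Z\<in>lin_w. n2 (\<lambda>\<omega>. X \<omega> + Y \<omega> - Z \<omega>) \<le> r"
    by (rule bexI[OF _ lin_w_add[OF X'(1) Y'(1)]])
qed

lemma gauss_cmult:
  assumes "gauss X"
  shows "gauss (\<lambda>\<omega>. c * X \<omega>)"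
  unfolding gauss_def
proof (intro conjI allI impI)
  show "sq_int (\<lambda>\<omega>. c * X \<omega>)" using assms by (simp add: sq_int_cmult gauss_sq_int)
  fix r :: real assume r: "0 < r"
  then have "0 < r / (\<bar>c\<bar> + 1)" by (simp add: add_nonneg_pos)
  then obtain X' where X': "X' \<in> lin_w" "n2 (\<lambda>\<omega>. X \<omega> - X' \<omega>) \<le> r / (\<bar>c\<bar> + 1)" using gaussE[OF assms] by blast
  have "n2 (\<lambda>\<omega>. c * X \<omega> - c * X' \<omega>) = \<bar>c\<bar> * n2 (\<lambda>\<omega>. X \<omega> - X' \<omega>)"
    by (simp add: n2_cmult flip: right_diff_distrib)
  also have "\<dots> \<le> (\<bar>c\<bar> + 1) * (r / (\<bar>c\<bar> + 1))" using X'(2) r by (intro mult_mono) auto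
  also have "\<dots> = r" using abs_ge_zero[of c] by (simp add: add_nonneg_eq_0_iff)
  finally show "\<exists>Z\<in>lin_w. n2 (\<lambda>\<omega>. c * X \<omega> - Z \<omega>) \<le> r"
    by (rule bexI[OF _ lin_w_cmult[OF X'(1)]])
qed

lemma gauss_diff: "gauss X \<Longrightarrow> gauss Y \<Longrightarrow> gauss (\<lambda>\<omega>. X \<omega> - Y \<omega>)"
  using gauss_add[of X "\<lambda>\<omega>. -1 * Y \<omega>"] gauss_cmult[of Y "-1"] by simp

lemma gauss_sum: "(\<And>i. i \<in> I \<Longrightarrow> gauss (X i)) \<Longrightarrow> gauss (\<lambda>\<omega>. \<Sum>i\<in>I. X i \<omega>)"
  by (induction I rule: infinite_finite_induct) (auto intro: gauss_add gauss_lin_w lin_w_0)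

text \<open>All variables are replaced by approximants in \<open>lin_w\<close>. Their covariances
  with the approximant of \<open>X\<close> are small rather than zero, which is why the Stein result
  was stated as a bound. The product of the \<open>\<psi> j\<close> is stable under the replacement
  because each factor is bounded by 1 and Lipschitz.\<close>

lemma gauss_orth_prod:
  fixes \<psi> \<psi>' :: "'j \<Rightarrow> real \<Rightarrow> real"
  assumes X: "gauss X" and J: "finite J" and Y: "\<And>j. j \<in> J \<Longrightarrow> gauss (Y j)"
    and XY: "\<And>j. j \<in> J \<Longrightarrow> expectation (\<lambda>\<omega>. X \<omega> * Y j \<omega>) = 0" and C: "0 \<le> C"
    and \<psi>: "\<And>j x. j \<in> J \<Longrightarrow> (\<psi> j has_real_derivative \<psi>' j x) (at x)" "\<And>j. j \<in> J \<Longrightarrow> continuous_on UNIV (\<psi>' j)"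
      "\<And>j x. j \<in> J \<Longrightarrow> \<bar>\<psi> j x\<bar> \<le> 1" "\<And>j x. j \<in> J \<Longrightarrow> \<bar>\<psi>' j x\<bar> \<le> C"
  shows "expectation (\<lambda>\<omega>. X \<omega> * (\<Prod>j\<in>J. \<psi> j (Y j \<omega>))) = 0"
proof -
  \<comment> \<open>The three summands bound, per unit of \<open>r\<close>, the Stein term for the
    approximants, the error of replacing \<open>X\<close>, and the error of replacing the
    \<open>Y j\<close>. The summand \<open>n2 X + 1\<close> bounds \<open>n2 X'\<close>, which uses
    \<open>r \<le> 1\<close>.\<close>
  define A where "A = C * (\<Sum>j\<in>J. n2 (Y j) + n2 X + 1) + 1 + n2 X * (C * real (card J))"
  define \<Phi> where "\<Phi> Z \<omega> = (\<Prod>j\<in>J. \<psi> j (Z j \<omega>))" for Z :: "'j \<Rightarrow> 'a \<Rightarrow> real" and \<omega>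
  have [measurable]: "\<psi> j \<in> borel_measurable borel" if "j \<in> J" for j
    using \<psi>(1)[OF that] by (intro borel_measurable_continuous_onI) (meson DERIV_isCont continuous_at_imp_continuous_on)
  have \<Phi>m: "\<Phi> Z \<in> borel_measurable M" if [measurable]: "\<And>j. j \<in> J \<Longrightarrow> Z j \<in> borel_measurable M" for Z
    unfolding \<Phi>_def by measurable
  have \<Phi>b: "\<bar>\<Phi> Z \<omega>\<bar> \<le> 1" for Z \<omega>
    unfolding \<Phi>_def abs_prod by (rule prod_le_1) (use \<psi>(3) in auto)
  have "\<bar>expectation (\<lambda>\<omega>. X \<omega> * \<Phi> Y \<omega>)\<bar> \<le> A * r" if r: "0 < r" "r \<le> 1" for r
  proof -
    obtain X' where X': "X' \<in> lin_w" "n2 (\<lambda>\<omega>. X \<omega> - X' \<omega>) \<le> r" using gaussE[OF X r(1)] by blast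
    have "\<forall>j\<in>J. \<exists>Z. Z \<in> lin_w \<and> n2 (\<lambda>\<omega>. Y j \<omega> - Z \<omega>) \<le> r" using gaussE[OF Y r(1)] by metis
    from bchoice[OF this] obtain Y' where Y': "\<And>j. j \<in> J \<Longrightarrow> Y' j \<in> lin_w" "\<And>j. j \<in> J \<Longrightarrow> n2 (\<lambda>\<omega>. Y j \<omega> - Y' j \<omega>) \<le> r"
      by blast
    have sX: "sq_int X" "sq_int X'" "sq_int (\<lambda>\<omega>. X \<omega> - X' \<omega>)"
      using X X' by (auto intro: sq_int_gauss_diff gauss_sq_int lin_w_sq_int)
    have sY: "sq_int (Y j)" "sq_int (Y' j)" "sq_int (\<lambda>\<omega>. Y j \<omega> - Y' j \<omega>)" if "j \<in> J" for j
      using Y Y' that by (auto intro: sq_int_gauss_diff gauss_sq_int lin_w_sq_int)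
    have "\<Phi> Y \<in> borel_measurable M" "\<Phi> Y' \<in> borel_measurable M"
      by (rule \<Phi>m, rule sq_int_measurable, erule sY)+
    note \<Phi>Y = sq_int_bounded[OF this(1) \<Phi>b] sq_int_bounded[OF this(2) \<Phi>b] n2_bounded[OF this(2) \<Phi>b]
    have nX': "n2 X' \<le> n2 X + 1"
      using n2_triangle[OF sX(1), of "\<lambda>\<omega>. X' \<omega> - X \<omega>"] sX n2_minus[of X' X] X'(2) r(2) sq_int_diff[OF sX(2,1)] by simp
    have 1: "\<bar>expectation (\<lambda>\<omega>. X' \<omega> * \<Phi> Y' \<omega>)\<bar> \<le> C * (\<Sum>j\<in>J. (n2 (Y j) + n2 X + 1) * r)"
    proof -
      have "\<bar>expectation (\<lambda>\<omega>. X' \<omega> * Y' j \<omega>)\<bar> \<le> (n2 (Y j) + n2 X + 1) * r" if j: "j \<in> J" for j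
      proof -
        have "expectation (\<lambda>\<omega>. X' \<omega> * Y' j \<omega>) = expectation (\<lambda>\<omega>. X \<omega> * Y j \<omega> - (X \<omega> - X' \<omega>) * Y j \<omega> - X' \<omega> * (Y j \<omega> - Y' j \<omega>))"
          by (rule Bochner_Integration.integral_cong) (simp_all add: algebra_simps)
        also have "\<dots> = 0 - expectation (\<lambda>\<omega>. (X \<omega> - X' \<omega>) * Y j \<omega>) - expectation (\<lambda>\<omega>. X' \<omega> * (Y j \<omega> - Y' j \<omega>))"
          using integrable_mult_sq_int[OF sX(1) sY(1)[OF j]] integrable_mult_sq_int[OF sX(3) sY(1)[OF j]]
            integrable_mult_sq_int[OF sX(2) sY(3)[OF j]] XY[OF j]
          by (subst Bochner_Integration.integral_diff, auto)+
        also have "\<bar>\<dots>\<bar> \<le> n2 (\<lambda>\<omega>. X \<omega> - X' \<omega>) * n2 (Y j) + n2 X' * n2 (\<lambda>\<omega>. Y j \<omega> - Y' j \<omega>)"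
          using n2_cauchy_schwarz[OF sX(3) sY(1)[OF j]] n2_cauchy_schwarz[OF sX(2) sY(3)[OF j]] by linarith
        also have "\<dots> \<le> r * n2 (Y j) + (n2 X + 1) * r"
          using X'(2) Y'(2)[OF j] nX' r by (intro add_mono mult_mono) auto
        finally show ?thesis by (simp add: algebra_simps)
      qed
      then have "C * (\<Sum>j\<in>J. \<bar>expectation (\<lambda>\<omega>. X' \<omega> * Y' j \<omega>)\<bar>) \<le> C * (\<Sum>j\<in>J. (n2 (Y j) + n2 X + 1) * r)"
        using C by (intro mult_left_mono sum_mono)
      moreover have "\<bar>expectation (\<lambda>\<omega>. X' \<omega> * \<Phi> Y' \<omega>)\<bar> \<le> C * (\<Sum>j\<in>J. \<bar>expectation (\<lambda>\<omega>. X' \<omega> * Y' j \<omega>)\<bar>)"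
        unfolding \<Phi>_def by (rule lin_w_stein[OF X'(1) J, where \<psi>'=\<psi>']) (use Y'(1) \<psi> in simp_all)
      ultimately show ?thesis by linarith
    qed
    have 2: "\<bar>expectation (\<lambda>\<omega>. (X \<omega> - X' \<omega>) * \<Phi> Y' \<omega>)\<bar> \<le> r"
      using n2_cauchy_schwarz[OF sX(3) \<Phi>Y(2)] mult_mono[OF X'(2) \<Phi>Y(3)] r by simp
    have n\<Phi>: "n2 (\<lambda>\<omega>. \<Phi> Y \<omega> - \<Phi> Y' \<omega>) \<le> C * real (card J) * r"
    proof -
      have "n2 (\<lambda>\<omega>. \<Phi> Y \<omega> - \<Phi> Y' \<omega>) \<le> n2 (\<lambda>\<omega>. C * (\<Sum>j\<in>J. \<bar>Y j \<omega> - Y' j \<omega>\<bar>))"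
      proof (rule n2_mono)
        fix \<omega>
        have "\<bar>\<Phi> Y \<omega> - \<Phi> Y' \<omega>\<bar> \<le> (\<Sum>j\<in>J. \<bar>\<psi> j (Y j \<omega>) - \<psi> j (Y' j \<omega>)\<bar>)"
          unfolding \<Phi>_def using norm_prod_diff[of J "\<lambda>j. \<psi> j (Y j \<omega>)" "\<lambda>j. \<psi> j (Y' j \<omega>)"] \<psi>(3) by simp
        also have "\<dots> \<le> (\<Sum>j\<in>J. C * \<bar>Y j \<omega> - Y' j \<omega>\<bar>)"
          by (intro sum_mono DERIV_bounded_lipschitz[OF \<psi>(1) \<psi>(4)])
        also have "\<dots> = C * (\<Sum>j\<in>J. \<bar>Y j \<omega> - Y' j \<omega>\<bar>)" by (simp add: sum_distrib_left)
        finally show "\<bar>\<Phi> Y \<omega> - \<Phi> Y' \<omega>\<bar> \<le> \<bar>C * (\<Sum>j\<in>J. \<bar>Y j \<omega> - Y' j \<omega>\<bar>)\<bar>" by linarith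
      next
        show "sq_int (\<lambda>\<omega>. C * (\<Sum>j\<in>J. \<bar>Y j \<omega> - Y' j \<omega>\<bar>))"
          by (rule sq_int_cmult, rule sq_int_sum, rule sq_int_abs, erule sY)
      qed (rule sq_int_diff[OF \<Phi>Y(1,2)])
      also have "\<dots> \<le> C * (\<Sum>j\<in>J. n2 (\<lambda>\<omega>. \<bar>Y j \<omega> - Y' j \<omega>\<bar>))"
      proof -
        have "n2 (\<lambda>\<omega>. \<Sum>j\<in>J. \<bar>Y j \<omega> - Y' j \<omega>\<bar>) \<le> (\<Sum>j\<in>J. n2 (\<lambda>\<omega>. \<bar>Y j \<omega> - Y' j \<omega>\<bar>))"
          by (rule n2_sum[OF J]) (rule sq_int_abs, erule sY)
        then show ?thesis using C by (simp add: n2_cmult mult_left_mono)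
      qed
      also have "\<dots> \<le> C * (\<Sum>j\<in>J. r)"
        using C by (intro mult_left_mono sum_mono) (simp_all add: n2_abs Y'(2))
      finally show ?thesis by simp
    qed
    have 3: "\<bar>expectation (\<lambda>\<omega>. X \<omega> * (\<Phi> Y \<omega> - \<Phi> Y' \<omega>))\<bar> \<le> n2 X * (C * real (card J) * r)"
      using n2_cauchy_schwarz[OF sX(1) sq_int_diff[OF \<Phi>Y(1,2)]] mult_left_mono[OF n\<Phi>, of "n2 X"] by simp
    have "expectation (\<lambda>\<omega>. X \<omega> * \<Phi> Y \<omega>) = expectation (\<lambda>\<omega>. X' \<omega> * \<Phi> Y' \<omega> + (X \<omega> - X' \<omega>) * \<Phi> Y' \<omega> + X \<omega> * (\<Phi> Y \<omega> - \<Phi> Y' \<omega>))"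
      by (rule Bochner_Integration.integral_cong) (simp_all add: algebra_simps)
    also have "\<dots> = expectation (\<lambda>\<omega>. X' \<omega> * \<Phi> Y' \<omega>) + expectation (\<lambda>\<omega>. (X \<omega> - X' \<omega>) * \<Phi> Y' \<omega>) + expectation (\<lambda>\<omega>. X \<omega> * (\<Phi> Y \<omega> - \<Phi> Y' \<omega>))"
      using integrable_mult_sq_int[OF sX(2) \<Phi>Y(2)] integrable_mult_sq_int[OF sX(3) \<Phi>Y(2)]
        integrable_mult_sq_int[OF sX(1) sq_int_diff[OF \<Phi>Y(1,2)]]
      by (subst Bochner_Integration.integral_add, auto)+
    finally have "\<bar>expectation (\<lambda>\<omega>. X \<omega> * \<Phi> Y \<omega>)\<bar> \<le> C * (\<Sum>j\<in>J. (n2 (Y j) + n2 X + 1) * r) + r + n2 X * (C * real (card J) * r)"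
      using 1 2 3 by linarith
    also have "\<dots> = A * r"
      unfolding A_def sum_distrib_right[symmetric] by (simp add: algebra_simps)
    finally show ?thesis .
  qed
  from nonpos_if_le_small_mult[OF this] show ?thesis unfolding \<Phi>_def by simp
qed

text \<open>A smooth approximation of the indicator of \<open>y \<le> c\<close>. The shift by
  \<open>sqrt (real (Suc k))\<close> makes the limit at \<open>y = c\<close> equal to 1 instead of
  \<open>1 / 2\<close>, while for \<open>y > c\<close> the linear term still dominates it.\<close>

definition soft_step :: "nat \<Rightarrow> real \<Rightarrow> real \<Rightarrow> real" where
  "soft_step k c y = 1 / 2 - arctan (real (Suc k) * (y - c) - sqrt (real (Suc k))) / pi"

lemma soft_step_bounds: "\<bar>soft_step k c y\<bar> \<le> 1"
proof -
  have "- (1 / 2) < arctan x / pi" "arctan x / pi < 1 / 2" for x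
    using arctan_lbound[of x] arctan_ubound[of x] pi_gt_zero by (simp_all add: field_simps)
  from this[of "real (Suc k) * (y - c) - sqrt (real (Suc k))"] show ?thesis
    unfolding soft_step_def by linarith
qed

lemma soft_step_deriv:
  "(soft_step k c has_real_derivative - (real (Suc k) / (1 + (real (Suc k) * (y - c) - sqrt (real (Suc k)))\<^sup>2)) / pi) (at y)"
proof -
  have "((\<lambda>y. 1 / 2 - arctan (m * (y - c) - s) / pi) has_real_derivative 0 - (inverse (1 + (m * (y - c) - s)\<^sup>2) * (m * 1)) / pi) (at y)"
    for m s :: real
    by (intro DERIV_diff DERIV_const DERIV_cdivide DERIV_chain2[OF DERIV_arctan])
       (auto intro!: derivative_eq_intros)
  from this[of "real (Suc k)" "sqrt (real (Suc k))"] show ?thesis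
    unfolding soft_step_def by (rule DERIV_cong) (simp only: divide_inverse mult_1_right diff_0 mult.commute)
qed

lemma soft_step_limit: "(\<lambda>k. soft_step k c y) \<longlonglongrightarrow> (if y \<le> c then 1 else 0)"
proof -
  consider "y < c" | "y = c" | "c < y" by linarith
  then show ?thesis
  proof cases
    case 1
    define d where "d = y - c"
    have "d < 0" using 1 by (simp add: d_def)
    then have "(\<lambda>k. 1 / 2 - arctan (real (Suc k) * d - sqrt (real (Suc k))) / pi) \<longlonglongrightarrow> 1" by real_asymp
    then show ?thesis using 1 by (simp add: soft_step_def d_def)
  next
    case 2
    have "(\<lambda>k. 1 / 2 - arctan (- sqrt (real (Suc k))) / pi) \<longlonglongrightarrow> 1" by real_asymp
    then show ?thesis using 2 by (simp add: soft_step_def)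
  next
    case 3
    define d where "d = y - c"
    have "d > 0" using 3 by (simp add: d_def)
    then have "(\<lambda>k. 1 / 2 - arctan (real (Suc k) * d - sqrt (real (Suc k))) / pi) \<longlonglongrightarrow> 0" by real_asymp
    then show ?thesis using 3 by (simp add: soft_step_def d_def)
  qed
qed

text \<open>The derivative bounds of the soft steps grow with \<open>k\<close>, but the expectation
  is exactly zero for each \<open>k\<close>, so only dominated convergence with majorant
  \<open>\<bar>X\<bar>\<close> is involved in the limit.\<close>

lemma gauss_orth_cylinder:
  assumes X: "gauss X" and J: "finite J" and Y: "\<And>j. j \<in> J \<Longrightarrow> gauss (Y j)"
    and XY: "\<And>j. j \<in> J \<Longrightarrow> expectation (\<lambda>\<omega>. X \<omega> * Y j \<omega>) = 0"
  shows "{\<omega> \<in> space M. \<forall>j\<in>J. Y j \<omega> \<le> c j} \<in> sets M"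
    and "expectation (\<lambda>\<omega>. X \<omega> * indicator {\<omega> \<in> space M. \<forall>j\<in>J. Y j \<omega> \<le> c j} \<omega>) = 0"
proof -
  let ?A = "{\<omega> \<in> space M. \<forall>j\<in>J. Y j \<omega> \<le> c j}"
  let ?\<Phi> = "\<lambda>k \<omega>. \<Prod>j\<in>J. soft_step k (c j) (Y j \<omega>)"
  have [measurable]: "Y j \<in> borel_measurable M" if "j \<in> J" for j using Y[OF that] by (simp add: gauss_def sq_int_def)
  have [measurable]: "X \<in> borel_measurable M" using X by (simp add: gauss_def sq_int_def)
  have [measurable]: "soft_step k c \<in> borel_measurable borel" for k c unfolding soft_step_def by measurable
  show A[measurable]: "?A \<in> sets M"
    using J by measurable
  have 0: "expectation (\<lambda>\<omega>. X \<omega> * ?\<Phi> k \<omega>) = 0" for k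
  proof (rule gauss_orth_prod[OF X J, where C="real (Suc k)" and \<psi>="\<lambda>j. soft_step k (c j)"
        and \<psi>'="\<lambda>j y. - (real (Suc k) / (1 + (real (Suc k) * (y - c j) - sqrt (real (Suc k)))\<^sup>2)) / pi"])
    fix j and y :: real
    show "(soft_step k (c j) has_real_derivative - (real (Suc k) / (1 + (real (Suc k) * (y - c j) - sqrt (real (Suc k)))\<^sup>2)) / pi) (at y)"
      by (rule soft_step_deriv)
    show "\<bar>soft_step k (c j) y\<bar> \<le> 1" by (rule soft_step_bounds)
    have "1 + (real (Suc k) * (y - c j) - sqrt (real (Suc k)))\<^sup>2 \<noteq> 0" for y
      using zero_le_power2[of "real (Suc k) * (y - c j) - sqrt (real (Suc k))"] by linarith
    then show "continuous_on UNIV (\<lambda>y. - (real (Suc k) / (1 + (real (Suc k) * (y - c j) - sqrt (real (Suc k)))\<^sup>2)) / pi)"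
      by (intro continuous_intros) auto
    let ?q = "1 + (real (Suc k) * (y - c j) - sqrt (real (Suc k)))\<^sup>2"
    have q: "1 \<le> ?q" by simp
    have "real (Suc k) / ?q / pi \<le> real (Suc k) / 1 / 1"
      using q pi_gt3 by (intro frac_le) auto
    then show "\<bar>- (real (Suc k) / ?q) / pi\<bar> \<le> real (Suc k)" using q by simp
  qed (simp_all add: Y XY)
  have lim: "(\<lambda>k. expectation (\<lambda>\<omega>. X \<omega> * ?\<Phi> k \<omega>)) \<longlonglongrightarrow> expectation (\<lambda>\<omega>. X \<omega> * indicator ?A \<omega>)"
  proof (rule integral_dominated_convergence[where w="\<lambda>\<omega>. \<bar>X \<omega>\<bar>"])
    show "integrable M (\<lambda>\<omega>. \<bar>X \<omega>\<bar>)" using sq_int_integrable[OF gauss_sq_int[OF X]] by simp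
    show "AE \<omega> in M. (\<lambda>k. X \<omega> * ?\<Phi> k \<omega>) \<longlonglongrightarrow> X \<omega> * indicator ?A \<omega>"
    proof (rule AE_I2)
      fix \<omega> assume \<omega>: "\<omega> \<in> space M"
      have "(\<lambda>k. ?\<Phi> k \<omega>) \<longlonglongrightarrow> (\<Prod>j\<in>J. if Y j \<omega> \<le> c j then 1 else 0)"
        by (intro tendsto_prod soft_step_limit)
      also have "(\<Prod>j\<in>J. if Y j \<omega> \<le> c j then 1 else 0) = (indicator ?A \<omega> :: real)"
        using J \<omega> by (auto simp: indicator_def prod_zero_iff)
      finally show "(\<lambda>k. X \<omega> * ?\<Phi> k \<omega>) \<longlonglongrightarrow> X \<omega> * indicator ?A \<omega>" by (intro tendsto_mult tendsto_const)
    qed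
    show "AE \<omega> in M. norm (X \<omega> * ?\<Phi> k \<omega>) \<le> \<bar>X \<omega>\<bar>" for k
    proof (rule AE_I2)
      fix \<omega>
      have "\<bar>?\<Phi> k \<omega>\<bar> \<le> 1" unfolding abs_prod by (rule prod_le_1) (auto simp: soft_step_bounds)
      then show "norm (X \<omega> * ?\<Phi> k \<omega>) \<le> \<bar>X \<omega>\<bar>" using mult_left_mono[of "\<bar>?\<Phi> k \<omega>\<bar>" 1 "\<bar>X \<omega>\<bar>"] by (simp add: abs_mult)
    qed
  qed measurable
  from LIMSEQ_unique[OF lim] 0 show "expectation (\<lambda>\<omega>. X \<omega> * indicator ?A \<omega>) = 0" by simp
qed

text \<open>Dynkin's argument: the cylinders over finite index sets are stable under intersection,
  and the sets on which \<open>X\<close> integrates to zero are closed under complements and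
  disjoint unions.\<close>

lemma gauss_orth_sigma_sets:
  fixes Y :: "'i \<Rightarrow> 'a \<Rightarrow> real"
  assumes X: "gauss X" and Y: "\<And>i. i \<in> I \<Longrightarrow> gauss (Y i)"
    and XY: "\<And>i. i \<in> I \<Longrightarrow> expectation (\<lambda>\<omega>. X \<omega> * Y i \<omega>) = 0"
    and A: "A \<in> sigma_sets (space M) {{\<omega> \<in> space M. \<forall>j\<in>J. Y j \<omega> \<le> c j} | J c. finite J \<and> J \<subseteq> I}"
  shows "A \<in> sets M \<and> expectation (\<lambda>\<omega>. X \<omega> * indicator A \<omega>) = 0"
proof -
  let ?G = "{{\<omega> \<in> space M. \<forall>j\<in>J. Y j \<omega> \<le> c j} | J c. finite J \<and> J \<subseteq> I}"
  have iX: "integrable M X" using sq_int_integrable[OF gauss_sq_int[OF X]] .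
  have G: "A \<in> sets M \<and> expectation (\<lambda>\<omega>. X \<omega> * indicator A \<omega>) = 0" if "A \<in> ?G" for A
  proof -
    from that obtain J c where "A = {\<omega> \<in> space M. \<forall>j\<in>J. Y j \<omega> \<le> c j} \<and> finite J \<and> J \<subseteq> I"
      unfolding mem_Collect_eq by (elim exE)
    then have J: "finite J" "J \<subseteq> I" "A = {\<omega> \<in> space M. \<forall>j\<in>J. Y j \<omega> \<le> c j}" by simp_all
    have YJ: "gauss (Y j)" "expectation (\<lambda>\<omega>. X \<omega> * Y j \<omega>) = 0" if "j \<in> J" for j
      using Y XY J(2) that by blast+
    show ?thesis unfolding J(3) using gauss_orth_cylinder[OF X J(1), of Y c] YJ by simp
  qed
  have Int: "Int_stable ?G"
  proof (rule Int_stableI)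
    fix a b assume ab: "a \<in> ?G" "b \<in> ?G"
    from ab(1) obtain J c where "a = {\<omega> \<in> space M. \<forall>j\<in>J. Y j \<omega> \<le> c j} \<and> finite J \<and> J \<subseteq> I"
      unfolding mem_Collect_eq by (elim exE)
    then have J: "finite J" "J \<subseteq> I" "a = {\<omega> \<in> space M. \<forall>j\<in>J. Y j \<omega> \<le> c j}" by simp_all
    from ab(2) obtain K d where "b = {\<omega> \<in> space M. \<forall>j\<in>K. Y j \<omega> \<le> d j} \<and> finite K \<and> K \<subseteq> I"
      unfolding mem_Collect_eq by (elim exE)
    then have K: "finite K" "K \<subseteq> I" "b = {\<omega> \<in> space M. \<forall>j\<in>K. Y j \<omega> \<le> d j}" by simp_all
    \<comment> \<open>On common indices both conditions hold exactly below the smaller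
      threshold.\<close>
    let ?e = "\<lambda>j. if j \<in> J then if j \<in> K then min (c j) (d j) else c j else d j"
    have "a \<inter> b = {\<omega> \<in> space M. \<forall>j\<in>J \<union> K. Y j \<omega> \<le> ?e j}" unfolding J K by auto
    moreover have "finite (J \<union> K) \<and> J \<union> K \<subseteq> I" using J(1,2) K(1,2) by simp
    ultimately show "a \<inter> b \<in> ?G"
      by (intro CollectI exI[of _ "J \<union> K"] exI[of _ ?e] conjI) simp_all
  qed
  \<comment> \<open>The cylinder over no index is the whole space, so \<open>X\<close> has mean
    zero; this starts the case of complements.\<close>
  have EX: "expectation X = 0"
  proof -
    have "space M \<in> ?G" by (intro CollectI exI[of _ "{}"] exI[of _ "\<lambda>_. 0"] conjI) simp_all
    from G[OF this] have "expectation (\<lambda>\<omega>. X \<omega> * indicator (space M) \<omega>) = 0" by simp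
    moreover have "expectation (\<lambda>\<omega>. X \<omega> * indicator (space M) \<omega>) = expectation X"
      by (rule Bochner_Integration.integral_cong) auto
    ultimately show ?thesis by simp
  qed
  have "?G \<subseteq> Pow (space M)" by auto
  from Int this A show ?thesis
  proof (induction rule: sigma_sets_induct_disjoint)
    case (basic A)
    then show ?case using G by blast
  next
    case empty
    then show ?case by simp
  next
    case (compl A)
    have "expectation (\<lambda>\<omega>. X \<omega> * indicator (space M - A) \<omega>) = expectation (\<lambda>\<omega>. X \<omega> - X \<omega> * indicator A \<omega>)"
      by (rule Bochner_Integration.integral_cong) (auto simp: indicator_def)
    also have "\<dots> = 0"
      using compl EX iX by (subst Bochner_Integration.integral_diff) (auto intro!: integrable_real_mult_indicator)
    finally show ?case using compl by auto
  next
    case (union A)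
    then have m: "A i \<in> sets M" and z: "expectation (\<lambda>\<omega>. X \<omega> * indicator (A i) \<omega>) = 0" for i by auto
    have "(LINT \<omega>:(\<Union>i. A i)|M. X \<omega>) = (\<Sum>i. (LINT \<omega>:(A i)|M. X \<omega>))"
    proof (rule lebesgue_integral_countable_add)
      show "A i \<inter> A j = {}" if "i \<noteq> j" for i j using union(1) that by (auto simp: disjoint_family_on_def)
      show "set_integrable M (\<Union>i. A i) X"
        unfolding set_integrable_def using m iX by (intro integrable_mult_indicator) auto
    qed (use m in auto)
    then have "expectation (\<lambda>\<omega>. X \<omega> * indicator (\<Union>i. A i) \<omega>) = 0"
      using z by (simp add: set_lebesgue_integral_def mult.commute)
    then show ?case using m by auto
  qed
qed

text \<open>The observation differs from Gaussian variables by a deterministic term, so its history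
  lies in the sigma-algebra generated by the cylinders. Uncorrelatedness with the individual
  observations thus becomes orthogonality to every square-integrable function of them, linear or
  not.\<close>

lemma gauss_orth_history:
  fixes z :: "real \<Rightarrow> 'a \<Rightarrow> real^'k::finite"
  assumes X: "gauss X" and Y: "\<And>s i. s \<in> {0..t} \<Longrightarrow> gauss (Y s i)"
    and XY: "\<And>s i. s \<in> {0..t} \<Longrightarrow> expectation (\<lambda>\<omega>. X \<omega> * Y s i \<omega>) = 0"
    and z: "\<And>s i \<omega>. s \<in> {0..t} \<Longrightarrow> \<omega> \<in> space M \<Longrightarrow> z s \<omega> $ i = c s i + Y s i \<omega>"
    and \<zeta>: "\<zeta> \<in> borel_measurable (history M z t)" "sq_int \<zeta>"
  shows "expectation (\<lambda>\<omega>. X \<omega> * \<zeta> \<omega>) = 0"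
proof -
  define I where "I = {0..t} \<times> (UNIV :: 'k set)"
  define Y' where "Y' = (\<lambda>(s, i). Y s i)"
  let ?G = "{{\<omega> \<in> space M. \<forall>j\<in>J. Y' j \<omega> \<le> c j} | J c. finite J \<and> J \<subseteq> I}"
  define N where "N = sigma (space M) ?G"
  have G: "?G \<subseteq> Pow (space M)" by auto
  have spN: "space N = space M" unfolding N_def using G by (simp add: space_measure_of_conv)
  have setsN: "sets N = sigma_sets (space M) ?G" unfolding N_def using G by (rule sets_measure_of)
  have Y'm: "Y' j \<in> borel_measurable N" if "j \<in> I" for j
  proof (rule borel_measurableI_le)
    fix y :: real
    have "{x \<in> space N. Y' j x \<le> y} = {\<omega> \<in> space M. \<forall>k\<in>{j}. Y' k \<omega> \<le> y}" by (auto simp: spN)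
    then have "{x \<in> space N. Y' j x \<le> y} \<in> ?G"
      using that by (intro CollectI exI[of _ "{j}"] exI[of _ "\<lambda>_. y"]) auto
    then show "{x \<in> space N. Y' j x \<le> y} \<in> sets N" unfolding setsN by blast
  qed
  have zm: "z s \<in> borel_measurable N" if s: "s \<in> {0..t}" for s
    unfolding borel_measurable_euclidean_space[of "z s"]
  proof
    fix b :: "real^'k" assume "b \<in> Basis"
    then obtain i where b: "b = axis i 1" by (auto simp: Basis_vec_def)
    have "(\<lambda>\<omega>. c s i + Y' (s, i) \<omega>) \<in> borel_measurable N"
      using Y'm[of "(s, i)"] s by (intro borel_measurable_add) (auto simp: I_def)
    then show "(\<lambda>\<omega>. z s \<omega> \<bullet> b) \<in> borel_measurable N"
      by (rule measurable_cong[THEN iffD1, rotated]) (use z[OF s] in \<open>auto simp: b inner_axis spN Y'_def\<close>)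
  qed
  have sp: "space (history M z t) = space M"
    unfolding history_def by (rule space_measure_of) auto
  have subN: "sets (history M z t) \<subseteq> sets N"
  proof -
    have "(\<Union>s\<in>{0..t}. {z s -` S \<inter> space M | S. S \<in> sets borel}) \<subseteq> sets N"
      using measurable_sets[OF zm] by (auto simp: spN)
    then have "sigma_sets (space M) (\<Union>s\<in>{0..t}. {z s -` S \<inter> space M | S. S \<in> sets borel}) \<subseteq> sets N"
      using sets.sigma_sets_subset[of _ N] by (simp add: spN)
    then show ?thesis unfolding history_def by (subst sets_measure_of) auto
  qed
  have orth: "A \<in> sets M \<and> expectation (\<lambda>\<omega>. X \<omega> * indicator A \<omega>) = 0" if "A \<in> sets N" for A
  proof (rule gauss_orth_sigma_sets[OF X, of I Y'])
    show "A \<in> sigma_sets (space M) ?G" using that unfolding setsN .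
  qed (use Y XY in \<open>auto simp: I_def Y'_def\<close>)
  have iX: "integrable M X" using sq_int_integrable[OF gauss_sq_int[OF X]] .
  let ?F = "history M z t"
  have subalg: "subalgebra M ?F" unfolding subalgebra_def using sp orth subN by blast
  interpret F: finite_measure_subalgebra M ?F by standard (rule subalg)
  \<comment> \<open>The conditional expectation serves only to pass from indicators of history
    events to all of \<zeta>: it vanishes because \<open>X\<close> integrates to zero over each such
    event.\<close>
  have "AE \<omega> in M. real_cond_exp M ?F X \<omega> = (\<lambda>_. 0) \<omega>"
  proof (rule F.real_cond_exp_charact)
    fix A assume "A \<in> sets ?F"
    then show "(LINT \<omega>:A|M. X \<omega>) = (LINT \<omega>:A|M. 0)"
      using orth subN by (auto simp: set_lebesgue_integral_def mult.commute)
  qed (use iX in auto)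
  moreover have "expectation (\<lambda>\<omega>. \<zeta> \<omega> * real_cond_exp M ?F X \<omega>) = expectation (\<lambda>\<omega>. \<zeta> \<omega> * X \<omega>)"
    using integrable_mult_sq_int[OF \<zeta>(2) gauss_sq_int[OF X]] \<zeta>(1) iX by (intro F.real_cond_exp_intg) auto
  moreover have "AE \<omega> in M. \<zeta> \<omega> * real_cond_exp M ?F X \<omega> = 0" using calculation(1) by eventually_elim simp
  ultimately show ?thesis by (simp add: integral_eq_zero_AE mult.commute)
qed

end

section \<open>Continuous square-integrable processes and their time integrals\<close>

lemma integral_has_derivative_continuous:
  fixes g :: "real \<Rightarrow> real"
  assumes g: "continuous_on UNIV g" and t: "0 \<le> t"
  shows "((\<lambda>t. integral {0..t} g) has_real_derivative g t) (at t within {0..})"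
proof -
  have "((\<lambda>t. integral {0..t} g) has_real_derivative g t) (at t within {0..t+1})"
    by (rule integral_has_real_derivative) (use g t in \<open>auto intro: continuous_on_subset\<close>)
  moreover have "at t within {0..t+1} = at t within {0..}"
    by (rule at_within_nhd[of _ "{..<t+1}"]) auto
  ultimately show ?thesis by simp
qed

text \<open>The integral is frozen at negative times; processes can then be continuous on the whole
  line, which spares one-sided statements at time 0.\<close>

lemma continuous_integral_max:
  fixes g :: "real \<Rightarrow> real"
  assumes g: "continuous_on UNIV g"
  shows "continuous_on UNIV (\<lambda>t. integral {0..max 0 t} g)"
proof -
  have "continuous_on {0..} (\<lambda>t. integral {0..t} g)"
    by (auto simp: continuous_on_eq_continuous_within intro: DERIV_continuous integral_has_derivative_continuous[OF g])
  then show ?thesis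
    by (rule continuous_on_compose2) (auto intro!: continuous_intros)
qed

lemma integral_itv_continuous_UNIV:
  fixes g :: "real \<Rightarrow> real"
  assumes "continuous_on UNIV g"
  shows "(\<integral>s. g s \<partial>itv a b) = integral {a..b} g" "integrable (itv a b) g" "g integrable_on {a..b}"
proof -
  have m: "g \<in> borel_measurable borel" using assms by (rule borel_measurable_continuous_onI)
  have c: "continuous_on {a..b} g" using assms by (rule continuous_on_subset) simp
  show "(\<integral>s. g s \<partial>itv a b) = integral {a..b} g" "integrable (itv a b) g"
    by (rule integral_itv_continuous[OF c m])+
  show "g integrable_on {a..b}" using c by (rule integrable_continuous_real)
qed

lemma continuous_bound_Icc:
  fixes f :: "real \<Rightarrow> real"
  assumes "continuous_on UNIV f"
  obtains F where "0 \<le> F" "\<And>s. s \<in> {a..b} \<Longrightarrow> \<bar>f s\<bar> \<le> F"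
proof -
  have "bounded (f ` {a..b})"
    using assms by (intro compact_imp_bounded compact_continuous_image) (auto intro: continuous_on_subset)
  then obtain F where F: "\<forall>x\<in>f ` {a..b}. norm x \<le> F" by (auto simp only: bounded_iff)
  show ?thesis
  proof (rule that[of "max 0 F"])
    show "\<bar>f s\<bar> \<le> max 0 F" if "s \<in> {a..b}" for s using F that by force
  qed simp
qed

lemma integral_grid:
  fixes g :: "real \<Rightarrow> real"
  assumes g: "continuous_on UNIV g" and h: "0 \<le> h"
  shows "integral {0..real n * h} g = (\<Sum>j<n. integral {real j * h..real (Suc j) * h} g)"
proof (induction n)
  case (Suc n)
  have "integral {0..real n * h} g + integral {real n * h..real (Suc n) * h} g = integral {0..real (Suc n) * h} g"
    by (rule Henstock_Kurzweil_Integration.integral_combine)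
       (use h in \<open>auto intro!: integral_itv_continuous_UNIV[OF g] mult_right_mono\<close>)
  then show ?case using Suc by simp
qed simp

context prob_space
begin

lemma l2_joint_integral_bound:
  assumes X: "l2_joint a b X" and ab: "a \<le> b" and B: "\<And>s. s \<in> {a..b} \<Longrightarrow> expectation (\<lambda>\<omega>. (X s \<omega>)\<^sup>2) \<le> B"
  shows "expectation (\<lambda>\<omega>. (\<integral>s. X s \<omega> \<partial>itv a b)\<^sup>2) \<le> (b - a)\<^sup>2 * B"
proof -
  interpret I: finite_measure "itv a b" by (rule finite_measure_itv)
  have "(\<integral>s. expectation (\<lambda>\<omega>. (X s \<omega>)\<^sup>2) \<partial>itv a b) \<le> (\<integral>s. B \<partial>itv a b)"
    by (rule integral_mono_AE) (use l2_joint_integral(2)[OF X ab] B in \<open>auto intro: AE_itvI\<close>)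
  also have "\<dots> = (b - a) * B" using measure_itv[OF ab] by simp
  finally have "(b - a) * (\<integral>s. expectation (\<lambda>\<omega>. (X s \<omega>)\<^sup>2) \<partial>itv a b) \<le> (b - a) * ((b - a) * B)"
    using ab by (intro mult_left_mono) auto
  then show ?thesis using l2_joint_integral(6)[OF X ab] by (simp add: power2_eq_square mult.assoc)
qed

text \<open>A class closed under sums, continuous deterministic factors and time integration. Path
  continuity supplies joint measurability, and the bound on compact intervals supplies joint square
  integrability.\<close>

definition l2_process :: "(real \<Rightarrow> 'a \<Rightarrow> real) \<Rightarrow> bool" where
  "l2_process X \<longleftrightarrow> (\<forall>\<omega>\<in>space M. continuous_on UNIV (\<lambda>s. X s \<omega>)) \<and> (\<forall>s. sq_int (X s)) \<and>
    (\<forall>T. \<exists>B. \<forall>s\<in>{0..T}. expectation (\<lambda>\<omega>. (X s \<omega>)\<^sup>2) \<le> B)"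

lemma l2_process_cont: "l2_process X \<Longrightarrow> \<omega> \<in> space M \<Longrightarrow> continuous_on UNIV (\<lambda>s. X s \<omega>)"
  and l2_process_sq_int: "l2_process X \<Longrightarrow> sq_int (X s)"
  by (simp_all add: l2_process_def)

lemma l2_process_bound:
  assumes "l2_process X"
  obtains B where "\<And>s. 0 \<le> s \<Longrightarrow> s \<le> T \<Longrightarrow> expectation (\<lambda>\<omega>. (X s \<omega>)\<^sup>2) \<le> B"
  using assms unfolding l2_process_def by (metis atLeastAtMost_iff)

lemma l2_process_measurable:
  "l2_process X \<Longrightarrow> (\<lambda>(t, \<omega>). X t \<omega>) \<in> borel_measurable (borel \<Otimes>\<^sub>M M)"
  by (rule measurable_continuous_process) (simp_all add: l2_process_def sq_int_def)

lemma l2_process_joint: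
  assumes X: "l2_process X" and a: "0 \<le> a"
  shows "l2_joint a b X"
proof -
  obtain B where "\<And>s. 0 \<le> s \<Longrightarrow> s \<le> b \<Longrightarrow> expectation (\<lambda>\<omega>. (X s \<omega>)\<^sup>2) \<le> B" using l2_process_bound[OF X] by blast
  then show ?thesis
    using a X by (intro l2_jointI_bounded[where B=B] l2_process_measurable) (auto intro: l2_process_sq_int)
qed

lemma expectation_square_add_le:
  assumes "sq_int X" "sq_int Y"
  shows "expectation (\<lambda>\<omega>. (X \<omega> + Y \<omega>)\<^sup>2) \<le> 2 * expectation (\<lambda>\<omega>. (X \<omega>)\<^sup>2) + 2 * expectation (\<lambda>\<omega>. (Y \<omega>)\<^sup>2)"
proof -
  have "(x + y)\<^sup>2 \<le> 2 * x\<^sup>2 + 2 * y\<^sup>2" for x y :: real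
    using zero_le_power2[of "x - y"] by (simp add: power2_sum power2_diff)
  then have "expectation (\<lambda>\<omega>. (X \<omega> + Y \<omega>)\<^sup>2) \<le> expectation (\<lambda>\<omega>. 2 * (X \<omega>)\<^sup>2 + 2 * (Y \<omega>)\<^sup>2)"
    using sq_int_add[OF assms] assms by (intro integral_mono) (auto simp: sq_int_def)
  also have "\<dots> = 2 * expectation (\<lambda>\<omega>. (X \<omega>)\<^sup>2) + 2 * expectation (\<lambda>\<omega>. (Y \<omega>)\<^sup>2)"
    using assms by (simp add: sq_int_def)
  finally show ?thesis .
qed

lemma l2_process_add:
  assumes X: "l2_process X" and Y: "l2_process Y"
  shows "l2_process (\<lambda>s \<omega>. X s \<omega> + Y s \<omega>)"
  unfolding l2_process_def
proof (intro conjI ballI allI)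
  fix T
  obtain B where B: "\<And>s. 0 \<le> s \<Longrightarrow> s \<le> T \<Longrightarrow> expectation (\<lambda>\<omega>. (X s \<omega>)\<^sup>2) \<le> B" using l2_process_bound[OF X] by blast
  obtain B' where B': "\<And>s. 0 \<le> s \<Longrightarrow> s \<le> T \<Longrightarrow> expectation (\<lambda>\<omega>. (Y s \<omega>)\<^sup>2) \<le> B'" using l2_process_bound[OF Y] by blast
  have "expectation (\<lambda>\<omega>. (X s \<omega> + Y s \<omega>)\<^sup>2) \<le> 2 * B + 2 * B'" if "s \<in> {0..T}" for s
    using expectation_square_add_le[OF l2_process_sq_int[OF X] l2_process_sq_int[OF Y], of s s] B[of s] B'[of s] that by auto
  then show "\<exists>B. \<forall>s\<in>{0..T}. expectation (\<lambda>\<omega>. (X s \<omega> + Y s \<omega>)\<^sup>2) \<le> B" by blast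
qed (auto intro!: continuous_intros sq_int_add l2_process_cont[OF X] l2_process_cont[OF Y] l2_process_sq_int[OF X] l2_process_sq_int[OF Y])

lemma l2_process_mult_fun:
  assumes X: "l2_process X" and f: "continuous_on UNIV f"
  shows "l2_process (\<lambda>s \<omega>. f s * X s \<omega>)"
  unfolding l2_process_def
proof (intro conjI ballI allI)
  fix T
  obtain B where B: "\<And>s. 0 \<le> s \<Longrightarrow> s \<le> T \<Longrightarrow> expectation (\<lambda>\<omega>. (X s \<omega>)\<^sup>2) \<le> B" using l2_process_bound[OF X] by blast
  obtain F where F: "0 \<le> F" "\<And>s. s \<in> {0..T} \<Longrightarrow> \<bar>f s\<bar> \<le> F" using continuous_bound_Icc[OF f] by blast
  have "expectation (\<lambda>\<omega>. (f s * X s \<omega>)\<^sup>2) \<le> F\<^sup>2 * B" if s: "s \<in> {0..T}" for s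
  proof -
    have "(f s)\<^sup>2 \<le> F\<^sup>2" using power_mono[OF F(2)[OF s], of 2] by simp
    moreover have "0 \<le> expectation (\<lambda>\<omega>. (X s \<omega>)\<^sup>2)" by simp
    ultimately show ?thesis using B[of s] s by (simp add: power_mult_distrib mult_mono)
  qed
  then show "\<exists>B. \<forall>s\<in>{0..T}. expectation (\<lambda>\<omega>. (f s * X s \<omega>)\<^sup>2) \<le> B" by blast
qed (auto intro!: continuous_intros sq_int_cmult l2_process_cont[OF X] l2_process_sq_int[OF X] f)

lemma l2_process_const: "sq_int Y \<Longrightarrow> l2_process (\<lambda>_. Y)"
  by (auto simp: l2_process_def)

lemma l2_process_diff: "l2_process X \<Longrightarrow> l2_process Y \<Longrightarrow> l2_process (\<lambda>s \<omega>. X s \<omega> - Y s \<omega>)"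
  using l2_process_add[of X "\<lambda>s \<omega>. -1 * Y s \<omega>"] l2_process_mult_fun[of Y "\<lambda>_. -1"] by simp

lemma l2_process_sum: "(\<And>i. i \<in> I \<Longrightarrow> l2_process (X i)) \<Longrightarrow> l2_process (\<lambda>s \<omega>. \<Sum>i\<in>I. X i s \<omega>)"
  by (induction I rule: infinite_finite_induct) (auto intro: l2_process_add l2_process_const)

lemma l2_process_integral_itv:
  assumes X: "l2_process X"
  shows "\<omega> \<in> space M \<Longrightarrow> integral {a..b} (\<lambda>s. X s \<omega>) = (\<integral>s. X s \<omega> \<partial>itv a b)"
    and "0 \<le> a \<Longrightarrow> a \<le> b \<Longrightarrow> sq_int (\<lambda>\<omega>. integral {a..b} (\<lambda>s. X s \<omega>))"
    and "0 \<le> a \<Longrightarrow> a \<le> b \<Longrightarrow> sq_int Y \<Longrightarrow>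
      expectation (\<lambda>\<omega>. Y \<omega> * integral {a..b} (\<lambda>s. X s \<omega>)) = (\<integral>s. expectation (\<lambda>\<omega>. Y \<omega> * X s \<omega>) \<partial>itv a b)"
    and "0 \<le> a \<Longrightarrow> a \<le> b \<Longrightarrow> (\<And>s. s \<in> {a..b} \<Longrightarrow> expectation (\<lambda>\<omega>. (X s \<omega>)\<^sup>2) \<le> B) \<Longrightarrow>
      expectation (\<lambda>\<omega>. (integral {a..b} (\<lambda>s. X s \<omega>))\<^sup>2) \<le> (b - a)\<^sup>2 * B"
proof -
  have eq: "integral {a..b} (\<lambda>s. X s \<omega>) = (\<integral>s. X s \<omega> \<partial>itv a b)" if "\<omega> \<in> space M" for \<omega>
    using integral_itv_continuous_UNIV(1)[OF l2_process_cont[OF X that]] by simp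
  then show "\<omega> \<in> space M \<Longrightarrow> integral {a..b} (\<lambda>s. X s \<omega>) = (\<integral>s. X s \<omega> \<partial>itv a b)" .
  assume a: "0 \<le> a" and ab: "a \<le> b"
  note j = l2_joint_integral[OF l2_process_joint[OF X a] ab]
  show "sq_int (\<lambda>\<omega>. integral {a..b} (\<lambda>s. X s \<omega>))"
    by (rule sq_int_cong[OF j(5)]) (simp add: eq)
  show "expectation (\<lambda>\<omega>. Y \<omega> * integral {a..b} (\<lambda>s. X s \<omega>)) = (\<integral>s. expectation (\<lambda>\<omega>. Y \<omega> * X s \<omega>) \<partial>itv a b)" if "sq_int Y"
    unfolding j(4)[OF that, symmetric] by (rule Bochner_Integration.integral_cong) (simp_all add: eq)
  show "expectation (\<lambda>\<omega>. (integral {a..b} (\<lambda>s. X s \<omega>))\<^sup>2) \<le> (b - a)\<^sup>2 * B"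
    if "\<And>s. s \<in> {a..b} \<Longrightarrow> expectation (\<lambda>\<omega>. (X s \<omega>)\<^sup>2) \<le> B"
  proof -
    have "expectation (\<lambda>\<omega>. (integral {a..b} (\<lambda>s. X s \<omega>))\<^sup>2) = expectation (\<lambda>\<omega>. (\<integral>s. X s \<omega> \<partial>itv a b)\<^sup>2)"
      by (rule Bochner_Integration.integral_cong) (simp_all add: eq)
    then show ?thesis using l2_joint_integral_bound[OF l2_process_joint[OF X a] ab that] by simp
  qed
qed

lemma l2_process_integral:
  assumes X: "l2_process X"
  shows "l2_process (\<lambda>t \<omega>. integral {0..max 0 t} (\<lambda>s. X s \<omega>))"
  unfolding l2_process_def
proof (intro conjI ballI allI)
  fix T
  obtain B where B: "\<And>s. 0 \<le> s \<Longrightarrow> s \<le> T \<Longrightarrow> expectation (\<lambda>\<omega>. (X s \<omega>)\<^sup>2) \<le> B" using l2_process_bound[OF X] by blast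
  have "expectation (\<lambda>\<omega>. (integral {0..max 0 t} (\<lambda>s. X s \<omega>))\<^sup>2) \<le> T\<^sup>2 * B" if t: "t \<in> {0..T}" for t
  proof -
    have "0 \<le> expectation (\<lambda>\<omega>. (X t \<omega>)\<^sup>2)" by simp
    then have B0: "0 \<le> B" using B[of t] t by (meson atLeastAtMost_iff order_trans)
    have "expectation (\<lambda>\<omega>. (integral {0..t} (\<lambda>s. X s \<omega>))\<^sup>2) \<le> (t - 0)\<^sup>2 * B"
      by (rule l2_process_integral_itv(4)[OF X]) (use B t in auto)
    also have "\<dots> \<le> T\<^sup>2 * B" using t B0 by (intro mult_right_mono power_mono) auto
    finally show ?thesis using t by (simp add: max_def)
  qed
  then show "\<exists>B. \<forall>s\<in>{0..T}. expectation (\<lambda>\<omega>. (integral {0..max 0 s} (\<lambda>s. X s \<omega>))\<^sup>2) \<le> B" by blast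
qed (auto intro!: continuous_integral_max l2_process_cont[OF X] l2_process_integral_itv(2)[OF X])

end

context wiener_space
begin

text \<open>The component of \<open>w\<close> in direction \<open>v\<close>, held at its initial
  value for negative times so that its paths are continuous on the whole line.\<close>

definition W :: "real^'q \<Rightarrow> real \<Rightarrow> 'a \<Rightarrow> real" where
  "W v s \<omega> = v \<bullet> w (max 0 s) \<omega>"

lemma W_cov: "0 \<le> s \<Longrightarrow> 0 \<le> t \<Longrightarrow> expectation (\<lambda>\<omega>. W u s \<omega> * W v t \<omega>) = (u \<bullet> v) * min s t"
  unfolding W_def by (subst inner_w_cov) auto

lemma sq_int_W: "sq_int (W v s)"
  unfolding W_def by (rule sq_int_inner_w) simp

lemma gauss_W: "gauss (W v s)"
  unfolding W_def by (rule gauss_lin_w[OF lin_w_inner]) simp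

lemma l2_process_W: "l2_process (W v)"
  unfolding l2_process_def
proof (intro conjI ballI allI)
  fix \<omega> assume \<omega>: "\<omega> \<in> space M"
  have "continuous_on UNIV (\<lambda>s. w (max 0 s) \<omega>)"
    by (rule continuous_on_compose2[OF w_continuous[OF \<omega>]]) (auto intro!: continuous_intros)
  then show "continuous_on UNIV (\<lambda>s. W v s \<omega>)" unfolding W_def by (intro continuous_intros)
next
  fix T
  have "expectation (\<lambda>\<omega>. (W v s \<omega>)\<^sup>2) \<le> (v \<bullet> v) * T" if "s \<in> {0..T}" for s
    using W_cov[of s s v v] that by (simp add: power2_eq_square mult_left_mono)
  then show "\<exists>B. \<forall>s\<in>{0..T}. expectation (\<lambda>\<omega>. (W v s \<omega>)\<^sup>2) \<le> B" by blast
qed (rule sq_int_W)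

text \<open>Left-endpoint sums belong to \<open>lin_w\<close> and converge: an increment over a cell
  of length \<open>h\<close> has L2 norm at most \<open>norm v * sqrt h\<close>, so the total error
  is of order \<open>sqrt h\<close>.\<close>

lemma gauss_integral_W:
  assumes f: "continuous_on UNIV f" and t: "0 \<le> t"
  shows "gauss (\<lambda>\<omega>. integral {0..t} (\<lambda>s. f s * W v s \<omega>))"
proof -
  have p: "l2_process (\<lambda>s \<omega>. f s * W v s \<omega>)" by (rule l2_process_mult_fun[OF l2_process_W f])
  obtain F where F0: "0 \<le> F" and F: "\<And>s. s \<in> {0..t} \<Longrightarrow> \<bar>f s\<bar> \<le> F" using continuous_bound_Icc[OF f] by blast
  show ?thesis
    unfolding gauss_def
  proof (intro conjI allI impI)
    show "sq_int (\<lambda>\<omega>. integral {0..t} (\<lambda>s. f s * W v s \<omega>))" by (rule l2_process_integral_itv(2)[OF p]) (use t in auto)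
    fix r :: real assume r: "0 < r"
    \<comment> \<open>The total error bound of the approximation with \<open>Suc n\<close> cells;
      \<open>n0\<close> is chosen to push it below \<open>r\<close>.\<close>
    have "(\<lambda>n. t * (F * norm v * sqrt (t / real (Suc n)))) \<longlonglongrightarrow> t * (F * norm v * sqrt 0)"
      by (intro tendsto_intros tendsto_real_sqrt LIMSEQ_Suc[OF lim_const_over_n])
    then have "\<forall>\<^sub>F n in sequentially. t * (F * norm v * sqrt (t / real (Suc n))) < r"
      using r by (auto dest: order_tendstoD(2))
    then obtain n0 where n0: "t * (F * norm v * sqrt (t / real (Suc n0))) < r" by (meson eventually_sequentially order_refl)
    define n where "n = Suc n0"
    define h where "h = t / real n"
    have h: "0 \<le> h" "real n * h = t" using t by (simp_all add: h_def n_def)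
    let ?t = "\<lambda>j. real j * h"
    define D where "D j \<omega> = integral {?t j..?t (Suc j)} (\<lambda>s. f s * (W v s \<omega> - W v (?t j) \<omega>))" for j \<omega>
    \<comment> \<open>The weights are the exact integrals of \<open>f\<close> over the cells. The
      error then comes from the increments of \<open>W\<close> alone, and the modulus of continuity
      of \<open>f\<close> does not enter.\<close>
    define X' where "X' \<omega> = (\<Sum>j<n. integral {?t j..?t (Suc j)} f * W v (?t j) \<omega>)" for \<omega>
    have X': "X' \<in> lin_w"
      unfolding X'_def W_def by (intro lin_w_sum lin_w_cmult lin_w_inner) simp
    have tj: "0 \<le> ?t j" "?t j \<le> ?t (Suc j)" "?t (Suc j) - ?t j = h" for j using h(1) by (simp_all add: algebra_simps)
    have tt: "?t (Suc j) \<le> t" if "j < n" for j using that h mult_right_mono[of "real (Suc j)" "real n" h] by simp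
    have pj: "l2_process (\<lambda>s \<omega>. f s * (W v s \<omega> - W v (?t j) \<omega>))" for j
      by (intro l2_process_mult_fun f l2_process_diff l2_process_W l2_process_const sq_int_W)
    have eq: "integral {0..t} (\<lambda>s. f s * W v s \<omega>) - X' \<omega> = (\<Sum>j<n. D j \<omega>)" if \<omega>: "\<omega> \<in> space M" for \<omega>
    proof -
      have Wc: "continuous_on UNIV (\<lambda>s. W v s \<omega>)" by (rule l2_process_cont[OF l2_process_W \<omega>])
      have "integral {0..t} (\<lambda>s. f s * W v s \<omega>) = (\<Sum>j<n. integral {?t j..?t (Suc j)} (\<lambda>s. f s * W v s \<omega>))"
        using integral_grid[OF l2_process_cont[OF p \<omega>] h(1), of n] h(2) by simp
      moreover have "D j \<omega> = integral {?t j..?t (Suc j)} (\<lambda>s. f s * W v s \<omega>) - integral {?t j..?t (Suc j)} f * W v (?t j) \<omega>" for j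
      proof -
        have "D j \<omega> = integral {?t j..?t (Suc j)} (\<lambda>s. f s * W v s \<omega> - f s * W v (?t j) \<omega>)"
          unfolding D_def by (simp add: right_diff_distrib)
        also have "\<dots> = integral {?t j..?t (Suc j)} (\<lambda>s. f s * W v s \<omega>) - integral {?t j..?t (Suc j)} (\<lambda>s. f s * W v (?t j) \<omega>)"
          by (rule Henstock_Kurzweil_Integration.integral_diff) (intro integral_itv_continuous_UNIV continuous_intros f Wc)+
        finally show ?thesis by simp
      qed
      ultimately show ?thesis unfolding X'_def by (simp add: sum_subtractf)
    qed
    have Dsq: "sq_int (D j)" for j
      unfolding D_def by (rule l2_process_integral_itv(2)[OF pj tj(1,2)])
    have "n2 (D j) \<le> F * norm v * (h * sqrt h)" if j: "j < n" for j
    proof -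
      have "expectation (\<lambda>\<omega>. (f s * (W v s \<omega> - W v (?t j) \<omega>))\<^sup>2) \<le> F\<^sup>2 * ((norm v)\<^sup>2 * h)" if s: "s \<in> {?t j..?t (Suc j)}" for s
      proof -
        have s': "0 \<le> s" "s \<le> t" "?t j \<le> s" using s tj(1)[of j] tt[OF j] by auto
        note i = integrable_mult_sq_int[OF sq_int_W sq_int_W]
        have "expectation (\<lambda>\<omega>. (W v s \<omega> - W v (?t j) \<omega>)\<^sup>2)
          = expectation (\<lambda>\<omega>. W v s \<omega> * W v s \<omega> - 2 * (W v s \<omega> * W v (?t j) \<omega>) + W v (?t j) \<omega> * W v (?t j) \<omega>)"
          by (rule Bochner_Integration.integral_cong) (simp_all add: power2_eq_square algebra_simps)
        also have "\<dots> = (norm v)\<^sup>2 * (s - ?t j)"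
          using i W_cov[OF s'(1) s'(1), of v v] W_cov[OF s'(1) tj(1)[of j], of v v] W_cov[OF tj(1)[of j] tj(1)[of j], of v v] s'(3)
          by (simp add: power2_norm_eq_inner algebra_simps)
        also have "\<dots> \<le> (norm v)\<^sup>2 * h" using s tj(3)[of j] by (intro mult_left_mono) auto
        finally have 1: "expectation (\<lambda>\<omega>. (W v s \<omega> - W v (?t j) \<omega>)\<^sup>2) \<le> (norm v)\<^sup>2 * h" .
        have "(f s)\<^sup>2 \<le> F\<^sup>2" using power_mono[OF F[of s], of 2] s' by simp
        then show ?thesis using 1 h(1) by (simp add: power_mult_distrib mult_mono)
      qed
      then have "expectation (\<lambda>\<omega>. (D j \<omega>)\<^sup>2) \<le> (?t (Suc j) - ?t j)\<^sup>2 * (F\<^sup>2 * ((norm v)\<^sup>2 * h))"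
        unfolding D_def by (intro l2_process_integral_itv(4)[OF pj tj(1,2)])
      also have "\<dots> = (F * norm v * h)\<^sup>2 * h" unfolding tj(3) by (simp add: power2_eq_square)
      finally have "n2 (D j) \<le> sqrt ((F * norm v * h)\<^sup>2 * h)" by (rule n2_le_sqrt)
      also have "\<dots> = F * norm v * (h * sqrt h)" using F0 h(1) by (simp add: real_sqrt_mult)
      finally show ?thesis .
    qed
    then have "(\<Sum>j<n. n2 (D j)) \<le> (\<Sum>j<n. F * norm v * (h * sqrt h))" by (intro sum_mono) simp
    also have "\<dots> = (real n * h) * (F * norm v * sqrt h)" by simp
    also have "\<dots> \<le> r" using n0 unfolding h(2) by (simp add: h_def n_def)
    finally have "n2 (\<lambda>\<omega>. \<Sum>j<n. D j \<omega>) \<le> r"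
      using n2_sum[of "{..<n}" D] Dsq by simp
    then have "n2 (\<lambda>\<omega>. integral {0..t} (\<lambda>s. f s * W v s \<omega>) - X' \<omega>) \<le> r"
      using n2_cong[of "\<lambda>\<omega>. integral {0..t} (\<lambda>s. f s * W v s \<omega>) - X' \<omega>" "\<lambda>\<omega>. \<Sum>j<n. D j \<omega>"] eq by simp
    then show "\<exists>X'\<in>lin_w. n2 (\<lambda>\<omega>. integral {0..t} (\<lambda>s. f s * W v s \<omega>) - X' \<omega>) \<le> r" using X' by (rule bexI)
  qed
qed

lemma W_integral_cov:
  assumes f: "continuous_on UNIV f" and t: "0 \<le> t" and s: "0 \<le> s"
  shows "expectation (\<lambda>\<omega>. W u s \<omega> * integral {0..t} (\<lambda>r. f r * W v r \<omega>)) = (u \<bullet> v) * integral {0..t} (\<lambda>r. f r * min s r)"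
proof -
  have p: "l2_process (\<lambda>s \<omega>. f s * W v s \<omega>)" by (rule l2_process_mult_fun[OF l2_process_W f])
  have "expectation (\<lambda>\<omega>. W u s \<omega> * integral {0..t} (\<lambda>r. f r * W v r \<omega>)) = (\<integral>r. expectation (\<lambda>\<omega>. W u s \<omega> * (f r * W v r \<omega>)) \<partial>itv 0 t)"
    by (rule l2_process_integral_itv(3)[OF p order_refl t sq_int_W])
  also have "\<dots> = (\<integral>r. (u \<bullet> v) * (f r * min s r) \<partial>itv 0 t)"
  proof (rule integral_cong_AE)
    have fm: "f \<in> borel_measurable borel" using f by (rule borel_measurable_continuous_onI)
    then show "(\<lambda>r. (u \<bullet> v) * (f r * min s r)) \<in> borel_measurable (itv 0 t)" by simp
    show "(\<lambda>r. expectation (\<lambda>\<omega>. W u s \<omega> * (f r * W v r \<omega>))) \<in> borel_measurable (itv 0 t)"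
      using l2_joint_integral(3)[OF l2_process_joint[OF p order_refl] t sq_int_W] by (rule borel_measurable_integrable)
    show "AE r in itv 0 t. expectation (\<lambda>\<omega>. W u s \<omega> * (f r * W v r \<omega>)) = (u \<bullet> v) * (f r * min s r)"
    proof (rule AE_itvI)
      fix r assume "r \<in> {0..t}"
      then have "expectation (\<lambda>\<omega>. f r * (W u s \<omega> * W v r \<omega>)) = f r * ((u \<bullet> v) * min s r)"
        using W_cov[OF s, of r u v] by simp
      then show "expectation (\<lambda>\<omega>. W u s \<omega> * (f r * W v r \<omega>)) = (u \<bullet> v) * (f r * min s r)" by (simp add: ac_simps)
    qed
  qed
  also have "\<dots> = (u \<bullet> v) * integral {0..t} (\<lambda>r. f r * min s r)"
    by (subst integral_itv_continuous_UNIV) (auto intro!: continuous_intros f)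
  finally show ?thesis .
qed

end

section \<open>The scalar filter\<close>

text \<open>One coordinate of the Kalman--Bucy filter for \<open>A = 0\<close>: the state is the Wiener process \<open>W a\<close>, the integrated
  observation is \<open>l \<integral> W a ds + W b\<close>; the variance \<open>tanh (l t) / l\<close> solves \<open>p' = 1 - l\<^sup>2 p\<^sup>2\<close>.\<close>

context wiener_space
begin

definition obs :: "real \<Rightarrow> real^'q \<Rightarrow> real^'q \<Rightarrow> real \<Rightarrow> 'a \<Rightarrow> real" where
  "obs l a b t \<omega> = l * integral {0..max 0 t} (\<lambda>s. W a s \<omega>) + W b t \<omega>"

text \<open>The filter \<open>d est = tanh (l t) (d obs - l est dt)\<close>, whose gain is
  \<open>l\<close> times the variance, solved with the integrating factor \<open>cosh (l t)\<close>.
  The stochastic integral of \<open>sinh (l s)\<close> against \<open>obs\<close> has been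
  integrated by parts, so the formula is pathwise.\<close>

definition est :: "real \<Rightarrow> real^'q \<Rightarrow> real^'q \<Rightarrow> real \<Rightarrow> 'a \<Rightarrow> real" where
  "est l a b t \<omega> = tanh (l * t) * obs l a b t \<omega> - l / cosh (l * t) * integral {0..max 0 t} (\<lambda>s. cosh (l * s) * obs l a b s \<omega>)"

definition err :: "real \<Rightarrow> real^'q \<Rightarrow> real^'q \<Rightarrow> real \<Rightarrow> 'a \<Rightarrow> real" where
  "err l a b t \<omega> = W a t \<omega> - est l a b t \<omega>"

lemma l2_process_obs: "l2_process (obs l a b)"
  unfolding obs_def by (intro l2_process_add l2_process_mult_fun l2_process_integral l2_process_W continuous_intros)

lemma cosh_pos_nonzero [simp]: "cosh x \<noteq> (0::real)"
  using cosh_real_pos[of x] by simp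

lemma l2_process_est: "l2_process (est l a b)"
  unfolding est_def
  by (intro l2_process_diff l2_process_mult_fun l2_process_integral l2_process_obs continuous_intros) auto

lemma l2_process_err: "l2_process (err l a b)"
  unfolding err_def by (intro l2_process_diff l2_process_W l2_process_est)

text \<open>Inserting \<open>obs\<close> into \<open>est\<close> produces a double integral of
  \<open>W a\<close>. One more integration by parts leaves single integrals of Wiener components, to
  which \<open>gauss_integral_W\<close> and \<open>W_integral_cov\<close> apply.\<close>

lemma cosh_err:
  assumes \<omega>: "\<omega> \<in> space M" and t: "0 \<le> t"
  shows "cosh (l * t) * err l a b t \<omega> =
    cosh (l * t) * W a t \<omega> - l * integral {0..t} (\<lambda>s. sinh (l * s) * W a s \<omega>)
    - sinh (l * t) * W b t \<omega> + l * integral {0..t} (\<lambda>s. cosh (l * s) * W b s \<omega>)"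
proof -
  have ca: "continuous_on UNIV (\<lambda>s. W a s \<omega>)" and cb: "continuous_on UNIV (\<lambda>s. W b s \<omega>)"
    by (rule l2_process_cont[OF l2_process_W \<omega>])+
  let ?I = "\<lambda>t. integral {0..t} (\<lambda>s. W a s \<omega>)"
  have cI: "continuous_on UNIV (\<lambda>t. integral {0..max 0 t} (\<lambda>s. W a s \<omega>))" by (rule continuous_integral_max[OF ca])
  \<comment> \<open>The primitive that removes the double integral; \<open>max 0 s\<close> appears
    because \<open>obs\<close> is written that way, and equals \<open>s\<close> here.\<close>
  have d: "((\<lambda>t. l * sinh (l * t) * ?I t) has_real_derivative
      (l\<^sup>2 * (cosh (l * s) * integral {0..max 0 s} (\<lambda>s. W a s \<omega>)) + l * (sinh (l * s) * W a s \<omega>))) (at s within {0..t})"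
    if s: "s \<in> {0..t}" for s
  proof -
    have "(?I has_real_derivative W a s \<omega>) (at s within {0..t})"
      by (rule DERIV_subset[OF integral_has_derivative_continuous[OF ca]]) (use s in auto)
    then show ?thesis
      using s by (auto intro!: derivative_eq_intros simp: max_def power2_eq_square algebra_simps)
  qed
  have "((\<lambda>s. l\<^sup>2 * (cosh (l * s) * integral {0..max 0 s} (\<lambda>s. W a s \<omega>)) + l * (sinh (l * s) * W a s \<omega>))
    has_integral (l * sinh (l * t) * ?I t - l * sinh (l * 0) * ?I 0)) {0..t}"
    by (rule fundamental_theorem_of_calculus)
       (use t d in \<open>auto simp: has_real_derivative_iff_has_vector_derivative[symmetric]\<close>)
  then have "l * sinh (l * t) * ?I t = integral {0..t} (\<lambda>s. l\<^sup>2 * (cosh (l * s) * integral {0..max 0 s} (\<lambda>s. W a s \<omega>)) + l * (sinh (l * s) * W a s \<omega>))"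
    by (simp add: integral_unique)
  also have "\<dots> = l\<^sup>2 * integral {0..t} (\<lambda>s. cosh (l * s) * integral {0..max 0 s} (\<lambda>s. W a s \<omega>)) + l * integral {0..t} (\<lambda>s. sinh (l * s) * W a s \<omega>)"
    by (subst Henstock_Kurzweil_Integration.integral_add)
       (auto intro!: integral_itv_continuous_UNIV(3) continuous_intros cI ca)
  finally have 1: "l * sinh (l * t) * ?I t = \<dots>" .
  have 2: "integral {0..t} (\<lambda>s. cosh (l * s) * obs l a b s \<omega>)
    = l * integral {0..t} (\<lambda>s. cosh (l * s) * integral {0..max 0 s} (\<lambda>s. W a s \<omega>)) + integral {0..t} (\<lambda>s. cosh (l * s) * W b s \<omega>)"
  proof -
    have "integral {0..t} (\<lambda>s. cosh (l * s) * obs l a b s \<omega>)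
      = integral {0..t} (\<lambda>s. l * (cosh (l * s) * integral {0..max 0 s} (\<lambda>s. W a s \<omega>)) + cosh (l * s) * W b s \<omega>)"
      unfolding obs_def by (simp add: algebra_simps)
    also have "\<dots> = l * integral {0..t} (\<lambda>s. cosh (l * s) * integral {0..max 0 s} (\<lambda>s. W a s \<omega>)) + integral {0..t} (\<lambda>s. cosh (l * s) * W b s \<omega>)"
      by (subst Henstock_Kurzweil_Integration.integral_add)
         (auto intro!: integral_itv_continuous_UNIV(3) continuous_intros cI cb)
    finally show ?thesis .
  qed
  have "cosh (l * t) * est l a b t \<omega> = sinh (l * t) * obs l a b t \<omega> - l * integral {0..t} (\<lambda>s. cosh (l * s) * obs l a b s \<omega>)"
    using t by (simp add: est_def right_diff_distrib tanh_def max_absorb2)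
  also have "\<dots> = l * sinh (l * t) * ?I t + sinh (l * t) * W b t \<omega> - l * integral {0..t} (\<lambda>s. cosh (l * s) * obs l a b s \<omega>)"
    using t by (simp add: obs_def algebra_simps max_absorb2)
  also have "\<dots> = l * integral {0..t} (\<lambda>s. sinh (l * s) * W a s \<omega>) + sinh (l * t) * W b t \<omega> - l * integral {0..t} (\<lambda>s. cosh (l * s) * W b s \<omega>)"
    unfolding 1 2 by (simp add: power2_eq_square algebra_simps)
  finally show ?thesis by (simp add: err_def right_diff_distrib)
qed

lemma gauss_obs: "0 \<le> t \<Longrightarrow> gauss (obs l a b t)"
proof -
  assume t: "0 \<le> t"
  have "gauss (\<lambda>\<omega>. integral {0..t} (\<lambda>s. 1 * W a s \<omega>))" by (rule gauss_integral_W[OF continuous_on_const t])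
  then show ?thesis using t unfolding obs_def by (auto intro!: gauss_add gauss_cmult gauss_W simp: max_absorb2)
qed

lemma gauss_err: "0 \<le> t \<Longrightarrow> gauss (err l a b t)"
proof -
  assume t: "0 \<le> t"
  have "gauss (\<lambda>\<omega>. (1 / cosh (l * t)) * (cosh (l * t) * W a t \<omega> - l * integral {0..t} (\<lambda>s. sinh (l * s) * W a s \<omega>)
    - sinh (l * t) * W b t \<omega> + l * integral {0..t} (\<lambda>s. cosh (l * s) * W b s \<omega>)))"
    by (intro gauss_cmult gauss_add gauss_diff gauss_W gauss_integral_W t continuous_intros)
  then show ?thesis
  proof (rule gauss_cong)
    fix \<omega> assume "\<omega> \<in> space M"
    from cosh_err[OF this t, of l a b, symmetric] show "(1 / cosh (l * t)) * (cosh (l * t) * W a t \<omega> - l * integral {0..t} (\<lambda>s. sinh (l * s) * W a s \<omega>)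
      - sinh (l * t) * W b t \<omega> + l * integral {0..t} (\<lambda>s. cosh (l * s) * W b s \<omega>)) = err l a b t \<omega>" by simp
  qed
qed

text \<open>The factor \<open>min s r\<close> is the Wiener covariance. Up to \<open>s\<close> it
  equals \<open>r\<close> and the primitive is \<open>F r * r - G r\<close>; after \<open>s\<close>
  it is constant.\<close>

lemma integral_min_split:
  fixes f F G :: "real \<Rightarrow> real"
  assumes f: "continuous_on UNIV f" and F: "\<And>r. (F has_real_derivative f r) (at r)" and G: "\<And>r. (G has_real_derivative F r) (at r)"
    and s: "0 \<le> s" "s \<le> t"
  shows "integral {0..t} (\<lambda>r. f r * min s r) = s * F t - G s + G 0"
proof -
  have c: "continuous_on UNIV (\<lambda>r. f r * min s r)" by (intro continuous_intros f)
  have 1: "((\<lambda>r. f r * min s r) has_integral (F s * s - G s) - (F 0 * 0 - G 0)) {0..s}"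
  proof (rule fundamental_theorem_of_calculus[OF s(1)])
    fix r assume r: "r \<in> {0..s}"
    have "((\<lambda>r. F r * r - G r) has_real_derivative f r * min s r) (at r)"
      using r by (auto intro!: derivative_eq_intros F G)
    then show "((\<lambda>r. F r * r - G r) has_vector_derivative f r * min s r) (at r within {0..s})"
      by (simp add: has_real_derivative_iff_has_vector_derivative has_vector_derivative_at_within)
  qed
  have 2: "((\<lambda>r. f r * min s r) has_integral F t * s - F s * s) {s..t}"
  proof (rule fundamental_theorem_of_calculus[OF s(2)])
    fix r assume r: "r \<in> {s..t}"
    have "((\<lambda>r. F r * s) has_real_derivative f r * min s r) (at r)"
      using r by (auto intro!: derivative_eq_intros F)
    then show "((\<lambda>r. F r * s) has_vector_derivative f r * min s r) (at r within {s..t})"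
      by (simp add: has_real_derivative_iff_has_vector_derivative has_vector_derivative_at_within)
  qed
  have "integral {0..t} (\<lambda>r. f r * min s r) = integral {0..s} (\<lambda>r. f r * min s r) + integral {s..t} (\<lambda>r. f r * min s r)"
    by (rule Henstock_Kurzweil_Integration.integral_combine[symmetric, OF s]) (rule integral_itv_continuous_UNIV(3)[OF c])
  also have "\<dots> = s * F t - G s + G 0"
    using integral_unique[OF 1] integral_unique[OF 2] by (simp add: algebra_simps)
  finally show ?thesis .
qed

text \<open>The closed form behind all later covariances of the error. The terms linear in
  \<open>s\<close> cancel between the pointwise and the integrated parts of \<open>cosh_err\<close>,
  leaving the response to the noise up to time \<open>s\<close>.\<close>

lemma err_W_cov:
  assumes l: "0 < l" and s: "0 \<le> s" "s \<le> t"
  shows "expectation (\<lambda>\<omega>. err l a b t \<omega> * W v s \<omega>) = ((a \<bullet> v) * sinh (l * s) - (b \<bullet> v) * (cosh (l * s) - 1)) / (l * cosh (l * t))"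
proof -
  have t: "0 \<le> t" using s by simp
  have i1: "integral {0..t} (\<lambda>r. sinh (l * r) * min s r) = s * (cosh (l * t) / l) - sinh (l * s) / l\<^sup>2 + sinh (l * 0) / l\<^sup>2"
    by (rule integral_min_split) (use l s in \<open>auto intro!: continuous_intros derivative_eq_intros simp: field_simps power2_eq_square\<close>)
  have i2: "integral {0..t} (\<lambda>r. cosh (l * r) * min s r) = s * (sinh (l * t) / l) - cosh (l * s) / l\<^sup>2 + cosh (l * 0) / l\<^sup>2"
    by (rule integral_min_split) (use l s in \<open>auto intro!: continuous_intros derivative_eq_intros simp: field_simps power2_eq_square\<close>)
  have cs: "continuous_on UNIV (\<lambda>r. sinh (l * r))" and cc: "continuous_on UNIV (\<lambda>r. cosh (l * r))"
    by (intro continuous_intros)+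
  let ?Ia = "\<lambda>\<omega>. integral {0..t} (\<lambda>r. sinh (l * r) * W a r \<omega>)" and ?Ib = "\<lambda>\<omega>. integral {0..t} (\<lambda>r. cosh (l * r) * W b r \<omega>)"
  have sI: "sq_int ?Ia" "sq_int ?Ib"
    using gauss_sq_int[OF gauss_integral_W[OF cs t]] gauss_sq_int[OF gauss_integral_W[OF cc t]] by auto
  note i = integrable_mult_sq_int[OF sq_int_W[of v s]]
  have "cosh (l * t) * expectation (\<lambda>\<omega>. err l a b t \<omega> * W v s \<omega>) = expectation (\<lambda>\<omega>. W v s \<omega> * (cosh (l * t) * err l a b t \<omega>))"
    by (simp add: ac_simps)
  also have "\<dots> = expectation (\<lambda>\<omega>. cosh (l * t) * (W v s \<omega> * W a t \<omega>) - l * (W v s \<omega> * ?Ia \<omega>)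
    - sinh (l * t) * (W v s \<omega> * W b t \<omega>) + l * (W v s \<omega> * ?Ib \<omega>))"
    by (rule Bochner_Integration.integral_cong[OF refl]) (simp only: cosh_err[OF _ t], simp add: algebra_simps)
  also have "\<dots> = cosh (l * t) * ((v \<bullet> a) * s) - l * ((v \<bullet> a) * integral {0..t} (\<lambda>r. sinh (l * r) * min s r))
    - sinh (l * t) * ((v \<bullet> b) * s) + l * ((v \<bullet> b) * integral {0..t} (\<lambda>r. cosh (l * r) * min s r))"
    using i[OF sq_int_W] i[OF sI(1)] i[OF sI(2)] W_cov[OF s(1) t, of v] W_integral_cov[OF cs t s(1), of v a] W_integral_cov[OF cc t s(1), of v b] s(2)
    by simp
  also have "\<dots> = ((v \<bullet> a) * sinh (l * s) - (v \<bullet> b) * (cosh (l * s) - 1)) / l"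
    unfolding i1 i2 using l by (simp add: field_simps power2_eq_square)
  finally have "cosh (l * t) * expectation (\<lambda>\<omega>. err l a b t \<omega> * W v s \<omega>) = ((a \<bullet> v) * sinh (l * s) - (b \<bullet> v) * (cosh (l * s) - 1)) / l"
    by (simp add: inner_commute)
  then show ?thesis using l by (simp add: field_simps)
qed

text \<open>The alternative in the hypotheses covers one channel against itself and two different
  channels at once. In the first case the contributions of the integrated state and of the
  measurement noise cancel; in the second both vanish.\<close>

lemma err_obs_orth:
  assumes l: "0 < l" and s: "0 \<le> s" "s \<le> t"
    and ab: "(a = a' \<and> b = b' \<and> l = l' \<and> a \<bullet> a = 1 \<and> b \<bullet> b = 1) \<or> (a \<bullet> a' = 0 \<and> b \<bullet> b' = 0)" "b \<bullet> a' = 0" "a \<bullet> b' = 0"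
  shows "expectation (\<lambda>\<omega>. err l a b t \<omega> * obs l' a' b' s \<omega>) = 0"
proof -
  have e: "sq_int (err l a b t)" by (rule l2_process_sq_int[OF l2_process_err])
  have "expectation (\<lambda>\<omega>. err l a b t \<omega> * integral {0..s} (\<lambda>r. W a' r \<omega>)) = (\<integral>r. expectation (\<lambda>\<omega>. err l a b t \<omega> * W a' r \<omega>) \<partial>itv 0 s)"
    by (rule l2_process_integral_itv(3)[OF l2_process_W order_refl s(1) e])
  also have "\<dots> = (\<integral>r. (a \<bullet> a') / (l * cosh (l * t)) * sinh (l * r) \<partial>itv 0 s)"
  proof (rule integral_cong_AE)
    show "(\<lambda>r. expectation (\<lambda>\<omega>. err l a b t \<omega> * W a' r \<omega>)) \<in> borel_measurable (itv 0 s)"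
      using l2_joint_integral(3)[OF l2_process_joint[OF l2_process_W order_refl] s(1) e] by (rule borel_measurable_integrable)
    show "(\<lambda>r. (a \<bullet> a') / (l * cosh (l * t)) * sinh (l * r)) \<in> borel_measurable (itv 0 s)"
      unfolding measurable_cong_sets[OF sets_itv refl] by (intro borel_measurable_continuous_onI continuous_intros)
    show "AE r in itv 0 s. expectation (\<lambda>\<omega>. err l a b t \<omega> * W a' r \<omega>) = (a \<bullet> a') / (l * cosh (l * t)) * sinh (l * r)"
      by (rule AE_itvI) (use err_W_cov[OF l, of _ t a b a'] s ab(2) in simp)
  qed
  also have "\<dots> = integral {0..s} (\<lambda>r. (a \<bullet> a') / (l * cosh (l * t)) * sinh (l * r))"
    by (rule integral_itv_continuous_UNIV) (intro continuous_intros)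
  also have "\<dots> = (a \<bullet> a') / (l * cosh (l * t)) * (cosh (l * s) - 1) / l"
  proof -
    have "((\<lambda>r. (a \<bullet> a') / (l * cosh (l * t)) * sinh (l * r)) has_integral
      ((a \<bullet> a') / (l * cosh (l * t)) * (cosh (l * s) / l) - (a \<bullet> a') / (l * cosh (l * t)) * (cosh (l * 0) / l))) {0..s}"
    proof (rule fundamental_theorem_of_calculus[OF s(1)])
      fix r
      have "((\<lambda>r. (a \<bullet> a') / (l * cosh (l * t)) * (cosh (l * r) / l)) has_real_derivative (a \<bullet> a') / (l * cosh (l * t)) * sinh (l * r)) (at r)"
        using l by (intro DERIV_cmult) (auto intro!: derivative_eq_intros)
      then show "((\<lambda>r. (a \<bullet> a') / (l * cosh (l * t)) * (cosh (l * r) / l)) has_vector_derivative (a \<bullet> a') / (l * cosh (l * t)) * sinh (l * r)) (at r within {0..s})"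
        by (simp add: has_real_derivative_iff_has_vector_derivative has_vector_derivative_at_within)
    qed
    from integral_unique[OF this] show ?thesis by (simp add: algebra_simps diff_divide_distrib)
  qed
  finally have 1: "expectation (\<lambda>\<omega>. err l a b t \<omega> * integral {0..s} (\<lambda>r. W a' r \<omega>)) = (a \<bullet> a') / (l * cosh (l * t)) * (cosh (l * s) - 1) / l" .
  have 2: "expectation (\<lambda>\<omega>. err l a b t \<omega> * W b' s \<omega>) = - ((b \<bullet> b') * (cosh (l * s) - 1)) / (l * cosh (l * t))"
    using err_W_cov[OF l s, of a b b'] ab(3) by simp
  have sI: "sq_int (\<lambda>\<omega>. integral {0..s} (\<lambda>r. W a' r \<omega>))"
    by (rule l2_process_integral_itv(2)[OF l2_process_W order_refl s(1)])
  have "expectation (\<lambda>\<omega>. err l a b t \<omega> * obs l' a' b' s \<omega>)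
    = expectation (\<lambda>\<omega>. l' * (err l a b t \<omega> * integral {0..s} (\<lambda>r. W a' r \<omega>)) + err l a b t \<omega> * W b' s \<omega>)"
    using s(1) by (simp add: obs_def max_absorb2 algebra_simps)
  also have "\<dots> = l' * ((a \<bullet> a') / (l * cosh (l * t)) * (cosh (l * s) - 1) / l) + - ((b \<bullet> b') * (cosh (l * s) - 1)) / (l * cosh (l * t))"
    using integrable_mult_sq_int[OF e sI] integrable_mult_sq_int[OF e sq_int_W] 1 2 by simp
  also have "\<dots> = 0" using ab(1) l by auto
  finally show ?thesis .
qed

lemma err_est_orth:
  assumes l: "0 < l" and t: "0 \<le> t"
    and ab: "(a = a' \<and> b = b' \<and> l = l' \<and> a \<bullet> a = 1 \<and> b \<bullet> b = 1) \<or> (a \<bullet> a' = 0 \<and> b \<bullet> b' = 0)" "b \<bullet> a' = 0" "a \<bullet> b' = 0"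
  shows "expectation (\<lambda>\<omega>. err l a b t \<omega> * est l' a' b' t \<omega>) = 0"
proof -
  have e: "sq_int (err l a b t)" by (rule l2_process_sq_int[OF l2_process_err])
  have p: "l2_process (\<lambda>s \<omega>. cosh (l' * s) * obs l' a' b' s \<omega>)"
    by (intro l2_process_mult_fun l2_process_obs continuous_intros)
  have "expectation (\<lambda>\<omega>. err l a b t \<omega> * integral {0..t} (\<lambda>s. cosh (l' * s) * obs l' a' b' s \<omega>))
     = (\<integral>s. expectation (\<lambda>\<omega>. err l a b t \<omega> * (cosh (l' * s) * obs l' a' b' s \<omega>)) \<partial>itv 0 t)"
    by (rule l2_process_integral_itv(3)[OF p order_refl t e])
  also have "\<dots> = 0"
  proof (rule integral_eq_zero_AE, rule AE_itvI)
    fix s assume "s \<in> {0..t}"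
    then have "expectation (\<lambda>\<omega>. cosh (l' * s) * (err l a b t \<omega> * obs l' a' b' s \<omega>)) = 0"
      using err_obs_orth[OF l _ _ ab, of s t] by simp
    then show "expectation (\<lambda>\<omega>. err l a b t \<omega> * (cosh (l' * s) * obs l' a' b' s \<omega>)) = 0" by (simp add: ac_simps)
  qed
  finally have 1: "expectation (\<lambda>\<omega>. err l a b t \<omega> * integral {0..t} (\<lambda>s. cosh (l' * s) * obs l' a' b' s \<omega>)) = 0" .
  have sI: "sq_int (\<lambda>\<omega>. integral {0..t} (\<lambda>s. cosh (l' * s) * obs l' a' b' s \<omega>))"
    by (rule l2_process_integral_itv(2)[OF p order_refl t])
  have so: "sq_int (obs l' a' b' t)" by (rule l2_process_sq_int[OF l2_process_obs])
  have "expectation (\<lambda>\<omega>. err l a b t \<omega> * est l' a' b' t \<omega>) = expectation (\<lambda>\<omega>. tanh (l' * t) * (err l a b t \<omega> * obs l' a' b' t \<omega>)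
    - l' / cosh (l' * t) * (err l a b t \<omega> * integral {0..t} (\<lambda>s. cosh (l' * s) * obs l' a' b' s \<omega>)))"
    using t by (simp add: est_def max_absorb2 algebra_simps)
  also have "\<dots> = 0"
    using integrable_mult_sq_int[OF e sI] integrable_mult_sq_int[OF e so] 1 err_obs_orth[OF l t order_refl ab]
    by (subst Bochner_Integration.integral_diff) auto
  finally show ?thesis .
qed

text \<open>Pythagoras: since the error is orthogonal to the estimate, its covariance with the other
  error equals that with the state itself, which \<open>err_W_cov\<close> evaluates at
  \<open>s = t\<close>.\<close>

lemma err_cov:
  assumes l: "0 < l" and t: "0 \<le> t"
    and ab: "(a = a' \<and> b = b' \<and> l = l' \<and> a \<bullet> a = 1 \<and> b \<bullet> b = 1) \<or> (a \<bullet> a' = 0 \<and> b \<bullet> b' = 0)" "b \<bullet> a' = 0" "a \<bullet> b' = 0"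
  shows "expectation (\<lambda>\<omega>. err l a b t \<omega> * W a' t \<omega>) = (a \<bullet> a') * (tanh (l * t) / l)"
    and "expectation (\<lambda>\<omega>. err l a b t \<omega> * err l' a' b' t \<omega>) = (a \<bullet> a') * (tanh (l * t) / l)"
proof -
  show 1: "expectation (\<lambda>\<omega>. err l a b t \<omega> * W a' t \<omega>) = (a \<bullet> a') * (tanh (l * t) / l)"
    using err_W_cov[OF l t order_refl, of a b a'] ab(2) l by (simp add: tanh_def)
  have e: "sq_int (err l a b t)" by (rule l2_process_sq_int[OF l2_process_err])
  have "expectation (\<lambda>\<omega>. err l a b t \<omega> * err l' a' b' t \<omega>) = expectation (\<lambda>\<omega>. err l a b t \<omega> * W a' t \<omega> - err l a b t \<omega> * est l' a' b' t \<omega>)"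
    unfolding err_def[of l' a' b'] by (simp add: right_diff_distrib)
  also have "\<dots> = (a \<bullet> a') * (tanh (l * t) / l)"
    using integrable_mult_sq_int[OF e sq_int_W] integrable_mult_sq_int[OF e l2_process_sq_int[OF l2_process_est]]
      1 err_est_orth[OF l t ab] by (subst Bochner_Integration.integral_diff) auto
  finally show "expectation (\<lambda>\<omega>. err l a b t \<omega> * err l' a' b' t \<omega>) = (a \<bullet> a') * (tanh (l * t) / l)" .
qed

end

section \<open>The product formula for expectations\<close>

lemma integral_product_triangle:
  fixes f h :: "real \<Rightarrow> real"
  assumes f: "integrable (itv 0 T) f" and h: "integrable (itv 0 T) h"
  shows "(\<integral>s. f s \<partial>itv 0 T) * (\<integral>t. h t \<partial>itv 0 T)
    = (\<integral>t. (\<integral>s. f s * indicator {..t} s \<partial>itv 0 T) * h t \<partial>itv 0 T) + (\<integral>t. (\<integral>s. h s * indicator {..t} s \<partial>itv 0 T) * f t \<partial>itv 0 T)"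
    and "integrable (itv 0 T) (\<lambda>t. (\<integral>s. f s * indicator {..t} s \<partial>itv 0 T) * h t)"
proof -
  interpret P: pair_sigma_finite "itv 0 T" "itv 0 T" by (rule pair_sigma_finite.intro) simp_all
  have [measurable]: "f \<in> borel_measurable borel" "h \<in> borel_measurable borel"
    using f h by (auto dest: borel_measurable_integrable)
  have prod: "integrable (itv 0 T \<Otimes>\<^sub>M itv 0 T) (\<lambda>(t, s). f s * h t)" if f: "integrable (itv 0 T) f" and h: "integrable (itv 0 T) h" for f h :: "real \<Rightarrow> real"
  proof (rule P.Fubini_integrable)
    have [measurable]: "f \<in> borel_measurable borel" "h \<in> borel_measurable borel"
      using f h by (auto dest: borel_measurable_integrable)
    show "(\<lambda>(t, s). f s * h t) \<in> borel_measurable (itv 0 T \<Otimes>\<^sub>M itv 0 T)" by measurable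
    show "integrable (itv 0 T) (\<lambda>x. \<integral>y. norm (case (x, y) of (t, s) \<Rightarrow> f s * h t) \<partial>itv 0 T)"
      using h by (simp add: abs_mult)
    show "AE x in itv 0 T. integrable (itv 0 T) (\<lambda>y. case (x, y) of (t, s) \<Rightarrow> f s * h t)"
      using f by simp
  qed
  have tri: "integrable (itv 0 T \<Otimes>\<^sub>M itv 0 T) (\<lambda>(t, s). f s * h t * indicator {..t} s)"
    if fh: "integrable (itv 0 T) f" "integrable (itv 0 T) h" for f h :: "real \<Rightarrow> real"
  proof (rule Bochner_Integration.integrable_bound[OF prod[OF fh]])
    have [measurable]: "f \<in> borel_measurable borel" "h \<in> borel_measurable borel"
      using fh by (auto dest: borel_measurable_integrable)
    show "(\<lambda>(t, s). f s * h t * indicator {..t} s) \<in> borel_measurable (itv 0 T \<Otimes>\<^sub>M itv 0 T)"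
      unfolding indicator_def atMost_iff by measurable
    show "AE x in itv 0 T \<Otimes>\<^sub>M itv 0 T. norm (case x of (t, s) \<Rightarrow> f s * h t * indicator {..t} s) \<le> norm (case x of (t, s) \<Rightarrow> f s * h t)"
      by (rule AE_I2) (auto simp: indicator_def)
  qed
  have inner: "(\<integral>s. f s * h t * indicator {..t} s \<partial>itv 0 T) = (\<integral>s. f s * indicator {..t} s \<partial>itv 0 T) * h t" for f h :: "real \<Rightarrow> real" and t
    by (subst integral_mult_left_zero[symmetric]) (simp add: ac_simps)
  show "integrable (itv 0 T) (\<lambda>t. (\<integral>s. f s * indicator {..t} s \<partial>itv 0 T) * h t)"
    using P.integrable_fst[OF tri[OF f h]] by (simp add: inner)
  have "(\<integral>s. f s \<partial>itv 0 T) * (\<integral>t. h t \<partial>itv 0 T) = (\<integral>p. (\<lambda>(t, s). f s * h t) p \<partial>(itv 0 T \<Otimes>\<^sub>M itv 0 T))"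
    unfolding P.integral_fst[OF prod[OF f h], symmetric] by simp
  also have "\<dots> = (\<integral>p. (\<lambda>(t, s). f s * h t * indicator {..t} s) p + (\<lambda>(t, s). h t * f s * indicator {..s} t) p \<partial>(itv 0 T \<Otimes>\<^sub>M itv 0 T))"
  proof (rule integral_cong_AE)
    show "(\<lambda>(t, s). f s * h t) \<in> borel_measurable (itv 0 T \<Otimes>\<^sub>M itv 0 T)" by measurable
    show "(\<lambda>p. (\<lambda>(t, s). f s * h t * indicator {..t} s) p + (\<lambda>(t, s). h t * f s * indicator {..s} t) p) \<in> borel_measurable (itv 0 T \<Otimes>\<^sub>M itv 0 T)"
      unfolding indicator_def atMost_iff by measurable
    \<comment> \<open>The square splits into the two triangles below and above the diagonal. Both
      indicators count the diagonal, which is a null set.\<close>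
    have "AE p in itv 0 T \<Otimes>\<^sub>M itv 0 T. fst p \<noteq> snd p"
    proof (rule P.AE_pair_measure)
      show "{x \<in> space (itv 0 T \<Otimes>\<^sub>M itv 0 T). fst x \<noteq> snd x} \<in> sets (itv 0 T \<Otimes>\<^sub>M itv 0 T)" by measurable
      have "AE y in itv 0 T. x \<noteq> y" for x
        unfolding itv_def by (subst AE_density) (auto intro!: AE_I[where N="{x}"])
      then show "AE x in itv 0 T. AE y in itv 0 T. fst (x, y) \<noteq> snd (x, y)" by simp
    qed
    then show "AE p in itv 0 T \<Otimes>\<^sub>M itv 0 T. (\<lambda>(t, s). f s * h t) p =
      (\<lambda>(t, s). f s * h t * indicator {..t} s) p + (\<lambda>(t, s). h t * f s * indicator {..s} t) p"
      by eventually_elim (auto simp: indicator_def)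
  qed
  also have "\<dots> = (\<integral>p. (\<lambda>(t, s). f s * h t * indicator {..t} s) p \<partial>(itv 0 T \<Otimes>\<^sub>M itv 0 T))
    + (\<integral>p. (\<lambda>(t, s). h t * f s * indicator {..s} t) p \<partial>(itv 0 T \<Otimes>\<^sub>M itv 0 T))"
    using tri[OF f h] P.integrable_product_swap[OF tri[OF h f]]
    by (intro Bochner_Integration.integral_add) (simp_all add: case_prod_unfold)
  also have "(\<integral>p. (\<lambda>(t, s). h t * f s * indicator {..s} t) p \<partial>(itv 0 T \<Otimes>\<^sub>M itv 0 T)) = (\<integral>p. (\<lambda>(t, s). h s * f t * indicator {..t} s) p \<partial>(itv 0 T \<Otimes>\<^sub>M itv 0 T))"
    using P.integral_product_swap[OF borel_measurable_integrable[OF tri[OF h f]]] by (simp add: case_prod_unfold)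
  finally show "(\<integral>s. f s \<partial>itv 0 T) * (\<integral>t. h t \<partial>itv 0 T)
    = (\<integral>t. (\<integral>s. f s * indicator {..t} s \<partial>itv 0 T) * h t \<partial>itv 0 T) + (\<integral>t. (\<integral>s. h s * indicator {..t} s \<partial>itv 0 T) * f t \<partial>itv 0 T)"
    unfolding P.integral_fst[OF tri[OF f h], symmetric] P.integral_fst[OF tri[OF h f], symmetric] inner .
qed

lemma integral_itv_indicator:
  fixes f :: "real \<Rightarrow> real"
  assumes [measurable]: "f \<in> borel_measurable borel" and t: "t \<le> T"
  shows "(\<integral>s. f s * indicator {..t} s \<partial>itv 0 T) = (\<integral>s. f s \<partial>itv 0 t)"
  using t by (subst integral_itv, simp, subst integral_itv, simp)
    (auto simp: set_lebesgue_integral_def indicator_def intro!: Bochner_Integration.integral_cong)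

context prob_space
begin

lemma l2_joint_iff:
  assumes m: "(\<lambda>(t, \<omega>). X t \<omega>) \<in> borel_measurable (borel \<Otimes>\<^sub>M M)"
  shows "l2_joint a b X \<longleftrightarrow> (\<integral>\<^sup>+s\<in>{a..b}. (\<integral>\<^sup>+\<omega>. ennreal ((X s \<omega>)\<^sup>2) \<partial>M) \<partial>lborel) < \<infinity>"
proof -
  note [measurable] = m
  have "l2_joint a b X \<longleftrightarrow> (\<integral>\<^sup>+p. ennreal (norm ((\<lambda>(t, \<omega>). (X t \<omega>)\<^sup>2) p)) \<partial>(itv a b \<Otimes>\<^sub>M M)) < \<infinity>"
    unfolding l2_joint_def integrable_iff_bounded using m by simp
  also have "(\<integral>\<^sup>+p. ennreal (norm ((\<lambda>(t, \<omega>). (X t \<omega>)\<^sup>2) p)) \<partial>(itv a b \<Otimes>\<^sub>M M)) = (\<integral>\<^sup>+s. (\<integral>\<^sup>+\<omega>. ennreal ((X s \<omega>)\<^sup>2) \<partial>M) \<partial>itv a b)"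
    by (subst nn_integral_fst[symmetric]) (simp_all add: case_prod_unfold)
  also have "\<dots> = (\<integral>\<^sup>+s\<in>{a..b}. (\<integral>\<^sup>+\<omega>. ennreal ((X s \<omega>)\<^sup>2) \<partial>M) \<partial>lborel)"
    by (rule nn_integral_itv) measurable
  finally show ?thesis .
qed

lemma l2_joint_subinterval:
  assumes "l2_joint a b X" "{c..d} \<subseteq> {a..b}"
  shows "l2_joint c d X"
proof -
  have m: "(\<lambda>(t, \<omega>). X t \<omega>) \<in> borel_measurable (borel \<Otimes>\<^sub>M M)" using assms by (simp add: l2_joint_def)
  have "(\<integral>\<^sup>+s\<in>{c..d}. (\<integral>\<^sup>+\<omega>. ennreal ((X s \<omega>)\<^sup>2) \<partial>M) \<partial>lborel) \<le> (\<integral>\<^sup>+s\<in>{a..b}. (\<integral>\<^sup>+\<omega>. ennreal ((X s \<omega>)\<^sup>2) \<partial>M) \<partial>lborel)"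
    using assms(2) by (intro nn_integral_mono) (auto simp: indicator_def)
  then show ?thesis using assms(1) unfolding l2_joint_iff[OF m] by (rule le_less_trans)
qed

text \<open>The measure \<open>itv 0 t\<close> varies with \<open>t\<close>. Moving the endpoint
  into the integrand fixes the measure, and joint measurability becomes that of a parameter
  integral.\<close>

lemma measurable_running_integral:
  fixes g :: "real \<Rightarrow> 'b \<Rightarrow> real"
  assumes [measurable]: "(\<lambda>(t, \<omega>). g t \<omega>) \<in> borel_measurable (borel \<Otimes>\<^sub>M N)"
  shows "(\<lambda>(t, \<omega>). \<integral>s. g s \<omega> \<partial>itv 0 t) \<in> borel_measurable (borel \<Otimes>\<^sub>M N)"
proof -
  have "(\<integral>s. g s \<omega> \<partial>itv 0 t) = (\<integral>s. (if 0 \<le> s \<and> s \<le> t then g s \<omega> else 0) \<partial>lborel)" if "\<omega> \<in> space N" for t \<omega>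
  proof -
    have [measurable]: "(\<lambda>s. g s \<omega>) \<in> borel_measurable borel"
      using that by measurable
    show ?thesis by (subst integral_itv) (auto simp: set_lebesgue_integral_def indicator_def intro!: Bochner_Integration.integral_cong)
  qed
  then have "(\<lambda>(t, \<omega>). \<integral>s. g s \<omega> \<partial>itv 0 t) \<in> borel_measurable (borel \<Otimes>\<^sub>M N) \<longleftrightarrow>
    (\<lambda>(t, \<omega>). \<integral>s. (if 0 \<le> s \<and> s \<le> t then g s \<omega> else 0) \<partial>lborel) \<in> borel_measurable (borel \<Otimes>\<^sub>M N)"
    by (intro measurable_cong) (auto simp: space_pair_measure)
  moreover have "(\<lambda>(t, \<omega>). \<integral>s. (if 0 \<le> s \<and> s \<le> t then g s \<omega> else 0) \<partial>lborel) \<in> borel_measurable (borel \<Otimes>\<^sub>M N)"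
    by measurable
  ultimately show ?thesis by simp
qed

lemma l2_joint_running_integral:
  assumes g: "l2_joint 0 T g" and T: "0 \<le> T"
  shows "l2_joint 0 T (\<lambda>t \<omega>. \<integral>s. g s \<omega> \<partial>itv 0 t)"
proof (rule l2_jointI_bounded)
  have m: "(\<lambda>(t, \<omega>). g t \<omega>) \<in> borel_measurable (borel \<Otimes>\<^sub>M M)" using g by (simp add: l2_joint_def)
  then show "(\<lambda>(t, \<omega>). \<integral>s. g s \<omega> \<partial>itv 0 t) \<in> borel_measurable (borel \<Otimes>\<^sub>M M)"
    by (rule measurable_running_integral)
  fix t assume t: "t \<in> {0..T}"
  have gt: "l2_joint 0 t g" by (rule l2_joint_subinterval[OF g]) (use t in auto)
  show "sq_int (\<lambda>\<omega>. \<integral>s. g s \<omega> \<partial>itv 0 t)" by (rule l2_joint_integral(5)[OF gt]) (use t in auto)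
  let ?h = "\<lambda>s. expectation (\<lambda>\<omega>. (g s \<omega>)\<^sup>2)"
  have hT: "integrable (itv 0 T) ?h" by (rule l2_joint_integral(2)[OF g T])
  then have [measurable]: "?h \<in> borel_measurable borel" by (auto dest: borel_measurable_integrable)
  have "expectation (\<lambda>\<omega>. (\<integral>s. g s \<omega> \<partial>itv 0 t)\<^sup>2) \<le> (t - 0) * (\<integral>s. ?h s \<partial>itv 0 t)"
    by (rule l2_joint_integral(6)[OF gt]) (use t in auto)
  also have "(\<integral>s. ?h s \<partial>itv 0 t) = (\<integral>s. ?h s * indicator {..t} s \<partial>itv 0 T)"
    by (rule integral_itv_indicator[symmetric]) (use t in auto)
  also have "\<dots> \<le> (\<integral>s. ?h s \<partial>itv 0 T)"
    using hT by (intro integral_mono integrable_real_mult_indicator) (auto simp: indicator_def)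
  finally show "expectation (\<lambda>\<omega>. (\<integral>s. g s \<omega> \<partial>itv 0 t)\<^sup>2) \<le> T * (\<integral>s. ?h s \<partial>itv 0 T)"
    using t by (smt (verit) Bochner_Integration.integral_nonneg atLeastAtMost_iff mult_left_mono mult_right_mono zero_le_power2)
qed

text \<open>Ito's formula for the expectation of a product, without stochastic integrals: \<open>g i\<close> is uncorrelated with the
  future increments of \<open>n j\<close>, so \<open>n j T\<close> may be replaced by \<open>n j t\<close> next to \<open>g i t\<close>.\<close>

lemma expectation_product_formula:
  fixes g n :: "bool \<Rightarrow> real \<Rightarrow> 'a \<Rightarrow> real" and c :: "bool \<Rightarrow> real"
  assumes T: "0 \<le> T" and g: "\<And>i. l2_joint 0 T (g i)" and n: "\<And>i. l2_process (n i)"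
    and path: "\<And>i \<omega>. \<omega> \<in> space M \<Longrightarrow> integrable (itv 0 T) (\<lambda>s. g i s \<omega>)"
    and mean: "\<And>i. expectation (n i T) = 0" and cov: "expectation (\<lambda>\<omega>. n True T \<omega> * n False T \<omega>) = \<sigma> * T"
    and orth: "\<And>i j t. t \<in> {0..T} \<Longrightarrow> sq_int (g i t) \<Longrightarrow> expectation (\<lambda>\<omega>. (n j T \<omega> - n j t \<omega>) * g i t \<omega>) = 0"
    and x: "\<And>i t \<omega>. x i t \<omega> = c i + (\<integral>s. g i s \<omega> \<partial>itv 0 t) + n i t \<omega>"
  shows "\<And>i. l2_joint 0 T (x i)"
    and "\<And>i. sq_int (x i T)"
    and "expectation (\<lambda>\<omega>. x True T \<omega> * x False T \<omega>) = c True * c False + \<sigma> * T +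
      (\<integral>t. expectation (\<lambda>\<omega>. x True t \<omega> * g False t \<omega>) \<partial>itv 0 T) + (\<integral>t. expectation (\<lambda>\<omega>. x False t \<omega> * g True t \<omega>) \<partial>itv 0 T)"
proof -
  \<comment> \<open>The labels \<open>True\<close> and \<open>False\<close> name the two factors, so
    that every estimate is proved once. \<open>G\<close> is the absolutely continuous part of the
    factor.\<close>
  define G where "G i t \<omega> = (\<integral>s. g i s \<omega> \<partial>itv 0 t)" for i t \<omega>
  have G: "l2_joint 0 T (G i)" for i unfolding G_def by (rule l2_joint_running_integral[OF g T])
  have nj: "l2_joint 0 T (n i)" for i by (rule l2_process_joint[OF n]) simp
  have sn: "sq_int (n i t)" for i t by (rule l2_process_sq_int[OF n])
  have sG: "sq_int (G i T)" for i unfolding G_def by (rule l2_joint_integral(5)[OF g T])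
  have xj: "l2_joint 0 T (x i)" for i
  proof -
    have "l2_joint 0 T (\<lambda>t \<omega>. (\<lambda>_. c i) \<omega> + G i t \<omega> + n i t \<omega>)"
      by (intro l2_joint_add l2_joint_const_time G nj sq_int_const T)
    then show ?thesis unfolding x[abs_def] G_def .
  qed
  show "l2_joint 0 T (x i)" for i by (rule xj)
  have "sq_int (\<lambda>\<omega>. c i + G i T \<omega> + n i T \<omega>)" for i by (intro sq_int_add sq_int_const sG sn)
  then show sx: "sq_int (x i T)" for i unfolding x[abs_def] G_def .
  interpret P: pair_sigma_finite "itv 0 T" M by (rule pair_sigma_finite_itv)
  have GG: "expectation (\<lambda>\<omega>. G True T \<omega> * G False T \<omega>)
     = (\<integral>t. expectation (\<lambda>\<omega>. G True t \<omega> * g False t \<omega>) \<partial>itv 0 T) + (\<integral>t. expectation (\<lambda>\<omega>. G False t \<omega> * g True t \<omega>) \<partial>itv 0 T)"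
  proof -
    have m: "(\<lambda>s. g i s \<omega>) \<in> borel_measurable borel" if "\<omega> \<in> space M" for i \<omega>
      using borel_measurable_integrable[OF path[OF that]] by simp
    have Gt: "(\<integral>t. (\<integral>s. g i s \<omega> * indicator {..t} s \<partial>itv 0 T) * g j t \<omega> \<partial>itv 0 T) = (\<integral>t. G i t \<omega> * g j t \<omega> \<partial>itv 0 T)"
      if \<omega>: "\<omega> \<in> space M" for i j \<omega>
    proof (rule integral_cong_AE)
      show "(\<lambda>t. (\<integral>s. g i s \<omega> * indicator {..t} s \<partial>itv 0 T) * g j t \<omega>) \<in> borel_measurable (itv 0 T)"
        using integral_product_triangle(2)[OF path[OF \<omega>] path[OF \<omega>]] by (rule borel_measurable_integrable)
      have "(\<lambda>(t, \<omega>). G i t \<omega>) \<in> borel_measurable (borel \<Otimes>\<^sub>M M)" using G by (simp add: l2_joint_def)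
      then have "(\<lambda>t. G i t \<omega>) \<in> borel_measurable borel" using \<omega> by measurable
      then show "(\<lambda>t. G i t \<omega> * g j t \<omega>) \<in> borel_measurable (itv 0 T)" using m[OF \<omega>] by simp
      show "AE t in itv 0 T. (\<integral>s. g i s \<omega> * indicator {..t} s \<partial>itv 0 T) * g j t \<omega> = G i t \<omega> * g j t \<omega>"
        unfolding G_def by (rule AE_itvI) (simp add: integral_itv_indicator[OF m[OF \<omega>]])
    qed
    have "G True T \<omega> * G False T \<omega> = (\<integral>t. G True t \<omega> * g False t \<omega> \<partial>itv 0 T) + (\<integral>t. G False t \<omega> * g True t \<omega> \<partial>itv 0 T)"
      if \<omega>: "\<omega> \<in> space M" for \<omega>
      using integral_product_triangle(1)[OF path[OF \<omega>] path[OF \<omega>], of True False] unfolding Gt[OF \<omega>] by (simp add: G_def)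
    then have "expectation (\<lambda>\<omega>. G True T \<omega> * G False T \<omega>)
      = expectation (\<lambda>\<omega>. (\<integral>t. G True t \<omega> * g False t \<omega> \<partial>itv 0 T) + (\<integral>t. G False t \<omega> * g True t \<omega> \<partial>itv 0 T))"
      by (intro Bochner_Integration.integral_cong) auto
    also have "\<dots> = (\<integral>t. expectation (\<lambda>\<omega>. G True t \<omega> * g False t \<omega>) \<partial>itv 0 T) + (\<integral>t. expectation (\<lambda>\<omega>. G False t \<omega> * g True t \<omega>) \<partial>itv 0 T)"
      using P.integrable_snd[OF l2_joint_mult[OF G g]] P.Fubini_integral[OF l2_joint_mult[OF G g]] by simp
    finally show ?thesis .
  qed
  \<comment> \<open>Inside the time integral the noise at the final time is exchanged for the noise
    at the running time; the difference is a future increment, orthogonal to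
    \<open>g i t\<close>.\<close>
  have nG: "expectation (\<lambda>\<omega>. n j T \<omega> * G i T \<omega>) = (\<integral>t. expectation (\<lambda>\<omega>. n j t \<omega> * g i t \<omega>) \<partial>itv 0 T)" for i j
  proof -
    have "expectation (\<lambda>\<omega>. n j T \<omega> * G i T \<omega>) = (\<integral>t. expectation (\<lambda>\<omega>. n j T \<omega> * g i t \<omega>) \<partial>itv 0 T)"
      unfolding G_def by (rule l2_joint_integral(4)[OF g T sn])
    also have "\<dots> = (\<integral>t. expectation (\<lambda>\<omega>. n j t \<omega> * g i t \<omega>) \<partial>itv 0 T)"
    proof (rule integral_cong_AE)
      show "(\<lambda>t. expectation (\<lambda>\<omega>. n j T \<omega> * g i t \<omega>)) \<in> borel_measurable (itv 0 T)"
        using l2_joint_integral(3)[OF g T sn] by (rule borel_measurable_integrable)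
      show "(\<lambda>t. expectation (\<lambda>\<omega>. n j t \<omega> * g i t \<omega>)) \<in> borel_measurable (itv 0 T)"
        using P.integrable_fst[OF l2_joint_mult[OF nj g]] by (rule borel_measurable_integrable)
      show "AE t in itv 0 T. expectation (\<lambda>\<omega>. n j T \<omega> * g i t \<omega>) = expectation (\<lambda>\<omega>. n j t \<omega> * g i t \<omega>)"
        using l2_joint_integral(1)[OF g[of i] T] AE_itv[of 0 T]
      proof eventually_elim
        case (elim t)
        have "expectation (\<lambda>\<omega>. (n j T \<omega> - n j t \<omega>) * g i t \<omega>) = expectation (\<lambda>\<omega>. n j T \<omega> * g i t \<omega>) - expectation (\<lambda>\<omega>. n j t \<omega> * g i t \<omega>)"
          using integrable_mult_sq_int[OF sn elim(1)] by (simp add: left_diff_distrib)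
        then show ?case using orth[OF elim(2,1), of j] by simp
      qed
    qed
    finally show ?thesis .
  qed
  have EG: "expectation (G i T) = (\<integral>t. expectation (g i t) \<partial>itv 0 T)" for i
    using l2_joint_integral(4)[OF g T sq_int_const, of 1 i] by (simp add: G_def[abs_def])
  have iEg: "integrable (itv 0 T) (\<lambda>t. expectation (g i t))" for i
    using l2_joint_integral(3)[OF g T sq_int_const, of 1 i] by simp
  have xg: "(\<integral>t. expectation (\<lambda>\<omega>. x i t \<omega> * g j t \<omega>) \<partial>itv 0 T)
     = c i * expectation (G j T) + (\<integral>t. expectation (\<lambda>\<omega>. G i t \<omega> * g j t \<omega>) \<partial>itv 0 T) + expectation (\<lambda>\<omega>. n i T \<omega> * G j T \<omega>)" for i j
  proof -
    note I = P.integrable_fst[OF l2_joint_mult[OF G g]] P.integrable_fst[OF l2_joint_mult[OF nj g]]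
    have "(\<integral>t. expectation (\<lambda>\<omega>. x i t \<omega> * g j t \<omega>) \<partial>itv 0 T)
      = (\<integral>t. c i * expectation (g j t) + expectation (\<lambda>\<omega>. G i t \<omega> * g j t \<omega>) + expectation (\<lambda>\<omega>. n i t \<omega> * g j t \<omega>) \<partial>itv 0 T)"
    proof (rule integral_cong_AE)
      show "(\<lambda>t. expectation (\<lambda>\<omega>. x i t \<omega> * g j t \<omega>)) \<in> borel_measurable (itv 0 T)"
        using P.integrable_fst[OF l2_joint_mult[OF xj g]] by (rule borel_measurable_integrable)
      show "(\<lambda>t. c i * expectation (g j t) + expectation (\<lambda>\<omega>. G i t \<omega> * g j t \<omega>) + expectation (\<lambda>\<omega>. n i t \<omega> * g j t \<omega>)) \<in> borel_measurable (itv 0 T)"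
        using I iEg by (intro borel_measurable_integrable Bochner_Integration.integrable_add integrable_mult_right)
      show "AE t in itv 0 T. expectation (\<lambda>\<omega>. x i t \<omega> * g j t \<omega>) = c i * expectation (g j t) + expectation (\<lambda>\<omega>. G i t \<omega> * g j t \<omega>) + expectation (\<lambda>\<omega>. n i t \<omega> * g j t \<omega>)"
        using l2_joint_integral(1)[OF g[of j] T] l2_joint_integral(1)[OF G[of i] T]
      proof eventually_elim
        case (elim t)
        have "expectation (\<lambda>\<omega>. x i t \<omega> * g j t \<omega>) = expectation (\<lambda>\<omega>. c i * g j t \<omega> + G i t \<omega> * g j t \<omega> + n i t \<omega> * g j t \<omega>)"
          by (simp add: x G_def distrib_right)
        also have "\<dots> = c i * expectation (g j t) + expectation (\<lambda>\<omega>. G i t \<omega> * g j t \<omega>) + expectation (\<lambda>\<omega>. n i t \<omega> * g j t \<omega>)"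
          using integrable_mult_sq_int[OF elim(2,1)] integrable_mult_sq_int[OF sn elim(1)] sq_int_integrable[OF elim(1)] by simp
        finally show ?case .
      qed
    qed
    also have "\<dots> = c i * expectation (G j T) + (\<integral>t. expectation (\<lambda>\<omega>. G i t \<omega> * g j t \<omega>) \<partial>itv 0 T) + expectation (\<lambda>\<omega>. n i T \<omega> * G j T \<omega>)"
      using I iEg by (simp add: EG nG)
    finally show ?thesis .
  qed
  \<comment> \<open>Every mixed term of the expanded product occurs in exactly one of the two
    instances of \<open>xg\<close> or in \<open>GG\<close>; what remains is the initial product and
    the covariation \<open>\<sigma> * T\<close>.\<close>
  have "expectation (\<lambda>\<omega>. x True T \<omega> * x False T \<omega>) = expectation (\<lambda>\<omega>. c True * c False
    + c True * (G False T \<omega>) + c True * n False T \<omega> + c False * G True T \<omega> + c False * n True T \<omega>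
    + G True T \<omega> * G False T \<omega> + n False T \<omega> * G True T \<omega> + n True T \<omega> * G False T \<omega> + n True T \<omega> * n False T \<omega>)"
    by (rule Bochner_Integration.integral_cong) (simp_all add: x G_def algebra_simps)
  also have "\<dots> = c True * c False + c True * expectation (G False T) + c False * expectation (G True T)
    + expectation (\<lambda>\<omega>. G True T \<omega> * G False T \<omega>) + expectation (\<lambda>\<omega>. n False T \<omega> * G True T \<omega>) + expectation (\<lambda>\<omega>. n True T \<omega> * G False T \<omega>) + \<sigma> * T"
    using sq_int_integrable[OF sG] sq_int_integrable[OF sn] integrable_mult_sq_int[OF sG sG] integrable_mult_sq_int[OF sn sG]
      integrable_mult_sq_int[OF sn sn] mean cov by (simp add: prob_space)
  also have "\<dots> = c True * c False + \<sigma> * T +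
      (\<integral>t. expectation (\<lambda>\<omega>. x True t \<omega> * g False t \<omega>) \<partial>itv 0 T) + (\<integral>t. expectation (\<lambda>\<omega>. x False t \<omega> * g True t \<omega>) \<partial>itv 0 T)"
    unfolding xg GG by simp
  finally show "expectation (\<lambda>\<omega>. x True T \<omega> * x False T \<omega>) = c True * c False + \<sigma> * T +
      (\<integral>t. expectation (\<lambda>\<omega>. x True t \<omega> * g False t \<omega>) \<partial>itv 0 T) + (\<integral>t. expectation (\<lambda>\<omega>. x False t \<omega> * g True t \<omega>) \<partial>itv 0 T)" .
qed

end

section \<open>Inverses and the inner product over time and probability\<close>

lemma pos_def_inverse:
  assumes "pos_def (A :: real^'n^'n)"
  shows "A ** matrix_inv A = mat 1" "matrix_inv A ** A = mat 1" "transpose (matrix_inv A) = matrix_inv A"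
proof -
  have "\<forall>x. A *v x = 0 \<longrightarrow> x = 0"
    using assms unfolding pos_def_def by (metis inner_zero_right less_irrefl)
  then obtain A' where "A' ** A = mat 1" using matrix_left_invertible_ker[of A] by blast
  then have "invertible A" unfolding invertible_def using matrix_left_right_inverse by blast
  then have inv: "A ** matrix_inv A = mat 1 \<and> matrix_inv A ** A = mat 1"
    unfolding invertible_def matrix_inv_def by (rule someI_ex)
  then show 1: "A ** matrix_inv A = mat 1" and 2: "matrix_inv A ** A = mat 1" by auto
  have At: "transpose A = A" using assms unfolding pos_def_def by auto
  have "transpose (matrix_inv A) ** A = transpose (A ** matrix_inv A)" by (simp add: matrix_transpose_mul At)
  then have "transpose (matrix_inv A) ** A = mat 1" by (simp add: 1)
  then have "transpose (matrix_inv A) ** (A ** matrix_inv A) = matrix_inv A" by (simp add: matrix_mul_assoc)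
  then show "transpose (matrix_inv A) = matrix_inv A" by (simp add: 1)
qed

context prob_space
begin

definition l2v :: "real \<Rightarrow> (real \<Rightarrow> 'a \<Rightarrow> real^'n) \<Rightarrow> bool" where
  "l2v T Z \<longleftrightarrow> (\<forall>i. l2_joint 0 T (\<lambda>t \<omega>. Z t \<omega> $ i))"

text \<open>Integration over the product measure makes sums split directly, without exceptional
  times at which an expectation might not exist.\<close>

definition IP :: "real \<Rightarrow> (real \<Rightarrow> 'a \<Rightarrow> real^'n) \<Rightarrow> (real \<Rightarrow> 'a \<Rightarrow> real^'n) \<Rightarrow> real" where
  "IP T Z Z' = (\<integral>p. (\<lambda>(t, \<omega>). Z t \<omega> \<bullet> Z' t \<omega>) p \<partial>(itv 0 T \<Otimes>\<^sub>M M))"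

lemma l2v_inner:
  assumes "l2v T Z" "l2v T Z'"
  shows "integrable (itv 0 T \<Otimes>\<^sub>M M) (\<lambda>(t, \<omega>). Z t \<omega> \<bullet> Z' t \<omega>)"
proof -
  have "integrable (itv 0 T \<Otimes>\<^sub>M M) (\<lambda>p. \<Sum>i\<in>UNIV. (\<lambda>(t, \<omega>). Z t \<omega> $ i * Z' t \<omega> $ i) p)"
    using assms unfolding l2v_def by (intro Bochner_Integration.integrable_sum l2_joint_mult) auto
  then show ?thesis by (simp add: inner_vec_def case_prod_unfold)
qed

lemma l2v_mult: "l2v T Z \<Longrightarrow> l2v T (\<lambda>t \<omega>. A *v Z t \<omega>)"
  unfolding l2v_def matrix_vector_mult_def by (auto intro!: l2_joint_sum l2_joint_cmult)

lemma l2v_add: "l2v T Z \<Longrightarrow> l2v T Z' \<Longrightarrow> l2v T (\<lambda>t \<omega>. Z t \<omega> + Z' t \<omega>)"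
  unfolding l2v_def by (auto intro!: l2_joint_add)

text \<open>Reduces quadratic forms to expectations of products of coordinates, the quantities that
  the product formula and the covariances of the filter error provide.\<close>

lemma IP_matrix:
  fixes A :: "real^'n^'m"
  assumes Z: "l2v T Z" and Z': "l2v T Z'"
  shows "IP T Z (\<lambda>t \<omega>. A *v Z' t \<omega>) = (\<Sum>i\<in>UNIV. \<Sum>j\<in>UNIV. A $ i $ j * (\<integral>t. expectation (\<lambda>\<omega>. Z t \<omega> $ i * Z' t \<omega> $ j) \<partial>itv 0 T))"
proof -
  interpret P: pair_sigma_finite "itv 0 T" M by (rule pair_sigma_finite_itv)
  have i: "integrable (itv 0 T \<Otimes>\<^sub>M M) (\<lambda>(t, \<omega>). Z t \<omega> $ i * Z' t \<omega> $ j)" for i j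
    using Z Z' unfolding l2v_def by (intro l2_joint_mult) auto
  have "IP T Z (\<lambda>t \<omega>. A *v Z' t \<omega>) = (\<integral>p. (\<Sum>i\<in>UNIV. \<Sum>j\<in>UNIV. A $ i $ j * (\<lambda>(t, \<omega>). Z t \<omega> $ i * Z' t \<omega> $ j) p) \<partial>(itv 0 T \<Otimes>\<^sub>M M))"
    unfolding IP_def by (rule Bochner_Integration.integral_cong[OF refl])
      (simp add: inner_vec_def matrix_vector_mult_def sum_distrib_left case_prod_unfold ac_simps)
  also have "\<dots> = (\<Sum>i\<in>UNIV. \<Sum>j\<in>UNIV. A $ i $ j * (\<integral>p. (\<lambda>(t, \<omega>). Z t \<omega> $ i * Z' t \<omega> $ j) p \<partial>(itv 0 T \<Otimes>\<^sub>M M)))"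
    using i by (simp add: Bochner_Integration.integral_sum)
  also have "\<dots> = (\<Sum>i\<in>UNIV. \<Sum>j\<in>UNIV. A $ i $ j * (\<integral>t. expectation (\<lambda>\<omega>. Z t \<omega> $ i * Z' t \<omega> $ j) \<partial>itv 0 T))"
    using P.integral_fst[OF i] by simp
  finally show ?thesis .
qed

lemma IP_integral:
  assumes "l2v T Z" "l2v T Z'" "0 \<le> T"
  shows "IP T Z Z' = (\<integral>t. expectation (\<lambda>\<omega>. Z t \<omega> \<bullet> Z' t \<omega>) \<partial>itv 0 T)"
    and "integrable (itv 0 T) (\<lambda>t. expectation (\<lambda>\<omega>. Z t \<omega> \<bullet> Z' t \<omega>))"
proof -
  interpret P: pair_sigma_finite "itv 0 T" M by (rule pair_sigma_finite_itv)
  show "IP T Z Z' = (\<integral>t. expectation (\<lambda>\<omega>. Z t \<omega> \<bullet> Z' t \<omega>) \<partial>itv 0 T)"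
    "integrable (itv 0 T) (\<lambda>t. expectation (\<lambda>\<omega>. Z t \<omega> \<bullet> Z' t \<omega>))"
    using P.integral_fst[OF l2v_inner[OF assms(1,2)]] P.integrable_fst[OF l2v_inner[OF assms(1,2)]] unfolding IP_def by simp_all
qed

end

section \<open>The driftless LQG problem\<close>

text \<open>Process and measurement noise are images of one Wiener process, and
  \<open>\<Gamma>D\<close> expresses that they are independent. \<open>P\<close> and
  \<open>l\<close> diagonalise the noise covariance together with the information matrix of the
  observations; \<open>ric\<close> is the Riccati equation of the control.\<close>

locale lqg_driftless = wiener_space M w for M :: "'a measure" and w :: "real \<Rightarrow> 'a \<Rightarrow> real^'q::finite" +
  fixes \<Gamma> D :: "real^'q^'k::finite" and B :: "real^'m::finite^'k" and C Q X S V P :: "real^'k^'k"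
    and R :: "real^'m^'m" and l :: "'k \<Rightarrow> real" and x\<^sub>0 :: "real^'k"
  assumes Q: "pos_def Q" and R: "pos_def R" and X: "pos_def X" and S: "pos_def S" and V: "pos_def V"
    and \<Gamma>: "\<Gamma> ** transpose \<Gamma> = S" and D: "D ** transpose D = V" and \<Gamma>D: "\<Gamma> ** transpose D = 0"
    and l: "\<And>i. 0 < l i" and PSP: "P ** S ** transpose P = mat 1" and PPS: "transpose P ** P ** S = mat 1"
    and SPP: "S ** transpose P ** P = mat 1"
    and K: "transpose C ** matrix_inv V ** C = transpose P ** diag_mat (\<lambda>i. (l i)\<^sup>2) ** P"
    and ric: "X ** (B ** matrix_inv R ** transpose B) ** X = Q"
begin

lemma sym: "transpose Q = Q" "transpose R = R" "transpose X = X" "transpose S = S" "transpose V = V"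
  using Q R X S V unfolding pos_def_def by auto

text \<open>The change of observation coordinates determined by \<open>UC\<close> and
  \<open>UVU\<close>: it decouples the channels and gives each of them unit noise. It equals
  \<open>diag_mat l ** P\<close> times the inverse of \<open>C\<close>, expressed through the
  information matrix.\<close>

definition U :: "real^'k^'k" where
  "U = diag_mat (\<lambda>i. 1 / l i) ** P ** S ** transpose C ** matrix_inv V"

text \<open>The directions of state and measurement noise in each scalar channel. By
  \<open>a_inner\<close>, \<open>b_inner\<close> and \<open>ab_inner\<close> together they are
  orthonormal, so the channels are uncorrelated copies of the scalar problem.\<close>

definition a :: "'k \<Rightarrow> real^'q" where "a i = (P ** \<Gamma>) $ i"
definition b :: "'k \<Rightarrow> real^'q" where "b i = (U ** D) $ i"

lemma diag_inv: "diag_mat (\<lambda>i. 1 / l i) ** diag_mat (\<lambda>i. (l i)\<^sup>2) = diag_mat l"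
proof -
  have "l i \<noteq> 0" for i using l[of i] by simp
  then have "(\<lambda>i. 1 / l i * (l i)\<^sup>2) = l" by (simp add: power2_eq_square)
  then show ?thesis by (simp add: diag_mat_mult)
qed

lemma UC: "U ** C = diag_mat l ** P"
proof -
  have "U ** C = diag_mat (\<lambda>i. 1 / l i) ** P ** S ** (transpose C ** matrix_inv V ** C)"
    by (simp add: U_def matrix_mul_assoc)
  also have "\<dots> = diag_mat (\<lambda>i. 1 / l i) ** (P ** S ** transpose P) ** diag_mat (\<lambda>i. (l i)\<^sup>2) ** P"
    unfolding K by (simp add: matrix_mul_assoc)
  finally show ?thesis unfolding PSP by (simp add: diag_inv)
qed

lemma UVU: "U ** V ** transpose U = mat 1"
proof -
  have "V ** transpose U = C ** S ** transpose P ** diag_mat (\<lambda>i. 1 / l i)"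
    unfolding U_def using pos_def_inverse[OF V]
    by (simp add: matrix_transpose_mul sym matrix_mul_assoc)
  then have "U ** V ** transpose U = U ** C ** S ** transpose P ** diag_mat (\<lambda>i. 1 / l i)"
    by (simp add: matrix_mul_assoc[symmetric])
  also have "\<dots> = diag_mat l ** (P ** S ** transpose P) ** diag_mat (\<lambda>i. 1 / l i)"
    unfolding UC by (simp add: matrix_mul_assoc)
  also have "\<dots> = mat 1"
  proof -
    have "l i \<noteq> 0" for i using l[of i] by simp
    then show ?thesis unfolding PSP by (simp add: diag_mat_mult diag_mat_1)
  qed
  finally show ?thesis .
qed

text \<open>A one-sided inverse of a square matrix is two-sided, so passing to the scalar
  observations loses no information.\<close>

lemma VUU: "V ** transpose U ** U = mat 1"
  using UVU matrix_left_right_inverse[of U "V ** transpose U"] by (simp add: matrix_mul_assoc)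

lemma rows_inner: "((A ** G) $ i) \<bullet> ((A' ** G') $ j) = (A ** (G ** transpose G') ** transpose A') $ i $ j"
  for A A' :: "real^'k^'k" and G G' :: "real^'q^'k"
proof -
  have "(A ** (G ** transpose G') ** transpose A') = (A ** G) ** transpose (A' ** G')"
    by (simp add: matrix_transpose_mul matrix_mul_assoc)
  then show ?thesis by (simp add: matrix_matrix_mult_def[of "A ** G"] transpose_def inner_vec_def)
qed

lemma a_inner: "a i \<bullet> a j = (if i = j then 1 else 0)"
  unfolding a_def rows_inner \<Gamma> PSP by (simp add: mat_def)

lemma b_inner: "b i \<bullet> b j = (if i = j then 1 else 0)"
  unfolding b_def rows_inner D UVU by (simp add: mat_def)

lemma ab_inner: "a i \<bullet> b j = 0" "b j \<bullet> a i = 0"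
proof -
  show "a i \<bullet> b j = 0" unfolding a_def b_def rows_inner \<Gamma>D by (simp add: matrix_matrix_mult_def)
  then show "b j \<bullet> a i = 0" by (simp add: inner_commute)
qed

abbreviation "ob i \<equiv> obs (l i) (a i) (b i)"
abbreviation "er i \<equiv> err (l i) (a i) (b i)"
abbreviation "es i \<equiv> est (l i) (a i) (b i)"

lemma orth_cond: "(a i = a j \<and> b i = b j \<and> l i = l j \<and> a i \<bullet> a i = 1 \<and> b i \<bullet> b i = 1) \<or> (a i \<bullet> a j = 0 \<and> b i \<bullet> b j = 0)"
  by (cases "i = j") (simp_all add: a_inner b_inner)

lemma er_cov: "0 \<le> t \<Longrightarrow> expectation (\<lambda>\<omega>. er i t \<omega> * W (a j) t \<omega>) = (if i = j then tanh (l i * t) / l i else 0)"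
  "0 \<le> t \<Longrightarrow> expectation (\<lambda>\<omega>. er i t \<omega> * er j t \<omega>) = (if i = j then tanh (l i * t) / l i else 0)"
  using err_cov[OF l _ orth_cond ab_inner(2) ab_inner(1), of t i j] by (simp_all add: a_inner)

text \<open>The integrated observation of the uncontrolled trajectory, assembled from the scalar
  channels. Its history is the same for every control.\<close>

definition free_obs :: "real \<Rightarrow> 'a \<Rightarrow> real^'k" where
  "free_obs t \<omega> = t *\<^sub>R (C *v x\<^sub>0) + (V ** transpose U) *v (\<chi> i. ob i t \<omega>)"

lemma orth_history:
  assumes Z: "gauss Z" and orth: "\<And>s i. 0 \<le> s \<Longrightarrow> s \<le> t \<Longrightarrow> expectation (\<lambda>\<omega>. Z \<omega> * ob i s \<omega>) = 0"
    and z: "\<And>s \<omega>. 0 \<le> s \<Longrightarrow> \<omega> \<in> space M \<Longrightarrow> z s \<omega> = free_obs s \<omega>"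
    and \<zeta>: "\<zeta> \<in> borel_measurable (history M z t)" "sq_int \<zeta>"
  shows "expectation (\<lambda>\<omega>. Z \<omega> * \<zeta> \<omega>) = 0"
proof -
  let ?Y = "\<lambda>s j \<omega>. \<Sum>i\<in>UNIV. (V ** transpose U) $ j $ i * ob i s \<omega>"
  let ?c = "\<lambda>s j. s * (C *v x\<^sub>0) $ j"
  show ?thesis
  proof (rule gauss_orth_history[OF Z, where Y="?Y" and c="?c"])
    fix s j assume "s \<in> {0..t}"
    then have s: "0 \<le> s" "s \<le> t" by auto
    show "gauss (?Y s j)" by (intro gauss_sum gauss_cmult gauss_obs s)
    have "expectation (\<lambda>\<omega>. Z \<omega> * ?Y s j \<omega>) = expectation (\<lambda>\<omega>. \<Sum>i\<in>UNIV. (V ** transpose U) $ j $ i * (Z \<omega> * ob i s \<omega>))"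
      by (simp add: sum_distrib_left mult.left_commute)
    also have "\<dots> = 0"
      using integrable_mult_sq_int[OF gauss_sq_int[OF Z] gauss_sq_int[OF gauss_obs[OF s(1)]]]
      by (simp add: Bochner_Integration.integral_sum orth[OF s])
    finally show "expectation (\<lambda>\<omega>. Z \<omega> * ?Y s j \<omega>) = 0" .
  next
    fix s j \<omega> assume "s \<in> {0..t}" and \<omega>: "\<omega> \<in> space M"
    then show "z s \<omega> $ j = ?c s j + ?Y s j \<omega>"
      using z[OF _ \<omega>, of s] by (simp add: free_obs_def matrix_vector_mult_def)
  qed (use \<zeta> in auto)
qed

lemma W_increment_obs_orth:
  assumes "0 \<le> r" "r \<le> t" "t \<le> T"
  shows "expectation (\<lambda>\<omega>. (W v T \<omega> - W v t \<omega>) * obs l' a' b' r \<omega>) = 0"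
proof -
  let ?Z = "\<lambda>\<omega>. W v T \<omega> - W v t \<omega>"
  have Z: "sq_int ?Z" by (intro sq_int_diff sq_int_W)
  have ZW: "expectation (\<lambda>\<omega>. ?Z \<omega> * W u q \<omega>) = 0" if "0 \<le> q" "q \<le> r" for u q
  proof -
    have "expectation (\<lambda>\<omega>. ?Z \<omega> * W u q \<omega>) = expectation (\<lambda>\<omega>. W v T \<omega> * W u q \<omega>) - expectation (\<lambda>\<omega>. W v t \<omega> * W u q \<omega>)"
      using integrable_mult_sq_int[OF sq_int_W sq_int_W] by (simp add: left_diff_distrib)
    then show ?thesis using W_cov[of T q v u] W_cov[of t q v u] that assms by (simp add: min_absorb2)
  qed
  have I: "expectation (\<lambda>\<omega>. ?Z \<omega> * integral {0..r} (\<lambda>s. W a' s \<omega>)) = 0"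
    by (subst l2_process_integral_itv(3)[OF l2_process_W order_refl assms(1) Z])
       (rule integral_eq_zero_AE, rule AE_itvI, simp add: ZW)
  have "expectation (\<lambda>\<omega>. ?Z \<omega> * obs l' a' b' r \<omega>) = expectation (\<lambda>\<omega>. l' * (?Z \<omega> * integral {0..r} (\<lambda>s. W a' s \<omega>)) + ?Z \<omega> * W b' r \<omega>)"
    using assms by (simp add: obs_def max_absorb2 algebra_simps)
  also have "\<dots> = 0"
    using integrable_mult_sq_int[OF Z l2_process_integral_itv(2)[OF l2_process_W order_refl assms(1)]]
      integrable_mult_sq_int[OF Z sq_int_W] I ZW[OF assms(1) order_refl]
    by (subst Bochner_Integration.integral_add) auto
  finally show ?thesis .
qed

text \<open>What the lower bound retains of an admissible control of finite cost. The observation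
  \<open>z\<close> is prescribed for nonnegative times on \<open>space M\<close>, which is where a
  trajectory is determined.\<close>

definition ctrl :: "(real \<Rightarrow> 'a \<Rightarrow> real^'m) \<Rightarrow> bool" where
  "ctrl u \<longleftrightarrow> (\<lambda>(t, \<omega>). u t \<omega>) \<in> borel_measurable (borel \<Otimes>\<^sub>M M) \<and> (\<forall>T\<ge>0. l2v T u) \<and>
    (\<forall>\<omega>\<in>space M. \<forall>t\<ge>0. set_integrable lborel {0..t} (\<lambda>s. u s \<omega>)) \<and>
    (\<exists>z. (\<forall>s\<ge>0. \<forall>\<omega>\<in>space M. z s \<omega> = free_obs s \<omega>) \<and> adapted_to_history M z u)"

definition state :: "(real \<Rightarrow> 'a \<Rightarrow> real^'m) \<Rightarrow> real \<Rightarrow> 'a \<Rightarrow> real^'k" where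
  "state u t \<omega> = (\<chi> i. x\<^sub>0 $ i + (\<integral>s. (B *v u s \<omega>) $ i \<partial>itv 0 t) + W (\<Gamma> $ i) t \<omega>)"

definition Kt :: "real^'k^'m" where "Kt = matrix_inv R ** transpose B ** X"

text \<open>The filter error in state coordinates, \<open>S ** transpose P\<close> being the inverse
  of \<open>P\<close>.\<close>

definition e :: "real \<Rightarrow> 'a \<Rightarrow> real^'k" where
  "e t \<omega> = (S ** transpose P) *v (\<chi> i. er i t \<omega>)"

definition phi :: "(real \<Rightarrow> 'a \<Rightarrow> real^'m) \<Rightarrow> real \<Rightarrow> real" where
  "phi u T = expectation (\<lambda>\<omega>. state u T \<omega> \<bullet> (X *v state u T \<omega>))"

lemma matrix_vector_nth: "((A :: real^'n^'p) *v x) $ i = A $ i \<bullet> x"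
  by (simp add: matrix_vector_mult_def inner_vec_def)

lemma ctrl_orth:
  assumes u: "ctrl u" and t: "0 \<le> t" and Z: "gauss Z"
    and orth: "\<And>s i. 0 \<le> s \<Longrightarrow> s \<le> t \<Longrightarrow> expectation (\<lambda>\<omega>. Z \<omega> * ob i s \<omega>) = 0"
    and sq: "sq_int (\<lambda>\<omega>. v \<bullet> u t \<omega>)"
  shows "expectation (\<lambda>\<omega>. Z \<omega> * (v \<bullet> u t \<omega>)) = 0"
proof -
  obtain z where z: "\<And>s \<omega>. 0 \<le> s \<Longrightarrow> \<omega> \<in> space M \<Longrightarrow> z s \<omega> = free_obs s \<omega>" and ad: "adapted_to_history M z u"
    using u unfolding ctrl_def by blast
  have "u t \<in> borel_measurable (history M z t)" using ad t by (simp add: adapted_to_history_def)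
  then have "(\<lambda>\<omega>. v \<bullet> u t \<omega>) \<in> borel_measurable (history M z t)" by (intro borel_measurable_inner borel_measurable_const)
  then show ?thesis by (intro orth_history[OF Z orth z _ sq])
qed

lemma l2v_ctrl: "ctrl u \<Longrightarrow> 0 \<le> T \<Longrightarrow> l2v T u"
  by (simp add: ctrl_def)

lemma ctrl_path:
  assumes "ctrl u" "\<omega> \<in> space M" "0 \<le> T"
  shows "integrable (itv 0 T) (\<lambda>s. (A *v u s \<omega>) $ i)"
proof -
  have [measurable]: "(\<lambda>(t, \<omega>). u t \<omega>) \<in> borel_measurable (borel \<Otimes>\<^sub>M M)" using assms by (simp add: ctrl_def)
  have m: "(\<lambda>s. u s \<omega>) \<in> borel_measurable borel" using assms(2) by measurable
  have "set_integrable lborel {0..T} (\<lambda>s. u s \<omega>)" using assms by (simp add: ctrl_def)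
  then have "integrable (itv 0 T) (\<lambda>s. u s \<omega>)" by (simp add: integrable_itv[OF m])
  then show ?thesis unfolding matrix_vector_nth by (rule integrable_inner_right)
qed

text \<open>The product formula applies to every output feedback: the input at time \<open>t\<close>
  is a function of the observations up to \<open>t\<close>, and those are orthogonal to later
  increments of the noise.\<close>

lemma state_expectation_product:
  assumes u: "ctrl u" and T: "0 \<le> T"
  shows "l2_joint 0 T (\<lambda>t \<omega>. state u t \<omega> $ i)" "sq_int (\<lambda>\<omega>. state u T \<omega> $ i)"
    "expectation (\<lambda>\<omega>. state u T \<omega> $ i * state u T \<omega> $ j) = x\<^sub>0 $ i * x\<^sub>0 $ j + S $ i $ j * T +
      (\<integral>t. expectation (\<lambda>\<omega>. state u t \<omega> $ i * (B *v u t \<omega>) $ j) \<partial>itv 0 T) +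
      (\<integral>t. expectation (\<lambda>\<omega>. state u t \<omega> $ j * (B *v u t \<omega>) $ i) \<partial>itv 0 T)"
proof -
  let ?k = "\<lambda>q :: bool. if q then i else j"
  let ?g = "\<lambda>q t \<omega>. (B *v u t \<omega>) $ ?k q" and ?n = "\<lambda>q. W (\<Gamma> $ ?k q)" and ?x = "\<lambda>q t \<omega>. state u t \<omega> $ ?k q"
    and ?c = "\<lambda>q. x\<^sub>0 $ ?k q"
  have g: "l2_joint 0 T (?g q)" for q
    using l2v_mult[OF l2v_ctrl[OF u T], of B] unfolding l2v_def by blast
  have S': "(\<Gamma> $ i) \<bullet> (\<Gamma> $ j) = S $ i $ j"
    using rows_inner[of "mat 1" \<Gamma> i "mat 1" \<Gamma> j] by (simp add: \<Gamma>)
  have orth: "expectation (\<lambda>\<omega>. (?n q T \<omega> - ?n q t \<omega>) * ?g q' t \<omega>) = 0" if "t \<in> {0..T}" "sq_int (?g q' t)" for q q' t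
    using that unfolding matrix_vector_nth
    by (intro ctrl_orth[OF u]) (auto intro!: gauss_diff gauss_W W_increment_obs_orth)
  have mean: "expectation (?n q T) = 0" for q
    unfolding W_def inner_vec_def inner_real_def using T w_moments
    by (subst Bochner_Integration.integral_sum) (auto intro!: integrable_mult_right sq_int_integrable simp: max_absorb2)
  have cov: "expectation (\<lambda>\<omega>. ?n True T \<omega> * ?n False T \<omega>) = S $ i $ j * T"
    using W_cov[OF T T, of "\<Gamma> $ i" "\<Gamma> $ j"] by (simp add: S')
  have path: "integrable (itv 0 T) (\<lambda>s. ?g q s \<omega>)" if "\<omega> \<in> space M" for q \<omega>
    by (rule ctrl_path[OF u that T])
  have x: "?x q t \<omega> = ?c q + (\<integral>s. ?g q s \<omega> \<partial>itv 0 t) + ?n q t \<omega>" for q t \<omega>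
    by (simp add: state_def)
  note F = expectation_product_formula[of T ?g ?n "S $ i $ j" ?x ?c, OF T g l2_process_W path mean cov orth x]
  show "l2_joint 0 T (\<lambda>t \<omega>. state u t \<omega> $ i)" "sq_int (\<lambda>\<omega>. state u T \<omega> $ i)"
    using F(1)[of True] F(2)[of True] by simp_all
  show "expectation (\<lambda>\<omega>. state u T \<omega> $ i * state u T \<omega> $ j) = x\<^sub>0 $ i * x\<^sub>0 $ j + S $ i $ j * T +
      (\<integral>t. expectation (\<lambda>\<omega>. state u t \<omega> $ i * (B *v u t \<omega>) $ j) \<partial>itv 0 T) +
      (\<integral>t. expectation (\<lambda>\<omega>. state u t \<omega> $ j * (B *v u t \<omega>) $ i) \<partial>itv 0 T)"
    using F(3) by simp
qed

lemma l2v_state: "ctrl u \<Longrightarrow> 0 \<le> T \<Longrightarrow> l2v T (state u)"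
  unfolding l2v_def using state_expectation_product(1) by blast

text \<open>Ito's formula for \<open>x \<bullet> (X *v x)\<close> in expectation, summed from
  products of coordinates. The symmetry of \<open>X\<close> merges the two mixed terms, and the
  covariation gives the trace.\<close>

lemma phi_eq:
  assumes u: "ctrl u" and T: "0 \<le> T"
  shows "phi u T = x\<^sub>0 \<bullet> (X *v x\<^sub>0) + T * trace (S ** X) + 2 * IP T (state u) (\<lambda>t \<omega>. X *v (B *v u t \<omega>))"
proof -
  define h where "h i j = (\<integral>t. expectation (\<lambda>\<omega>. state u t \<omega> $ i * (B *v u t \<omega>) $ j) \<partial>itv 0 T)" for i j
  have Xs: "X $ i $ j = X $ j $ i" for i j using arg_cong[OF sym(3), of "\<lambda>A. A $ j $ i"] by (simp add: transpose_def)
  note F = state_expectation_product[OF u T]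
  have "phi u T = expectation (\<lambda>\<omega>. \<Sum>i\<in>UNIV. \<Sum>j\<in>UNIV. X $ i $ j * (state u T \<omega> $ i * state u T \<omega> $ j))"
    unfolding phi_def by (simp add: inner_vec_def matrix_vector_mult_def sum_distrib_left ac_simps)
  also have "\<dots> = (\<Sum>i\<in>UNIV. \<Sum>j\<in>UNIV. X $ i $ j * expectation (\<lambda>\<omega>. state u T \<omega> $ i * state u T \<omega> $ j))"
    using integrable_mult_sq_int[OF F(2) F(2)] by (simp add: Bochner_Integration.integral_sum)
  also have "\<dots> = (\<Sum>i\<in>UNIV. \<Sum>j\<in>UNIV. X $ i $ j * (x\<^sub>0 $ i * x\<^sub>0 $ j)) + T * (\<Sum>i\<in>UNIV. \<Sum>j\<in>UNIV. X $ i $ j * S $ i $ j)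
    + ((\<Sum>i\<in>UNIV. \<Sum>j\<in>UNIV. X $ i $ j * h i j) + (\<Sum>i\<in>UNIV. \<Sum>j\<in>UNIV. X $ i $ j * h j i))"
    unfolding F(3) h_def[symmetric] by (simp add: distrib_left sum.distrib sum_distrib_left ac_simps)
  also have "(\<Sum>i\<in>UNIV. \<Sum>j\<in>UNIV. X $ i $ j * h j i) = (\<Sum>i\<in>UNIV. \<Sum>j\<in>UNIV. X $ i $ j * h i j)"
    by (subst sum.swap) (simp add: Xs)
  also have "(\<Sum>i\<in>UNIV. \<Sum>j\<in>UNIV. X $ i $ j * h i j) = IP T (state u) (\<lambda>t \<omega>. X *v (B *v u t \<omega>))"
    unfolding h_def by (rule IP_matrix[symmetric, OF l2v_state[OF u T] l2v_mult[OF l2v_ctrl[OF u T]]])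
  also have "(\<Sum>i\<in>UNIV. \<Sum>j\<in>UNIV. X $ i $ j * (x\<^sub>0 $ i * x\<^sub>0 $ j)) = x\<^sub>0 \<bullet> (X *v x\<^sub>0)"
    by (simp add: inner_vec_def matrix_vector_mult_def sum_distrib_left ac_simps)
  also have "(\<Sum>i\<in>UNIV. \<Sum>j\<in>UNIV. X $ i $ j * S $ i $ j) = trace (S ** X)"
    unfolding trace_def matrix_matrix_mult_def by (simp add: Xs ac_simps)
  finally show ?thesis by simp
qed

lemma R_Kt: "R ** Kt = transpose B ** X" "transpose Kt ** R = X ** B" "transpose Kt ** R ** Kt = Q"
proof -
  show 1: "R ** Kt = transpose B ** X" unfolding Kt_def using pos_def_inverse(1)[OF R] by (simp add: matrix_mul_assoc)
  have "transpose (R ** Kt) = X ** B" unfolding 1 by (simp add: matrix_transpose_mul sym)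
  then show 2: "transpose Kt ** R = X ** B" by (simp add: matrix_transpose_mul sym)
  have "transpose Kt ** R ** Kt = X ** B ** Kt" by (simp only: 2)
  also have "\<dots> = Q" unfolding Kt_def ric[symmetric] by (simp only: matrix_mul_assoc)
  finally show "transpose Kt ** R ** Kt = Q" .
qed

lemma quad_forms:
  "(Kt *v x) \<bullet> (R *v u) = x \<bullet> (X *v (B *v u))" "u \<bullet> (R *v (Kt *v x)) = x \<bullet> (X *v (B *v u))"
  "(Kt *v x) \<bullet> (R *v (Kt *v y)) = x \<bullet> (Q *v y)" "X *v (B *v (Kt *v y)) = Q *v y"
proof -
  have *: "(Kt *v x) \<bullet> v = x \<bullet> (transpose Kt *v v)" for x v
    by (simp add: inner_matrix_transpose[of x "transpose Kt"] del: transpose_matrix_vector)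
  have 1: "(Kt *v x) \<bullet> (R *v u) = x \<bullet> (X *v (B *v u))" for x u
    unfolding * matrix_vector_mul_assoc R_Kt by (simp add: matrix_vector_mul_assoc)
  then show "(Kt *v x) \<bullet> (R *v u) = x \<bullet> (X *v (B *v u))" .
  have XBK: "X ** B ** Kt = Q" using R_Kt(3) unfolding R_Kt(2) .
  show "u \<bullet> (R *v (Kt *v x)) = x \<bullet> (X *v (B *v u))"
    unfolding pos_def_inner_sym[OF sym(2), of u "Kt *v x"] 1 ..
  show "X *v (B *v (Kt *v y)) = Q *v y" by (simp add: matrix_vector_mul_assoc matrix_mul_assoc XBK)
  show "(Kt *v x) \<bullet> (R *v (Kt *v y)) = x \<bullet> (Q *v y)"
    unfolding 1 by (simp add: matrix_vector_mul_assoc matrix_mul_assoc XBK)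
qed

definition cost :: "(real \<Rightarrow> 'a \<Rightarrow> real^'m) \<Rightarrow> real \<Rightarrow> real" where
  "cost u T = IP T (state u) (\<lambda>t \<omega>. Q *v state u t \<omega>) + IP T u (\<lambda>t \<omega>. R *v u t \<omega>)"

lemma l2v_residual: "ctrl u \<Longrightarrow> 0 \<le> T \<Longrightarrow> l2v T (\<lambda>t \<omega>. u t \<omega> + Kt *v state u t \<omega>)"
  by (intro l2v_add l2v_mult l2v_ctrl l2v_state)

text \<open>By the Riccati equation \<open>x \<bullet> (Q *v x)\<close> is the squared
  \<open>R\<close>-norm of \<open>Kt *v x\<close>, so the cost lacks only the cross term of a
  complete square, and this is the term that \<open>phi_eq\<close> contributes.\<close>

lemma cost_identity:
  assumes u: "ctrl u" and T: "0 \<le> T"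
  shows "cost u T + phi u T = x\<^sub>0 \<bullet> (X *v x\<^sub>0) + T * trace (S ** X)
    + IP T (\<lambda>t \<omega>. u t \<omega> + Kt *v state u t \<omega>) (\<lambda>t \<omega>. R *v (u t \<omega> + Kt *v state u t \<omega>))"
proof -
  let ?N = "itv 0 T \<Otimes>\<^sub>M M"
  note lu = l2v_ctrl[OF u T] and lx = l2v_state[OF u T]
  note i1 = l2v_inner[OF lx l2v_mult[OF lx, of Q]] and i2 = l2v_inner[OF lu l2v_mult[OF lu, of R]]
    and i3 = l2v_inner[OF lx l2v_mult[OF l2v_mult[OF lu, of B], of X]]
  have "IP T (\<lambda>t \<omega>. u t \<omega> + Kt *v state u t \<omega>) (\<lambda>t \<omega>. R *v (u t \<omega> + Kt *v state u t \<omega>))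
    = (\<integral>p. (\<lambda>(t, \<omega>). state u t \<omega> \<bullet> (Q *v state u t \<omega>)) p + (\<lambda>(t, \<omega>). u t \<omega> \<bullet> (R *v u t \<omega>)) p
       + 2 * (\<lambda>(t, \<omega>). state u t \<omega> \<bullet> (X *v (B *v u t \<omega>))) p \<partial>?N)"
    unfolding IP_def
    by (rule Bochner_Integration.integral_cong[OF refl])
       (simp add: case_prod_unfold matrix_vector_right_distrib inner_add_left inner_add_right quad_forms)
  also have "\<dots> = cost u T + 2 * IP T (state u) (\<lambda>t \<omega>. X *v (B *v u t \<omega>))"
    unfolding cost_def IP_def using i1 i2 i3 by simp
  finally show ?thesis using phi_eq[OF u T] by simp
qed

lemma l2_process_e: "l2_process (\<lambda>t \<omega>. e t \<omega> $ i)"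
  unfolding e_def matrix_vector_mult_def
  by (simp, intro l2_process_sum l2_process_mult_fun l2_process_err continuous_intros)

lemma l2v_e: "l2v T e"
  unfolding l2v_def by (intro allI l2_process_joint[OF l2_process_e]) simp

lemma sq_int_e: "sq_int (\<lambda>\<omega>. e t \<omega> $ i)"
  by (rule l2_process_sq_int[OF l2_process_e])

lemma gauss_e: "0 \<le> t \<Longrightarrow> gauss (\<lambda>\<omega>. e t \<omega> $ i)"
  unfolding e_def matrix_vector_mult_def by (simp, intro gauss_sum gauss_cmult gauss_err)

lemma noise_eq: "W (\<Gamma> $ i) t \<omega> = ((S ** transpose P) *v (\<chi> k. W (a k) t \<omega>)) $ i"
proof -
  have "(\<chi> k. W (a k) t \<omega>) = (P ** \<Gamma>) *v w (max 0 t) \<omega>"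
    by (simp add: vec_eq_iff W_def a_def matrix_vector_nth)
  then have "(S ** transpose P) *v (\<chi> k. W (a k) t \<omega>) = \<Gamma> *v w (max 0 t) \<omega>"
    by (simp add: matrix_vector_mul_assoc matrix_mul_assoc SPP)
  then show ?thesis by (simp add: W_def matrix_vector_nth)
qed

text \<open>Entry \<open>(i, j)\<close> of the error covariance: the solution, started at 0, of the
  Riccati differential equation whose limit is the stationary Riccati solution.\<close>

definition evar :: "'k \<Rightarrow> 'k \<Rightarrow> real \<Rightarrow> real" where
  "evar i j t = (\<Sum>k\<in>UNIV. (S ** transpose P) $ i $ k * (S ** transpose P) $ j $ k * (tanh (l k * t) / l k))"

lemma e_cov:
  assumes t: "0 \<le> t"
  shows "expectation (\<lambda>\<omega>. e t \<omega> $ i * e t \<omega> $ j) = evar i j t"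
    and "expectation (\<lambda>\<omega>. e t \<omega> $ i * W (\<Gamma> $ j) t \<omega>) = evar i j t"
proof -
  let ?L = "S ** transpose P"
  have *: "expectation (\<lambda>\<omega>. e t \<omega> $ i * (?L *v (\<chi> k. Z k \<omega>)) $ j) = evar i j t"
    if Z: "\<And>k. sq_int (Z k)" and c: "\<And>k m. expectation (\<lambda>\<omega>. er k t \<omega> * Z m \<omega>) = (if k = m then tanh (l k * t) / l k else 0)" for Z
  proof -
    have "expectation (\<lambda>\<omega>. e t \<omega> $ i * (?L *v (\<chi> k. Z k \<omega>)) $ j) = expectation (\<lambda>\<omega>. \<Sum>k\<in>UNIV. \<Sum>m\<in>UNIV. ?L $ i $ k * ?L $ j $ m * (er k t \<omega> * Z m \<omega>))"
      unfolding e_def matrix_vector_mult_def vec_lambda_beta sum_product by (simp only: ac_simps)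
    also have "\<dots> = (\<Sum>k\<in>UNIV. \<Sum>m\<in>UNIV. ?L $ i $ k * ?L $ j $ m * (if k = m then tanh (l k * t) / l k else 0))"
      using integrable_mult_sq_int[OF l2_process_sq_int[OF l2_process_err] Z] by (simp add: Bochner_Integration.integral_sum c)
    also have "\<dots> = evar i j t" unfolding evar_def by (simp add: mult_if_0)
    finally show ?thesis .
  qed
  show "expectation (\<lambda>\<omega>. e t \<omega> $ i * e t \<omega> $ j) = evar i j t"
    using *[of "\<lambda>k. er k t"] er_cov(2)[OF t] l2_process_sq_int[OF l2_process_err] by (simp add: e_def)
  show "expectation (\<lambda>\<omega>. e t \<omega> $ i * W (\<Gamma> $ j) t \<omega>) = evar i j t"
    unfolding noise_eq[of j] by (rule *) (use er_cov(1)[OF t] sq_int_W in auto)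
qed

lemma e_orth_obs: "0 \<le> s \<Longrightarrow> s \<le> t \<Longrightarrow> expectation (\<lambda>\<omega>. e t \<omega> $ i * ob j s \<omega>) = 0"
proof -
  assume s: "0 \<le> s" "s \<le> t"
  have "expectation (\<lambda>\<omega>. e t \<omega> $ i * ob j s \<omega>) = expectation (\<lambda>\<omega>. \<Sum>k\<in>UNIV. (S ** transpose P) $ i $ k * (er k t \<omega> * ob j s \<omega>))"
    unfolding e_def matrix_vector_mult_def by (simp add: sum_distrib_right mult.assoc)
  also have "\<dots> = (\<Sum>k\<in>UNIV. (S ** transpose P) $ i $ k * expectation (\<lambda>\<omega>. er k t \<omega> * ob j s \<omega>))"
    using integrable_mult_sq_int[OF l2_process_sq_int[OF l2_process_err] l2_process_sq_int[OF l2_process_obs]]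
    by (simp add: Bochner_Integration.integral_sum)
  also have "\<dots> = 0" using err_obs_orth[OF l s orth_cond ab_inner(2) ab_inner(1)] by simp
  finally show ?thesis .
qed

lemma e_orth_ctrl:
  assumes u: "ctrl u" and s: "0 \<le> s" "s \<le> t" and sq: "sq_int (\<lambda>\<omega>. v \<bullet> u s \<omega>)"
  shows "expectation (\<lambda>\<omega>. e t \<omega> $ i * (v \<bullet> u s \<omega>)) = 0"
  by (rule ctrl_orth[OF u s(1) gauss_e _ sq]) (use s e_orth_obs in auto)

text \<open>The covariance of error and state is the same for every control: at each earlier time
  the input is a function of the observations up to that time, to which the error is orthogonal.
  Only the noise part of the state contributes.\<close>

lemma e_state_cov:
  assumes u: "ctrl u" and t: "0 \<le> t"
  shows "expectation (\<lambda>\<omega>. e t \<omega> $ i * state u t \<omega> $ j) = evar i j t"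
proof -
  have g: "l2_joint 0 t (\<lambda>s \<omega>. (B *v u s \<omega>) $ j)"
    using l2v_mult[OF l2v_ctrl[OF u t], of B] unfolding l2v_def by blast
  have "expectation (\<lambda>\<omega>. e t \<omega> $ i * (\<integral>s. (B *v u s \<omega>) $ j \<partial>itv 0 t)) = (\<integral>s. expectation (\<lambda>\<omega>. e t \<omega> $ i * (B *v u s \<omega>) $ j) \<partial>itv 0 t)"
    by (rule l2_joint_integral(4)[OF g t sq_int_e])
  also have "\<dots> = 0"
  proof (rule integral_eq_zero_AE)
    show "AE s in itv 0 t. expectation (\<lambda>\<omega>. e t \<omega> $ i * (B *v u s \<omega>) $ j) = 0"
      using l2_joint_integral(1)[OF g t] AE_itv[of 0 t]
    proof eventually_elim
      case (elim s)
      then show ?case unfolding matrix_vector_nth by (intro e_orth_ctrl[OF u]) auto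
    qed
  qed
  finally have 1: "expectation (\<lambda>\<omega>. e t \<omega> $ i * (\<integral>s. (B *v u s \<omega>) $ j \<partial>itv 0 t)) = 0" .
  \<comment> \<open>A constant is measurable for the history, so orthogonality to the history
    includes mean zero.\<close>
  have E0: "expectation (\<lambda>\<omega>. e t \<omega> $ i) = 0"
  proof -
    obtain z where z: "\<And>s \<omega>. 0 \<le> s \<Longrightarrow> \<omega> \<in> space M \<Longrightarrow> z s \<omega> = free_obs s \<omega>"
      using u unfolding ctrl_def by blast
    have "expectation (\<lambda>\<omega>. e t \<omega> $ i * (\<lambda>_. 1) \<omega>) = 0"
      by (rule orth_history[OF gauss_e[OF t] e_orth_obs z]) auto
    then show ?thesis by simp
  qed
  have "expectation (\<lambda>\<omega>. e t \<omega> $ i * state u t \<omega> $ j) = expectation (\<lambda>\<omega>. x\<^sub>0 $ j * (e t \<omega> $ i) + e t \<omega> $ i * (\<integral>s. (B *v u s \<omega>) $ j \<partial>itv 0 t) + e t \<omega> $ i * W (\<Gamma> $ j) t \<omega>)"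
    by (simp add: state_def algebra_simps)
  also have "\<dots> = evar i j t"
    using sq_int_integrable[OF sq_int_e] integrable_mult_sq_int[OF sq_int_e l2_joint_integral(5)[OF g t]] integrable_mult_sq_int[OF sq_int_e sq_int_W]
      1 E0 e_cov(2)[OF t] by simp
  finally show ?thesis .
qed

definition G :: "real \<Rightarrow> real" where "G T = IP T e (\<lambda>t \<omega>. Q *v e t \<omega>)"

lemma IP_e_state:
  assumes u: "ctrl u" and T: "0 \<le> T"
  shows "IP T e (\<lambda>t \<omega>. Q *v state u t \<omega>) = G T" and "IP T e (\<lambda>t \<omega>. X *v (B *v u t \<omega>)) = 0"
proof -
  interpret P: pair_sigma_finite "itv 0 T" M by (rule pair_sigma_finite_itv)
  have e_i: "l2_joint 0 T (\<lambda>t \<omega>. e t \<omega> $ i)" for i using l2v_e[of T] by (simp add: l2v_def)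
  have "(\<integral>t. expectation (\<lambda>\<omega>. e t \<omega> $ i * state u t \<omega> $ j) \<partial>itv 0 T) = (\<integral>t. expectation (\<lambda>\<omega>. e t \<omega> $ i * e t \<omega> $ j) \<partial>itv 0 T)" for i j
  proof (rule integral_cong_AE)
    show "(\<lambda>t. expectation (\<lambda>\<omega>. e t \<omega> $ i * state u t \<omega> $ j)) \<in> borel_measurable (itv 0 T)"
      using P.integrable_fst[OF l2_joint_mult[OF e_i state_expectation_product(1)[OF u T]]] by (rule borel_measurable_integrable)
    show "(\<lambda>t. expectation (\<lambda>\<omega>. e t \<omega> $ i * e t \<omega> $ j)) \<in> borel_measurable (itv 0 T)"
      using P.integrable_fst[OF l2_joint_mult[OF e_i e_i]] by (rule borel_measurable_integrable)
    show "AE t in itv 0 T. expectation (\<lambda>\<omega>. e t \<omega> $ i * state u t \<omega> $ j) = expectation (\<lambda>\<omega>. e t \<omega> $ i * e t \<omega> $ j)"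
      by (rule AE_itvI) (simp add: e_state_cov[OF u] e_cov)
  qed
  then show "IP T e (\<lambda>t \<omega>. Q *v state u t \<omega>) = G T"
    unfolding G_def IP_matrix[OF l2v_e l2v_state[OF u T]] IP_matrix[OF l2v_e l2v_e] by simp
  have "(\<integral>t. expectation (\<lambda>\<omega>. e t \<omega> $ i * u t \<omega> $ j) \<partial>itv 0 T) = 0" for i j
  proof (rule integral_eq_zero_AE)
    have uj: "l2_joint 0 T (\<lambda>t \<omega>. u t \<omega> $ j)" using l2v_ctrl[OF u T] by (simp add: l2v_def)
    show "AE t in itv 0 T. expectation (\<lambda>\<omega>. e t \<omega> $ i * u t \<omega> $ j) = 0"
      using l2_joint_integral(1)[OF uj T] AE_itv[of 0 T]
    proof eventually_elim
      case (elim t)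
      have eq: "u t \<omega> $ j = axis j 1 \<bullet> u t \<omega>" for \<omega> by (simp add: inner_axis')
      show ?case using elim unfolding eq by (intro e_orth_ctrl[OF u]) auto
    qed
  qed
  then show "IP T e (\<lambda>t \<omega>. X *v (B *v u t \<omega>)) = 0"
    unfolding matrix_vector_mul_assoc IP_matrix[OF l2v_e l2v_ctrl[OF u T]] by simp
qed

text \<open>Bessel's inequality in the \<open>R\<close>-norm: the residual is compared with
  \<open>Kt *v e\<close>, whose inner product with it is \<open>G T\<close> whatever the control, by
  \<open>IP_e_state\<close>.\<close>

lemma residual_lower_bound:
  assumes u: "ctrl u" and T: "0 \<le> T"
  shows "G T \<le> IP T (\<lambda>t \<omega>. u t \<omega> + Kt *v state u t \<omega>) (\<lambda>t \<omega>. R *v (u t \<omega> + Kt *v state u t \<omega>))"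
proof -
  let ?N = "itv 0 T \<Otimes>\<^sub>M M" and ?v = "\<lambda>t \<omega>. u t \<omega> + Kt *v state u t \<omega>"
  note lu = l2v_ctrl[OF u T] and lx = l2v_state[OF u T] and lv = l2v_residual[OF u T]
  note i1 = l2v_inner[OF l2v_e l2v_mult[OF lx, of Q]] and i2 = l2v_inner[OF l2v_e l2v_mult[OF l2v_mult[OF lu, of B], of X]]
    and i3 = l2v_inner[OF l2v_e l2v_mult[OF l2v_e, where A=Q]] and i4 = l2v_inner[OF lv l2v_mult[OF lv, of R]]
  have pt: "2 * (y \<bullet> (Q *v x) + y \<bullet> (X *v (B *v v))) - y \<bullet> (Q *v y) \<le> (v + Kt *v x) \<bullet> (R *v (v + Kt *v x))" for x y v
  proof -
    have "0 \<le> (v + Kt *v x - Kt *v y) \<bullet> (R *v (v + Kt *v x - Kt *v y))"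
      using pos_def_imp_pos_semidef[OF R] unfolding pos_semidef_def by blast
    also have "\<dots> = (v + Kt *v x) \<bullet> (R *v (v + Kt *v x)) - 2 * ((Kt *v y) \<bullet> (R *v (v + Kt *v x))) + (Kt *v y) \<bullet> (R *v (Kt *v y))"
      using pos_def_inner_sym[OF sym(2), of "v + Kt *v x" "Kt *v y"]
      by (simp add: matrix_vector_mult_diff_distrib inner_diff_left inner_diff_right)
    also have "(Kt *v y) \<bullet> (R *v (v + Kt *v x)) = y \<bullet> (X *v (B *v v)) + y \<bullet> (Q *v x)"
      by (simp add: matrix_vector_right_distrib inner_add_right quad_forms pos_def_inner_sym[OF sym(1), of x y])
    finally show ?thesis by (simp add: quad_forms)
  qed
  \<comment> \<open>This reads \<open>G T = 2 * (G T + 0) - G T\<close>, arranged to match the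
    left-hand side of \<open>pt\<close>.\<close>
  have "G T = 2 * (IP T e (\<lambda>t \<omega>. Q *v state u t \<omega>) + IP T e (\<lambda>t \<omega>. X *v (B *v u t \<omega>))) - G T"
    by (simp add: IP_e_state[OF u T])
  also have "\<dots> = (\<integral>p. 2 * ((\<lambda>(t, \<omega>). e t \<omega> \<bullet> (Q *v state u t \<omega>)) p + (\<lambda>(t, \<omega>). e t \<omega> \<bullet> (X *v (B *v u t \<omega>))) p)
      - (\<lambda>(t, \<omega>). e t \<omega> \<bullet> (Q *v e t \<omega>)) p \<partial>?N)"
    unfolding G_def IP_def using i1 i2 i3 by simp
  also have "\<dots> \<le> IP T ?v (\<lambda>t \<omega>. R *v ?v t \<omega>)"
    unfolding IP_def using i1 i2 i3 i4 by (intro integral_mono) (auto simp: pt[unfolded distrib_left])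
  finally show ?thesis .
qed

text \<open>The error variances have the primitive \<open>ln (cosh (l t)) / l\<^sup>2\<close>. The
  weights are the diagonal of \<open>Q\<close> in the coordinates that decouple the filter.\<close>

lemma G_eq:
  assumes T: "0 \<le> T"
  shows "G T = (\<Sum>k\<in>UNIV. (P ** S ** Q ** S ** transpose P) $ k $ k * (ln (cosh (l k * T)) / (l k)\<^sup>2))"
proof -
  let ?L = "S ** transpose P"
  have c: "continuous_on UNIV (\<lambda>t. tanh (l k * t) / l k)" for k
    using l[of k] by (intro continuous_intros) auto
  have I: "integral {0..T} (\<lambda>t. tanh (l k * t) / l k) = ln (cosh (l k * T)) / (l k)\<^sup>2" for k
  proof -
    have "((\<lambda>t. tanh (l k * t) / l k) has_integral (ln (cosh (l k * T)) / (l k)\<^sup>2 - ln (cosh (l k * 0)) / (l k)\<^sup>2)) {0..T}"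
    proof (rule fundamental_theorem_of_calculus[OF T])
      fix t
      have "((\<lambda>t. ln (cosh (l k * t)) / (l k)\<^sup>2) has_real_derivative tanh (l k * t) / l k) (at t)"
        using l[of k] cosh_real_pos[of "l k * t"]
        by (auto intro!: derivative_eq_intros simp: tanh_def power2_eq_square)
      then show "((\<lambda>t. ln (cosh (l k * t)) / (l k)\<^sup>2) has_vector_derivative tanh (l k * t) / l k) (at t within {0..T})"
        by (simp add: has_real_derivative_iff_has_vector_derivative has_vector_derivative_at_within)
    qed
    from integral_unique[OF this] show ?thesis by simp
  qed
  have ev: "(\<integral>t. expectation (\<lambda>\<omega>. e t \<omega> $ i * e t \<omega> $ j) \<partial>itv 0 T) = (\<Sum>k\<in>UNIV. ?L $ i $ k * ?L $ j $ k * (ln (cosh (l k * T)) / (l k)\<^sup>2))" for i j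
  proof -
    interpret P: pair_sigma_finite "itv 0 T" M by (rule pair_sigma_finite_itv)
    have e_i: "l2_joint 0 T (\<lambda>t \<omega>. e t \<omega> $ i)" for i using l2v_e[of T] by (simp add: l2v_def)
    have ce: "continuous_on UNIV (evar i j)" unfolding evar_def by (intro continuous_intros c)
    have "(\<integral>t. expectation (\<lambda>\<omega>. e t \<omega> $ i * e t \<omega> $ j) \<partial>itv 0 T) = (\<integral>t. evar i j t \<partial>itv 0 T)"
    proof (rule integral_cong_AE)
      show "(\<lambda>t. expectation (\<lambda>\<omega>. e t \<omega> $ i * e t \<omega> $ j)) \<in> borel_measurable (itv 0 T)"
        using P.integrable_fst[OF l2_joint_mult[OF e_i e_i]] by (rule borel_measurable_integrable)
      show "evar i j \<in> borel_measurable (itv 0 T)"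
        using integral_itv_continuous_UNIV(2)[OF ce] by (rule borel_measurable_integrable)
      show "AE t in itv 0 T. expectation (\<lambda>\<omega>. e t \<omega> $ i * e t \<omega> $ j) = evar i j t"
        by (rule AE_itvI) (simp add: e_cov)
    qed
    also have "\<dots> = (\<Sum>k\<in>UNIV. ?L $ i $ k * ?L $ j $ k * (\<integral>t. tanh (l k * t) / l k \<partial>itv 0 T))"
      unfolding evar_def using integral_itv_continuous_UNIV(2)[OF c]
      by (subst Bochner_Integration.integral_sum) (auto simp del: times_divide_eq_right)
    also have "\<dots> = (\<Sum>k\<in>UNIV. ?L $ i $ k * ?L $ j $ k * (ln (cosh (l k * T)) / (l k)\<^sup>2))"
      by (simp only: integral_itv_continuous_UNIV(1)[OF c] I)
    finally show ?thesis .
  qed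
  have diag: "(P ** S ** Q ** S ** transpose P) $ k $ k = (\<Sum>i\<in>UNIV. \<Sum>j\<in>UNIV. Q $ i $ j * (?L $ i $ k * ?L $ j $ k))" for k
  proof -
    have "(P ** S ** Q ** S ** transpose P) = (P ** S) ** Q ** transpose (P ** S)"
      by (simp add: matrix_transpose_mul sym matrix_mul_assoc)
    moreover have "(P ** S) $ k $ i = ?L $ i $ k" for i
    proof -
      have "P ** S = transpose ?L" by (simp add: matrix_transpose_mul sym)
      then show ?thesis by (simp add: transpose_def)
    qed
    ultimately show ?thesis
      by (simp add: congruence_nth inner_vec_def matrix_vector_mult_def sum_distrib_left ac_simps)
  qed
  have "G T = (\<Sum>i\<in>UNIV. \<Sum>j\<in>UNIV. \<Sum>k\<in>UNIV. Q $ i $ j * (?L $ i $ k * ?L $ j $ k) * (ln (cosh (l k * T)) / (l k)\<^sup>2))"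
    unfolding G_def IP_matrix[OF l2v_e l2v_e] ev by (simp only: sum_distrib_left mult.assoc)
  also have "\<dots> = (\<Sum>i\<in>UNIV. \<Sum>k\<in>UNIV. \<Sum>j\<in>UNIV. Q $ i $ j * (?L $ i $ k * ?L $ j $ k) * (ln (cosh (l k * T)) / (l k)\<^sup>2))"
    by (intro sum.cong refl sum.swap)
  also have "\<dots> = (\<Sum>k\<in>UNIV. \<Sum>i\<in>UNIV. \<Sum>j\<in>UNIV. Q $ i $ j * (?L $ i $ k * ?L $ j $ k) * (ln (cosh (l k * T)) / (l k)\<^sup>2))"
    by (rule sum.swap)
  also have "\<dots> = (\<Sum>k\<in>UNIV. (P ** S ** Q ** S ** transpose P) $ k $ k * (ln (cosh (l k * T)) / (l k)\<^sup>2))"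
    unfolding diag by (simp only: sum_distrib_right)
  finally show ?thesis .
qed

end

section \<open>From admissible controls to the lower bound\<close>

lemma history_cong:
  assumes "\<And>s \<omega>. s \<in> {0..t} \<Longrightarrow> \<omega> \<in> space M \<Longrightarrow> z s \<omega> = z' s \<omega>"
  shows "history M z t = history M z' t"
proof -
  have "z s -` A \<inter> space M = z' s -` A \<inter> space M" if "s \<in> {0..t}" for s A using assms[OF that] by auto
  then have "(\<Union>s\<in>{0..t}. {z s -` A \<inter> space M | A. A \<in> sets borel}) = (\<Union>s\<in>{0..t}. {z' s -` A \<inter> space M | A. A \<in> sets borel})"
    by (intro SUP_cong refl) auto
  then show ?thesis unfolding history_def by (rule arg_cong)
qed

lemma LINT_nth_continuous:
  fixes f :: "real \<Rightarrow> real^'n"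
  assumes "continuous_on {0..t} f"
  shows "set_integrable lborel {0..t} f" "(LINT s:{0..t}|lborel. f s) $ i = integral {0..t} (\<lambda>s. f s $ i)"
proof -
  show i: "set_integrable lborel {0..t} f" by (rule borel_integrable_atLeastAtMost'[OF assms])
  show "(LINT s:{0..t}|lborel. f s) $ i = integral {0..t} (\<lambda>s. f s $ i)"
    using set_borel_integral_eq_integral[OF i] integral_component_eq_cart[of f "{0..t}" i] by simp
qed

lemma pos_def_dominates:
  fixes A Q :: "real^'n^'n"
  assumes "pos_def Q"
  obtains \<kappa> where "0 \<le> \<kappa>" "\<And>x. x \<bullet> (A *v x) \<le> \<kappa> * (x \<bullet> (Q *v x))"
proof -
  obtain c where c: "c > 0" "\<And>x. c * (x \<bullet> x) \<le> x \<bullet> (Q *v x)" using pos_def_coercive[OF assms] by metis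
  obtain b where b: "b > 0" "\<And>x. norm (A *v x) \<le> b * norm x"
    using linear_bounded_pos[OF matrix_vector_mul_linear[of A]] by (metis mult.commute)
  show ?thesis
  proof (rule that[of "b / c"])
    fix x
    have "x \<bullet> (A *v x) \<le> norm x * (b * norm x)"
      using norm_cauchy_schwarz[of x "A *v x"] mult_left_mono[OF b(2)[of x], of "norm x"] by simp
    also have "\<dots> = b / c * (c * (x \<bullet> x))" using c(1) by (simp add: power2_norm_eq_inner[symmetric] power2_eq_square)
    also have "\<dots> \<le> b / c * (x \<bullet> (Q *v x))" using c b(1) by (intro mult_left_mono) auto
    finally show "x \<bullet> (A *v x) \<le> b / c * (x \<bullet> (Q *v x))" .
  qed (use b c in simp)
qed

context prob_space
begin

lemma IP_mono_scaled:
  assumes "l2v T Z" "0 \<le> \<kappa>" "\<And>x. x \<bullet> (A *v x) \<le> \<kappa> * (x \<bullet> (A' *v x))"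
  shows "IP T Z (\<lambda>t \<omega>. A *v Z t \<omega>) \<le> \<kappa> * IP T Z (\<lambda>t \<omega>. A' *v Z t \<omega>)"
proof -
  have "IP T Z (\<lambda>t \<omega>. A *v Z t \<omega>) \<le> (\<integral>p. \<kappa> * (\<lambda>(t, \<omega>). Z t \<omega> \<bullet> (A' *v Z t \<omega>)) p \<partial>(itv 0 T \<Otimes>\<^sub>M M))"
    unfolding IP_def using l2v_inner[OF assms(1) l2v_mult[OF assms(1), of A]] l2v_inner[OF assms(1) l2v_mult[OF assms(1), of A']]
    by (intro integral_mono integrable_mult_right) (auto simp: assms(3))
  then show ?thesis unfolding IP_def by simp
qed

lemma IP_nonneg:
  assumes "\<And>x. 0 \<le> x \<bullet> (A *v x)"
  shows "0 \<le> IP T Z (\<lambda>t \<omega>. A *v Z t \<omega>)"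
  unfolding IP_def by (rule Bochner_Integration.integral_nonneg) (auto simp: assms)

end

context lqg_driftless
begin

lemma semidef: "0 \<le> x \<bullet> (Q *v x)" "0 \<le> y \<bullet> (R *v y)" "0 \<le> x \<bullet> (X *v x)"
  using pos_def_imp_pos_semidef[OF Q] pos_def_imp_pos_semidef[OF R] pos_def_imp_pos_semidef[OF X]
  unfolding pos_semidef_def by blast+

lemma a_W: "W (a k) t \<omega> = (\<Sum>i\<in>UNIV. P $ k $ i * W (\<Gamma> $ i) t \<omega>)"
proof -
  have "(P ** \<Gamma>) $ k = (\<Sum>i\<in>UNIV. P $ k $ i *\<^sub>R \<Gamma> $ i)" by (simp add: vec_eq_iff matrix_matrix_mult_def)
  then show ?thesis unfolding W_def a_def by (simp add: inner_sum_left)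
qed

lemma W_continuous: "\<omega> \<in> space M \<Longrightarrow> continuous_on UNIV (\<lambda>s. W v s \<omega>)"
  by (rule l2_process_cont[OF l2_process_W])

lemma obs_vector:
  assumes \<omega>: "\<omega> \<in> space M" and t: "0 \<le> t"
  shows "U *v (C *v (\<chi> i. integral {0..t} (\<lambda>s. W (\<Gamma> $ i) s \<omega>)) + D *v w t \<omega>) = (\<chi> k. ob k t \<omega>)"
proof -
  let ?I = "\<chi> i. integral {0..t} (\<lambda>s. W (\<Gamma> $ i) s \<omega>)"
  have "(diag_mat l ** P *v ?I) $ k = l k * integral {0..t} (\<lambda>s. W (a k) s \<omega>)" for k
  proof -
    have "integral {0..t} (\<lambda>s. W (a k) s \<omega>) = (\<Sum>i\<in>UNIV. integral {0..t} (\<lambda>s. P $ k $ i * W (\<Gamma> $ i) s \<omega>))"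
      unfolding a_W by (rule Henstock_Kurzweil_Integration.integral_sum)
        (auto intro!: integral_itv_continuous_UNIV(3) continuous_intros W_continuous \<omega>)
    moreover have "(diag_mat l ** P *v ?I) $ k = l k * (P *v ?I) $ k" by (simp only: matrix_vector_mul_assoc[symmetric] diag_mat_vec)
    ultimately show ?thesis by (simp add: matrix_vector_mult_def)
  qed
  moreover have "(U ** D *v w t \<omega>) $ k = W (b k) t \<omega>" for k
    using t by (simp add: W_def b_def matrix_vector_nth max_absorb2)
  ultimately show ?thesis
    using t by (simp add: vec_eq_iff matrix_vector_right_distrib matrix_vector_mul_assoc UC obs_def max_absorb2)
qed

text \<open>The accumulated input \<open>y\<close> enters the observation additively. The case
  \<open>y = 0\<close> identifies the uncontrolled observation with \<open>free_obs\<close>; the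
  general case serves the closed loop of the optimal control.\<close>

lemma observation_eq:
  assumes \<omega>: "\<omega> \<in> space M" and t: "0 \<le> t"
    and x: "\<And>s. 0 \<le> s \<Longrightarrow> x s \<omega> = x\<^sub>0 + y s + \<Gamma> *v w s \<omega>" and y: "continuous_on UNIV y"
  shows "lqg_observation C (\<lambda>t \<omega>. D *v w t \<omega>) x t \<omega> = free_obs t \<omega> + C *v (\<chi> i. integral {0..t} (\<lambda>s. y s $ i))"
proof -
  let ?I = "\<chi> i. integral {0..t} (\<lambda>s. W (\<Gamma> $ i) s \<omega>)" and ?J = "\<chi> i. integral {0..t} (\<lambda>s. y s $ i)"
  have wc: "continuous_on {0..t} (\<lambda>s. w s \<omega>)" by (rule continuous_on_subset[OF w_continuous[OF \<omega>]]) auto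
  have yc: "continuous_on {0..t} y" using y by (rule continuous_on_subset) simp
  have fc: "continuous_on {0..t} (\<lambda>s. C *v (x\<^sub>0 + y s + \<Gamma> *v w s \<omega>))"
    by (intro matrix_vector_mult_linear_continuous_on[THEN continuous_on_compose2, of _ _ UNIV] continuous_intros yc
        continuous_on_compose2[OF matrix_vector_mult_linear_continuous_on wc]) auto
  have "(LINT s:{0..t}|lborel. C *v x s \<omega>) = (LINT s:{0..t}|lborel. C *v (x\<^sub>0 + y s + \<Gamma> *v w s \<omega>))"
    by (rule set_lebesgue_integral_cong) (auto simp: x)
  also have "\<dots> = C *v (t *\<^sub>R x\<^sub>0 + ?J + ?I)"
  proof (subst vec_eq_iff, intro allI)
    fix j
    have yi: "(\<lambda>s. y s $ i) integrable_on {0..t}" for i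
      by (rule integral_itv_continuous_UNIV(3)) (intro continuous_intros y)
    have Wi: "(\<lambda>s. W v s \<omega>) integrable_on {0..t}" for v
      by (rule integral_itv_continuous_UNIV(3)[OF W_continuous[OF \<omega>]])
    have "(LINT s:{0..t}|lborel. C *v (x\<^sub>0 + y s + \<Gamma> *v w s \<omega>)) $ j = integral {0..t} (\<lambda>s. (C *v (x\<^sub>0 + y s + \<Gamma> *v w s \<omega>)) $ j)"
      by (rule LINT_nth_continuous(2)[OF fc])
    also have "\<dots> = integral {0..t} (\<lambda>s. \<Sum>i\<in>UNIV. C $ j $ i * (x\<^sub>0 $ i + y s $ i + W (\<Gamma> $ i) s \<omega>))"
      by (rule Henstock_Kurzweil_Integration.integral_cong) (simp add: matrix_vector_mult_def[of C] matrix_vector_nth W_def max_absorb2)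
    also have "\<dots> = (\<Sum>i\<in>UNIV. C $ j $ i * integral {0..t} (\<lambda>s. x\<^sub>0 $ i + y s $ i + W (\<Gamma> $ i) s \<omega>))"
      by (subst Henstock_Kurzweil_Integration.integral_sum)
         (auto intro!: integral_itv_continuous_UNIV(3) continuous_intros y W_continuous[OF \<omega>])
    also have "\<dots> = (\<Sum>i\<in>UNIV. C $ j $ i * (t *\<^sub>R x\<^sub>0 + ?J + ?I) $ i)"
    proof (intro sum.cong refl arg_cong2[where f="(*)"])
      fix i
      have "integral {0..t} (\<lambda>s. x\<^sub>0 $ i + y s $ i) = t * x\<^sub>0 $ i + integral {0..t} (\<lambda>s. y s $ i)"
        using Henstock_Kurzweil_Integration.integral_add[OF integrable_const_ivl yi, of "x\<^sub>0 $ i" i] t by simp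
      then show "integral {0..t} (\<lambda>s. x\<^sub>0 $ i + y s $ i + W (\<Gamma> $ i) s \<omega>) = (t *\<^sub>R x\<^sub>0 + ?J + ?I) $ i"
        using Henstock_Kurzweil_Integration.integral_add[OF integrable_add[OF integrable_const_ivl yi] Wi, of "x\<^sub>0 $ i" i "\<Gamma> $ i"] by simp
    qed
    finally show "(LINT s:{0..t}|lborel. C *v (x\<^sub>0 + y s + \<Gamma> *v w s \<omega>)) $ j = (C *v (t *\<^sub>R x\<^sub>0 + ?J + ?I)) $ j"
      by (simp add: matrix_vector_mult_def)
  qed
  finally have "lqg_observation C (\<lambda>t \<omega>. D *v w t \<omega>) x t \<omega> = t *\<^sub>R (C *v x\<^sub>0) + C *v ?J + (C *v ?I + D *v w t \<omega>)"
    unfolding lqg_observation_def by (simp add: matrix_vector_right_distrib matrix_vector_mult_scaleR add.assoc)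
  \<comment> \<open>The noise part of the observation is sent through \<open>U\<close> and back,
    which exposes the scalar channels.\<close>
  also have "C *v ?I + D *v w t \<omega> = V ** transpose U ** U *v (C *v ?I + D *v w t \<omega>)" by (simp add: VUU)
  also have "\<dots> = (V ** transpose U) *v (\<chi> k. ob k t \<omega>)"
    unfolding obs_vector[OF \<omega> t, symmetric] by (simp only: matrix_vector_mul_assoc)
  finally show ?thesis by (simp add: free_obs_def add.assoc add.commute)
qed

text \<open>With zero drift matrix the integral equation no longer contains the unknown, so the
  trajectory is an explicit functional of the control.\<close>

lemma trajectory_state:
  assumes tr: "lqg_trajectory M 0 B x\<^sub>0 (\<lambda>t \<omega>. \<Gamma> *v w t \<omega>) u x"
    and um: "(\<lambda>(t, \<omega>). u t \<omega>) \<in> borel_measurable (borel \<Otimes>\<^sub>M M)" and \<omega>: "\<omega> \<in> space M" and t: "0 \<le> t"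
  shows "x t \<omega> = state u t \<omega>"
proof -
  note [measurable] = um
  have m: "(\<lambda>s. u s \<omega>) \<in> borel_measurable borel" using \<omega> by measurable
  have su: "set_integrable lborel {0..t} (\<lambda>s. u s \<omega>)" and
    eq: "x t \<omega> = x\<^sub>0 + (LINT s:{0..t}|lborel. 0 *v x s \<omega> + B *v u s \<omega>) + \<Gamma> *v w t \<omega>"
    using tr \<omega> t unfolding lqg_trajectory_def by blast+
  have iu: "integrable (itv 0 t) (\<lambda>s. u s \<omega>)" using su by (simp add: integrable_itv[OF m])
  have iB: "integrable (itv 0 t) (\<lambda>s. B *v u s \<omega>)"
    by (rule integrable_bounded_linear[OF _ iu]) (rule matrix_vector_mul_bounded_linear)
  have "(LINT s:{0..t}|lborel. 0 *v x s \<omega> + B *v u s \<omega>) = (\<integral>s. B *v u s \<omega> \<partial>itv 0 t)"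
    using borel_measurable_integrable[OF iB] by (subst integral_itv) auto
  moreover have "(\<integral>s. B *v u s \<omega> \<partial>itv 0 t) $ i = (\<integral>s. (B *v u s \<omega>) $ i \<partial>itv 0 t)" for i
    using integral_bounded_linear[OF bounded_linear_vec_nth iB, of i] by simp
  ultimately show ?thesis
    unfolding eq state_def using t by (simp add: vec_eq_iff W_def matrix_vector_nth max_absorb2)
qed

lemma state_measurable:
  assumes um: "(\<lambda>(t, \<omega>). u t \<omega>) \<in> borel_measurable (borel \<Otimes>\<^sub>M M)"
  shows "(\<lambda>(t, \<omega>). state u t \<omega>) \<in> borel_measurable (borel \<Otimes>\<^sub>M M)"
proof (subst borel_measurable_euclidean_space, rule ballI)
  fix v :: "real^'k" assume "v \<in> Basis"
  then obtain i where v: "v = axis i 1" by (auto simp: Basis_vec_def)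
  have "(\<lambda>p. (B *v u (fst p) (snd p)) $ i) \<in> borel_measurable (borel \<Otimes>\<^sub>M M)"
    unfolding matrix_vector_nth using um by (intro borel_measurable_inner) (simp_all add: case_prod_unfold)
  then have "(\<lambda>(t, \<omega>). \<integral>s. (B *v u s \<omega>) $ i \<partial>itv 0 t) \<in> borel_measurable (borel \<Otimes>\<^sub>M M)"
    by (intro measurable_running_integral) (simp add: case_prod_unfold)
  moreover have "(\<lambda>(t, \<omega>). W (\<Gamma> $ i) t \<omega>) \<in> borel_measurable (borel \<Otimes>\<^sub>M M)"
    by (rule l2_process_measurable[OF l2_process_W])
  ultimately have "(\<lambda>p. x\<^sub>0 $ i + (\<lambda>(t, \<omega>). \<integral>s. (B *v u s \<omega>) $ i \<partial>itv 0 t) p + (\<lambda>(t, \<omega>). W (\<Gamma> $ i) t \<omega>) p) \<in> borel_measurable (borel \<Otimes>\<^sub>M M)"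
    by (intro borel_measurable_add borel_measurable_const)
  then show "(\<lambda>p. (case p of (t, \<omega>) \<Rightarrow> state u t \<omega>) \<bullet> v) \<in> borel_measurable (borel \<Otimes>\<^sub>M M)"
    by (simp add: v inner_axis case_prod_unfold state_def)
qed

definition rate :: "(real \<Rightarrow> 'a \<Rightarrow> real^'m) \<Rightarrow> real \<Rightarrow> 'a \<Rightarrow> real" where
  "rate u t \<omega> = state u t \<omega> \<bullet> (Q *v state u t \<omega>) + u t \<omega> \<bullet> (R *v u t \<omega>)"

lemma rate_nonneg: "0 \<le> rate u t \<omega>"
  unfolding rate_def by (intro add_nonneg_nonneg semidef)

lemma rate_measurable:
  assumes um: "(\<lambda>(t, \<omega>). u t \<omega>) \<in> borel_measurable (borel \<Otimes>\<^sub>M M)"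
  shows "(\<lambda>(t, \<omega>). rate u t \<omega>) \<in> borel_measurable (borel \<Otimes>\<^sub>M M)"
proof -
  have mv: "(\<lambda>p. (A *v f p) \<bullet> g p) \<in> borel_measurable N" if [measurable]: "f \<in> borel_measurable N" "g \<in> borel_measurable N"
    for A :: "real^'n^'p" and f :: "real \<times> 'a \<Rightarrow> real^'n" and g :: "real \<times> 'a \<Rightarrow> real^'p" and N
    by (intro borel_measurable_inner measurable_compose[OF that(1)] that borel_measurable_continuous_onI matrix_vector_mult_linear_continuous_on)
  show ?thesis
    unfolding rate_def case_prod_unfold
    using mv[of "\<lambda>p. state u (fst p) (snd p)" _ "\<lambda>p. state u (fst p) (snd p)" Q] mv[of "\<lambda>p. u (fst p) (snd p)" _ "\<lambda>p. u (fst p) (snd p)" R]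
      um state_measurable[OF um] by (auto simp: case_prod_unfold inner_commute)
qed

lemma total_cost_eq:
  assumes um: "(\<lambda>(t, \<omega>). u t \<omega>) \<in> borel_measurable (borel \<Otimes>\<^sub>M M)"
    and x: "\<And>t \<omega>. 0 \<le> t \<Longrightarrow> \<omega> \<in> space M \<Longrightarrow> x t \<omega> = state u t \<omega>"
  shows "(\<integral>\<^sup>+\<omega>. (\<integral>\<^sup>+t\<in>{0..T}. ennreal (x t \<omega> \<bullet> (Q *v x t \<omega>) + u t \<omega> \<bullet> (R *v u t \<omega>)) \<partial>lborel) \<partial>M)
    = (\<integral>\<^sup>+p. ennreal ((\<lambda>(t, \<omega>). rate u t \<omega>) p) \<partial>(itv 0 T \<Otimes>\<^sub>M M))"
proof -
  interpret P: pair_sigma_finite "itv 0 T" M by (rule pair_sigma_finite_itv)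
  note m = rate_measurable[OF um]
  have "(\<integral>\<^sup>+\<omega>. (\<integral>\<^sup>+t\<in>{0..T}. ennreal (x t \<omega> \<bullet> (Q *v x t \<omega>) + u t \<omega> \<bullet> (R *v u t \<omega>)) \<partial>lborel) \<partial>M)
    = (\<integral>\<^sup>+\<omega>. (\<integral>\<^sup>+t. ennreal (rate u t \<omega>) \<partial>itv 0 T) \<partial>M)"
  proof (rule nn_integral_cong)
    fix \<omega> assume \<omega>: "\<omega> \<in> space M"
    have "(\<lambda>t. ennreal (rate u t \<omega>)) \<in> borel_measurable borel" using m \<omega> by measurable
    then have "(\<integral>\<^sup>+t. ennreal (rate u t \<omega>) \<partial>itv 0 T) = (\<integral>\<^sup>+t\<in>{0..T}. ennreal (rate u t \<omega>) \<partial>lborel)"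
      by (rule nn_integral_itv)
    also have "\<dots> = (\<integral>\<^sup>+t\<in>{0..T}. ennreal (x t \<omega> \<bullet> (Q *v x t \<omega>) + u t \<omega> \<bullet> (R *v u t \<omega>)) \<partial>lborel)"
      by (rule nn_integral_cong) (auto simp: indicator_def rate_def x \<omega>)
    finally show "(\<integral>\<^sup>+t\<in>{0..T}. ennreal (x t \<omega> \<bullet> (Q *v x t \<omega>) + u t \<omega> \<bullet> (R *v u t \<omega>)) \<partial>lborel) = (\<integral>\<^sup>+t. ennreal (rate u t \<omega>) \<partial>itv 0 T)" ..
  qed
  also have "\<dots> = (\<integral>\<^sup>+p. ennreal ((\<lambda>(t, \<omega>). rate u t \<omega>) p) \<partial>(itv 0 T \<Otimes>\<^sub>M M))"
  proof -
    have "(\<lambda>p. ennreal ((\<lambda>(t, \<omega>). rate u t \<omega>) p)) \<in> borel_measurable (itv 0 T \<Otimes>\<^sub>M M)" using m by simp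
    from P.nn_integral_snd[OF this] show ?thesis by (simp add: case_prod_unfold)
  qed
  finally show ?thesis .
qed

lemma total_cost_ctrl:
  assumes u: "ctrl u" and T: "0 \<le> T"
  shows "(\<integral>\<^sup>+p. ennreal ((\<lambda>(t, \<omega>). rate u t \<omega>) p) \<partial>(itv 0 T \<Otimes>\<^sub>M M)) = ennreal (cost u T)"
proof -
  note i1 = l2v_inner[OF l2v_state[OF u T] l2v_mult[OF l2v_state[OF u T], where A=Q]] and i2 = l2v_inner[OF l2v_ctrl[OF u T] l2v_mult[OF l2v_ctrl[OF u T], where A=R]]
  have i: "integrable (itv 0 T \<Otimes>\<^sub>M M) (\<lambda>(t, \<omega>). rate u t \<omega>)"
    using Bochner_Integration.integrable_add[OF i1 i2] by (simp add: rate_def case_prod_unfold)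
  have "(\<integral>\<^sup>+p. ennreal ((\<lambda>(t, \<omega>). rate u t \<omega>) p) \<partial>(itv 0 T \<Otimes>\<^sub>M M)) = ennreal (\<integral>p. (\<lambda>(t, \<omega>). rate u t \<omega>) p \<partial>(itv 0 T \<Otimes>\<^sub>M M))"
    by (rule nn_integral_eq_integral[OF i]) (auto simp: rate_nonneg)
  also have "(\<integral>p. (\<lambda>(t, \<omega>). rate u t \<omega>) p \<partial>(itv 0 T \<Otimes>\<^sub>M M)) = cost u T"
    unfolding cost_def IP_def using Bochner_Integration.integral_add[OF i1 i2] by (simp add: rate_def case_prod_unfold)
  finally show ?thesis .
qed

lemma cost_nonneg: "0 \<le> cost u T"
  unfolding cost_def by (intro add_nonneg_nonneg IP_nonneg semidef)

lemma total_rate_mono: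
  assumes "s \<le> T" and um: "(\<lambda>(t, \<omega>). u t \<omega>) \<in> borel_measurable (borel \<Otimes>\<^sub>M M)"
  shows "(\<integral>\<^sup>+p. ennreal ((\<lambda>(t, \<omega>). rate u t \<omega>) p) \<partial>(itv 0 s \<Otimes>\<^sub>M M)) \<le> (\<integral>\<^sup>+p. ennreal ((\<lambda>(t, \<omega>). rate u t \<omega>) p) \<partial>(itv 0 T \<Otimes>\<^sub>M M))"
  unfolding total_cost_eq[OF um refl, symmetric] using assms(1)
  by (intro nn_integral_mono) (auto simp: indicator_def)

lemma cost_mono:
  assumes u: "ctrl u" and s: "0 \<le> s" "s \<le> T"
  shows "cost u s \<le> cost u T"
proof -
  have "ennreal (cost u s) \<le> ennreal (cost u T)"
    unfolding total_cost_ctrl[OF u s(1), symmetric] total_cost_ctrl[OF u order_trans[OF s], symmetric]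
    by (rule total_rate_mono[OF s(2)]) (use u in \<open>simp add: ctrl_def\<close>)
  then show ?thesis by (simp add: cost_nonneg)
qed

lemma phi_nonneg: "0 \<le> phi u T"
  unfolding phi_def by (rule Bochner_Integration.integral_nonneg) (rule semidef)

text \<open>Since \<open>Q\<close> is definite, \<open>X\<close> is dominated by a multiple of
  \<open>Q\<close>: the terminal cost can be large at single times, but not on average over
  time.\<close>

lemma integral_phi_le_cost:
  obtains \<kappa> where "0 \<le> \<kappa>" "\<And>u T. ctrl u \<Longrightarrow> 0 \<le> T \<Longrightarrow> integrable (itv 0 T) (phi u) \<and> (\<integral>t. phi u t \<partial>itv 0 T) \<le> \<kappa> * cost u T"
proof -
  obtain \<kappa> where \<kappa>: "0 \<le> \<kappa>" "\<And>x. x \<bullet> (X *v x) \<le> \<kappa> * (x \<bullet> (Q *v x))" using pos_def_dominates[OF Q] by blast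
  have "integrable (itv 0 T) (phi u) \<and> (\<integral>t. phi u t \<partial>itv 0 T) \<le> \<kappa> * cost u T" if u: "ctrl u" and T: "0 \<le> T" for u T
  proof -
    note lx = l2v_state[OF u T]
    have p: "phi u = (\<lambda>t. expectation (\<lambda>\<omega>. state u t \<omega> \<bullet> (X *v state u t \<omega>)))" by (simp add: phi_def fun_eq_iff)
    have "(\<integral>t. phi u t \<partial>itv 0 T) = IP T (state u) (\<lambda>t \<omega>. X *v state u t \<omega>)"
      unfolding p by (rule IP_integral(1)[symmetric, OF lx l2v_mult[OF lx] T])
    also have "\<dots> \<le> \<kappa> * IP T (state u) (\<lambda>t \<omega>. Q *v state u t \<omega>)"
      by (rule IP_mono_scaled[OF lx \<kappa>])
    also have "\<dots> \<le> \<kappa> * cost u T"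
      unfolding cost_def using \<kappa>(1) IP_nonneg[OF semidef(2)] by (intro mult_left_mono) auto
    finally show ?thesis unfolding p using IP_integral(2)[OF lx l2v_mult[OF lx] T] by simp
  qed
  then show ?thesis using that \<kappa>(1) by blast
qed

lemma integral_itv_ge_window:
  assumes f: "integrable (itv 0 T) f" "\<And>t. 0 \<le> f t" and h: "0 \<le> h" "h \<le> T" and ge: "\<And>t. T - h \<le> t \<Longrightarrow> t \<le> T \<Longrightarrow> m \<le> f t"
  shows "h * m \<le> (\<integral>t. f t \<partial>itv 0 T)"
proof -
  interpret I: finite_measure "itv 0 T" by (rule finite_measure_itv)
  have "emeasure (itv 0 T) {T - h..T} = ennreal h"
  proof -
    have "emeasure (itv 0 T) {T - h..T} = (\<integral>\<^sup>+t. indicator {0..T} t * indicator {T - h..T} t \<partial>lborel)"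
      unfolding itv_def by (subst emeasure_density) auto
    also have "\<dots> = (\<integral>\<^sup>+t. indicator {T - h..T} t \<partial>lborel)"
      using h by (intro nn_integral_cong) (auto simp: indicator_def)
    also have "\<dots> = ennreal h" using h by simp
    finally show ?thesis .
  qed
  then have "h * m = (\<integral>t. m * indicator {T - h..T} t \<partial>itv 0 T)"
    using h by (simp add: measure_def)
  also have "\<dots> \<le> (\<integral>t. f t \<partial>itv 0 T)"
    using f ge by (intro integral_mono integrable_real_mult_indicator) (auto simp: indicator_def)
  finally show ?thesis .
qed

text \<open>The sum is the trace of the filter Riccati solution times \<open>Q\<close>, written in
  the coordinates of \<open>P\<close>; it is the limit of \<open>G T / T\<close>.\<close>

definition Jopt :: real where
  "Jopt = trace (S ** X) + (\<Sum>k\<in>UNIV. (P ** S ** Q ** S ** transpose P) $ k $ k / l k)"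

lemma G_limit: "((\<lambda>T. (T * trace (S ** X) + G T) / T) \<longlongrightarrow> Jopt) at_top"
proof -
  let ?q = "\<lambda>k. (P ** S ** Q ** S ** transpose P) $ k $ k"
  have lim: "((\<lambda>T. ln (cosh (c * T)) / c\<^sup>2 / T) \<longlongrightarrow> 1 / c) at_top" if c: "0 < c" for c :: real
    using c unfolding cosh_field_def by real_asymp (simp add: field_simps power2_eq_square)
  have "((\<lambda>T. trace (S ** X) + (\<Sum>k\<in>UNIV. ?q k * (ln (cosh (l k * T)) / (l k)\<^sup>2 / T))) \<longlongrightarrow> trace (S ** X) + (\<Sum>k\<in>UNIV. ?q k * (1 / l k))) at_top"
    by (intro tendsto_intros lim l)
  moreover have "\<forall>\<^sub>F T in at_top. trace (S ** X) + (\<Sum>k\<in>UNIV. ?q k * (ln (cosh (l k * T)) / (l k)\<^sup>2 / T)) = (T * trace (S ** X) + G T) / T"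
    using eventually_gt_at_top[of 0]
    by eventually_elim (simp add: G_eq add_divide_distrib sum_divide_distrib)
  ultimately show ?thesis unfolding Jopt_def by (simp add: filterlim_cong)
qed

text \<open>A limit below \<open>Jopt\<close> would leave a deficit that only the terminal term
  could fill, at every late time. Integrated over the second half of a long horizon this exceeds the
  bound of \<open>integral_phi_le_cost\<close>, quadratic against linear growth.\<close>

lemma cost_limit_ge:
  assumes u: "ctrl u" and lim: "((\<lambda>T. cost u T / T) \<longlongrightarrow> c) at_top"
  shows "Jopt \<le> c"
proof (rule ccontr)
  assume "\<not> Jopt \<le> c"
  \<comment> \<open>A third of the gap: one part for each of the two limits, and one left over as
    the growth rate of the terminal term.\<close>
  define \<delta> where "\<delta> = (Jopt - c) / 3"
  have \<delta>: "0 < \<delta>" "c + \<delta> < Jopt - \<delta>" using \<open>\<not> Jopt \<le> c\<close> by (auto simp: \<delta>_def field_simps)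
  obtain \<kappa> where \<kappa>: "0 \<le> \<kappa>" "\<And>u T. ctrl u \<Longrightarrow> 0 \<le> T \<Longrightarrow> integrable (itv 0 T) (phi u) \<and> (\<integral>t. phi u t \<partial>itv 0 T) \<le> \<kappa> * cost u T"
    by (rule integral_phi_le_cost) blast
  have "\<forall>\<^sub>F T in at_top. cost u T / T < c + \<delta>" using order_tendstoD(2)[OF lim] \<delta> by simp
  moreover have "\<forall>\<^sub>F T in at_top. Jopt - \<delta> < (T * trace (S ** X) + G T) / T" using order_tendstoD(1)[OF G_limit] \<delta> by simp
  ultimately have "\<forall>\<^sub>F T in at_top. \<delta> * T \<le> phi u T \<and> cost u T \<le> (c + \<delta>) * T"
    using eventually_gt_at_top[of 0]
  proof eventually_elim
    case (elim T)
    have 1: "cost u T \<le> (c + \<delta>) * T" using elim by (simp add: field_simps)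
    have "(Jopt - \<delta>) * T \<le> T * trace (S ** X) + G T" using elim by (simp add: field_simps)
    moreover have "T * trace (S ** X) + G T \<le> cost u T + phi u T"
      using cost_identity[OF u, of T] residual_lower_bound[OF u, of T] semidef(3)[of x\<^sub>0] elim by simp
    moreover have "(c + \<delta>) * T + \<delta> * T \<le> (Jopt - \<delta>) * T"
    proof -
      have "(c + \<delta>) + \<delta> \<le> Jopt - \<delta>" by (simp add: \<delta>_def field_simps)
      then show ?thesis using elim by (simp add: mult_right_mono flip: distrib_right)
    qed
    ultimately show ?case using 1 by linarith
  qed
  then obtain T1 where T1: "\<And>T. T1 \<le> T \<Longrightarrow> \<delta> * T \<le> phi u T \<and> cost u T \<le> (c + \<delta>) * T"
    by (auto simp: eventually_at_top_linorder)
  \<comment> \<open>Three demands: a positive horizon, its second half beyond \<open>T1\<close>, and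
    \<open>\<delta> * T\<^sup>2 / 4\<close> larger than
    \<open>\<kappa> * (\<bar>c\<bar> + \<delta>) * T\<close>; the \<open>+ 1\<close> makes the last
    one strict.\<close>
  define T where "T = max 1 (max (2 * T1) (4 * \<kappa> * (\<bar>c\<bar> + \<delta>) / \<delta> + 1))"
  have T: "1 \<le> T" "2 * T1 \<le> T" "4 * \<kappa> * (\<bar>c\<bar> + \<delta>) / \<delta> < T" unfolding T_def by linarith+
  have "T / 2 * (\<delta> * (T / 2)) \<le> (\<integral>t. phi u t \<partial>itv 0 T)"
  proof (rule integral_itv_ge_window)
    show "integrable (itv 0 T) (phi u)" using \<kappa>(2)[OF u, of T] T by simp
    fix t assume t: "T - T / 2 \<le> t" "t \<le> T"
    have "\<delta> * (T / 2) \<le> \<delta> * t" using \<delta> t by (intro mult_left_mono) auto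
    also have "\<dots> \<le> phi u t" using T1[of t] t T by simp
    finally show "\<delta> * (T / 2) \<le> phi u t" .
  qed (use T phi_nonneg in auto)
  also have "\<dots> \<le> \<kappa> * cost u T" using \<kappa>(2)[OF u, of T] T by simp
  also have "\<dots> \<le> \<kappa> * ((\<bar>c\<bar> + \<delta>) * T)"
  proof -
    have "cost u T \<le> (c + \<delta>) * T" using T1[of T] T by auto
    also have "\<dots> \<le> (\<bar>c\<bar> + \<delta>) * T" using T by (intro mult_right_mono) auto
    finally show ?thesis using \<kappa>(1) by (intro mult_left_mono)
  qed
  finally have "T * (\<delta> * T) \<le> T * (4 * \<kappa> * (\<bar>c\<bar> + \<delta>))" by (simp add: algebra_simps)
  then have "\<delta> * T \<le> 4 * \<kappa> * (\<bar>c\<bar> + \<delta>)" using T(1) by (simp add: mult_le_cancel_left)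
  moreover have "4 * \<kappa> * (\<bar>c\<bar> + \<delta>) < T * \<delta>" using T(3) \<delta>(1) by (simp only: divide_less_eq if_True)
  ultimately show False by (simp only: mult.commute)
qed

lemma average_cost_eq:
  assumes u: "ctrl u" and x: "\<And>t \<omega>. 0 \<le> t \<Longrightarrow> \<omega> \<in> space M \<Longrightarrow> x t \<omega> = state u t \<omega>" and T: "0 < T"
  shows "lqg_average_cost M Q R u x T = ennreal (cost u T / T)"
proof -
  have um: "(\<lambda>(t, \<omega>). u t \<omega>) \<in> borel_measurable (borel \<Otimes>\<^sub>M M)" using u by (simp add: ctrl_def)
  have "lqg_average_cost M Q R u x T = ennreal (cost u T) / ennreal T"
    unfolding lqg_average_cost_def using total_cost_eq[OF um x, of T] total_cost_ctrl[OF u, of T] T by simp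
  then show ?thesis using T by (simp add: divide_ennreal cost_nonneg)
qed

text \<open>Square integrability of the control is not part of admissibility; it is extracted from
  the finite limit of the cost through the coercivity of \<open>R\<close>. The second clause of
  adaptedness refers to the uncontrolled observation, which is \<open>free_obs\<close>.\<close>

lemma admissible_ctrl:
  assumes adm: "lqg_admissible M 0 B C x\<^sub>0 (\<lambda>t \<omega>. \<Gamma> *v w t \<omega>) (\<lambda>t \<omega>. D *v w t \<omega>) u x"
    and lim: "(lqg_average_cost M Q R u x \<longlongrightarrow> c) at_top" and c: "c < \<infinity>"
  shows "ctrl u" and "\<And>t \<omega>. 0 \<le> t \<Longrightarrow> \<omega> \<in> space M \<Longrightarrow> x t \<omega> = state u t \<omega>"
proof -
  have um: "(\<lambda>(t, \<omega>). u t \<omega>) \<in> borel_measurable (borel \<Otimes>\<^sub>M M)" and tr: "lqg_trajectory M 0 B x\<^sub>0 (\<lambda>t \<omega>. \<Gamma> *v w t \<omega>) u x"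
    using adm unfolding lqg_admissible_def by blast+
  show x: "x t \<omega> = state u t \<omega>" if "0 \<le> t" "\<omega> \<in> space M" for t \<omega>
    by (rule trajectory_state[OF tr um that(2,1)])
  obtain x' where tr': "lqg_trajectory M 0 B x\<^sub>0 (\<lambda>t \<omega>. \<Gamma> *v w t \<omega>) (\<lambda>_ _. 0) x'"
    and ad: "adapted_to_history M (lqg_observation C (\<lambda>t \<omega>. D *v w t \<omega>) x') u"
    using adm unfolding lqg_admissible_def by blast
  have z: "lqg_observation C (\<lambda>t \<omega>. D *v w t \<omega>) x' s \<omega> = free_obs s \<omega>" if s: "0 \<le> s" and \<omega>: "\<omega> \<in> space M" for s \<omega>
  proof -
    have "x' r \<omega> = x\<^sub>0 + 0 + \<Gamma> *v w r \<omega>" if "0 \<le> r" for r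
      using tr' \<omega> that unfolding lqg_trajectory_def by simp
    from observation_eq[OF \<omega> s, of x' "\<lambda>_. 0", OF this] have "lqg_observation C (\<lambda>t \<omega>. D *v w t \<omega>) x' s \<omega> = free_obs s \<omega> + C *v (\<chi> i. 0)" by simp
    then show ?thesis by (simp add: matrix_vector_mult_def vec_eq_iff)
  qed
  define tot where "tot T = (\<integral>\<^sup>+p. ennreal ((\<lambda>(t, \<omega>). rate u t \<omega>) p) \<partial>(itv 0 T \<Otimes>\<^sub>M M))" for T
  have avg: "lqg_average_cost M Q R u x T = tot T / ennreal T" for T
    unfolding lqg_average_cost_def tot_def using total_cost_eq[OF um x, of T] by simp
  have "\<forall>\<^sub>F T in at_top. lqg_average_cost M Q R u x T < \<infinity>" using order_tendstoD(2)[OF lim c] .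
  then obtain T1 where T1: "\<And>T. T1 \<le> T \<Longrightarrow> tot T / ennreal T < \<infinity>" by (auto simp: eventually_at_top_linorder avg)
  \<comment> \<open>The limit gives finiteness at late horizons only; monotonicity in the horizon
    carries it to all earlier ones.\<close>
  have fin: "tot T < \<infinity>" for T
  proof -
    let ?T = "max T (max T1 1)"
    have "tot ?T / ennreal ?T < \<infinity>" by (rule T1) simp
    then have "tot ?T < \<infinity>" by (cases "tot ?T = \<top>") (simp_all add: ennreal_top_divide less_top[symmetric])
    moreover have "tot T \<le> tot ?T" unfolding tot_def by (rule total_rate_mono[OF _ um]) simp
    ultimately show ?thesis by (rule le_less_trans[rotated])
  qed
  have "l2v T u" if T: "0 \<le> T" for T
    unfolding l2v_def
  proof
    fix j
    obtain d where d: "d > 0" "\<And>x. d * (x \<bullet> x) \<le> x \<bullet> (R *v x)" using pos_def_coercive[OF R] by metis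
    have mj: "(\<lambda>(t, \<omega>). u t \<omega> $ j) \<in> borel_measurable (borel \<Otimes>\<^sub>M M)"
    proof -
      have "(\<lambda>p. (\<lambda>(t, \<omega>). u t \<omega>) p \<bullet> axis j 1) \<in> borel_measurable (borel \<Otimes>\<^sub>M M)" using um by (intro borel_measurable_inner) auto
      then show ?thesis by (simp add: inner_axis case_prod_unfold)
    qed
    have le: "(u t \<omega> $ j)\<^sup>2 \<le> 1 / d * rate u t \<omega>" for t \<omega>
    proof -
      have "(u t \<omega> $ j)\<^sup>2 \<le> u t \<omega> \<bullet> u t \<omega>"
        using power_mono[OF component_le_norm_cart[of "u t \<omega>" j], of 2] by (simp add: power2_norm_eq_inner)
      then have "d * (u t \<omega> $ j)\<^sup>2 \<le> d * (u t \<omega> \<bullet> u t \<omega>)" using d(1) by simp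
      also have "\<dots> \<le> rate u t \<omega>" unfolding rate_def using d(2)[of "u t \<omega>"] semidef(1)[of "state u t \<omega>"] by linarith
      finally show ?thesis using d(1) by (simp add: field_simps)
    qed
    have "integrable (itv 0 T \<Otimes>\<^sub>M M) (\<lambda>(t, \<omega>). rate u t \<omega>)"
      unfolding integrable_iff_bounded using rate_measurable[OF um] fin[of T]
      by (simp add: tot_def case_prod_unfold rate_nonneg)
    then have i: "integrable (itv 0 T \<Otimes>\<^sub>M M) (\<lambda>p. 1 / d * (\<lambda>(t, \<omega>). rate u t \<omega>) p)" by (rule integrable_mult_right)
    have "integrable (itv 0 T \<Otimes>\<^sub>M M) (\<lambda>(t, \<omega>). (u t \<omega> $ j)\<^sup>2)"
    proof (rule Bochner_Integration.integrable_bound[OF i])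
      have "(\<lambda>p. ((\<lambda>(t, \<omega>). u t \<omega> $ j) p)\<^sup>2) \<in> borel_measurable (itv 0 T \<Otimes>\<^sub>M M)" using mj by (intro borel_measurable_power) simp
      then show "(\<lambda>(t, \<omega>). (u t \<omega> $ j)\<^sup>2) \<in> borel_measurable (itv 0 T \<Otimes>\<^sub>M M)" by (simp add: case_prod_unfold)
      show "AE p in itv 0 T \<Otimes>\<^sub>M M. norm (case p of (t, \<omega>) \<Rightarrow> (u t \<omega> $ j)\<^sup>2) \<le> norm (1 / d * (\<lambda>(t, \<omega>). rate u t \<omega>) p)"
      proof (rule AE_I2)
        fix p
        have "(u (fst p) (snd p) $ j)\<^sup>2 \<le> \<bar>1 / d * rate u (fst p) (snd p)\<bar>" using le[of "fst p" "snd p"] by linarith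
        then show "norm (case p of (t, \<omega>) \<Rightarrow> (u t \<omega> $ j)\<^sup>2) \<le> norm (1 / d * (\<lambda>(t, \<omega>). rate u t \<omega>) p)"
          by (simp add: case_prod_unfold)
      qed
    qed
    then show "l2_joint 0 T (\<lambda>t \<omega>. u t \<omega> $ j)" using mj by (simp add: l2_joint_def)
  qed
  moreover have "\<exists>z. (\<forall>s\<ge>0. \<forall>\<omega>\<in>space M. z s \<omega> = free_obs s \<omega>) \<and> adapted_to_history M z u"
    using ad z by (intro exI[of _ "lqg_observation C (\<lambda>t \<omega>. D *v w t \<omega>) x'"]) simp
  moreover have "\<forall>\<omega>\<in>space M. \<forall>t\<ge>0. set_integrable lborel {0..t} (\<lambda>s. u s \<omega>)"
    using tr unfolding lqg_trajectory_def by blast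
  ultimately show "ctrl u" unfolding ctrl_def using um by simp
qed

lemma average_cost_limit_ge:
  assumes adm: "lqg_admissible M 0 B C x\<^sub>0 (\<lambda>t \<omega>. \<Gamma> *v w t \<omega>) (\<lambda>t \<omega>. D *v w t \<omega>) u x"
    and lim: "(lqg_average_cost M Q R u x \<longlongrightarrow> c) at_top"
  shows "ennreal Jopt \<le> c"
proof (cases "c < \<infinity>")
  case True
  then obtain c' where c': "c = ennreal c'" "0 \<le> c'" by (cases c) auto
  note u = admissible_ctrl(1)[OF adm lim True] and x = admissible_ctrl(2)[OF adm lim True]
  have "((\<lambda>T. ennreal (cost u T / T)) \<longlongrightarrow> ennreal c') at_top"
  proof (rule Lim_transform_eventually[OF lim[unfolded c']])
    show "\<forall>\<^sub>F T in at_top. lqg_average_cost M Q R u x T = ennreal (cost u T / T)"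
      using eventually_gt_at_top[of 0] by eventually_elim (rule average_cost_eq[OF u x])
  qed
  moreover have "\<forall>\<^sub>F T in at_top. 0 \<le> cost u T / T"
    using eventually_gt_at_top[of 0] by eventually_elim (simp add: cost_nonneg)
  ultimately have "((\<lambda>T. cost u T / T) \<longlongrightarrow> c') at_top" using c'(2) by (simp add: tendsto_ennreal_iff)
  from cost_limit_ge[OF u this] show ?thesis unfolding c' by (rule ennreal_leI)
next
  case False
  then have "c = \<top>" by (simp add: less_top[symmetric])
  then show ?thesis by simp
qed

end

section \<open>The certainty-equivalent control\<close>

lemma borel_measurable_vecI:
  fixes f :: "'a \<Rightarrow> real^'n"
  assumes "\<And>i. (\<lambda>x. f x $ i) \<in> borel_measurable N"
  shows "f \<in> borel_measurable N"
proof (subst borel_measurable_euclidean_space, rule ballI)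
  fix v :: "real^'n" assume "v \<in> Basis"
  then obtain i where "v = axis i 1" by (auto simp: Basis_vec_def)
  then show "(\<lambda>x. f x \<bullet> v) \<in> borel_measurable N" using assms[of i] by (simp add: inner_axis)
qed

lemma borel_measurable_matrix_nth:
  assumes "\<And>k. f k \<in> borel_measurable N"
  shows "(\<lambda>x. ((A :: real^'n^'m) *v (\<chi> k. f k x)) $ i) \<in> borel_measurable N"
  using assms by (simp add: matrix_vector_mult_def)

lemma history_measurable:
  fixes z :: "real \<Rightarrow> 'a \<Rightarrow> real^'y"
  assumes "s \<in> {0..t}"
  shows "z s \<in> borel_measurable (history M z t)"
proof (rule measurableI)
  let ?G = "\<Union>s\<in>{0..t}. {z s -` S \<inter> space M | S. S \<in> sets borel}"
  have G: "?G \<subseteq> Pow (space M)" by auto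
  fix A assume "A \<in> sets (borel :: (real^'y) measure)"
  then have "z s -` A \<inter> space M \<in> ?G" using assms by blast
  then show "z s -` A \<inter> space (history M z t) \<in> sets (history M z t)"
    unfolding history_def sets_measure_of[OF G] space_measure_of[OF G] by blast
qed simp

lemma space_history: "space (history M z t) = space M"
  unfolding history_def by (rule space_measure_of) auto

lemma adapted_integral:
  fixes X :: "real \<Rightarrow> 'a \<Rightarrow> real"
  assumes t: "0 \<le> t" and X: "\<And>r. r \<in> {0..t} \<Longrightarrow> X r \<in> borel_measurable N"
    and c: "\<And>\<omega>. \<omega> \<in> space N \<Longrightarrow> continuous_on {0..t} (\<lambda>r. X r \<omega>)"
  shows "(\<lambda>\<omega>. integral {0..t} (\<lambda>r. X r \<omega>)) \<in> borel_measurable N"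
proof -
  \<comment> \<open>Measurability and continuity are known on \<open>{0..t}\<close> only. Clamping
    time to this interval gives a process on the whole line with the same integral.\<close>
  define Y where "Y r = X (max 0 (min t r))" for r
  have Yc: "continuous_on UNIV (\<lambda>r. Y r \<omega>)" if "\<omega> \<in> space N" for \<omega>
    unfolding Y_def by (rule continuous_on_compose2[OF c[OF that]]) (use t in \<open>auto intro!: continuous_intros\<close>)
  have [measurable]: "(\<lambda>(r, \<omega>). Y r \<omega>) \<in> borel_measurable (borel \<Otimes>\<^sub>M N)"
    by (rule measurable_continuous_process) (use t Yc in \<open>auto simp: Y_def intro!: X\<close>)
  have "(\<lambda>\<omega>. \<integral>r. Y r \<omega> \<partial>itv 0 t) \<in> borel_measurable N"
    by (rule sigma_finite_measure.borel_measurable_lebesgue_integral[OF sigma_finite_itv]) measurable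
  moreover have "(\<integral>r. Y r \<omega> \<partial>itv 0 t) = integral {0..t} (\<lambda>r. X r \<omega>)" if "\<omega> \<in> space N" for \<omega>
    unfolding integral_itv_continuous_UNIV(1)[OF Yc[OF that]]
    by (rule Henstock_Kurzweil_Integration.integral_cong) (simp add: Y_def)
  ultimately show ?thesis by (subst (asm) measurable_cong) auto
qed

lemma continuous_on_integral_Icc:
  fixes g :: "real \<Rightarrow> real"
  assumes "continuous_on {0..T} g"
  shows "continuous_on {0..T} (\<lambda>t. integral {0..t} g)"
  by (rule indefinite_integral_continuous_1) (rule integrable_continuous_real[OF assms])

text \<open>Picard iteration: the solution of a linear Volterra equation is a pointwise limit of functionals of the forcing term.\<close>

lemma volterra_measurable:
  fixes \<xi> g :: "'k::finite \<Rightarrow> real \<Rightarrow> 'a \<Rightarrow> real" and A :: "'k \<Rightarrow> 'k \<Rightarrow> real \<Rightarrow> real"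
  assumes A: "\<And>k j. continuous_on UNIV (A k j)"
    and \<xi>: "\<And>k \<omega>. \<omega> \<in> space N \<Longrightarrow> continuous_on {0..T} (\<lambda>t. \<xi> k t \<omega>)"
    and eq: "\<And>k t \<omega>. \<omega> \<in> space N \<Longrightarrow> t \<in> {0..T} \<Longrightarrow> \<xi> k t \<omega> = g k t \<omega> - integral {0..t} (\<lambda>s. \<Sum>j\<in>UNIV. A k j s * \<xi> j s \<omega>)"
    and g: "\<And>k t. t \<in> {0..T} \<Longrightarrow> g k t \<in> borel_measurable N"
    and t: "t \<in> {0..T}"
  shows "\<xi> k t \<in> borel_measurable N"
proof -
  \<comment> \<open>Started from 0, each iterate is an explicit functional of the forcing
    \<open>g\<close>, so measurability passes from one iterate to the next.\<close>
  define \<phi> where "\<phi> = rec_nat (\<lambda>_ _ _. 0) (\<lambda>_ f k t \<omega>. g k t \<omega> - integral {0..t} (\<lambda>s. \<Sum>j\<in>UNIV. A k j s * f j s \<omega>))"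
  have \<phi>0: "\<phi> 0 k t \<omega> = 0" and \<phi>S: "\<phi> (Suc n) k t \<omega> = g k t \<omega> - integral {0..t} (\<lambda>s. \<Sum>j\<in>UNIV. A k j s * \<phi> n j s \<omega>)" for n k t \<omega>
    by (simp_all add: \<phi>_def)
  have Ac: "continuous_on {0..r} (A k j)" for k j r using A by (rule continuous_on_subset) simp
  have sub: "continuous_on {0..r} f" if "continuous_on {0..T} f" "r \<in> {0..T}" for r and f :: "real \<Rightarrow> real"
    using that(1) by (rule continuous_on_subset) (use that in auto)
  have gc: "continuous_on {0..T} (\<lambda>t. g k t \<omega>)" if \<omega>: "\<omega> \<in> space N" for k \<omega>
  proof -
    have "continuous_on {0..T} (\<lambda>t. \<xi> k t \<omega> + integral {0..t} (\<lambda>s. \<Sum>j\<in>UNIV. A k j s * \<xi> j s \<omega>))"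
      by (intro continuous_intros continuous_on_integral_Icc Ac \<xi> \<omega>)
    then show ?thesis by (rule continuous_on_eq) (simp add: eq[OF \<omega>])
  qed
  have \<phi>c: "continuous_on {0..T} (\<lambda>t. \<phi> n k t \<omega>)" if \<omega>: "\<omega> \<in> space N" for n k \<omega>
  proof (induction n arbitrary: k)
    case 0 then show ?case by (simp add: \<phi>0)
  next
    case (Suc n)
    then show ?case unfolding \<phi>S by (intro continuous_intros continuous_on_integral_Icc Ac gc \<omega>)
  qed
  have \<phi>m: "\<phi> n k t \<in> borel_measurable N" if "t \<in> {0..T}" for n k t
    using that
  proof (induction n arbitrary: k t)
    case 0 then show ?case by (simp add: \<phi>0[abs_def])
  next
    case (Suc n)
    have "(\<lambda>\<omega>. integral {0..t} (\<lambda>s. \<Sum>j\<in>UNIV. A k j s * \<phi> n j s \<omega>)) \<in> borel_measurable N"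
    proof (rule adapted_integral)
      show "continuous_on {0..t} (\<lambda>r. \<Sum>j\<in>UNIV. A k j r * \<phi> n j r \<omega>)" if "\<omega> \<in> space N" for \<omega>
        by (intro continuous_intros Ac sub[OF \<phi>c[OF that] Suc.prems])
      show "(\<lambda>\<omega>. \<Sum>j\<in>UNIV. A k j r * \<phi> n j r \<omega>) \<in> borel_measurable N" if r: "r \<in> {0..t}" for r
      proof -
        have "r \<in> {0..T}" using r Suc.prems by auto
        then show ?thesis using Suc.IH[of r] by (intro borel_measurable_sum borel_measurable_times) auto
      qed
    qed (use Suc.prems in auto)
    then show ?case unfolding \<phi>S[abs_def] by (intro borel_measurable_diff g Suc.prems)
  qed
  show ?thesis
  proof (rule borel_measurable_LIMSEQ_real[OF _ \<phi>m[OF t]])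
    fix \<omega> assume \<omega>: "\<omega> \<in> space N"
    have "\<exists>F. \<forall>s\<in>{0..T}. \<bar>f s\<bar> \<le> F" if "continuous_on {0..T} f" for f :: "real \<Rightarrow> real"
      using compact_imp_bounded[OF compact_continuous_image[OF that compact_Icc]] by (force simp: bounded_iff)
    note bd = this
    \<comment> \<open>These bounds on the solution may depend on the path, which is harmless because
      convergence is needed pointwise only.\<close>
    define m where "m k = (SOME b. \<forall>s\<in>{0..T}. \<bar>\<xi> k s \<omega>\<bar> \<le> b)" for k
    define a where "a k j = (SOME b. \<forall>s\<in>{0..T}. \<bar>A k j s\<bar> \<le> b)" for k j
    have m: "\<bar>\<xi> k s \<omega>\<bar> \<le> m k" if "s \<in> {0..T}" for k s
      using someI_ex[OF bd[OF \<xi>[OF \<omega>, of k]]] that unfolding m_def by blast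
    have a: "\<bar>A k j s\<bar> \<le> a k j" if "s \<in> {0..T}" for k j s
      using someI_ex[OF bd[OF Ac[of T k j]]] that unfolding a_def by blast
    define Mx where "Mx = (\<Sum>k\<in>UNIV. \<bar>m k\<bar>)"
    define c where "c = (\<Sum>k\<in>UNIV. \<Sum>j\<in>UNIV. \<bar>a k j\<bar>)"
    have Mx: "\<bar>\<xi> k s \<omega>\<bar> \<le> Mx" if "s \<in> {0..T}" for k s
    proof -
      have "\<bar>m k\<bar> \<le> (\<Sum>k\<in>UNIV. \<bar>m k\<bar>)" by (rule member_le_sum) auto
      then show ?thesis using m[OF that, of k] unfolding Mx_def by linarith
    qed
    have c: "(\<Sum>j\<in>UNIV. \<bar>A k j s\<bar>) \<le> c" if "s \<in> {0..T}" for k s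
    proof -
      have "(\<Sum>j\<in>UNIV. \<bar>A k j s\<bar>) \<le> (\<Sum>j\<in>UNIV. \<bar>a k j\<bar>)" by (rule sum_mono) (rule order_trans[OF a[OF that] abs_ge_self])
      also have "\<dots> \<le> c" unfolding c_def by (rule member_le_sum[of k UNIV "\<lambda>k. \<Sum>j\<in>UNIV. \<bar>a k j\<bar>"]) (auto intro: sum_nonneg)
      finally show ?thesis .
    qed
    \<comment> \<open>The initial error is the solution itself, bounded by \<open>Mx\<close>; every
      further integration supplies one more factor \<open>c * r\<close> and the next divisor of the
      factorial.\<close>
    have "\<bar>\<phi> n k r \<omega> - \<xi> k r \<omega>\<bar> \<le> Mx * ((c * r) ^ n / fact n)" if "r \<in> {0..T}" for n k r
      using that
    proof (induction n arbitrary: k r)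
      case 0 then show ?case using Mx[of r k] by (simp add: \<phi>0)
    next
      case (Suc n)
      let ?d = "\<lambda>s. \<Sum>j\<in>UNIV. A k j s * (\<xi> j s \<omega> - \<phi> n j s \<omega>)"
      have i: "(\<lambda>s. \<Sum>j\<in>UNIV. A k j s * \<xi> j s \<omega>) integrable_on {0..r}" "(\<lambda>s. \<Sum>j\<in>UNIV. A k j s * \<phi> n j s \<omega>) integrable_on {0..r}"
        by (intro integrable_continuous_real continuous_intros Ac sub[OF \<xi>[OF \<omega>] Suc.prems] sub[OF \<phi>c[OF \<omega>] Suc.prems])+
      have "\<phi> (Suc n) k r \<omega> - \<xi> k r \<omega> = integral {0..r} (\<lambda>s. \<Sum>j\<in>UNIV. A k j s * \<xi> j s \<omega>) - integral {0..r} (\<lambda>s. \<Sum>j\<in>UNIV. A k j s * \<phi> n j s \<omega>)"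
        unfolding \<phi>S eq[OF \<omega> Suc.prems] by simp
      also have "\<dots> = integral {0..r} ?d"
        unfolding Henstock_Kurzweil_Integration.integral_diff[OF i, symmetric] by (simp add: right_diff_distrib sum_subtractf)
      finally have e: "\<phi> (Suc n) k r \<omega> - \<xi> k r \<omega> = integral {0..r} ?d" .
      have hi: "((\<lambda>s. c * (Mx * ((c * s) ^ n / fact n))) has_integral (Mx * ((c * r) ^ Suc n / fact (Suc n)) - Mx * ((c * 0) ^ Suc n / fact (Suc n)))) {0..r}"
      proof (rule fundamental_theorem_of_calculus)
        fix s
        have f0: "(fact n :: real) \<noteq> 0" "real (Suc n) \<noteq> 0" by simp_all
        have "((\<lambda>s. (c * s) ^ Suc n) has_real_derivative of_nat (Suc n) * (c * (c * s) ^ (Suc n - Suc 0))) (at s within {0..r})"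
          by (rule DERIV_power) (auto intro!: derivative_eq_intros)
        then have "((\<lambda>s. Mx * ((c * s) ^ Suc n / fact (Suc n))) has_real_derivative Mx * (of_nat (Suc n) * (c * (c * s) ^ (Suc n - Suc 0)) / fact (Suc n))) (at s within {0..r})"
          by (intro DERIV_cmult DERIV_cdivide)
        also have "Mx * (of_nat (Suc n) * (c * (c * s) ^ (Suc n - Suc 0)) / fact (Suc n)) = c * (Mx * ((c * s) ^ n / fact n))"
          using f0 by (simp only: fact_Suc of_nat_mult of_nat_fact diff_Suc_Suc diff_zero) (simp add: field_simps del: of_nat_Suc)
        finally show "((\<lambda>s. Mx * ((c * s) ^ Suc n / fact (Suc n))) has_vector_derivative c * (Mx * ((c * s) ^ n / fact n))) (at s within {0..r})"
          by (simp add: has_real_derivative_iff_has_vector_derivative)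
      qed (use Suc.prems in auto)
      have "norm (integral {0..r} ?d) \<le> integral {0..r} (\<lambda>s. c * (Mx * ((c * s) ^ n / fact n)))"
      proof (rule integral_norm_bound_integral)
        show "?d integrable_on {0..r}"
          by (intro integrable_continuous_real continuous_intros Ac sub[OF \<xi>[OF \<omega>] Suc.prems] sub[OF \<phi>c[OF \<omega>] Suc.prems])
        show "(\<lambda>s. c * (Mx * ((c * s) ^ n / fact n))) integrable_on {0..r}" using hi by (rule has_integral_integrable)
        fix s assume s: "s \<in> {0..r}"
        then have s': "s \<in> {0..T}" using Suc.prems by auto
        have "\<bar>?d s\<bar> \<le> (\<Sum>j\<in>UNIV. \<bar>A k j s\<bar> * (Mx * ((c * s) ^ n / fact n)))"
        proof (rule order_trans[OF sum_abs], rule sum_mono)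
          fix j
          show "\<bar>A k j s * (\<xi> j s \<omega> - \<phi> n j s \<omega>)\<bar> \<le> \<bar>A k j s\<bar> * (Mx * ((c * s) ^ n / fact n))"
            unfolding abs_mult abs_minus_commute[of "\<xi> j s \<omega>"] by (rule mult_left_mono[OF Suc.IH[OF s']]) simp
        qed
        also have "\<dots> = (\<Sum>j\<in>UNIV. \<bar>A k j s\<bar>) * (Mx * ((c * s) ^ n / fact n))" by (simp only: sum_distrib_right)
        also have "\<dots> \<le> c * (Mx * ((c * s) ^ n / fact n))"
        proof (rule mult_right_mono[OF c[OF s']])
          have "0 \<le> \<bar>\<phi> n k s \<omega> - \<xi> k s \<omega>\<bar>" by simp
          then show "0 \<le> Mx * ((c * s) ^ n / fact n)" using Suc.IH[OF s', of k] by linarith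
        qed
        finally show "norm (?d s) \<le> c * (Mx * ((c * s) ^ n / fact n))" by simp
      qed
      then show ?case unfolding e integral_unique[OF hi] by simp
    qed
    note bound = this[OF t]
    have "(\<lambda>n. (c * t) ^ n / fact n) \<longlonglongrightarrow> 0"
      using summable_LIMSEQ_zero[OF summable_exp[of "c * t"]] by (simp only: divide_inverse mult.commute)
    then have "(\<lambda>n. Mx * ((c * t) ^ n / fact n)) \<longlonglongrightarrow> 0" by (rule tendsto_mult_right_zero)
    then have "(\<lambda>n. \<phi> n k t \<omega> - \<xi> k t \<omega>) \<longlonglongrightarrow> 0"
      by (rule Lim_null_comparison[rotated]) (use bound in \<open>auto intro!: always_eventually\<close>)
    then show "(\<lambda>n. \<phi> n k t \<omega>) \<longlonglongrightarrow> \<xi> k t \<omega>" by (rule LIM_zero_cancel)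
  qed
qed

context wiener_space
begin

text \<open>The filter in terms of an observation \<zeta> that contains the response
  \<open>p\<close> to the inputs: \<open>d est = tanh (l t) (d \<zeta> - l (p + est) dt)\<close>,
  integrated by parts against \<zeta>. The unknown occurs on the right only under a time
  integral.\<close>

lemma est_volterra:
  assumes \<omega>: "\<omega> \<in> space M" and t: "0 \<le> t" and p: "continuous_on UNIV p"
    and \<zeta>: "\<And>s. 0 \<le> s \<Longrightarrow> \<zeta> s = obs l a b s \<omega> + l * integral {0..s} p"
  shows "est l a b t \<omega> = tanh (l * t) * \<zeta> t - integral {0..t} (\<lambda>s. l * (1 - (tanh (l * s))\<^sup>2) * \<zeta> s + l * tanh (l * s) * (p s + est l a b s \<omega>))"
proof -
  have oc: "continuous_on UNIV (\<lambda>s. obs l a b s \<omega>)" by (rule l2_process_cont[OF l2_process_obs \<omega>])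
  have cc: "continuous_on UNIV (\<lambda>s. cosh (l * s) * obs l a b s \<omega>)" by (intro continuous_intros oc)
  let ?q = "\<lambda>s. integral {0..s} (\<lambda>r. cosh (l * r) * obs l a b r \<omega>)" and ?\<Pi> = "\<lambda>s. integral {0..s} p"
  \<comment> \<open>This is \<open>tanh (l * s) * \<zeta> s - est\<close>. The terms with
    \<open>obs\<close>, which is merely continuous in time, cancel, so what is left can be
    differentiated.\<close>
  let ?h = "\<lambda>s. l * (tanh (l * s) * ?\<Pi> s) + l * (?q s / cosh (l * s))"
  have est: "est l a b s \<omega> = tanh (l * s) * obs l a b s \<omega> - l * (?q s / cosh (l * s))" if "0 \<le> s" for s
    using that by (simp add: est_def max_absorb2)
  have d: "(?h has_real_derivative l * (1 - (tanh (l * s))\<^sup>2) * \<zeta> s + l * tanh (l * s) * (p s + est l a b s \<omega>)) (at s within {0..t})"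
    if s: "s \<in> {0..t}" for s
  proof -
    have q: "(?q has_real_derivative cosh (l * s) * obs l a b s \<omega>) (at s within {0..t})"
      by (rule DERIV_subset[OF integral_has_derivative_continuous[OF cc]]) (use s in auto)
    have P: "(?\<Pi> has_real_derivative p s) (at s within {0..t})"
      by (rule DERIV_subset[OF integral_has_derivative_continuous[OF p]]) (use s in auto)
    have th: "((\<lambda>s. tanh (l * s)) has_real_derivative (1 - (tanh (l * s))\<^sup>2) * l) (at s within {0..t})"
      by (auto intro!: derivative_eq_intros)
    have ch: "((\<lambda>s. cosh (l * s)) has_real_derivative sinh (l * s) * l) (at s within {0..t})"
      by (auto intro!: derivative_eq_intros)
    have "(?h has_real_derivative l * ((1 - (tanh (l * s))\<^sup>2) * l * ?\<Pi> s + p s * tanh (l * s))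
      + l * ((cosh (l * s) * obs l a b s \<omega> * cosh (l * s) - ?q s * (sinh (l * s) * l)) / (cosh (l * s) * cosh (l * s)))) (at s within {0..t})"
      by (intro DERIV_add DERIV_cmult DERIV_mult th P DERIV_divide q ch) simp
    also have "l * ((1 - (tanh (l * s))\<^sup>2) * l * ?\<Pi> s + p s * tanh (l * s))
      + l * ((cosh (l * s) * obs l a b s \<omega> * cosh (l * s) - ?q s * (sinh (l * s) * l)) / (cosh (l * s) * cosh (l * s)))
      = l * (1 - (tanh (l * s))\<^sup>2) * \<zeta> s + l * tanh (l * s) * (p s + est l a b s \<omega>)"
    proof -
      have fr: "(cosh (l * s) * obs l a b s \<omega> * cosh (l * s) - ?q s * (sinh (l * s) * l)) / (cosh (l * s) * cosh (l * s))
        = obs l a b s \<omega> - l * tanh (l * s) * (?q s / cosh (l * s))"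
        by (simp add: tanh_def field_simps)
      show ?thesis unfolding fr using s by (simp add: \<zeta> est algebra_simps power2_eq_square)
    qed
    finally show ?thesis .
  qed
  have "((\<lambda>s. l * (1 - (tanh (l * s))\<^sup>2) * \<zeta> s + l * tanh (l * s) * (p s + est l a b s \<omega>)) has_integral (?h t - ?h 0)) {0..t}"
    by (rule fundamental_theorem_of_calculus[OF t]) (use d in \<open>simp add: has_real_derivative_iff_has_vector_derivative\<close>)
  then have I: "integral {0..t} (\<lambda>s. l * (1 - (tanh (l * s))\<^sup>2) * \<zeta> s + l * tanh (l * s) * (p s + est l a b s \<omega>)) = ?h t - ?h 0"
    by (rule integral_unique)
  show ?thesis unfolding I using t by (simp add: \<zeta> est algebra_simps)
qed

end

text \<open>\<open>E\<close> and \<open>mu\<close> diagonalise the closed loop: in the coordinates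
  \<open>E\<close> the matrix \<open>B ** Kt\<close> becomes \<open>diag_mat mu\<close>, so the
  controlled equation splits into scalar linear equations with explicit solutions.\<close>

locale lqg_controlled = lqg_driftless M w \<Gamma> D B C Q X S V P R l x\<^sub>0
  for M :: "'a measure" and w :: "real \<Rightarrow> 'a \<Rightarrow> real^'q::finite" and \<Gamma> D :: "real^'q^'k::finite" and B :: "real^'m::finite^'k"
    and C Q X S V P :: "real^'k^'k" and R :: "real^'m^'m" and l :: "'k \<Rightarrow> real" and x\<^sub>0 :: "real^'k" +
  fixes E :: "real^'k^'k" and mu :: "'k \<Rightarrow> real"
  assumes EL: "E ** (B ** matrix_inv R ** transpose B) ** transpose E = mat 1"
    and LEE: "(B ** matrix_inv R ** transpose B) ** transpose E ** E = mat 1"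
    and XE: "X = transpose E ** diag_mat mu ** E"
begin

text \<open>The part of the state estimate that no input affects, namely initial state and filtered
  noise, in closed-loop coordinates.\<close>

definition F :: "'k \<Rightarrow> real \<Rightarrow> 'a \<Rightarrow> real" where
  "F i s \<omega> = (E *v (x\<^sub>0 + (S ** transpose P) *v (\<chi> k. es k s \<omega>))) $ i"

text \<open>Variation of constants for \<open>eta' = - mu (F + eta)\<close> with initial value
  0.\<close>

definition eta :: "'k \<Rightarrow> real \<Rightarrow> 'a \<Rightarrow> real" where
  "eta i t \<omega> = - mu i * exp (- (mu i * t)) * integral {0..max 0 t} (\<lambda>s. exp (mu i * s) * F i s \<omega>)"

text \<open>The matrix is the inverse of \<open>E\<close> by \<open>EL\<close>, so this is
  \<open>eta\<close> in state coordinates; by \<open>yv_integral\<close> it is the accumulated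
  input.\<close>

definition yv :: "real \<Rightarrow> 'a \<Rightarrow> real^'k" where
  "yv t \<omega> = ((B ** matrix_inv R ** transpose B) ** transpose E) *v (\<chi> i. eta i t \<omega>)"

definition xh :: "real \<Rightarrow> 'a \<Rightarrow> real^'k" where
  "xh t \<omega> = x\<^sub>0 + (S ** transpose P) *v (\<chi> k. es k t \<omega>) + yv t \<omega>"

definition us :: "real \<Rightarrow> 'a \<Rightarrow> real^'m" where
  "us t \<omega> = - (Kt *v xh t \<omega>)"

lemma l2_process_matrix: "(\<And>k. l2_process (Z k)) \<Longrightarrow> l2_process (\<lambda>s \<omega>. ((A :: real^'n^'p) *v (\<chi> k. Z k s \<omega>)) $ i)"
  unfolding matrix_vector_mult_def by (simp, intro l2_process_sum l2_process_mult_fun continuous_on_const)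

lemma l2_process_F: "l2_process (F i)"
proof -
  have eq: "F i = (\<lambda>s \<omega>. (\<lambda>_ _. (E *v x\<^sub>0) $ i) s \<omega> + ((E ** (S ** transpose P)) *v (\<chi> k. es k s \<omega>)) $ i)"
    by (simp add: F_def fun_eq_iff matrix_vector_right_distrib matrix_vector_mul_assoc)
  show ?thesis unfolding eq by (intro l2_process_add l2_process_const sq_int_const l2_process_matrix l2_process_est)
qed

lemma l2_process_eta: "l2_process (eta i)"
  unfolding eta_def by (intro l2_process_mult_fun l2_process_integral l2_process_F continuous_intros)

lemma l2_process_yv: "l2_process (\<lambda>t \<omega>. yv t \<omega> $ i)"
  unfolding yv_def by (intro l2_process_matrix l2_process_eta)

lemma l2_process_xh: "l2_process (\<lambda>t \<omega>. xh t \<omega> $ i)"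
  unfolding xh_def by (simp, intro l2_process_add l2_process_const sq_int_const l2_process_matrix l2_process_est l2_process_yv)

lemma l2_process_us: "l2_process (\<lambda>t \<omega>. us t \<omega> $ j)"
proof -
  have "l2_process (\<lambda>t \<omega>. (- 1) * (Kt *v (\<chi> i. xh t \<omega> $ i)) $ j)"
    by (intro l2_process_mult_fun l2_process_matrix l2_process_xh continuous_intros)
  then show ?thesis by (simp add: us_def)
qed

lemma eta_integral:
  assumes \<omega>: "\<omega> \<in> space M" and t: "0 \<le> t"
  shows "eta i t \<omega> = integral {0..t} (\<lambda>s. - mu i * (F i s \<omega> + eta i s \<omega>))"
proof -
  have Fc: "continuous_on UNIV (\<lambda>s. exp (mu i * s) * F i s \<omega>)" by (intro continuous_intros l2_process_cont[OF l2_process_F \<omega>])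
  let ?I = "\<lambda>s. integral {0..s} (\<lambda>r. exp (mu i * r) * F i r \<omega>)"
  have "((\<lambda>s. - mu i * (F i s \<omega> + eta i s \<omega>)) has_integral (- mu i * (exp (- (mu i * t)) * ?I t) - - mu i * (exp (- (mu i * 0)) * ?I 0))) {0..t}"
  proof (rule fundamental_theorem_of_calculus[OF t])
    fix s assume s: "s \<in> {0..t}"
    have "(?I has_real_derivative exp (mu i * s) * F i s \<omega>) (at s within {0..t})"
      by (rule DERIV_subset[OF integral_has_derivative_continuous[OF Fc]]) (use s in auto)
    then have "((\<lambda>s. - mu i * (exp (- (mu i * s)) * ?I s)) has_real_derivative
        - mu i * (exp (- (mu i * s)) * (- mu i) * ?I s + exp (mu i * s) * F i s \<omega> * exp (- (mu i * s)))) (at s within {0..t})"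
      by (intro DERIV_cmult DERIV_mult) (auto intro!: derivative_eq_intros)
    also have "- mu i * (exp (- (mu i * s)) * (- mu i) * ?I s + exp (mu i * s) * F i s \<omega> * exp (- (mu i * s))) = - mu i * (F i s \<omega> + eta i s \<omega>)"
    proof -
      have "exp (mu i * s) * exp (- (mu i * s)) = 1" by (simp add: exp_minus)
      then have "exp (mu i * s) * F i s \<omega> * exp (- (mu i * s)) = F i s \<omega>" by (simp add: mult.commute mult.left_commute)
      then show ?thesis using s by (simp add: eta_def max_absorb2 algebra_simps)
    qed
    finally show "((\<lambda>s. - mu i * (exp (- (mu i * s)) * ?I s)) has_vector_derivative - mu i * (F i s \<omega> + eta i s \<omega>)) (at s within {0..t})"
      by (simp add: has_real_derivative_iff_has_vector_derivative)
  qed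
  note I = integral_unique[OF this]
  show ?thesis unfolding I using t by (simp add: eta_def max_absorb2)
qed

lemma BKt: "B ** Kt = (B ** matrix_inv R ** transpose B) ** transpose E ** diag_mat mu ** E"
  unfolding Kt_def by (subst XE) (simp only: matrix_mul_assoc)

lemma drift_eq: "B *v us s \<omega> = ((B ** matrix_inv R ** transpose B) ** transpose E) *v (\<chi> j. - mu j * (F j s \<omega> + eta j s \<omega>))"
proof -
  have "E *v xh s \<omega> = (\<chi> j. F j s \<omega> + eta j s \<omega>)"
  proof -
    \<comment> \<open>By \<open>EL\<close> the closed-loop coordinates of the accumulated input are
      \<open>eta\<close> again.\<close>
    have "E *v yv s \<omega> = (\<chi> i. eta i s \<omega>)"
      unfolding yv_def matrix_vector_mul_assoc by (simp add: matrix_mul_assoc[symmetric] EL[unfolded matrix_mul_assoc[symmetric]])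
    then show ?thesis unfolding xh_def by (simp add: matrix_vector_right_distrib F_def vec_eq_iff)
  qed
  moreover have "B *v us s \<omega> = - (((B ** matrix_inv R ** transpose B) ** transpose E) *v (diag_mat mu *v (E *v xh s \<omega>)))"
    unfolding us_def by (simp add: matrix_vector_mul_assoc BKt matrix_mul_assoc linear_neg[OF matrix_vector_mul_linear])
  moreover have "(\<chi> j. - mu j * (F j s \<omega> + eta j s \<omega>)) = - (diag_mat mu *v (\<chi> j. F j s \<omega> + eta j s \<omega>))"
    by (simp add: vec_eq_iff diag_mat_vec)
  ultimately show ?thesis by (simp add: linear_neg[OF matrix_vector_mul_linear])
qed

lemma drift_nth: "(B *v us s \<omega>) $ i = (\<Sum>j\<in>UNIV. ((B ** matrix_inv R ** transpose B) ** transpose E) $ i $ j * (- mu j * (F j s \<omega> + eta j s \<omega>)))"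
  by (subst drift_eq, subst matrix_vector_mult_def) simp

lemma drift_continuous: "\<omega> \<in> space M \<Longrightarrow> continuous_on UNIV (\<lambda>s. (B *v us s \<omega>) $ i)"
  unfolding drift_nth
  by (intro continuous_intros l2_process_cont[OF l2_process_F] l2_process_cont[OF l2_process_eta])

lemma yv_integral:
  assumes \<omega>: "\<omega> \<in> space M" and t: "0 \<le> t"
  shows "yv t \<omega> $ i = integral {0..t} (\<lambda>s. (B *v us s \<omega>) $ i)"
proof -
  let ?A = "(B ** matrix_inv R ** transpose B) ** transpose E"
  have "integral {0..t} (\<lambda>s. (B *v us s \<omega>) $ i) = integral {0..t} (\<lambda>s. \<Sum>j\<in>UNIV. ?A $ i $ j * (- mu j * (F j s \<omega> + eta j s \<omega>)))"
    unfolding drift_nth ..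
  also have "\<dots> = (\<Sum>j\<in>UNIV. integral {0..t} (\<lambda>s. ?A $ i $ j * (- mu j * (F j s \<omega> + eta j s \<omega>))))"
    by (rule Henstock_Kurzweil_Integration.integral_sum)
       (auto intro!: integral_itv_continuous_UNIV(3) continuous_intros l2_process_cont[OF l2_process_F \<omega>] l2_process_cont[OF l2_process_eta \<omega>])
  also have "\<dots> = (\<Sum>j\<in>UNIV. ?A $ i $ j * eta j t \<omega>)"
    unfolding eta_integral[OF \<omega> t] by (simp only: integral_mult_right)
  finally show ?thesis by (simp add: yv_def matrix_vector_mult_def)
qed

text \<open>The noise splits into its estimate and the error, so in the second equation state and
  estimate differ by \<open>e\<close>, a process unaffected by the control.\<close>

lemma state_us:
  assumes \<omega>: "\<omega> \<in> space M" and t: "0 \<le> t"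
  shows "state us t \<omega> = x\<^sub>0 + yv t \<omega> + \<Gamma> *v w t \<omega>" and "state us t \<omega> = xh t \<omega> + e t \<omega>"
proof -
  have 1: "(\<integral>s. (B *v us s \<omega>) $ i \<partial>itv 0 t) = yv t \<omega> $ i" for i
    unfolding integral_itv_continuous_UNIV(1)[OF drift_continuous[OF \<omega>]] yv_integral[OF \<omega> t] ..
  then show "state us t \<omega> = x\<^sub>0 + yv t \<omega> + \<Gamma> *v w t \<omega>"
    using t by (simp add: state_def vec_eq_iff W_def matrix_vector_nth max_absorb2)
  have "(\<chi> k. W (a k) t \<omega>) = (\<chi> k. es k t \<omega>) + (\<chi> k. er k t \<omega>)" by (simp add: vec_eq_iff err_def)
  then have "W (\<Gamma> $ i) t \<omega> = ((S ** transpose P) *v (\<chi> k. es k t \<omega>)) $ i + e t \<omega> $ i" for i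
    unfolding noise_eq e_def by (simp add: matrix_vector_right_distrib)
  then show "state us t \<omega> = xh t \<omega> + e t \<omega>"
    by (simp add: state_def vec_eq_iff 1 xh_def)
qed

lemma us_path: "\<omega> \<in> space M \<Longrightarrow> continuous_on UNIV (\<lambda>s. us s \<omega>)"
proof -
  assume "\<omega> \<in> space M"
  then have "continuous_on UNIV (\<lambda>s. \<chi> j. us s \<omega> $ j)" by (intro continuous_on_vec_lambda l2_process_cont[OF l2_process_us])
  then show ?thesis by simp
qed

lemma us_measurable: "(\<lambda>(t, \<omega>). us t \<omega>) \<in> borel_measurable (borel \<Otimes>\<^sub>M M)"
  by (rule borel_measurable_vecI) (use l2_process_measurable[OF l2_process_us] in \<open>simp add: case_prod_unfold\<close>)

lemma us_measurable_if_es: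
  assumes sp: "space N = space M" and t: "0 \<le> t" and es: "\<And>k s. s \<in> {0..t} \<Longrightarrow> es k s \<in> borel_measurable N"
  shows "us t \<in> borel_measurable N"
proof -
  have F: "F i s \<in> borel_measurable N" if "s \<in> {0..t}" for i s
  proof -
    have "(\<lambda>\<omega>. (E *v x\<^sub>0) $ i + ((E ** (S ** transpose P)) *v (\<chi> k. es k s \<omega>)) $ i) \<in> borel_measurable N"
      by (intro borel_measurable_add borel_measurable_const borel_measurable_matrix_nth es that)
    then show ?thesis by (simp add: F_def[abs_def] matrix_vector_right_distrib matrix_vector_mul_assoc)
  qed
  have "(\<lambda>\<omega>. integral {0..t} (\<lambda>s. exp (mu i * s) * F i s \<omega>)) \<in> borel_measurable N" for i
  proof (rule adapted_integral[OF t])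
    show "continuous_on {0..t} (\<lambda>s. exp (mu i * s) * F i s \<omega>)" if "\<omega> \<in> space N" for \<omega>
      by (rule continuous_on_subset[of UNIV]) (use that sp in \<open>auto intro!: continuous_intros l2_process_cont[OF l2_process_F]\<close>)
  qed (use F in measurable)
  then have eta: "eta i t \<in> borel_measurable N" for i
    unfolding eta_def[abs_def] using t by (simp add: max_absorb2)
  have xh: "(\<lambda>\<omega>. xh t \<omega> $ i) \<in> borel_measurable N" for i
    unfolding xh_def yv_def vector_add_component
    by (intro borel_measurable_add borel_measurable_const borel_measurable_matrix_nth eta es) (use t in auto)
  show ?thesis
  proof (rule borel_measurable_vecI)
    fix j
    have "(\<lambda>\<omega>. - (Kt *v (\<chi> i. xh t \<omega> $ i)) $ j) \<in> borel_measurable N"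
      by (intro borel_measurable_uminus borel_measurable_matrix_nth xh)
    then show "(\<lambda>\<omega>. us t \<omega> $ j) \<in> borel_measurable N" by (simp add: us_def)
  qed
qed

text \<open>Adaptedness to the free observations is explicit: \<open>U\<close> extracts the scalar
  channels, from which estimate, accumulated input and control are obtained by time
  integrals.\<close>

lemma us_adapted_free: "adapted_to_history M free_obs us"
  unfolding adapted_to_history_def
proof (intro allI impI)
  fix t :: real assume t: "0 \<le> t"
  let ?N = "history M free_obs t"
  have ob: "ob k s \<in> borel_measurable ?N" if s: "s \<in> {0..t}" for k s
  proof -
    have "(\<chi> i. ob i s \<omega>) = U *v (free_obs s \<omega> - s *\<^sub>R (C *v x\<^sub>0))" for \<omega>
      by (simp add: free_obs_def matrix_vector_mul_assoc matrix_mul_assoc UVU)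
    then have "ob k s = (\<lambda>\<omega>. U $ k \<bullet> (free_obs s \<omega> - s *\<^sub>R (C *v x\<^sub>0)))"
      by (simp add: fun_eq_iff flip: matrix_vector_nth) (simp add: vec_eq_iff)
    then show ?thesis using history_measurable[OF s, of free_obs M]
      by (simp add: borel_measurable_inner borel_measurable_diff)
  qed
  show "us t \<in> borel_measurable ?N"
  proof (rule us_measurable_if_es[OF space_history t])
    fix k s assume s: "s \<in> {0..t}"
    have "(\<lambda>\<omega>. integral {0..s} (\<lambda>r. cosh (l k * r) * ob k r \<omega>)) \<in> borel_measurable ?N"
    proof (rule adapted_integral)
      show "(\<lambda>\<omega>. cosh (l k * r) * ob k r \<omega>) \<in> borel_measurable ?N" if "r \<in> {0..s}" for r
        using ob[of r k] that s by simp
      show "continuous_on {0..s} (\<lambda>r. cosh (l k * r) * ob k r \<omega>)" if "\<omega> \<in> space ?N" for \<omega>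
        by (rule continuous_on_subset[of UNIV]) (use that in \<open>auto simp: space_history intro!: continuous_intros l2_process_cont[OF l2_process_obs]\<close>)
    qed (use s in auto)
    then show "es k s \<in> borel_measurable ?N"
      unfolding est_def[abs_def] using ob[OF s] s by (simp add: max_absorb2)
  qed
qed

lemma ctrl_us: "ctrl us"
  unfolding ctrl_def
proof (intro conjI ballI allI impI)
  show "l2v T us" if "0 \<le> T" for T
    unfolding l2v_def by (intro allI l2_process_joint[OF l2_process_us]) simp
  show "set_integrable lborel {0..t} (\<lambda>s. us s \<omega>)" if "\<omega> \<in> space M" for \<omega> t
    by (rule LINT_nth_continuous(1)) (rule continuous_on_subset[OF us_path[OF that]], simp)
  show "\<exists>z. (\<forall>s\<ge>0. \<forall>\<omega>\<in>space M. z s \<omega> = free_obs s \<omega>) \<and> adapted_to_history M z us"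
    using us_adapted_free by blast
qed (rule us_measurable)

end

section \<open>Adaptedness to the closed-loop observations\<close>

context lqg_controlled
begin

abbreviation "noise \<equiv> \<lambda>t \<omega>. \<Gamma> *v w t \<omega>"
abbreviation "mnoise \<equiv> \<lambda>t \<omega>. D *v w t \<omega>"

definition us_obs :: "real \<Rightarrow> 'a \<Rightarrow> real^'k" where "us_obs = lqg_observation C mnoise (state us)"
text \<open>The closed loop in filter coordinates: \<open>pk\<close> is the response to initial
  state and inputs, \<open>zeta\<close> the observation normalised by \<open>U\<close>, and
  \<open>xi\<close> the state estimate, recovered by \<open>xh_xi\<close>.\<close>

definition pk :: "'k \<Rightarrow> real \<Rightarrow> 'a \<Rightarrow> real" where "pk k t \<omega> = (P *v (x\<^sub>0 + yv t \<omega>)) $ k"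
definition zeta :: "'k \<Rightarrow> real \<Rightarrow> 'a \<Rightarrow> real" where "zeta k t \<omega> = (U *v us_obs t \<omega>) $ k"
definition xi :: "'k \<Rightarrow> real \<Rightarrow> 'a \<Rightarrow> real" where "xi k t \<omega> = pk k t \<omega> + es k t \<omega>"

lemma yv_continuous: "\<omega> \<in> space M \<Longrightarrow> continuous_on UNIV (\<lambda>s. yv s \<omega>)"
proof -
  assume "\<omega> \<in> space M"
  then have "continuous_on UNIV (\<lambda>s. \<chi> j. yv s \<omega> $ j)" by (intro continuous_on_vec_lambda l2_process_cont[OF l2_process_yv])
  then show ?thesis by simp
qed

lemma us_obs_eq:
  assumes "\<omega> \<in> space M" "0 \<le> t"
  shows "us_obs t \<omega> = free_obs t \<omega> + C *v (\<chi> i. integral {0..t} (\<lambda>s. yv s \<omega> $ i))"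
  unfolding us_obs_def
  by (rule observation_eq[OF assms, where y="\<lambda>s. yv s \<omega>"]) (rule state_us(1)[OF assms(1)], assumption, rule yv_continuous[OF assms(1)])

lemma pk_sum: "pk k t \<omega> = (\<Sum>i\<in>UNIV. P $ k $ i * (x\<^sub>0 $ i + yv t \<omega> $ i))"
  unfolding pk_def by (simp add: matrix_vector_mult_def)

lemma pk_continuous: "\<omega> \<in> space M \<Longrightarrow> continuous_on UNIV (\<lambda>s. pk k s \<omega>)"
  unfolding pk_sum by (intro continuous_intros l2_process_cont[OF l2_process_yv])

lemma zeta_eq:
  assumes \<omega>: "\<omega> \<in> space M" and t: "0 \<le> t"
  shows "zeta k t \<omega> = ob k t \<omega> + l k * integral {0..t} (\<lambda>s. pk k s \<omega>)"
proof -
  let ?I = "\<chi> i. integral {0..t} (\<lambda>s. yv s \<omega> $ i)"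
  have yi: "(\<lambda>s. yv s \<omega> $ i) integrable_on {0..t}" for i
    by (rule integral_itv_continuous_UNIV(3)[OF l2_process_cont[OF l2_process_yv \<omega>]])
  have "integral {0..t} (\<lambda>s. pk k s \<omega>) = (\<Sum>i\<in>UNIV. integral {0..t} (\<lambda>s. P $ k $ i * (x\<^sub>0 $ i + yv s \<omega> $ i)))"
    unfolding pk_sum by (rule Henstock_Kurzweil_Integration.integral_sum)
      (auto intro!: integral_itv_continuous_UNIV(3) continuous_intros l2_process_cont[OF l2_process_yv \<omega>])
  also have "\<dots> = (\<Sum>i\<in>UNIV. P $ k $ i * (t * x\<^sub>0 $ i + ?I $ i))"
  proof (rule sum.cong[OF refl])
    fix i
    show "integral {0..t} (\<lambda>s. P $ k $ i * (x\<^sub>0 $ i + yv s \<omega> $ i)) = P $ k $ i * (t * x\<^sub>0 $ i + ?I $ i)"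
      using Henstock_Kurzweil_Integration.integral_add[OF integrable_const_ivl yi, of "x\<^sub>0 $ i" i] t by simp
  qed
  also have "\<dots> = (P *v (t *\<^sub>R x\<^sub>0 + ?I)) $ k" by (simp add: matrix_vector_mult_def)
  finally have p: "integral {0..t} (\<lambda>s. pk k s \<omega>) = (P *v (t *\<^sub>R x\<^sub>0 + ?I)) $ k" .
  have "U *v us_obs t \<omega> = U *v (C *v (t *\<^sub>R x\<^sub>0 + ?I)) + U *v ((V ** transpose U) *v (\<chi> i. ob i t \<omega>))"
    unfolding us_obs_eq[OF \<omega> t] free_obs_def by (simp add: matrix_vector_right_distrib matrix_vector_mult_scaleR add.commute add.left_commute)
  also have "U *v ((V ** transpose U) *v (\<chi> i. ob i t \<omega>)) = (\<chi> i. ob i t \<omega>)"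
    by (simp add: matrix_vector_mul_assoc matrix_mul_assoc UVU)
  also have "U *v (C *v (t *\<^sub>R x\<^sub>0 + ?I)) = diag_mat l *v (P *v (t *\<^sub>R x\<^sub>0 + ?I))"
    by (simp only: matrix_vector_mul_assoc UC)
  finally show ?thesis unfolding zeta_def p by (simp add: diag_mat_vec)
qed

lemma xh_xi: "xh t \<omega> = (S ** transpose P) *v (\<chi> k. xi k t \<omega>)"
proof -
  have "(\<chi> k. xi k t \<omega>) = P *v (x\<^sub>0 + yv t \<omega>) + (\<chi> k. es k t \<omega>)" by (simp add: vec_eq_iff xi_def pk_def)
  moreover have "(S ** transpose P) *v (P *v (x\<^sub>0 + yv t \<omega>)) = x\<^sub>0 + yv t \<omega>"
    by (simp add: matrix_vector_mul_assoc SPP)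
  ultimately show ?thesis by (simp add: xh_def matrix_vector_right_distrib)
qed

text \<open>The feedback matrix \<open>B ** Kt\<close> in filter coordinates,
  \<open>S ** transpose P\<close> being the inverse of \<open>P\<close>.\<close>

definition A0 :: "real^'k^'k" where "A0 = P ** B ** Kt ** S ** transpose P"

lemma xi_continuous: "\<omega> \<in> space M \<Longrightarrow> continuous_on UNIV (\<lambda>s. xi k s \<omega>)"
  unfolding xi_def by (intro continuous_intros pk_continuous l2_process_cont[OF l2_process_est])

lemma pk_integral:
  assumes \<omega>: "\<omega> \<in> space M" and t: "0 \<le> t"
  shows "pk k t \<omega> = (P *v x\<^sub>0) $ k - integral {0..t} (\<lambda>s. \<Sum>j\<in>UNIV. A0 $ k $ j * xi j s \<omega>)"
proof -
  have eq: "(\<Sum>i\<in>UNIV. P $ k $ i * (B *v us s \<omega>) $ i) = - (\<Sum>j\<in>UNIV. A0 $ k $ j * xi j s \<omega>)" for s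
  proof -
    have "P *v (B *v us s \<omega>) = - (A0 *v (\<chi> j. xi j s \<omega>))"
      unfolding us_def xh_xi A0_def by (simp add: matrix_vector_mul_assoc matrix_mul_assoc linear_neg[OF matrix_vector_mul_linear])
    then have "(P *v (B *v us s \<omega>)) $ k = (- (A0 *v (\<chi> j. xi j s \<omega>))) $ k" by simp
    then show ?thesis by (simp add: matrix_vector_mult_def[of P] matrix_vector_mult_def[of A0])
  qed
  have "pk k t \<omega> = (P *v x\<^sub>0) $ k + (\<Sum>i\<in>UNIV. P $ k $ i * yv t \<omega> $ i)"
    unfolding pk_sum by (simp add: matrix_vector_mult_def distrib_left sum.distrib)
  also have "(\<Sum>i\<in>UNIV. P $ k $ i * yv t \<omega> $ i) = (\<Sum>i\<in>UNIV. integral {0..t} (\<lambda>s. P $ k $ i * (B *v us s \<omega>) $ i))"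
    unfolding yv_integral[OF \<omega> t] by (simp only: integral_mult_right)
  also have "\<dots> = integral {0..t} (\<lambda>s. \<Sum>i\<in>UNIV. P $ k $ i * (B *v us s \<omega>) $ i)"
    by (rule Henstock_Kurzweil_Integration.integral_sum[symmetric])
       (auto intro!: integral_itv_continuous_UNIV(3) continuous_intros drift_continuous \<omega>)
  also have "\<dots> = - integral {0..t} (\<lambda>s. \<Sum>j\<in>UNIV. A0 $ k $ j * xi j s \<omega>)" unfolding eq by simp
  finally show ?thesis by simp
qed

lemma zeta_continuous: "\<omega> \<in> space M \<Longrightarrow> continuous_on {0..t} (\<lambda>s. zeta k s \<omega>)"
proof -
  assume \<omega>: "\<omega> \<in> space M"
  have "continuous_on {0..t} (\<lambda>s. ob k s \<omega> + l k * integral {0..s} (\<lambda>s. pk k s \<omega>))"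
    by (intro continuous_intros continuous_on_integral_Icc)
       (rule continuous_on_subset[OF l2_process_cont[OF l2_process_obs \<omega>] subset_UNIV], rule continuous_on_subset[OF pk_continuous[OF \<omega>] subset_UNIV])
  then show ?thesis by (rule continuous_on_eq) (simp add: zeta_eq[OF \<omega>])
qed

definition f1 :: "'k \<Rightarrow> real \<Rightarrow> 'a \<Rightarrow> real" where "f1 k s \<omega> = l k * (1 - (tanh (l k * s))\<^sup>2) * zeta k s \<omega>"
definition Av :: "'k \<Rightarrow> 'k \<Rightarrow> real \<Rightarrow> real" where
  "Av k j s = A0 $ k $ j + (if j = k then l k * tanh (l k * s) else 0)"

lemma f1_continuous: "\<omega> \<in> space M \<Longrightarrow> continuous_on {0..t} (\<lambda>s. f1 k s \<omega>)"
  unfolding f1_def by (intro continuous_intros zeta_continuous) auto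

text \<open>The estimate has a filter part, given by \<open>est_volterra\<close>, and a response
  part, given by \<open>pk_integral\<close>. Their sum satisfies a closed equation for
  \<open>xi\<close> whose forcing depends on the actual observation alone.\<close>

lemma xi_volterra:
  assumes \<omega>: "\<omega> \<in> space M" and t: "0 \<le> t"
  shows "xi k t \<omega> = ((P *v x\<^sub>0) $ k + tanh (l k * t) * zeta k t \<omega> - integral {0..t} (\<lambda>s. f1 k s \<omega>))
    - integral {0..t} (\<lambda>s. \<Sum>j\<in>UNIV. Av k j s * xi j s \<omega>)"
proof -
  let ?f2 = "\<lambda>s. l k * tanh (l k * s) * xi k s \<omega>" and ?f3 = "\<lambda>s. \<Sum>j\<in>UNIV. A0 $ k $ j * xi j s \<omega>"
  have i1: "(\<lambda>s. f1 k s \<omega>) integrable_on {0..t}" by (rule integrable_continuous_real[OF f1_continuous[OF \<omega>]])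
  have i2: "?f2 integrable_on {0..t}"
    by (rule integral_itv_continuous_UNIV(3)) (intro continuous_intros xi_continuous \<omega>, auto)
  have i3: "?f3 integrable_on {0..t}"
    by (rule integral_itv_continuous_UNIV(3)) (intro continuous_intros xi_continuous \<omega>)
  have "es k t \<omega> = tanh (l k * t) * zeta k t \<omega> - integral {0..t} (\<lambda>s. f1 k s \<omega> + ?f2 s)"
    unfolding f1_def xi_def by (rule est_volterra[OF \<omega> t pk_continuous[OF \<omega>] zeta_eq[OF \<omega>]])
  moreover have "integral {0..t} (\<lambda>s. f1 k s \<omega> + ?f2 s) = integral {0..t} (\<lambda>s. f1 k s \<omega>) + integral {0..t} ?f2"
    by (rule Henstock_Kurzweil_Integration.integral_add[OF i1 i2])
  moreover have "(\<lambda>s. \<Sum>j\<in>UNIV. Av k j s * xi j s \<omega>) = (\<lambda>s. ?f3 s + ?f2 s)"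
    by (simp add: Av_def distrib_right sum.distrib mult_if_0 if_distribR fun_eq_iff if_distrib[of "\<lambda>x. x * _"] cong: if_cong)
  moreover have "integral {0..t} (\<lambda>s. ?f3 s + ?f2 s) = integral {0..t} ?f3 + integral {0..t} ?f2"
    by (rule Henstock_Kurzweil_Integration.integral_add[OF i3 i2])
  ultimately show ?thesis using pk_integral[OF \<omega> t, of k] by (simp add: xi_def[of k t])
qed

text \<open>\<open>us\<close> is written in terms of the free observations, whereas the controller
  sees \<open>us_obs\<close>, which contains the effect of its own past inputs.
  \<open>xi_volterra\<close> breaks this circle, because the solution of the Volterra equation is a
  measurable functional of its forcing.\<close>

lemma us_adapted: "adapted_to_history M us_obs us"
  unfolding adapted_to_history_def
proof (intro allI impI)
  fix T :: real assume T: "0 \<le> T"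
  let ?N = "history M us_obs T"
  have z: "zeta k s \<in> borel_measurable ?N" if s: "s \<in> {0..T}" for k s
  proof -
    have "(\<lambda>\<omega>. U $ k \<bullet> us_obs s \<omega>) \<in> borel_measurable ?N"
      by (intro borel_measurable_inner borel_measurable_const history_measurable s)
    then show ?thesis by (simp add: zeta_def[abs_def] matrix_vector_nth)
  qed
  have m: "xi k T \<in> borel_measurable ?N" for k
  proof (rule volterra_measurable[where A=Av and T=T and g="\<lambda>k t \<omega>. (P *v x\<^sub>0) $ k + tanh (l k * t) * zeta k t \<omega> - integral {0..t} (\<lambda>s. f1 k s \<omega>)"])
    show "continuous_on UNIV (Av k j)" for k j
      unfolding Av_def[abs_def] by (cases "j = k") (auto intro!: continuous_intros)
    show "continuous_on {0..T} (\<lambda>t. xi k t \<omega>)" if "\<omega> \<in> space ?N" for k \<omega>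
      using xi_continuous[of \<omega> k] that by (auto simp: space_history intro: continuous_on_subset)
    show "xi k t \<omega> = (P *v x\<^sub>0) $ k + tanh (l k * t) * zeta k t \<omega> - integral {0..t} (\<lambda>s. f1 k s \<omega>) - integral {0..t} (\<lambda>s. \<Sum>j\<in>UNIV. Av k j s * xi j s \<omega>)"
      if "\<omega> \<in> space ?N" "t \<in> {0..T}" for k t \<omega>
      by (rule xi_volterra) (use that in \<open>simp_all add: space_history\<close>)
    show "(\<lambda>\<omega>. (P *v x\<^sub>0) $ k + tanh (l k * t) * zeta k t \<omega> - integral {0..t} (\<lambda>s. f1 k s \<omega>)) \<in> borel_measurable ?N"
      if t: "t \<in> {0..T}" for k t
    proof -
      have "(\<lambda>\<omega>. integral {0..t} (\<lambda>s. f1 k s \<omega>)) \<in> borel_measurable ?N"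
      proof (rule adapted_integral)
        show "f1 k r \<in> borel_measurable ?N" if "r \<in> {0..t}" for r
          unfolding f1_def[abs_def] using z[of r k] that t by simp
        show "continuous_on {0..t} (\<lambda>s. f1 k s \<omega>)" if "\<omega> \<in> space ?N" for \<omega>
          using f1_continuous[of \<omega> t k] that by (simp add: space_history)
      qed (use t in simp)
      then show ?thesis by (intro borel_measurable_add borel_measurable_diff borel_measurable_times borel_measurable_const z t)
    qed
  qed (use T in simp)
  show "us T \<in> borel_measurable ?N"
  proof (rule borel_measurable_vecI)
    fix j
    have "(\<lambda>\<omega>. - ((Kt ** (S ** transpose P)) *v (\<chi> i. xi i T \<omega>)) $ j) \<in> borel_measurable ?N"
      by (intro borel_measurable_uminus borel_measurable_matrix_nth m)
    then show "(\<lambda>\<omega>. us T \<omega> $ j) \<in> borel_measurable ?N" by (simp add: us_def xh_xi matrix_vector_mul_assoc)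
  qed
qed

lemma path_continuous: "\<omega> \<in> space M \<Longrightarrow> continuous_on UNIV y \<Longrightarrow> continuous_on {0..t} (\<lambda>s. x\<^sub>0 + y s + \<Gamma> *v w s \<omega>)"
proof -
  assume \<omega>: "\<omega> \<in> space M" and y: "continuous_on UNIV y"
  have wc: "continuous_on {0..t} (\<lambda>s. w s \<omega>)" by (rule continuous_on_subset[OF w_continuous[OF \<omega>]]) auto
  show ?thesis
    by (intro continuous_intros continuous_on_subset[OF y] continuous_on_compose2[OF matrix_vector_mult_linear_continuous_on wc]) auto
qed

lemma us_trajectory: "lqg_trajectory M 0 B x\<^sub>0 noise us (state us)"
  unfolding lqg_trajectory_def
proof (intro ballI allI impI conjI)
  fix \<omega> t assume \<omega>: "\<omega> \<in> space M" and t: "(0::real) \<le> t"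
  show "set_integrable lborel {0..t} (\<lambda>s. us s \<omega>)" using ctrl_us \<omega> t by (simp add: ctrl_def)
  have "continuous_on {0..t} (\<lambda>s. state us s \<omega>)"
    by (rule continuous_on_eq[OF path_continuous[OF \<omega> yv_continuous[OF \<omega>]]]) (simp add: state_us(1)[OF \<omega>])
  then show "set_integrable lborel {0..t} (\<lambda>s. state us s \<omega>)" by (rule LINT_nth_continuous(1))
  have Bc: "continuous_on {0..t} (\<lambda>s. B *v us s \<omega>)"
    by (rule continuous_on_compose2[OF matrix_vector_mult_linear_continuous_on continuous_on_subset[OF us_path[OF \<omega>]]]) auto
  have "(LINT s:{0..t}|lborel. 0 *v state us s \<omega> + B *v us s \<omega>) = yv t \<omega>"
    by (simp add: vec_eq_iff LINT_nth_continuous(2)[OF Bc] yv_integral[OF \<omega> t])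
  then show "state us t \<omega> = x\<^sub>0 + (LINT s:{0..t}|lborel. 0 *v state us s \<omega> + B *v us s \<omega>) + noise t \<omega>"
    using state_us(1)[OF \<omega> t] by simp
qed

lemma us_admissible: "lqg_admissible M 0 B C x\<^sub>0 noise mnoise us (state us)"
  unfolding lqg_admissible_def
proof (intro conjI exI[of _ "\<lambda>t \<omega>. x\<^sub>0 + noise t \<omega>"])
  show "adapted_to_history M (lqg_observation C mnoise (state us)) us" using us_adapted by (simp add: us_obs_def)
  show "lqg_trajectory M 0 B x\<^sub>0 noise (\<lambda>_ _. 0) (\<lambda>t \<omega>. x\<^sub>0 + noise t \<omega>)"
    unfolding lqg_trajectory_def
    using LINT_nth_continuous(1)[OF path_continuous[where y="\<lambda>_. 0"]] by (auto simp: set_integrable_def)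
  have "history M (lqg_observation C mnoise (\<lambda>t \<omega>. x\<^sub>0 + noise t \<omega>)) t = history M free_obs t" for t
  proof (rule history_cong)
    fix s \<omega> assume s: "s \<in> {0..t}" and \<omega>: "\<omega> \<in> space M"
    have "lqg_observation C mnoise (\<lambda>t \<omega>. x\<^sub>0 + noise t \<omega>) s \<omega> = free_obs s \<omega> + C *v (\<chi> i. integral {0..s} (\<lambda>s. (0 :: real^'k) $ i))"
      by (rule observation_eq[OF \<omega>]) (use s in auto)
    then show "lqg_observation C mnoise (\<lambda>t \<omega>. x\<^sub>0 + noise t \<omega>) s \<omega> = free_obs s \<omega>"
      by (simp add: matrix_vector_mult_def vec_eq_iff)
  qed
  then show "adapted_to_history M (lqg_observation C mnoise (\<lambda>t \<omega>. x\<^sub>0 + noise t \<omega>)) us"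
    using us_adapted_free by (simp add: adapted_to_history_def)
qed (rule us_measurable us_trajectory)+

section \<open>The cost of the certainty-equivalent control\<close>

lemma cost_us:
  assumes T: "0 \<le> T"
  shows "cost us T + phi us T = x\<^sub>0 \<bullet> (X *v x\<^sub>0) + T * trace (S ** X) + G T"
proof -
  let ?v = "\<lambda>t \<omega>. us t \<omega> + Kt *v state us t \<omega>"
  note lv = l2v_residual[OF ctrl_us T]
  have "IP T ?v (\<lambda>t \<omega>. R *v ?v t \<omega>) = G T"
    unfolding G_def IP_integral(1)[OF lv l2v_mult[OF lv] T] IP_integral(1)[OF l2v_e l2v_mult[OF l2v_e] T]
  proof (rule integral_cong_AE)
    show "AE t in itv 0 T. expectation (\<lambda>\<omega>. ?v t \<omega> \<bullet> (R *v ?v t \<omega>)) = expectation (\<lambda>\<omega>. e t \<omega> \<bullet> (Q *v e t \<omega>))"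
    proof (rule AE_itvI)
      fix t :: real assume "t \<in> {0..T}"
      then have t: "0 \<le> t" by simp
      show "expectation (\<lambda>\<omega>. ?v t \<omega> \<bullet> (R *v ?v t \<omega>)) = expectation (\<lambda>\<omega>. e t \<omega> \<bullet> (Q *v e t \<omega>))"
      proof (rule Bochner_Integration.integral_cong[OF refl])
        fix \<omega> assume \<omega>: "\<omega> \<in> space M"
        \<comment> \<open>The equality case of \<open>residual_lower_bound\<close>: the residual is
          the feedback gain applied to the filter error.\<close>
        have "?v t \<omega> = Kt *v e t \<omega>" by (simp add: state_us(2)[OF \<omega> t] us_def matrix_vector_right_distrib)
        then show "?v t \<omega> \<bullet> (R *v ?v t \<omega>) = e t \<omega> \<bullet> (Q *v e t \<omega>)" by (simp add: quad_forms)
      qed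
    qed
  qed (rule borel_measurable_integrable[OF IP_integral(2)[OF lv l2v_mult[OF lv] T]] borel_measurable_integrable[OF IP_integral(2)[OF l2v_e l2v_mult[OF l2v_e] T]])+
  then show ?thesis using cost_identity[OF ctrl_us T] by simp
qed

text \<open>The weights are nonnegative and \<open>ln (cosh x)\<close> has slope at most 1 on the
  nonnegative axis, so the long-time growth rate of \<open>G\<close> bounds its growth on every
  interval.\<close>

lemma G_increment:
  assumes "0 \<le> s" "s \<le> T"
  shows "G T - G s \<le> (\<Sum>k\<in>UNIV. (P ** S ** Q ** S ** transpose P) $ k $ k / l k) * (T - s)"
proof -
  let ?q = "\<lambda>k. (P ** S ** Q ** S ** transpose P) $ k $ k"
  have q: "0 \<le> ?q k" for k
  proof -
    have "P ** S ** Q ** S ** transpose P = (P ** S) ** Q ** transpose (P ** S)"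
      by (simp add: matrix_transpose_mul sym matrix_mul_assoc)
    then show ?thesis by (simp add: congruence_nth semidef)
  qed
  \<comment> \<open>The slope bound in multiplicative form:
    \<open>cosh y \<le> exp (y - x) * cosh x\<close>.\<close>
  have lc: "ln (cosh y) - ln (cosh x) \<le> y - x" if "0 \<le> x" "x \<le> y" for x y :: real
  proof -
    have "cosh y \<le> exp (y - x) * cosh x"
      using that by (simp add: cosh_def distrib_left flip: exp_add)
    then have "ln (cosh y) \<le> ln (exp (y - x) * cosh x)" by (simp add: cosh_real_pos)
    then show ?thesis by (simp add: ln_mult cosh_real_pos)
  qed
  have "G T - G s = (\<Sum>k\<in>UNIV. ?q k * ((ln (cosh (l k * T)) - ln (cosh (l k * s))) / (l k)\<^sup>2))"
    using assms by (simp add: G_eq sum_subtractf[symmetric] diff_divide_distrib right_diff_distrib)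
  also have "\<dots> \<le> (\<Sum>k\<in>UNIV. ?q k / l k * (T - s))"
  proof (rule sum_mono)
    fix k
    have "ln (cosh (l k * T)) - ln (cosh (l k * s)) \<le> l k * T - l k * s"
      using l[of k] assms by (intro lc) auto
    then have "(ln (cosh (l k * T)) - ln (cosh (l k * s))) / (l k)\<^sup>2 \<le> (l k * T - l k * s) / (l k)\<^sup>2"
      by (intro divide_right_mono) auto
    also have "\<dots> = (T - s) / l k" using l[of k] by (simp add: power2_eq_square right_diff_distrib[symmetric])
    finally show "?q k * ((ln (cosh (l k * T)) - ln (cosh (l k * s))) / (l k)\<^sup>2) \<le> ?q k / l k * (T - s)"
      using mult_left_mono[OF _ q[of k]] by fastforce
  qed
  finally show ?thesis by (simp only: sum_distrib_right)
qed

text \<open>The running cost is monotone in the horizon, so by \<open>cost_us\<close> the terminal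
  cost cannot grow faster than the explicit right-hand side. The closed-loop dynamics need not be
  estimated.\<close>

lemma phi_increment:
  assumes "0 \<le> s" "s \<le> T"
  shows "phi us T - phi us s \<le> Jopt * (T - s)"
proof -
  have "0 \<le> T" using assms by simp
  from cost_us[OF this] cost_us[OF assms(1)] cost_mono[OF ctrl_us assms] G_increment[OF assms]
  have "phi us T - phi us s \<le> T * trace (S ** X) - s * trace (S ** X) + (\<Sum>k\<in>UNIV. (P ** S ** Q ** S ** transpose P) $ k $ k / l k) * (T - s)"
    by linarith
  then show ?thesis unfolding Jopt_def by (simp add: algebra_simps)
qed

text \<open>The terminal cost grows at most linearly in time and its integral is bounded by the running cost, so it cannot exceed the order of \<open>sqrt T\<close>.\<close>

lemma phi_limit: "((\<lambda>T. phi us T / T) \<longlongrightarrow> 0) at_top"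
proof -
  obtain \<kappa> where \<kappa>: "0 \<le> \<kappa>" "\<And>u T. ctrl u \<Longrightarrow> 0 \<le> T \<Longrightarrow> integrable (itv 0 T) (phi u) \<and> (\<integral>t. phi u t \<partial>itv 0 T) \<le> \<kappa> * cost u T"
    by (rule integral_phi_le_cost) blast
  \<comment> \<open>The first summand is the growth of the terminal cost across the window below;
    the second comes from the bound on its time integral, with the initial cost absorbed by
    \<open>1 \<le> T\<close>.\<close>
  define c where "c = \<bar>Jopt\<bar> + \<kappa> * (x\<^sub>0 \<bullet> (X *v x\<^sub>0) + \<bar>Jopt\<bar>)"
  have "phi us T / T \<le> c / sqrt T" if T: "1 \<le> T" for T
  proof -
    let ?h = "sqrt T"
    have cancel: "b * h / (h * h) = b / h" if "0 < h" for b h :: real using that by simp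
    have hh: "?h * ?h = T" and h0: "0 < ?h" "1 \<le> ?h" using T by auto
    have h: "?h \<le> T" using mult_left_mono[OF h0(2), of ?h] h0 hh by simp
    \<comment> \<open>The window length \<open>sqrt T\<close> balances the two losses:
      \<open>\<bar>Jopt\<bar> * ?h\<close> from the growth bound against order \<open>T / ?h\<close>
      from the integral bound.\<close>
    have "?h * (phi us T - \<bar>Jopt\<bar> * ?h) \<le> (\<integral>t. phi us t \<partial>itv 0 T)"
    proof (rule integral_itv_ge_window)
      show "integrable (itv 0 T) (phi us)" using \<kappa>(2)[OF ctrl_us, of T] T by simp
      fix t assume t: "T - ?h \<le> t" "t \<le> T"
      have "phi us T - phi us t \<le> Jopt * (T - t)" using phi_increment[of t T] t h by simp
      also have "\<dots> \<le> \<bar>Jopt\<bar> * ?h" using t by (intro mult_mono) auto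
      finally show "phi us T - \<bar>Jopt\<bar> * ?h \<le> phi us t" by simp
    qed (use h h0 phi_nonneg in auto)
    also have "\<dots> \<le> \<kappa> * cost us T" using \<kappa>(2)[OF ctrl_us, of T] T by simp
    also have "\<dots> \<le> \<kappa> * ((x\<^sub>0 \<bullet> (X *v x\<^sub>0) + \<bar>Jopt\<bar>) * T)"
    proof (rule mult_left_mono[OF _ \<kappa>(1)])
      have "cost us T \<le> x\<^sub>0 \<bullet> (X *v x\<^sub>0) + T * trace (S ** X) + G T" using cost_us[of T] phi_nonneg[of us T] T by simp
      also have "\<dots> \<le> x\<^sub>0 \<bullet> (X *v x\<^sub>0) + Jopt * T"
        using G_increment[of 0 T] T by (simp add: G_eq[of 0] Jopt_def algebra_simps)
      also have "\<dots> \<le> x\<^sub>0 \<bullet> (X *v x\<^sub>0) * T + \<bar>Jopt\<bar> * T"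
        using mult_left_mono[OF T semidef(3)[of x\<^sub>0]] T by (intro add_mono mult_right_mono) auto
      finally show "cost us T \<le> (x\<^sub>0 \<bullet> (X *v x\<^sub>0) + \<bar>Jopt\<bar>) * T" by (simp only: distrib_right)
    qed
    finally have 1: "?h * (phi us T - \<bar>Jopt\<bar> * ?h) \<le> \<kappa> * ((x\<^sub>0 \<bullet> (X *v x\<^sub>0) + \<bar>Jopt\<bar>) * T)" .
    have split: "h * p = h * (p - J * h) + J * (h * h)" for h p J :: real by (simp add: algebra_simps)
    have "?h * phi us T = ?h * (phi us T - \<bar>Jopt\<bar> * ?h) + \<bar>Jopt\<bar> * T"
      using split[of ?h "phi us T" "\<bar>Jopt\<bar>"] unfolding hh .
    moreover have "c * T = \<bar>Jopt\<bar> * T + \<kappa> * ((x\<^sub>0 \<bullet> (X *v x\<^sub>0) + \<bar>Jopt\<bar>) * T)" unfolding c_def by (simp only: distrib_right mult.assoc)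
    ultimately have "?h * phi us T \<le> c * T" using 1 by linarith
    then have "?h * phi us T \<le> c * (?h * ?h)" unfolding hh .
    then have "?h * phi us T \<le> ?h * (c * ?h)" by (simp only: ac_simps)
    then have "phi us T \<le> c * ?h" using h0(1) by (simp only: mult_le_cancel_left_pos)
    then have "phi us T / (?h * ?h) \<le> c * ?h / (?h * ?h)" by (intro divide_right_mono) auto
    also have "c * ?h / (?h * ?h) = c / ?h" by (rule cancel[OF h0(1)])
    finally show ?thesis unfolding hh .
  qed
  note bound = this
  show ?thesis
  proof (rule tendsto_sandwich[OF _ _ tendsto_const])
    show "\<forall>\<^sub>F T in at_top. 0 \<le> phi us T / T" using eventually_gt_at_top[of 0] by eventually_elim (simp add: phi_nonneg)
    show "\<forall>\<^sub>F T in at_top. phi us T / T \<le> c / sqrt T" using eventually_ge_at_top[of 1] by eventually_elim (rule bound)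
    show "((\<lambda>T. c / sqrt T) \<longlongrightarrow> 0) at_top"
      by (intro tendsto_divide_0[OF tendsto_const] filterlim_at_top_imp_at_infinity sqrt_at_top)
  qed
qed

lemma cost_us_limit: "((\<lambda>T. cost us T / T) \<longlongrightarrow> Jopt) at_top"
proof -
  have "((\<lambda>T. (x\<^sub>0 \<bullet> (X *v x\<^sub>0)) / T) \<longlongrightarrow> 0) at_top"
    by (intro tendsto_divide_0[OF tendsto_const] filterlim_at_top_imp_at_infinity filterlim_ident)
  then have "((\<lambda>T. (x\<^sub>0 \<bullet> (X *v x\<^sub>0)) / T + (T * trace (S ** X) + G T) / T - phi us T / T) \<longlongrightarrow> 0 + Jopt - 0) at_top"
    by (intro tendsto_intros G_limit phi_limit)
  moreover have "\<forall>\<^sub>F T in at_top. (x\<^sub>0 \<bullet> (X *v x\<^sub>0)) / T + (T * trace (S ** X) + G T) / T - phi us T / T = cost us T / T"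
    using eventually_gt_at_top[of 0]
  proof eventually_elim
    case (elim T)
    have "cost us T = x\<^sub>0 \<bullet> (X *v x\<^sub>0) + (T * trace (S ** X) + G T) - phi us T" using cost_us[of T] elim by simp
    then show ?case by (simp only: add_divide_distrib diff_divide_distrib)
  qed
  ultimately show ?thesis by (simp add: filterlim_cong)
qed

lemma optimal_cost: "lqg_optimal_cost M 0 B C x\<^sub>0 noise mnoise Q R = ennreal Jopt"
  unfolding lqg_optimal_cost_def
proof (rule antisym)
  have "((\<lambda>T. ennreal (cost us T / T)) \<longlongrightarrow> ennreal Jopt) at_top"
    by (rule tendsto_ennrealI[OF cost_us_limit])
  then have "(lqg_average_cost M Q R us (state us) \<longlongrightarrow> ennreal Jopt) at_top"
  proof (rule Lim_transform_eventually)
    show "\<forall>\<^sub>F T in at_top. ennreal (cost us T / T) = lqg_average_cost M Q R us (state us) T"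
      using eventually_gt_at_top[of 0] by eventually_elim (rule average_cost_eq[OF ctrl_us refl, symmetric])
  qed
  then show "Inf {c. \<exists>u x. lqg_admissible M 0 B C x\<^sub>0 noise mnoise u x \<and> (lqg_average_cost M Q R u x \<longlongrightarrow> c) at_top} \<le> ennreal Jopt"
    using us_admissible by (intro Inf_lower CollectI exI conjI)
  show "ennreal Jopt \<le> Inf {c. \<exists>u x. lqg_admissible M 0 B C x\<^sub>0 noise mnoise u x \<and> (lqg_average_cost M Q R u x \<longlongrightarrow> c) at_top}"
  proof (rule Inf_greatest)
    fix c assume "c \<in> {c. \<exists>u x. lqg_admissible M 0 B C x\<^sub>0 noise mnoise u x \<and> (lqg_average_cost M Q R u x \<longlongrightarrow> c) at_top}"
    then show "ennreal Jopt \<le> c" by (elim CollectE exE conjE) (rule average_cost_limit_ge)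
  qed
qed

end

text \<open>The diagonalisation is applied twice: to the pair of information matrix and noise
  covariance for the filter, and to \<open>X\<close> with
  \<open>B ** matrix_inv R ** transpose B\<close> for the closed loop. Nonnegativity is stated
  separately because \<open>ennreal\<close> truncates negative numbers and the limit statement has
  to undo it.\<close>

theorem lqg_optimal_cost_driftless:
  fixes w :: "real \<Rightarrow> 'a \<Rightarrow> real^'q" and \<Gamma> D :: "real^'q^'k" and B :: "real^'m^'k"
    and C Q X Y S V :: "real^'k^'k" and R :: "real^'m^'m"
  assumes w: "standard_wiener M w" and Q: "pos_def Q" and R: "pos_def R" and S: "pos_def S" and V: "pos_def V"
    and \<Gamma>: "\<Gamma> ** transpose \<Gamma> = S" "D ** transpose D = V" "\<Gamma> ** transpose D = 0"
    and Kpos: "pos_def (transpose C ** matrix_inv V ** C)" and Lpos: "pos_def (B ** matrix_inv R ** transpose B)"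
    and Y: "pd_riccati_solution (transpose C ** matrix_inv V ** C) S Y"
    and X: "pd_riccati_solution (B ** matrix_inv R ** transpose B) Q X"
  shows "lqg_optimal_cost M 0 B C x\<^sub>0 (\<lambda>t \<omega>. \<Gamma> *v w t \<omega>) (\<lambda>t \<omega>. D *v w t \<omega>) Q R = ennreal (trace (Y ** Q + S ** X))"
    and "0 \<le> trace (Y ** Q + S ** X)"
proof -
  have X': "pos_def X" "X ** (B ** matrix_inv R ** transpose B) ** X = Q"
    using X by (auto simp: pd_riccati_solution_def)
  obtain P :: "real^'k^'k" and l :: "'k \<Rightarrow> real" where P: "\<And>i. 0 < l i" "P ** S ** transpose P = mat 1"
    "transpose P ** P ** S = mat 1" "S ** transpose P ** P = mat 1"
    "transpose C ** matrix_inv V ** C = transpose P ** diag_mat (\<lambda>i. (l i)\<^sup>2) ** P"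
    by (rule simultaneous_diagonalization[OF Kpos S]) (rule that)
  obtain E :: "real^'k^'k" and m :: "'k \<Rightarrow> real" where E: "\<And>i. 0 < m i" "E ** (B ** matrix_inv R ** transpose B) ** transpose E = mat 1"
    "transpose E ** E ** (B ** matrix_inv R ** transpose B) = mat 1" "(B ** matrix_inv R ** transpose B) ** transpose E ** E = mat 1"
    "X = transpose E ** diag_mat (\<lambda>i. (m i)\<^sup>2) ** E"
    by (rule simultaneous_diagonalization[OF X'(1) Lpos]) (rule that)
  interpret prob_space M using w by (simp add: standard_wiener_def)
  interpret lqg_controlled M w \<Gamma> D B C Q X S V P R l x\<^sub>0 E "\<lambda>i. (m i)\<^sup>2"
    by unfold_locales (fact w Q R X'(1) S V \<Gamma> P X'(2) E)+
  \<comment> \<open>Uniqueness identifies the given solution with the explicit one; cyclicity of the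
    trace then turns its trace against \<open>Q\<close> into the sum in \<open>Jopt\<close>.\<close>
  have Y_eq: "Y = S ** transpose P ** diag_mat (\<lambda>i. 1 / l i) ** P ** S"
    by (rule pd_riccati_solution_unique[OF Kpos Y riccati_solution_diagonal[OF P(1,2,3,5) S]])
  have "trace (Y ** Q) = trace ((S ** transpose P) ** (diag_mat (\<lambda>i. 1 / l i) ** P ** S ** Q))"
    unfolding Y_eq by (simp add: matrix_mul_assoc)
  also have "\<dots> = trace (diag_mat (\<lambda>i. 1 / l i) ** (P ** S ** Q ** S ** transpose P))"
    by (subst trace_mul_sym) (simp add: matrix_mul_assoc)
  also have "\<dots> = (\<Sum>k\<in>UNIV. (P ** S ** Q ** S ** transpose P) $ k $ k / l k)"
    unfolding trace_def by (subst matrix_matrix_mult_def) (simp add: diag_mat_def mult_if_0)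
  finally have J: "trace (Y ** Q + S ** X) = Jopt" by (simp add: trace_add Jopt_def)
  show "lqg_optimal_cost M 0 B C x\<^sub>0 (\<lambda>t \<omega>. \<Gamma> *v w t \<omega>) (\<lambda>t \<omega>. D *v w t \<omega>) Q R = ennreal (trace (Y ** Q + S ** X))"
    unfolding J by (rule optimal_cost)
  show "0 \<le> trace (Y ** Q + S ** X)"
    unfolding J
  proof (rule tendsto_lowerbound[OF cost_us_limit])
    show "\<forall>\<^sub>F T in at_top. 0 \<le> cost us T / T"
      using eventually_gt_at_top[of 0] by eventually_elim (simp add: cost_nonneg)
  qed simp
qed

section \<open>Matrices of the tracking problem\<close>

lemma scaleR_matrix:
  fixes A :: "real^'n^'m" and B :: "real^'p^'n"
  shows "(c *\<^sub>R A) ** B = c *\<^sub>R (A ** B)" "A ** (c *\<^sub>R B) = c *\<^sub>R (A ** B)" "transpose (c *\<^sub>R A) = c *\<^sub>R transpose A"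
    "(c *\<^sub>R A) *v x = c *\<^sub>R (A *v x)"
  by (simp_all add: vec_eq_iff matrix_matrix_mult_def matrix_vector_mult_def transpose_def sum_distrib_left ac_simps)

lemma trace_scaleR: "trace (c *\<^sub>R A) = c * trace (A :: real^'n^'n)"
  by (simp add: trace_def sum_distrib_left)

lemma pos_def_scaleR: "0 < c \<Longrightarrow> pos_def A \<Longrightarrow> pos_def (c *\<^sub>R A)"
  by (simp add: pos_def_def scaleR_matrix)

lemma pos_semidef_scaleR: "0 \<le> c \<Longrightarrow> pos_semidef A \<Longrightarrow> pos_semidef (c *\<^sub>R A)"
  by (simp add: pos_semidef_def scaleR_matrix)

lemma transpose_add: "transpose (A + B) = transpose A + transpose (B :: real^'n^'m)"
  by (simp add: vec_eq_iff transpose_def)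

lemma pos_def_add: "pos_semidef A \<Longrightarrow> pos_def B \<Longrightarrow> pos_def (A + B)"
  unfolding pos_def_def pos_semidef_def
  by (auto simp: transpose_add matrix_vector_mult_add_rdistrib inner_add_right intro!: add_nonneg_pos)

lemma inner_gram: "x \<bullet> ((A ** transpose A) *v x) = (transpose A *v x) \<bullet> (transpose A *v x)" for A :: "real^'n^'m"
  unfolding matrix_vector_mul_assoc[symmetric] by (rule inner_matrix_transpose)

lemma pos_semidef_gram: "pos_semidef (A ** transpose A)"
  unfolding pos_semidef_def inner_gram by (simp add: matrix_transpose_mul)

lemma pos_def_gram: "(\<And>x. transpose A *v x = 0 \<Longrightarrow> x = 0) \<Longrightarrow> pos_def (A ** transpose A)"
  unfolding pos_def_def inner_gram by (auto simp: matrix_transpose_mul)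

text \<open>A zero of a nonnegative form is a minimiser, so the form has zero derivative there;
  differentiating in the direction \<open>Q *v x\<close> gives \<open>Q *v x = 0\<close>.\<close>

lemma pos_semidef_inj_imp_pos_def:
  assumes Q: "pos_semidef Q" and inj: "\<And>x. Q *v x = 0 \<Longrightarrow> x = 0"
  shows "pos_def Q"
proof -
  have sym: "transpose Q = Q" and nn: "\<And>x. 0 \<le> x \<bullet> (Q *v x)" using Q by (auto simp: pos_semidef_def)
  have "x = 0" if x: "x \<bullet> (Q *v x) = 0" for x
  proof (rule inj)
    have "(Q *v x) \<bullet> (Q *v x) = 0"
    proof (rule quadratic_nonneg_imp_zero[where c="(Q *v x) \<bullet> (Q *v (Q *v x))"])
      fix t :: real
      have "0 \<le> (x + t *\<^sub>R (Q *v x)) \<bullet> (Q *v (x + t *\<^sub>R (Q *v x)))" by (rule nn)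
      also have "\<dots> = 2 * t * ((Q *v x) \<bullet> (Q *v x)) + t\<^sup>2 * ((Q *v x) \<bullet> (Q *v (Q *v x)))"
        using x pos_def_inner_sym[OF sym, of x "Q *v x"]
        by (simp add: matrix_vector_right_distrib matrix_vector_mult_scaleR inner_add_left inner_add_right power2_eq_square algebra_simps)
      finally show "0 \<le> 2 * t * ((Q *v x) \<bullet> (Q *v x)) + t\<^sup>2 * ((Q *v x) \<bullet> (Q *v (Q *v x)))" .
    qed
    then show "Q *v x = 0" by simp
  qed
  then show ?thesis unfolding pos_def_def using sym nn by (metis less_eq_real_def)
qed

lemma pos_def_matrix_inv:
  assumes "pos_def (A :: real^'n^'n)"
  shows "pos_def (matrix_inv A)"
proof -
  note i = pos_def_inverse[OF assms]
  have "pos_def (transpose (matrix_inv A) ** A ** matrix_inv A)"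
  proof (rule pos_def_congruence[OF assms])
    fix x assume "matrix_inv A *v x = 0"
    then have "A *v (matrix_inv A *v x) = 0" by simp
    then show "x = 0" by (simp add: matrix_vector_mul_assoc i(1))
  qed
  then show ?thesis by (simp add: i)
qed

lemma matrix_inv_eqI:
  fixes A B :: "real^'n^'n"
  assumes "B ** A = mat 1" "A ** B = mat 1"
  shows "matrix_inv A = B"
proof -
  have "A ** matrix_inv A = mat 1 \<and> matrix_inv A ** A = mat 1"
    unfolding matrix_inv_def by (rule someI[of _ B]) (simp add: assms)
  then have "B ** (A ** matrix_inv A) = B" by simp
  then show ?thesis by (simp add: matrix_mul_assoc assms(1))
qed

text \<open>With zero drift only the block \<open>k = 0\<close> of the controllability matrix has
  nonzero columns. A vector annihilated by the transpose is orthogonal to the span, hence to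
  itself.\<close>

lemma controllable_0_inj:
  fixes B :: "real^'m^'d"
  assumes "controllable 0 B" "transpose B *v x = 0"
  shows "x = 0"
proof -
  have "orthogonal x x"
  proof (rule orthogonal_to_span)
    show "x \<in> span (\<Union>k<CARD('d). columns (((\<lambda>P. (0 :: real^'d^'d) ** P) ^^ k) B))" using assms(1) by (simp add: controllable_def)
    fix y assume "y \<in> (\<Union>k<CARD('d). columns (((\<lambda>P. (0 :: real^'d^'d) ** P) ^^ k) B))"
    then obtain k j where y: "y = column j (((\<lambda>P. (0 :: real^'d^'d) ** P) ^^ k) B)" by (auto simp: columns_def)
    show "orthogonal x y"
    proof (cases k)
      case 0
      have "x \<bullet> y = (transpose B *v x) $ j"
        unfolding y 0 by (simp add: inner_vec_def column_def matrix_vector_mult_def transpose_def mult.commute del: transpose_matrix_vector)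
      then show ?thesis using assms(2) by (simp add: orthogonal_def del: transpose_matrix_vector)
    next
      case (Suc n)
      then show ?thesis unfolding y by (simp add: orthogonal_def inner_vec_def column_def matrix_matrix_mult_def)
    qed
  qed
  then show ?thesis by (simp add: orthogonal_def)
qed

lemma observable_0_inj:
  assumes "observable 0 C" "C *v x = 0"
  shows "x = 0"
proof -
  have "C *v (((*v) 0 ^^ k) x) = 0" for k
    using assms(2) by (cases k) simp_all
  then show ?thesis using assms(1) by (auto simp: observable_def)
qed

section \<open>Kronecker products and block matrices\<close>

lemma sum_UNIV_prod: "(\<Sum>p\<in>UNIV. f p) = (\<Sum>i\<in>UNIV. \<Sum>a\<in>UNIV. f (i, a))" for f :: "'i::finite \<times> 'j::finite \<Rightarrow> real"
  unfolding UNIV_Times_UNIV[symmetric] sum.cartesian_product[symmetric] by (simp add: case_prod_unfold sum.cartesian_product)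

lemma kron_mult: "(A \<otimes>\<^sub>K B) ** (C \<otimes>\<^sub>K D) = (A ** C) \<otimes>\<^sub>K (B ** D)"
  by (simp add: vec_eq_iff kron_def matrix_matrix_mult_def sum_UNIV_prod sum_product ac_simps)

lemma transpose_kron: "transpose (A \<otimes>\<^sub>K B) = transpose A \<otimes>\<^sub>K transpose B"
  by (simp add: vec_eq_iff kron_def transpose_def)

lemma kron_mat_1: "mat 1 \<otimes>\<^sub>K mat 1 = mat 1"
  by (auto simp: vec_eq_iff kron_def mat_def prod_eq_iff)

lemma kron_0: "A \<otimes>\<^sub>K 0 = 0"
  by (simp add: vec_eq_iff kron_def)

lemma kron_linear:
  "A \<otimes>\<^sub>K (c *\<^sub>R B) = c *\<^sub>R (A \<otimes>\<^sub>K B)" "(c *\<^sub>R A) \<otimes>\<^sub>K B = c *\<^sub>R (A \<otimes>\<^sub>K B)"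
  "A \<otimes>\<^sub>K (B + B') = A \<otimes>\<^sub>K B + A \<otimes>\<^sub>K B'"
  by (simp_all add: vec_eq_iff kron_def distrib_left)

lemma trace_kron: "trace (A \<otimes>\<^sub>K B) = trace A * trace B"
  by (simp add: trace_def kron_def sum_UNIV_prod sum_product)

lemma matrix_inv_kron:
  assumes "pos_def V"
  shows "matrix_inv (mat 1 \<otimes>\<^sub>K V) = mat 1 \<otimes>\<^sub>K matrix_inv V"
  by (rule matrix_inv_eqI) (simp_all add: kron_mult pos_def_inverse[OF assms] kron_mat_1)

lemma ones_mat_square: "ones_mat ** ones_mat = real CARD('n) *\<^sub>R (ones_mat :: real^'n^'n)"
  by (simp add: vec_eq_iff ones_mat_def matrix_matrix_mult_def)

lemma trace_ones_mat: "trace (ones_mat :: real^'n^'n) = real CARD('n)"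
  by (simp add: trace_def ones_mat_def)

lemma transpose_ones_mat: "transpose ones_mat = ones_mat"
  by (simp add: vec_eq_iff transpose_def ones_mat_def)

lemma transpose_mat_1: "transpose (mat 1) = (mat 1 :: real^'n^'n)"
  by (rule transpose_mat)

lemma pos_def_kron:
  assumes A: "pos_def A"
  shows "pos_def (mat 1 \<otimes>\<^sub>K A :: real^('n::finite \<times> 'd::finite)^('n \<times> 'd))"
  unfolding pos_def_def
proof (intro conjI allI impI)
  show "transpose (mat 1 \<otimes>\<^sub>K A) = mat 1 \<otimes>\<^sub>K A" using A by (simp add: transpose_kron pos_def_def transpose_mat_1)
  fix x :: "real^('n \<times> 'd)" assume x: "x \<noteq> 0"
  let ?x = "\<lambda>i. \<chi> a. x $ (i, a)"
  have "x \<bullet> ((mat 1 \<otimes>\<^sub>K A) *v x) = (\<Sum>i\<in>UNIV. ?x i \<bullet> (A *v ?x i))"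
  proof -
    have "((mat 1 \<otimes>\<^sub>K A) *v x) $ (i, a) = (A *v ?x i) $ a" for i a
    proof -
      have "((mat 1 \<otimes>\<^sub>K A) *v x) $ (i, a) = (\<Sum>j\<in>UNIV. (if i = j then 1 else 0) * (\<Sum>b\<in>UNIV. A $ a $ b * x $ (j, b)))"
        by (simp add: matrix_vector_mult_def kron_def sum_UNIV_prod mat_def sum_distrib_left mult.assoc)
      also have "\<dots> = (A *v ?x i) $ a" by (simp add: mult_if_0 matrix_vector_mult_def)
      finally show ?thesis .
    qed
    then show ?thesis unfolding inner_vec_def sum_UNIV_prod by simp
  qed
  moreover obtain i a where "x $ (i, a) \<noteq> 0" using x by (auto simp: vec_eq_iff)
  then have "?x i \<noteq> 0" by (auto simp: vec_eq_iff)
  then have "0 < (\<Sum>i\<in>UNIV. ?x i \<bullet> (A *v ?x i))"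
    using A pos_def_imp_pos_semidef[OF A] by (intro sum_pos2[of _ i]) (auto simp: pos_def_def pos_semidef_def)
  ultimately show "0 < x \<bullet> ((mat 1 \<otimes>\<^sub>K A) *v x)" by simp
qed

text \<open>The form sees a vector only through the sum of its blocks, which can vanish for a
  nonzero vector; this is why the limit object is semidefinite and the continuity estimate is stated
  for semidefinite matrices.\<close>

lemma pos_semidef_ones_kron:
  assumes "pos_def Y"
  shows "pos_semidef (ones_mat \<otimes>\<^sub>K Y :: real^('n::finite \<times> 'd::finite)^('n \<times> 'd))"
  unfolding pos_semidef_def
proof (intro conjI allI)
  show "transpose (ones_mat \<otimes>\<^sub>K Y) = ones_mat \<otimes>\<^sub>K Y" using assms by (simp add: transpose_kron pos_def_def transpose_ones_mat)
  fix x :: "real^('n \<times> 'd)"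
  let ?s = "\<chi> a. \<Sum>i\<in>UNIV. x $ (i, a)"
  have "((ones_mat \<otimes>\<^sub>K Y) *v x) $ (i, a) = (Y *v ?s) $ a" for i a
    unfolding matrix_vector_mult_def vec_lambda_beta sum_UNIV_prod
    by (subst sum.swap) (simp add: kron_def ones_mat_def sum_distrib_left)
  then have "x \<bullet> ((ones_mat \<otimes>\<^sub>K Y) *v x) = ?s \<bullet> (Y *v ?s)"
    unfolding inner_vec_def sum_UNIV_prod by (subst sum.swap) (simp add: sum_distrib_right)
  then show "0 \<le> x \<bullet> ((ones_mat \<otimes>\<^sub>K Y) *v x)" using pos_def_imp_pos_semidef[OF assms] by (simp add: pos_semidef_def)
qed

lemma ones_kron_gram: "ones_kron G ** transpose (ones_kron G) = ones_mat \<otimes>\<^sub>K (G ** transpose G)"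
  by (simp add: vec_eq_iff ones_kron_def transpose_def matrix_matrix_mult_def kron_def ones_mat_def)

text \<open>The block row matching \<open>stack3\<close>, so that three independent noises with
  their gains become one matrix acting on one Wiener process.\<close>

definition row3 :: "real^'i^'p \<Rightarrow> real^'j^'p \<Rightarrow> real^'k^'p \<Rightarrow> real^('i + 'j + 'k)^'p" where
  "row3 A B C = (\<chi> p. stack3 (A $ p) (B $ p) (C $ p))"

lemma sum_stack3: "(\<Sum>q\<in>UNIV. stack3 a b c $ q * stack3 a' b' c' $ q) = (\<Sum>i\<in>UNIV. a $ i * a' $ i) + (\<Sum>i\<in>UNIV. b $ i * b' $ i) + (\<Sum>i\<in>UNIV. c $ i * c' $ i)"
  unfolding UNIV_Plus_UNIV[symmetric] by (simp add: sum.Plus stack3_def del: UNIV_Plus_UNIV)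

lemma row3_vec: "row3 A B C *v stack3 a b c = A *v a + B *v b + C *v c"
  by (simp add: vec_eq_iff matrix_vector_mult_def row3_def sum_stack3)

lemma row3_gram: "row3 A B C ** transpose (row3 A' B' C') = A ** transpose A' + B ** transpose B' + C ** transpose C'"
  by (simp add: vec_eq_iff matrix_matrix_mult_def transpose_def row3_def sum_stack3)

lemma matrix_add_rdistrib: "(A + B) ** C = A ** C + B ** (C :: real^'p^'n)" for A B :: "real^'n^'m"
  by (simp add: vec_eq_iff matrix_matrix_mult_def distrib_right sum.distrib)

lemma uminus_matrix:
  fixes A :: "real^'n^'m"
  shows "(- A) *v x = - (A *v x)" "(- A) ** transpose (- A) = A ** transpose A"
  by (simp_all add: vec_eq_iff matrix_vector_mult_def matrix_matrix_mult_def transpose_def sum_negf)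

section \<open>The limit of vanishing process noise\<close>

lemma pd_riccati_solution_riccati:
  assumes "pos_def K" "pos_def S"
  shows "pd_riccati_solution K S (riccati K S)"
  unfolding riccati_def by (rule theI') (rule pd_riccati_solution_ex1[OF assms])

text \<open>The entries differ by at most a constant times \<open>sqrt \<epsilon>\<close>. Since
  that constant depends on \<open>K\<close> alone, no lower bound on the solutions is required as
  \<epsilon> tends to 0.\<close>

lemma riccati_perturbation_limit:
  fixes K N :: "real^'k^'k"
  assumes K: "pos_def K" and Y: "\<And>\<epsilon>. 0 < \<epsilon> \<Longrightarrow> pos_semidef (Y \<epsilon>)" and Z: "\<And>\<epsilon>. 0 < \<epsilon> \<Longrightarrow> pos_semidef (Z \<epsilon>)"
    and eq: "\<And>\<epsilon>. 0 < \<epsilon> \<Longrightarrow> Y \<epsilon> ** K ** Y \<epsilon> - Z \<epsilon> ** K ** Z \<epsilon> = \<epsilon> *\<^sub>R N"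
  shows "((\<lambda>\<epsilon>. Y \<epsilon> - Z \<epsilon>) \<longlongrightarrow> 0) (at_right 0)"
proof (rule riccati_holder[OF K])
  fix c assume c: "\<And>Y Z \<delta> i j. pos_semidef Y \<Longrightarrow> pos_semidef Z \<Longrightarrow>
    (\<And>x. \<bar>x \<bullet> ((Y ** K ** Y - Z ** K ** Z) *v x)\<bar> \<le> \<delta> * (x \<bullet> x)) \<Longrightarrow> \<bar>(Y - Z) $ i $ j\<bar> \<le> c * sqrt \<delta>"
  obtain b where b: "b > 0" "\<And>x. norm (N *v x) \<le> b * norm x"
    using linear_bounded_pos[OF matrix_vector_mul_linear[of N]] by (metis mult.commute)
  have bound: "\<bar>(Y \<epsilon> - Z \<epsilon>) $ i $ j\<bar> \<le> c * sqrt (\<epsilon> * b)" if \<epsilon>: "0 < \<epsilon>" for \<epsilon> i j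
  proof (rule c[OF Y[OF \<epsilon>] Z[OF \<epsilon>]])
    fix x
    have "\<bar>x \<bullet> (N *v x)\<bar> \<le> norm x * (b * norm x)"
      by (rule order_trans[OF Cauchy_Schwarz_ineq2]) (intro mult_left_mono b norm_ge_zero)
    then have "\<bar>x \<bullet> (N *v x)\<bar> \<le> b * (x \<bullet> x)" by (simp add: dot_square_norm power2_eq_square mult.left_commute)
    then show "\<bar>x \<bullet> ((Y \<epsilon> ** K ** Y \<epsilon> - Z \<epsilon> ** K ** Z \<epsilon>) *v x)\<bar> \<le> \<epsilon> * b * (x \<bullet> x)"
      unfolding eq[OF \<epsilon>] using \<epsilon> by (simp add: scaleR_matrix abs_mult mult.assoc)
  qed
  show ?thesis
  proof (intro vec_tendstoI)
    fix i j
    have "((\<lambda>\<epsilon>. c * sqrt (\<epsilon> * b)) \<longlongrightarrow> c * sqrt (0 * b)) (at_right 0)"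
      by (intro tendsto_intros)
    then have "((\<lambda>\<epsilon>. c * sqrt (\<epsilon> * b)) \<longlongrightarrow> 0) (at_right 0)" by simp
    moreover have "\<forall>\<^sub>F \<epsilon> in at_right 0. norm ((Y \<epsilon> - Z \<epsilon>) $ i $ j) \<le> c * sqrt (\<epsilon> * b)"
      using eventually_at_right_less[of 0] by eventually_elim (use bound in simp)
    ultimately have "((\<lambda>\<epsilon>. (Y \<epsilon> - Z \<epsilon>) $ i $ j) \<longlongrightarrow> 0) (at_right 0)" by (rule Lim_null_comparison[rotated])
    then show "((\<lambda>\<epsilon>. (Y \<epsilon> - Z \<epsilon>) $ i $ j) \<longlongrightarrow> 0 $ i $ j) (at_right 0)" by simp
  qed
qed

lemma tendsto_trace_mult:
  fixes \<Delta> :: "'b \<Rightarrow> real^'k^'k"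
  assumes "(\<Delta> \<longlongrightarrow> 0) F"
  shows "((\<lambda>x. trace (\<Delta> x ** N)) \<longlongrightarrow> 0) F"
proof -
  have "((\<lambda>x. \<Sum>i\<in>UNIV. \<Sum>j\<in>UNIV. \<Delta> x $ i $ j * N $ j $ i) \<longlongrightarrow> (\<Sum>i\<in>UNIV. \<Sum>j\<in>UNIV. (0 :: real^'k^'k) $ i $ j * N $ j $ i)) F"
    by (intro tendsto_sum tendsto_mult tendsto_vec_nth tendsto_const assms)
  then show ?thesis by (simp add: trace_def matrix_matrix_mult_def)
qed

theorem mainTheorem4:
  fixes A C F G H Q W Z V :: "real^'d^'d"
    and B :: "real^'m^'d" and R :: "real^'m^'m"
    and I\<^sub>n E\<^sub>n :: "real^'n^'n"
    and C\<^sub>n Q\<^sub>n W\<^sub>n Z\<^sub>n V\<^sub>n :: "real^('n::finite \<times> 'd::finite)^('n \<times> 'd)"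
    and B\<^sub>n :: "real^('n \<times> 'm)^('n \<times> 'd)" and R\<^sub>n :: "real^('n \<times> 'm)^('n \<times> 'm)"
    and n :: real
    and Y\<^sub>1 :: "real \<Rightarrow> real^'d^'d" and Y\<^sub>n :: "real \<Rightarrow> real^('n \<times> 'd)^('n \<times> 'd)"
    and X\<^sub>1 :: "real^'d^'d" and X\<^sub>n :: "real^('n \<times> 'd)^('n \<times> 'd)"
    and M :: "'a measure"
    and w\<^sub>p v :: "real \<Rightarrow> 'a \<Rightarrow> real^('n \<times> 'd)" and w\<^sub>e :: "real \<Rightarrow> 'a \<Rightarrow> real^'d"
    and x\<^sub>0 :: "real^('n \<times> 'd)"
    and J :: "real \<Rightarrow> ennreal"
  assumes "A = 0"
    and "W = G ** transpose G" and "Z = F ** transpose F" and "V = H ** transpose H"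
    and "pos_def V" and "pos_semidef Q" and "pos_def R"
    and "controllable A B" and "controllable A F" and "observable A C" and "observable A Q"
    and "n = real CARD('n)" and "I\<^sub>n = mat 1" and "E\<^sub>n = ones_mat"
    and "B\<^sub>n = I\<^sub>n \<otimes>\<^sub>K B" and "C\<^sub>n = I\<^sub>n \<otimes>\<^sub>K C" and "V\<^sub>n = I\<^sub>n \<otimes>\<^sub>K V" and "Z\<^sub>n = I\<^sub>n \<otimes>\<^sub>K Z"
    and "Q\<^sub>n = I\<^sub>n \<otimes>\<^sub>K Q" and "R\<^sub>n = I\<^sub>n \<otimes>\<^sub>K R" and "W\<^sub>n = E\<^sub>n \<otimes>\<^sub>K W"
    and "\<And>\<epsilon>. Y\<^sub>1 \<epsilon> = riccati (transpose C ** matrix_inv V ** C) (W + \<epsilon> *\<^sub>R Z)"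
    and "\<And>\<epsilon>. Y\<^sub>n \<epsilon> = riccati (transpose C\<^sub>n ** matrix_inv V\<^sub>n ** C\<^sub>n) (W\<^sub>n + \<epsilon> *\<^sub>R Z\<^sub>n)"
    and "X\<^sub>1 = riccati (B ** matrix_inv R ** transpose B) Q"
    and "X\<^sub>n = riccati (n *\<^sub>R (B\<^sub>n ** matrix_inv R\<^sub>n ** transpose B\<^sub>n)) ((1 / n) *\<^sub>R Q\<^sub>n)"
    and "independent_wiener M w\<^sub>p w\<^sub>e v"
    and "\<And>\<epsilon>. J \<epsilon> = tracking_cost_per_agent M w\<^sub>p w\<^sub>e v x\<^sub>0 A B C F G H Q R \<epsilon>"
  shows
    "(\<forall>\<epsilon>>0. \<exists>!Y. pd_riccati_solution (transpose C ** matrix_inv V ** C) (W + \<epsilon> *\<^sub>R Z) Y) \<and>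
     (\<forall>\<epsilon>>0. \<exists>!Y. pd_riccati_solution (transpose C\<^sub>n ** matrix_inv V\<^sub>n ** C\<^sub>n) (W\<^sub>n + \<epsilon> *\<^sub>R Z\<^sub>n) Y) \<and>
     (\<exists>!X. pd_riccati_solution (B ** matrix_inv R ** transpose B) Q X) \<and>
     (\<exists>!X. pd_riccati_solution (n *\<^sub>R (B\<^sub>n ** matrix_inv R\<^sub>n ** transpose B\<^sub>n)) ((1 / n) *\<^sub>R Q\<^sub>n) X) \<and>
     ((\<lambda>\<epsilon>. Y\<^sub>n \<epsilon> - (1 / sqrt n) *\<^sub>R (E\<^sub>n \<otimes>\<^sub>K Y\<^sub>1 \<epsilon>)) \<longlongrightarrow> 0) (at_right 0) \<and>
     (\<forall>\<epsilon>>0. J \<epsilon> = ennreal (trace (Y\<^sub>n \<epsilon> ** ((1 / n) *\<^sub>R Q\<^sub>n) + (W\<^sub>n + \<epsilon> *\<^sub>R Z\<^sub>n) ** X\<^sub>n))) \<and>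
     ((\<lambda>\<epsilon>. enn2real (J \<epsilon>) - ((1 / sqrt n) * trace (Y\<^sub>1 \<epsilon> ** Q) + trace (W ** X\<^sub>1))) \<longlongrightarrow> 0) (at_right 0)"
  proof -
  let ?I = "mat 1 :: real^'n^'n" and ?E = "ones_mat :: real^'n^'n"
  have n: "0 < n" using assms(12) by simp
  have Q: "pos_def Q"
    by (rule pos_semidef_inj_imp_pos_def[OF assms(6)]) (rule observable_0_inj[OF assms(11)[unfolded assms(1)]])
  define K where "K = transpose C ** matrix_inv V ** C"
  define L where "L = B ** matrix_inv R ** transpose B"
  define S where "S \<epsilon> = W + \<epsilon> *\<^sub>R Z" for \<epsilon>
  define Sn where "Sn \<epsilon> = W\<^sub>n + \<epsilon> *\<^sub>R Z\<^sub>n" for \<epsilon>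
  have K: "pos_def K"
    unfolding K_def by (rule pos_def_congruence[OF pos_def_matrix_inv[OF assms(5)]]) (rule observable_0_inj[OF assms(10)[unfolded assms(1)]])
  have L: "pos_def L"
    using pos_def_congruence[OF pos_def_matrix_inv[OF assms(7)], of "transpose B"] controllable_0_inj[OF assms(8)[unfolded assms(1)]]
    by (simp add: L_def del: transpose_matrix_vector)
  have Z: "pos_def Z"
    unfolding assms(3) by (rule pos_def_gram) (rule controllable_0_inj[OF assms(9)[unfolded assms(1)]])
  \<comment> \<open>\<open>W\<close> is only semidefinite; adding a positive multiple of the
    definite \<open>Z\<close> makes the sum definite, which is where \<open>0 < \<epsilon>\<close>
    enters.\<close>
  have S: "pos_def (S \<epsilon>)" if "0 < \<epsilon>" for \<epsilon>
    unfolding S_def assms(2) by (rule pos_def_add[OF pos_semidef_gram pos_def_scaleR[OF that Z]])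
  have Wn: "W\<^sub>n = ones_kron G ** transpose (ones_kron G)" by (simp add: assms(2,14,21) ones_kron_gram)
  have Sn: "pos_def (Sn \<epsilon>)" if "0 < \<epsilon>" for \<epsilon>
    unfolding Sn_def Wn assms(18,13) by (rule pos_def_add[OF pos_semidef_gram pos_def_scaleR[OF that pos_def_kron[OF Z]]])
  have Kn: "transpose C\<^sub>n ** matrix_inv V\<^sub>n ** C\<^sub>n = ?I \<otimes>\<^sub>K K"
    by (simp add: assms(16,17,13) K_def matrix_inv_kron[OF assms(5)] transpose_kron kron_mult transpose_mat_1)
  have Ln: "B\<^sub>n ** matrix_inv R\<^sub>n ** transpose B\<^sub>n = ?I \<otimes>\<^sub>K L"
    by (simp add: assms(15,20,13) L_def matrix_inv_kron[OF assms(7)] transpose_kron kron_mult transpose_mat_1)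
  have Kn_pd: "pos_def (?I \<otimes>\<^sub>K K)" and nLn_pd: "pos_def (n *\<^sub>R (?I \<otimes>\<^sub>K L))" and Qn_pd: "pos_def ((1 / n) *\<^sub>R Q\<^sub>n)"
    using n by (simp_all add: pos_def_kron K L Q assms(13,19) pos_def_scaleR)
  have Y1: "pd_riccati_solution K (S \<epsilon>) (Y\<^sub>1 \<epsilon>)" if "0 < \<epsilon>" for \<epsilon>
    unfolding assms(22) K_def[symmetric] S_def[symmetric] by (rule pd_riccati_solution_riccati[OF K S[OF that]])
  have Yn: "pd_riccati_solution (?I \<otimes>\<^sub>K K) (Sn \<epsilon>) (Y\<^sub>n \<epsilon>)" if "0 < \<epsilon>" for \<epsilon>
    unfolding assms(23) Kn Sn_def[symmetric] by (rule pd_riccati_solution_riccati[OF Kn_pd Sn[OF that]])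
  have X1: "pd_riccati_solution L Q X\<^sub>1"
    unfolding assms(24) L_def[symmetric] by (rule pd_riccati_solution_riccati[OF L Q])
  have Xn: "pd_riccati_solution (n *\<^sub>R (?I \<otimes>\<^sub>K L)) ((1 / n) *\<^sub>R Q\<^sub>n) X\<^sub>n"
    unfolding assms(25) Ln by (rule pd_riccati_solution_riccati[OF nLn_pd Qn_pd])
  \<comment> \<open>The agents are decoupled on the control side: inserting the ansatz gives
    \<open>n * (1 / n) * (1 / n) = 1 / n\<close> in front of
    \<open>?I \<otimes>\<^sub>K Q\<close>.\<close>
  have Xn_eq: "X\<^sub>n = (1 / n) *\<^sub>R (?I \<otimes>\<^sub>K X\<^sub>1)"
  proof (rule pd_riccati_solution_unique[OF nLn_pd Xn])
    show "pd_riccati_solution (n *\<^sub>R (?I \<otimes>\<^sub>K L)) ((1 / n) *\<^sub>R Q\<^sub>n) ((1 / n) *\<^sub>R (?I \<otimes>\<^sub>K X\<^sub>1))"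
      using X1 n by (simp add: pd_riccati_solution_def pos_def_scaleR pos_def_kron scaleR_matrix kron_mult assms(13,19))
  qed
  have cost: "J \<epsilon> = ennreal (trace (Y\<^sub>n \<epsilon> ** ((1 / n) *\<^sub>R Q\<^sub>n) + Sn \<epsilon> ** X\<^sub>n))" "0 \<le> trace (Y\<^sub>n \<epsilon> ** ((1 / n) *\<^sub>R Q\<^sub>n) + Sn \<epsilon> ** X\<^sub>n)"
    if \<epsilon>: "0 < \<epsilon>" for \<epsilon>
  proof -
    let ?w = "\<lambda>t \<omega>. stack3 (w\<^sub>p t \<omega>) (w\<^sub>e t \<omega>) (v t \<omega>)"
    \<comment> \<open>\<open>\<Gamma>\<close> and \<open>D\<close> occupy complementary blocks of
      the stacked noise, hence \<open>\<Gamma>D\<close>. The target motion enters with a minus sign,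
      which its Gram matrix forgets.\<close>
    define \<Gamma> :: "real^(('n \<times> 'd) + 'd + ('n \<times> 'd))^('n \<times> 'd)" where "\<Gamma> = row3 (sqrt \<epsilon> *\<^sub>R (?I \<otimes>\<^sub>K F)) (- ones_kron G) 0"
    define D :: "real^(('n \<times> 'd) + 'd + ('n \<times> 'd))^('n \<times> 'd)" where "D = row3 0 0 (?I \<otimes>\<^sub>K H)"
    have \<Gamma>\<Gamma>: "\<Gamma> ** transpose \<Gamma> = Sn \<epsilon>"
      using \<epsilon> unfolding \<Gamma>_def row3_gram
      by (simp add: uminus_matrix scaleR_matrix transpose_kron kron_mult transpose_mat_1 Sn_def Wn assms(18,13,3) matrix_matrix_mult_def[of 0] vec_eq_iff)
    have DD: "D ** transpose D = V\<^sub>n"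
      unfolding D_def row3_gram
      by (simp add: transpose_kron kron_mult transpose_mat_1 assms(17,13,4) matrix_matrix_mult_def[of 0] vec_eq_iff)
    have \<Gamma>D: "\<Gamma> ** transpose D = 0"
      unfolding D_def \<Gamma>_def row3_gram by (simp add: vec_eq_iff matrix_matrix_mult_def transpose_def)
    have w: "standard_wiener M ?w" using assms(26) by (simp add: independent_wiener_def)
    have Rn_pd: "pos_def R\<^sub>n" using assms(7) by (simp add: assms(20,13) pos_def_kron)
    \<comment> \<open>The cost per agent weights the input by \<open>R\<^sub>n / n\<close>; its
      inverse is the origin of the factor \<open>n\<close> in the Riccati equation for
      \<open>X\<^sub>n\<close>.\<close>
    have "matrix_inv ((1 / n) *\<^sub>R R\<^sub>n) = n *\<^sub>R matrix_inv R\<^sub>n"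
      using n by (intro matrix_inv_eqI) (simp_all add: scaleR_matrix pos_def_inverse[OF Rn_pd])
    then have L': "B\<^sub>n ** matrix_inv ((1 / n) *\<^sub>R R\<^sub>n) ** transpose B\<^sub>n = n *\<^sub>R (?I \<otimes>\<^sub>K L)"
      by (simp add: scaleR_matrix Ln)
    have J: "J \<epsilon> = lqg_optimal_cost M 0 B\<^sub>n C\<^sub>n x\<^sub>0 (\<lambda>t \<omega>. \<Gamma> *v ?w t \<omega>) (\<lambda>t \<omega>. D *v ?w t \<omega>) ((1 / n) *\<^sub>R Q\<^sub>n) ((1 / n) *\<^sub>R R\<^sub>n)"
      unfolding assms(27) tracking_cost_per_agent_def Let_def \<Gamma>_def D_def row3_vec
      by (simp add: assms(1,12,13,15,16,19,20) kron_0 uminus_matrix scaleR_matrix)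
    have Vn_pd: "pos_def V\<^sub>n" using assms(5) by (simp add: assms(17,13) pos_def_kron)
    have R'_pd: "pos_def ((1 / n) *\<^sub>R R\<^sub>n)" using n Rn_pd by (simp add: pos_def_scaleR)
    note opt = lqg_optimal_cost_driftless[OF w Qn_pd R'_pd Sn[OF \<epsilon>] Vn_pd \<Gamma>\<Gamma> DD \<Gamma>D, where C="C\<^sub>n" and B="B\<^sub>n", unfolded Kn L', OF Kn_pd nLn_pd Yn[OF \<epsilon>] Xn]
    show "J \<epsilon> = ennreal (trace (Y\<^sub>n \<epsilon> ** ((1 / n) *\<^sub>R Q\<^sub>n) + Sn \<epsilon> ** X\<^sub>n))" unfolding J by (rule opt(1))
    show "0 \<le> trace (Y\<^sub>n \<epsilon> ** ((1 / n) *\<^sub>R Q\<^sub>n) + Sn \<epsilon> ** X\<^sub>n)" by (rule opt(2))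
  qed
  let ?\<Delta> = "\<lambda>\<epsilon>. Y\<^sub>n \<epsilon> - (1 / sqrt n) *\<^sub>R (?E \<otimes>\<^sub>K Y\<^sub>1 \<epsilon>)"
  \<comment> \<open>Since \<open>ones_mat ** ones_mat\<close> is \<open>n\<close> times
    \<open>ones_mat\<close>, the factor \<open>1 / sqrt n\<close> is what makes the ansatz solve a
    Riccati equation with right-hand side \<open>?E \<otimes>\<^sub>K S \<epsilon>\<close>.\<close>
  have sqrt_n: "1 / sqrt n * (1 / sqrt n) * n = 1" using n by simp
  have \<Delta>: "(?\<Delta> \<longlongrightarrow> 0) (at_right 0)"
  proof (rule riccati_perturbation_limit[OF Kn_pd])
    fix \<epsilon> :: real assume \<epsilon>: "0 < \<epsilon>"
    show "pos_semidef (Y\<^sub>n \<epsilon>)" using Yn[OF \<epsilon>] by (simp add: pd_riccati_solution_def pos_def_imp_pos_semidef)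
    have Y1': "pos_def (Y\<^sub>1 \<epsilon>)" "Y\<^sub>1 \<epsilon> ** K ** Y\<^sub>1 \<epsilon> = S \<epsilon>" using Y1[OF \<epsilon>] by (simp_all add: pd_riccati_solution_def)
    show "pos_semidef ((1 / sqrt n) *\<^sub>R (?E \<otimes>\<^sub>K Y\<^sub>1 \<epsilon>))" using n by (simp add: pos_semidef_scaleR pos_semidef_ones_kron[OF Y1'(1)])
    have "((1 / sqrt n) *\<^sub>R (?E \<otimes>\<^sub>K Y\<^sub>1 \<epsilon>)) ** (?I \<otimes>\<^sub>K K) ** ((1 / sqrt n) *\<^sub>R (?E \<otimes>\<^sub>K Y\<^sub>1 \<epsilon>)) = (1 / sqrt n * (1 / sqrt n) * n) *\<^sub>R (?E \<otimes>\<^sub>K S \<epsilon>)"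
      by (simp only: scaleR_matrix kron_mult matrix_mul_rid ones_mat_square kron_linear Y1'(2) scaleR_scaleR assms(12) mult.assoc)
    moreover have "Y\<^sub>n \<epsilon> ** (?I \<otimes>\<^sub>K K) ** Y\<^sub>n \<epsilon> = Sn \<epsilon>" using Yn[OF \<epsilon>] by (simp add: pd_riccati_solution_def)
    \<comment> \<open>The contributions of \<open>W\<close> agree in both equations, as the common
      target moves all agents alike; only the process noise, independent across agents in one
      equation and common in the other, differs.\<close>
    ultimately show "Y\<^sub>n \<epsilon> ** (?I \<otimes>\<^sub>K K) ** Y\<^sub>n \<epsilon> - ((1 / sqrt n) *\<^sub>R (?E \<otimes>\<^sub>K Y\<^sub>1 \<epsilon>)) ** (?I \<otimes>\<^sub>K K) ** ((1 / sqrt n) *\<^sub>R (?E \<otimes>\<^sub>K Y\<^sub>1 \<epsilon>))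
      = \<epsilon> *\<^sub>R (?I \<otimes>\<^sub>K Z - ?E \<otimes>\<^sub>K Z)"
      unfolding sqrt_n
      by (simp add: Sn_def S_def assms(21,18,14,13) kron_linear scaleR_diff_right)
  qed
  have J_lim: "((\<lambda>\<epsilon>. enn2real (J \<epsilon>) - ((1 / sqrt n) * trace (Y\<^sub>1 \<epsilon> ** Q) + trace (W ** X\<^sub>1))) \<longlongrightarrow> 0) (at_right 0)"
  proof -
    have "((\<lambda>\<epsilon>. trace (?\<Delta> \<epsilon> ** ((1 / n) *\<^sub>R Q\<^sub>n)) + \<epsilon> * trace (Z ** X\<^sub>1)) \<longlongrightarrow> 0 + 0 * trace (Z ** X\<^sub>1)) (at_right 0)"
      by (intro tendsto_intros tendsto_trace_mult \<Delta>)
    then have lim: "((\<lambda>\<epsilon>. trace (?\<Delta> \<epsilon> ** ((1 / n) *\<^sub>R Q\<^sub>n)) + \<epsilon> * trace (Z ** X\<^sub>1)) \<longlongrightarrow> 0) (at_right 0)" by simp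
    \<comment> \<open>The trace of a Kronecker product is the product of the traces, and both
      \<open>?I\<close> and \<open>?E\<close> have trace \<open>n\<close>. This cancels each factor
      \<open>1 / n\<close>, leaving \<open>1 / sqrt n\<close> only in the filter term.\<close>
    have eq: "trace (?\<Delta> \<epsilon> ** ((1 / n) *\<^sub>R Q\<^sub>n)) + \<epsilon> * trace (Z ** X\<^sub>1) = enn2real (J \<epsilon>) - ((1 / sqrt n) * trace (Y\<^sub>1 \<epsilon> ** Q) + trace (W ** X\<^sub>1))"
      if \<epsilon>: "0 < \<epsilon>" for \<epsilon>
    proof -
      have "trace (?\<Delta> \<epsilon> ** ((1 / n) *\<^sub>R Q\<^sub>n)) = trace (Y\<^sub>n \<epsilon> ** ((1 / n) *\<^sub>R Q\<^sub>n)) - 1 / sqrt n * (1 / n * (n * trace (Y\<^sub>1 \<epsilon> ** Q)))"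
        by (simp add: matrix_diff_distribs trace_sub scaleR_matrix trace_scaleR kron_mult trace_kron trace_ones_mat diff_divide_distrib assms(12,13,19))
      moreover have "trace (Sn \<epsilon> ** X\<^sub>n) = 1 / n * (n * trace (W ** X\<^sub>1)) + 1 / n * (\<epsilon> * (n * trace (Z ** X\<^sub>1)))"
        unfolding Sn_def Xn_eq
        by (simp add: matrix_add_rdistrib trace_add scaleR_matrix trace_scaleR kron_mult trace_kron trace_ones_mat trace_I distrib_left assms(12,13,14,18,21))
      ultimately show ?thesis
        using cost[OF \<epsilon>] n by (simp add: trace_add)
    qed
    show ?thesis
    proof (rule Lim_transform_eventually[OF lim])
      show "\<forall>\<^sub>F \<epsilon> in at_right 0. trace (?\<Delta> \<epsilon> ** ((1 / n) *\<^sub>R Q\<^sub>n)) + \<epsilon> * trace (Z ** X\<^sub>1) = enn2real (J \<epsilon>) - ((1 / sqrt n) * trace (Y\<^sub>1 \<epsilon> ** Q) + trace (W ** X\<^sub>1))"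
        using eventually_at_right_less[of 0] by eventually_elim (rule eq)
    qed
  qed
  show ?thesis
    unfolding Kn Ln K_def[symmetric] L_def[symmetric] S_def[symmetric] Sn_def[symmetric] assms(14)
    using pd_riccati_solution_ex1[OF K S] pd_riccati_solution_ex1[OF Kn_pd Sn] pd_riccati_solution_ex1[OF L Q] pd_riccati_solution_ex1[OF nLn_pd Qn_pd] \<Delta> cost(1) J_lim
    by blast
qed

end
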